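(* Let $i:\Sigma\hookrightarrow Y_0$ be the inclusion of a closed codimension-two stratum of a complex threefold with transverse singularity of type $\frac14(1,1)$, and let $\mathcal T^{\mathrm{mot}}_{4,\Sigma}:=i_*(\mathbf 1_\Sigma/4)[2]$. Assume that the Betti realization functor $$\operatorname{Real}_B:D^{\mathbb Z}_{\mathrm{mot}}(Y_0)\longrightarrow D^b_c(Y_0,\mathbb Z)$$ commutes with cones, multiplication by $4$, shifts, and $i_*$. Then $$\operatorname{Real}_B\left(\mathcal T^{\mathrm{mot}}_{4,\Sigma}\right)\cong i_*(\mathbb Z/4)_\Sigma[2].$$ Consequently, the full Coble $E$-discrepancy term $i_*E_\Sigma[2]\cong i_*(\mathbb Z/4)_\Sigma[2]$ is the Betti realization of the motivic object $i_*(\mathbf 1_\Sigma/4)[2]$.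
   Context: $D^{\mathbb Z}_{\mathrm{mot}}(-)$ is any integral motivic sheaf formalism: triangulated categories over varieties, with unit objects $\mathbf 1_\Sigma$, cones, shifts, proper pushforward $i_*$, and a Betti realization $\operatorname{Real}_B$ to $D^b_c(-,\mathbb Z)$ which sends the unit to the constant sheaf, $\operatorname{Real}_B(\mathbf 1_\Sigma)\cong\mathbb Z_\Sigma$. One sets $\mathbf 1_\Sigma/4:=\operatorname{Cone}(\mathbf 1_\Sigma\xrightarrow{4}\mathbf 1_\Sigma)$. The $\frac14(1,1)$ singularity is $\mathbb C^2/\mu_4$ (scalar action), with link $L(4,1)=S^3/\mu_4$. $E_\Sigma\cong(\mathbb Z/4)_\Sigma$ is the local system on $\Sigma$ whose fibers are $H^2(L(4,1),\mathbb Z)_{\mathrm{tors}}\cong\mathbb Z/4$ of the transverse links, and $i_*E_\Sigma[2]$ is the cone of the natural morphism from the ordinary to the dual middle-perversity integral intersection complex of $Y_0$. *)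

theory Defs
  imports "HOL-Analysis.Analysis" "HOL-Homology.Homology"
begin

section \<open>Complex algebraic varieties\<close>

text \<open>
  Varieties in the sense of Serre: a Zariski topology together with, for every open set, the
  regular complex-valued functions on it.  Functions on \<open>U\<close> are represented by functions that are
  extensional on \<open>U\<close>.  Affine space of dimension \<open>n\<close> consists of the sequences that vanish from
  index \<open>n\<close> on.
\<close>

record 'x fspace =
  zar :: "'x topology"
  reg :: "'x set \<Rightarrow> ('x \<Rightarrow> complex) set"

abbreviation pts :: "'x fspace \<Rightarrow> 'x set" where
  "pts X \<equiv> topspace (zar X)"

definition affine_space :: "nat \<Rightarrow> (nat \<Rightarrow> complex) set" where
  "affine_space n = {z. \<forall>i\<ge>n. z i = 0}"

inductive_set polyfun :: "nat \<Rightarrow> ((nat \<Rightarrow> complex) \<Rightarrow> complex) set" for n :: nat where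
  const: "(\<lambda>z. c) \<in> polyfun n"
| coord: "i < n \<Longrightarrow> (\<lambda>z. z i) \<in> polyfun n"
| add: "p \<in> polyfun n \<Longrightarrow> q \<in> polyfun n \<Longrightarrow> (\<lambda>z. p z + q z) \<in> polyfun n"
| mult: "p \<in> polyfun n \<Longrightarrow> q \<in> polyfun n \<Longrightarrow> (\<lambda>z. p z * q z) \<in> polyfun n"

definition zero_locus ::
  "nat \<Rightarrow> ((nat \<Rightarrow> complex) \<Rightarrow> complex) set \<Rightarrow> (nat \<Rightarrow> complex) set" where
  "zero_locus n P = {z \<in> affine_space n. \<forall>p\<in>P. p z = 0}"

definition affine_top ::
  "nat \<Rightarrow> ((nat \<Rightarrow> complex) \<Rightarrow> complex) set \<Rightarrow> (nat \<Rightarrow> complex) topology" where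
  "affine_top n P = topology_generated_by {{z \<in> zero_locus n P. p z \<noteq> 0} | p. p \<in> polyfun n}"

definition affine_set ::
  "nat \<Rightarrow> ((nat \<Rightarrow> complex) \<Rightarrow> complex) set \<Rightarrow> (nat \<Rightarrow> complex) fspace" where
  "affine_set n P =
     \<lparr>zar = affine_top n P,
      reg = (\<lambda>U. {f \<in> extensional U. \<forall>x\<in>U. \<exists>V p q.
        openin (affine_top n P) V \<and> x \<in> V \<and> V \<subseteq> U \<and> p \<in> polyfun n \<and> q \<in> polyfun n \<and>
        (\<forall>y\<in>V. q y \<noteq> 0 \<and> f y = p y / q y)})\<rparr>"

text \<open>The induced (reduced) structure on a locally closed subset.\<close>

definition subvar :: "'x fspace \<Rightarrow> 'x set \<Rightarrow> 'x fspace" where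
  "subvar X S =
     \<lparr>zar = subtopology (zar X) S,
      reg = (\<lambda>W. {f \<in> extensional W. \<forall>x\<in>W. \<exists>U g.
        openin (zar X) U \<and> x \<in> U \<and> g \<in> reg X U \<and> (\<forall>y\<in>U \<inter> W. f y = g y)})\<rparr>"

definition fs_morphism :: "'x fspace \<Rightarrow> 'y fspace \<Rightarrow> ('x \<Rightarrow> 'y) \<Rightarrow> bool" where
  "fs_morphism X Y h \<longleftrightarrow>
     continuous_map (zar X) (zar Y) h \<and>
     (\<forall>V f. openin (zar Y) V \<and> f \<in> reg Y V \<longrightarrow>
        restrict (f \<circ> h) {x \<in> pts X. h x \<in> V} \<in> reg X {x \<in> pts X. h x \<in> V})"

definition fs_isomorphic :: "'x fspace \<Rightarrow> 'y fspace \<Rightarrow> bool" where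
  "fs_isomorphic X Y \<longleftrightarrow>
     (\<exists>h k. fs_morphism X Y h \<and> fs_morphism Y X k \<and>
        (\<forall>x\<in>pts X. k (h x) = x) \<and> (\<forall>y\<in>pts Y. h (k y) = y))"

definition affine_open :: "'x fspace \<Rightarrow> 'x set \<Rightarrow> bool" where
  "affine_open X U \<longleftrightarrow>
     openin (zar X) U \<and>
     (\<exists>n P. P \<subseteq> polyfun n \<and> fs_isomorphic (subvar X U) (affine_set n P))"

text \<open>The Zariski topology of the product variety, which is finer than the product topology.\<close>

definition zprod :: "'x fspace \<Rightarrow> 'y fspace \<Rightarrow> ('x \<times> 'y) topology" where
  "zprod X Y = topology_generated_by
     {{(x, y). x \<in> U \<and> y \<in> V \<and> (\<Sum>i<k. f i x * g i y) \<noteq> 0} | U V (k::nat) f g.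
        openin (zar X) U \<and> openin (zar Y) V \<and> (\<forall>i<k. f i \<in> reg X U \<and> g i \<in> reg Y V)}"

definition variety :: "'x fspace \<Rightarrow> bool" where
  "variety X \<longleftrightarrow>
     (\<forall>U f. openin (zar X) U \<longrightarrow>
        (f \<in> reg X U \<longleftrightarrow> f \<in> extensional U \<and>
           (\<forall>x\<in>U. \<exists>V. openin (zar X) V \<and> x \<in> V \<and> V \<subseteq> U \<and> restrict f V \<in> reg X V))) \<and>
     (\<forall>U V f. openin (zar X) U \<and> openin (zar X) V \<and> V \<subseteq> U \<and> f \<in> reg X U \<longrightarrow>
        restrict f V \<in> reg X V) \<and>
     (\<exists>\<U>. finite \<U> \<and> \<Union>\<U> = pts X \<and> (\<forall>U\<in>\<U>. affine_open X U)) \<and>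
     closedin (zprod X X) {(x, x) | x. x \<in> pts X}"

text \<open>
  Properness is universal closedness; every variety is isomorphic to one whose points are of type
  \<^typ>\<open>nat \<Rightarrow> complex\<close>, so that the quantifier over \<open>Z\<close> ranges over all varieties.
\<close>

definition proper_morphism :: "'x fspace \<Rightarrow> 'y fspace \<Rightarrow> ('x \<Rightarrow> 'y) \<Rightarrow> bool" where
  "proper_morphism X Y h \<longleftrightarrow>
     fs_morphism X Y h \<and>
     (\<forall>Z :: (nat \<Rightarrow> complex) fspace. variety Z \<longrightarrow>
        closed_map (zprod X Z) (zprod Y Z) (\<lambda>(x, z). (h x, z)))"

definition irreducible_closed :: "'x topology \<Rightarrow> 'x set \<Rightarrow> bool" where
  "irreducible_closed T C \<longleftrightarrow>
     closedin T C \<and> C \<noteq> {} \<and>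
     (\<forall>A B. closedin T A \<and> closedin T B \<and> C \<subseteq> A \<union> B \<longrightarrow> C \<subseteq> A \<or> C \<subseteq> B)"

definition krull_dim_ge :: "'x topology \<Rightarrow> nat \<Rightarrow> bool" where
  "krull_dim_ge T d \<longleftrightarrow>
     (\<exists>C. (\<forall>i\<le>d. irreducible_closed T (C i)) \<and> (\<forall>i<d. C i \<subset> C (Suc i)))"

definition pure_dimension :: "'x fspace \<Rightarrow> nat \<Rightarrow> bool" where
  "pure_dimension X d \<longleftrightarrow>
     (\<forall>C. irreducible_closed (zar X) C \<and>
          (\<forall>C'. irreducible_closed (zar X) C' \<and> C \<subseteq> C' \<longrightarrow> C' = C) \<longrightarrow>
          krull_dim_ge (subtopology (zar X) C) d \<and>
          \<not> krull_dim_ge (subtopology (zar X) C) (Suc d))"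


section \<open>Analytic topology and the transverse singularity\<close>

definition analytic_top :: "'x fspace \<Rightarrow> 'x topology" where
  "analytic_top X = topology_generated_by
     {{x \<in> U. f x \<in> D} | U f D. openin (zar X) U \<and> f \<in> reg X U \<and> open D}"

definition holomorphic_several ::
  "nat \<Rightarrow> (nat \<Rightarrow> complex) set \<Rightarrow> ((nat \<Rightarrow> complex) \<Rightarrow> complex) \<Rightarrow> bool" where
  "holomorphic_several n D h \<longleftrightarrow>
     openin (top_of_set (affine_space n)) D \<and> continuous_on D h \<and>
     (\<forall>z\<in>D. \<forall>i<n. (\<lambda>w. h (z(i := w))) field_differentiable at (z i))"

text \<open>
  The sections over \<open>V\<close> of the structure sheaf of the reduced analytic space attached to \<open>X\<close>:
  locally, holomorphic functions of finitely many regular functions.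
\<close>

definition holomorphic_fun :: "'x fspace \<Rightarrow> 'x set \<Rightarrow> ('x \<Rightarrow> complex) \<Rightarrow> bool" where
  "holomorphic_fun X V g \<longleftrightarrow>
     (\<forall>x\<in>V. \<exists>U W k f D h.
        openin (zar X) U \<and> (\<forall>i<k. f i \<in> reg X U) \<and>
        openin (analytic_top X) W \<and> x \<in> W \<and> W \<subseteq> U \<inter> V \<and>
        holomorphic_several k D h \<and>
        (\<forall>y\<in>W. (\<lambda>i. if i < k then f i y else 0) \<in> D \<and>
                g y = h (\<lambda>i. if i < k then f i y else 0)))"

definition scalar_act :: "complex \<Rightarrow> (nat \<Rightarrow> complex) \<Rightarrow> (nat \<Rightarrow> complex)" where
  "scalar_act \<zeta> z = (\<lambda>i. if i < 2 then \<zeta> * z i else z i)"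

text \<open>
  Near every point of \<open>S\<close> the pair \<open>(X, S)\<close> is, as an analytic space, the product of the quotient
  of the plane by the scalar action of the fourth roots of unity with a disc, \<open>S\<close> being the product
  of the singular point with the disc.  The last clause says that holomorphic functions downstairs
  are the invariant holomorphic functions upstairs, i.e. that \<open>\<phi>\<close> induces an isomorphism of the
  analytic quotient \<open>B/\<mu>\<^sub>4\<close> with \<open>V\<close>.
\<close>

definition transverse_quarter_11 :: "'x fspace \<Rightarrow> 'x set \<Rightarrow> bool" where
  "transverse_quarter_11 X S \<longleftrightarrow>
     (\<forall>x\<in>S. \<exists>V B \<phi>.
        openin (analytic_top X) V \<and> x \<in> V \<and>
        openin (top_of_set (affine_space 3)) B \<and> (\<lambda>i. 0) \<in> B \<and>
        (\<forall>\<zeta> a. \<zeta> ^ 4 = 1 \<and> a \<in> B \<longrightarrow> scalar_act \<zeta> a \<in> B) \<and>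
        quotient_map (top_of_set B) (subtopology (analytic_top X) V) \<phi> \<and>
        \<phi> (\<lambda>i. 0) = x \<and>
        (\<forall>a\<in>B. \<forall>b\<in>B. \<phi> a = \<phi> b \<longleftrightarrow> (\<exists>\<zeta>. \<zeta> ^ 4 = 1 \<and> b = scalar_act \<zeta> a)) \<and>
        (\<forall>a\<in>B. \<phi> a \<in> S \<longleftrightarrow> a 0 = 0 \<and> a 1 = 0) \<and>
        (\<forall>W g. openin (analytic_top X) W \<and> W \<subseteq> V \<longrightarrow>
           (holomorphic_fun X W g \<longleftrightarrow> holomorphic_several 3 {a \<in> B. \<phi> a \<in> W} (g \<circ> \<phi>))))"


section \<open>Sheaves of abelian groups\<close>

text \<open>
  Abelian groups are written multiplicatively, as in HOL-Algebra.  Only the values on open sets and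
  the restrictions between nested open sets matter.
\<close>

record ('x, 'u) presheaf =
  sec :: "'x set \<Rightarrow> 'u monoid"
  res :: "'x set \<Rightarrow> 'x set \<Rightarrow> 'u \<Rightarrow> 'u"

definition is_presheaf :: "'x topology \<Rightarrow> ('x, 'u) presheaf \<Rightarrow> bool" where
  "is_presheaf T F \<longleftrightarrow>
     (\<forall>U. openin T U \<longrightarrow> comm_group (sec F U)) \<and>
     (\<forall>U V. openin T U \<and> openin T V \<and> V \<subseteq> U \<longrightarrow> res F U V \<in> hom (sec F U) (sec F V)) \<and>
     (\<forall>U. openin T U \<longrightarrow> (\<forall>s\<in>carrier (sec F U). res F U U s = s)) \<and>
     (\<forall>U V W. openin T U \<and> openin T V \<and> openin T W \<and> W \<subseteq> V \<and> V \<subseteq> U \<longrightarrow>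
        (\<forall>s\<in>carrier (sec F U). res F V W (res F U V s) = res F U W s))"

definition is_sheaf :: "'x topology \<Rightarrow> ('x, 'u) presheaf \<Rightarrow> bool" where
  "is_sheaf T F \<longleftrightarrow>
     is_presheaf T F \<and>
     (\<forall>\<U> s. (\<forall>U\<in>\<U>. openin T U \<and> s U \<in> carrier (sec F U)) \<and>
        (\<forall>U\<in>\<U>. \<forall>V\<in>\<U>. res F U (U \<inter> V) (s U) = res F V (U \<inter> V) (s V)) \<longrightarrow>
        (\<exists>!t. t \<in> carrier (sec F (\<Union>\<U>)) \<and> (\<forall>U\<in>\<U>. res F (\<Union>\<U>) U t = s U)))"

definition presheaf_hom ::
  "'x topology \<Rightarrow> ('x, 'u) presheaf \<Rightarrow> ('x, 'v) presheaf \<Rightarrow> ('x set \<Rightarrow> 'u \<Rightarrow> 'v) \<Rightarrow> bool" where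
  "presheaf_hom T F G f \<longleftrightarrow>
     (\<forall>U. openin T U \<longrightarrow> f U \<in> hom (sec F U) (sec G U)) \<and>
     (\<forall>U V. openin T U \<and> openin T V \<and> V \<subseteq> U \<longrightarrow>
        (\<forall>s\<in>carrier (sec F U). f V (res F U V s) = res G U V (f U s)))"

definition presheaf_iso ::
  "'x topology \<Rightarrow> ('x, 'u) presheaf \<Rightarrow> ('x, 'v) presheaf \<Rightarrow> ('x set \<Rightarrow> 'u \<Rightarrow> 'v) \<Rightarrow> bool" where
  "presheaf_iso T F G f \<longleftrightarrow>
     presheaf_hom T F G f \<and> (\<forall>U. openin T U \<longrightarrow> f U \<in> iso (sec F U) (sec G U))"

definition presheaf_isomorphic ::
  "'x topology \<Rightarrow> ('x, 'u) presheaf \<Rightarrow> ('x, 'v) presheaf \<Rightarrow> bool" where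
  "presheaf_isomorphic T F G \<longleftrightarrow> (\<exists>f. presheaf_iso T F G f)"

type_synonym ('x, 'u) germ = "('x set \<times> 'u) set"

definition germ :: "'x topology \<Rightarrow> ('x, 'u) presheaf \<Rightarrow> 'x \<Rightarrow> 'x set \<Rightarrow> 'u \<Rightarrow> ('x, 'u) germ" where
  "germ T F x U s =
     {(V, t). openin T V \<and> x \<in> V \<and> t \<in> carrier (sec F V) \<and>
        (\<exists>W. openin T W \<and> x \<in> W \<and> W \<subseteq> U \<inter> V \<and> res F U W s = res F V W t)}"

text \<open>The unions below are over families all of whose members are the same germ.\<close>

definition stalk :: "'x topology \<Rightarrow> ('x, 'u) presheaf \<Rightarrow> 'x \<Rightarrow> ('x, 'u) germ monoid" where
  "stalk T F x =
     \<lparr>carrier = {germ T F x U s | U s. openin T U \<and> x \<in> U \<and> s \<in> carrier (sec F U)},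
      mult = (\<lambda>a b. \<Union>{germ T F x U (s \<otimes>\<^bsub>sec F U\<^esub> t) | U s t. (U, s) \<in> a \<and> (U, t) \<in> b}),
      one = germ T F x (topspace T) \<one>\<^bsub>sec F (topspace T)\<^esub>\<rparr>"

definition stalk_map ::
  "'x topology \<Rightarrow> ('x, 'v) presheaf \<Rightarrow> ('x set \<Rightarrow> 'u \<Rightarrow> 'v) \<Rightarrow> 'x
     \<Rightarrow> ('x, 'u) germ \<Rightarrow> ('x, 'v) germ" where
  "stalk_map T G f x a = \<Union>{germ T G x U (f U s) | U s. (U, s) \<in> a}"

text \<open>
  Inverse image (as a sheaf) along the inclusion of an arbitrary subset: a section is a family of
  germs that is locally the family of germs of a section.  For the whole space this is
  sheafification.
\<close>

definition inverse_image ::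
  "'x topology \<Rightarrow> ('x, 'u) presheaf \<Rightarrow> 'x set \<Rightarrow> ('x, 'x \<Rightarrow> ('x, 'u) germ) presheaf" where
  "inverse_image T F S =
     \<lparr>sec = (\<lambda>W.
        \<lparr>carrier = {s \<in> (\<Pi>\<^sub>E x\<in>W. carrier (stalk T F x)). \<forall>x\<in>W. \<exists>U t.
            openin T U \<and> x \<in> U \<and> U \<inter> S \<subseteq> W \<and> t \<in> carrier (sec F U) \<and>
            (\<forall>y\<in>U \<inter> S. s y = germ T F y U t)},
         mult = (\<lambda>s t. \<lambda>x\<in>W. s x \<otimes>\<^bsub>stalk T F x\<^esub> t x),
         one = (\<lambda>x\<in>W. \<one>\<^bsub>stalk T F x\<^esub>)\<rparr>),
      res = (\<lambda>W W' s. restrict s W')\<rparr>"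

definition sheafify ::
  "'x topology \<Rightarrow> ('x, 'u) presheaf \<Rightarrow> ('x, 'x \<Rightarrow> ('x, 'u) germ) presheaf" where
  "sheafify T F = inverse_image T F (topspace T)"

definition sheafify_map ::
  "'x topology \<Rightarrow> ('x, 'v) presheaf \<Rightarrow> ('x set \<Rightarrow> 'u \<Rightarrow> 'v) \<Rightarrow> 'x set
     \<Rightarrow> ('x \<Rightarrow> ('x, 'u) germ) \<Rightarrow> ('x \<Rightarrow> ('x, 'v) germ)" where
  "sheafify_map T G f U s = (\<lambda>x\<in>U. stalk_map T G f x (s x))"

text \<open>Constant sheaf: locally constant functions.\<close>

definition const_sheaf :: "'x topology \<Rightarrow> 'g monoid \<Rightarrow> ('x, 'x \<Rightarrow> 'g) presheaf" where
  "const_sheaf T G =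
     \<lparr>sec = (\<lambda>U.
        \<lparr>carrier = {c \<in> (\<Pi>\<^sub>E x\<in>U. carrier G).
            \<forall>x\<in>U. \<exists>W. openin T W \<and> x \<in> W \<and> W \<subseteq> U \<and> (\<forall>y\<in>W. c y = c x)},
         mult = (\<lambda>c d. \<lambda>x\<in>U. c x \<otimes>\<^bsub>G\<^esub> d x),
         one = (\<lambda>x\<in>U. \<one>\<^bsub>G\<^esub>)\<rparr>),
      res = (\<lambda>U V c. restrict c V)\<rparr>"

definition locally_constant_sheaf :: "'x topology \<Rightarrow> ('x, 'u) presheaf \<Rightarrow> bool" where
  "locally_constant_sheaf T F \<longleftrightarrow>
     (\<forall>x\<in>topspace T. \<exists>V. openin T V \<and> x \<in> V \<and>
        presheaf_isomorphic (subtopology T V) F (const_sheaf (subtopology T V) (stalk T F x)))"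

definition finitely_generated_group :: "'g monoid \<Rightarrow> bool" where
  "finitely_generated_group G \<longleftrightarrow> (\<exists>A. finite A \<and> A \<subseteq> carrier G \<and> generate G A = carrier G)"

text \<open>Algebraic constructibility of a sheaf for the analytic topology.\<close>

definition constructible :: "'x fspace \<Rightarrow> ('x, 'u) presheaf \<Rightarrow> bool" where
  "constructible X F \<longleftrightarrow>
     (\<exists>\<S>. finite \<S> \<and> \<Union>\<S> = pts X \<and> pairwise disjnt \<S> \<and>
        (\<forall>S\<in>\<S>. (\<exists>U C. openin (zar X) U \<and> closedin (zar X) C \<and> S = U \<inter> C) \<and>
           locally_constant_sheaf (subtopology (analytic_top X) S)
             (inverse_image (analytic_top X) F S) \<and>
           (\<forall>x\<in>S. finitely_generated_group (stalk (analytic_top X) F x))))"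


section \<open>Bounded complexes of sheaves\<close>

text \<open>
  Sections of the sheaves occurring in complexes are drawn from a fixed type.  Up to isomorphism
  this only imposes a cardinality bound on sections; the bound is stable under products of sections
  indexed by points of the space, hence under the formation of cohomology sheaves and of Godement
  resolutions, and constructible complexes are represented within it.
\<close>

type_synonym 'x univ = "nat \<Rightarrow> 'x \<Rightarrow> int"

definition upair :: "'x univ \<Rightarrow> 'x univ \<Rightarrow> 'x univ" where
  "upair a b = (\<lambda>n. if even n then a (n div 2) else b (n div 2))"

definition ufst :: "'x univ \<Rightarrow> 'x univ" where "ufst c = (\<lambda>n. c (2 * n))"
definition usnd :: "'x univ \<Rightarrow> 'x univ" where "usnd c = (\<lambda>n. c (2 * n + 1))"

text \<open>Transport of a sheaf with integer-valued functions as sections into the fixed type.\<close>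

definition to_univ :: "('x, 'x \<Rightarrow> int) presheaf \<Rightarrow> ('x, 'x univ) presheaf" where
  "to_univ F =
     \<lparr>sec = (\<lambda>U.
        \<lparr>carrier = (\<lambda>c. (\<lambda>n. c)) ` carrier (sec F U),
         mult = (\<lambda>a b. (\<lambda>n. a 0 \<otimes>\<^bsub>sec F U\<^esub> b 0)),
         one = (\<lambda>n. \<one>\<^bsub>sec F U\<^esub>)\<rparr>),
      res = (\<lambda>U V a. (\<lambda>n. res F U V (a 0)))\<rparr>"

definition zero_sheaf :: "('x, 'x univ) presheaf" where
  "zero_sheaf =
     \<lparr>sec = (\<lambda>U. \<lparr>carrier = {\<lambda>n x. 0}, mult = (\<lambda>a b. (\<lambda>n x. 0)), one = (\<lambda>n x. 0)\<rparr>),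
      res = (\<lambda>U V a. (\<lambda>n x. 0))\<rparr>"

definition sheaf_sum ::
  "('x, 'x univ) presheaf \<Rightarrow> ('x, 'x univ) presheaf \<Rightarrow> ('x, 'x univ) presheaf" where
  "sheaf_sum F G =
     \<lparr>sec = (\<lambda>U.
        \<lparr>carrier = {upair a b | a b. a \<in> carrier (sec F U) \<and> b \<in> carrier (sec G U)},
         mult = (\<lambda>p q. upair (ufst p \<otimes>\<^bsub>sec F U\<^esub> ufst q) (usnd p \<otimes>\<^bsub>sec G U\<^esub> usnd q)),
         one = upair \<one>\<^bsub>sec F U\<^esub> \<one>\<^bsub>sec G U\<^esub>\<rparr>),
      res = (\<lambda>U V p. upair (res F U V (ufst p)) (res G U V (usnd p)))\<rparr>"

record 'x cx =
  trm :: "int \<Rightarrow> ('x, 'x univ) presheaf"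
  dif :: "int \<Rightarrow> 'x set \<Rightarrow> 'x univ \<Rightarrow> 'x univ"

type_synonym 'x cxmap = "int \<Rightarrow> 'x set \<Rightarrow> 'x univ \<Rightarrow> 'x univ"

definition bounded_complex :: "'x topology \<Rightarrow> 'x cx \<Rightarrow> bool" where
  "bounded_complex T K \<longleftrightarrow>
     (\<forall>n. is_sheaf T (trm K n)) \<and>
     (\<forall>n. presheaf_hom T (trm K n) (trm K (n + 1)) (dif K n)) \<and>
     (\<forall>n U. openin T U \<longrightarrow> (\<forall>s\<in>carrier (sec (trm K n) U).
        dif K (n + 1) U (dif K n U s) = \<one>\<^bsub>sec (trm K (n + 1 + 1)) U\<^esub>)) \<and>
     (\<exists>N. \<forall>n U. \<bar>n\<bar> > N \<and> openin T U \<longrightarrow> carrier (sec (trm K n) U) = {\<one>\<^bsub>sec (trm K n) U\<^esub>})"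

definition cx_hom :: "'x topology \<Rightarrow> 'x cx \<Rightarrow> 'x cx \<Rightarrow> 'x cxmap \<Rightarrow> bool" where
  "cx_hom T K L f \<longleftrightarrow>
     bounded_complex T K \<and> bounded_complex T L \<and>
     (\<forall>n. presheaf_hom T (trm K n) (trm L n) (f n)) \<and>
     (\<forall>n U. openin T U \<longrightarrow> (\<forall>s\<in>carrier (sec (trm K n) U).
        f (n + 1) U (dif K n U s) = dif L n U (f n U s)))"

definition cx_cocycles :: "'x cx \<Rightarrow> int \<Rightarrow> 'x set \<Rightarrow> 'x univ monoid" where
  "cx_cocycles K n U = (sec (trm K n) U)
     \<lparr>carrier := {s \<in> carrier (sec (trm K n) U). dif K n U s = \<one>\<^bsub>sec (trm K (n + 1)) U\<^esub>}\<rparr>"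

definition cx_coboundaries :: "'x cx \<Rightarrow> int \<Rightarrow> 'x set \<Rightarrow> 'x univ set" where
  "cx_coboundaries K n U = dif K (n - 1) U ` carrier (sec (trm K (n - 1)) U)"

text \<open>Maps between quotients send a coset to the coset generated by its image.\<close>

definition cohomology_presheaf :: "'x cx \<Rightarrow> int \<Rightarrow> ('x, 'x univ set) presheaf" where
  "cohomology_presheaf K n =
     \<lparr>sec = (\<lambda>U. cx_cocycles K n U Mod cx_coboundaries K n U),
      res = (\<lambda>U V A. cx_coboundaries K n V <#>\<^bsub>sec (trm K n) V\<^esub> (res (trm K n) U V ` A))\<rparr>"

definition cohomology_presheaf_map ::
  "'x cx \<Rightarrow> 'x cxmap \<Rightarrow> int \<Rightarrow> 'x set \<Rightarrow> 'x univ set \<Rightarrow> 'x univ set" where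
  "cohomology_presheaf_map L f n U A = cx_coboundaries L n U <#>\<^bsub>sec (trm L n) U\<^esub> (f n U ` A)"

definition cohomology_sheaf ::
  "'x topology \<Rightarrow> 'x cx \<Rightarrow> int \<Rightarrow> ('x, 'x \<Rightarrow> ('x, 'x univ set) germ) presheaf" where
  "cohomology_sheaf T K n = sheafify T (cohomology_presheaf K n)"

definition quasi_iso :: "'x topology \<Rightarrow> 'x cx \<Rightarrow> 'x cx \<Rightarrow> 'x cxmap \<Rightarrow> bool" where
  "quasi_iso T K L f \<longleftrightarrow>
     cx_hom T K L f \<and>
     (\<forall>n. presheaf_iso T (cohomology_sheaf T K n) (cohomology_sheaf T L n)
        (sheafify_map T (cohomology_presheaf L n) (cohomology_presheaf_map L f n)))"

definition cx_add :: "'x cx \<Rightarrow> 'x cxmap \<Rightarrow> 'x cxmap \<Rightarrow> 'x cxmap" where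
  "cx_add L f g = (\<lambda>n U s. f n U s \<otimes>\<^bsub>sec (trm L n) U\<^esub> g n U s)"

definition cx_zero :: "'x cx \<Rightarrow> 'x cxmap" where
  "cx_zero L = (\<lambda>n U s. \<one>\<^bsub>sec (trm L n) U\<^esub>)"

definition cx_shift :: "'x cx \<Rightarrow> 'x cx" where
  "cx_shift K =
     \<lparr>trm = (\<lambda>n. trm K (n + 1)),
      dif = (\<lambda>n U s. inv\<^bsub>sec (trm K (n + 1 + 1)) U\<^esub> (dif K (n + 1) U s))\<rparr>"

definition cx_shift_map :: "'x cxmap \<Rightarrow> 'x cxmap" where
  "cx_shift_map f = (\<lambda>n. f (n + 1))"

text \<open>The mapping cone of \<open>f : K \<rightarrow> L\<close>, with differential \<open>(a, b) \<mapsto> (- d a, f a + d b)\<close>.\<close>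

definition mapping_cone :: "'x cx \<Rightarrow> 'x cx \<Rightarrow> 'x cxmap \<Rightarrow> 'x cx" where
  "mapping_cone K L f =
     \<lparr>trm = (\<lambda>n. sheaf_sum (trm K (n + 1)) (trm L n)),
      dif = (\<lambda>n U p. upair
        (inv\<^bsub>sec (trm K (n + 1 + 1)) U\<^esub> (dif K (n + 1) U (ufst p)))
        (f (n + 1) U (ufst p) \<otimes>\<^bsub>sec (trm L (n + 1)) U\<^esub> dif L n U (usnd p)))\<rparr>"

definition mapping_cone_in :: "'x cx \<Rightarrow> 'x cxmap" where
  "mapping_cone_in K = (\<lambda>n U b. upair \<one>\<^bsub>sec (trm K (n + 1)) U\<^esub> b)"

definition mapping_cone_out :: "'x cxmap" where
  "mapping_cone_out = (\<lambda>n U p. ufst p)"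

definition degree_zero :: "('x, 'x univ) presheaf \<Rightarrow> 'x cx" where
  "degree_zero F =
     \<lparr>trm = (\<lambda>n. if n = 0 then F else zero_sheaf),
      dif = (\<lambda>n U s. if n = -1 then \<one>\<^bsub>sec F U\<^esub> else (\<lambda>n x. 0))\<rparr>"

text \<open>
  Termwise direct image along the inclusion of \<open>S\<close>.  It is only used for closed \<open>S\<close>, where direct
  image is exact and hence equal to its derived functor.
\<close>

definition cx_push :: "'x set \<Rightarrow> 'x cx \<Rightarrow> 'x cx" where
  "cx_push S K =
     \<lparr>trm = (\<lambda>n. \<lparr>sec = (\<lambda>V. sec (trm K n) (V \<inter> S)),
                  res = (\<lambda>V W. res (trm K n) (V \<inter> S) (W \<inter> S))\<rparr>),
      dif = (\<lambda>n V. dif K n (V \<inter> S))\<rparr>"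

definition cx_push_map :: "'x set \<Rightarrow> 'x cxmap \<Rightarrow> 'x cxmap" where
  "cx_push_map S f = (\<lambda>n V. f n (V \<inter> S))"


section \<open>Triangulated categories\<close>

text \<open>\<open>Cmp g f\<close> is \<open>f\<close> followed by \<open>g\<close>; \<open>Sho\<close> and \<open>Shm\<close> are the shift \<open>[1]\<close> on objects and morphisms.\<close>

record ('o, 'm) tricat =
  Ob :: "'o set"
  Hom :: "'o \<Rightarrow> 'o \<Rightarrow> 'm set"
  Idn :: "'o \<Rightarrow> 'm"
  Cmp :: "'m \<Rightarrow> 'm \<Rightarrow> 'm"
  Add :: "'m \<Rightarrow> 'm \<Rightarrow> 'm"
  Zer :: "'o \<Rightarrow> 'o \<Rightarrow> 'm"
  Sho :: "'o \<Rightarrow> 'o"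
  Shm :: "'m \<Rightarrow> 'm"
  Tri :: "('o \<times> 'o \<times> 'o \<times> 'm \<times> 'm \<times> 'm) set"

record ('o, 'm, 'p, 'q) funct =
  Fo :: "'o \<Rightarrow> 'p"
  Fm :: "'m \<Rightarrow> 'q"

definition category :: "('o, 'm) tricat \<Rightarrow> bool" where
  "category C \<longleftrightarrow>
     (\<forall>A\<in>Ob C. Idn C A \<in> Hom C A A) \<and>
     (\<forall>A\<in>Ob C. \<forall>B\<in>Ob C. \<forall>D\<in>Ob C. \<forall>f\<in>Hom C A B. \<forall>g\<in>Hom C B D. Cmp C g f \<in> Hom C A D) \<and>
     (\<forall>A\<in>Ob C. \<forall>B\<in>Ob C. \<forall>f\<in>Hom C A B. Cmp C f (Idn C A) = f \<and> Cmp C (Idn C B) f = f) \<and>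
     (\<forall>A\<in>Ob C. \<forall>B\<in>Ob C. \<forall>D\<in>Ob C. \<forall>E\<in>Ob C.
        \<forall>f\<in>Hom C A B. \<forall>g\<in>Hom C B D. \<forall>h\<in>Hom C D E. Cmp C h (Cmp C g f) = Cmp C (Cmp C h g) f)"

definition iso_mor :: "('o, 'm) tricat \<Rightarrow> 'o \<Rightarrow> 'o \<Rightarrow> 'm \<Rightarrow> bool" where
  "iso_mor C A B f \<longleftrightarrow>
     f \<in> Hom C A B \<and> (\<exists>g\<in>Hom C B A. Cmp C g f = Idn C A \<and> Cmp C f g = Idn C B)"

definition isomorphic_in :: "('o, 'm) tricat \<Rightarrow> 'o \<Rightarrow> 'o \<Rightarrow> bool" where
  "isomorphic_in C A B \<longleftrightarrow> A \<in> Ob C \<and> B \<in> Ob C \<and> (\<exists>f. iso_mor C A B f)"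

definition is_functor ::
  "('o, 'm) tricat \<Rightarrow> ('p, 'q) tricat \<Rightarrow> ('o, 'm, 'p, 'q) funct \<Rightarrow> bool" where
  "is_functor C D F \<longleftrightarrow>
     (\<forall>A\<in>Ob C. Fo F A \<in> Ob D \<and> Fm F (Idn C A) = Idn D (Fo F A)) \<and>
     (\<forall>A\<in>Ob C. \<forall>B\<in>Ob C. \<forall>f\<in>Hom C A B. Fm F f \<in> Hom D (Fo F A) (Fo F B)) \<and>
     (\<forall>A\<in>Ob C. \<forall>B\<in>Ob C. \<forall>E\<in>Ob C. \<forall>f\<in>Hom C A B. \<forall>g\<in>Hom C B E.
        Fm F (Cmp C g f) = Cmp D (Fm F g) (Fm F f))"

definition additive_functor ::
  "('o, 'm) tricat \<Rightarrow> ('p, 'q) tricat \<Rightarrow> ('o, 'm, 'p, 'q) funct \<Rightarrow> bool" where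
  "additive_functor C D F \<longleftrightarrow>
     is_functor C D F \<and>
     (\<forall>A\<in>Ob C. \<forall>B\<in>Ob C. \<forall>f\<in>Hom C A B. \<forall>g\<in>Hom C A B.
        Fm F (Add C f g) = Add D (Fm F f) (Fm F g))"

definition comp_functor ::
  "('p, 'q, 'r, 's) funct \<Rightarrow> ('o, 'm, 'p, 'q) funct \<Rightarrow> ('o, 'm, 'r, 's) funct" where
  "comp_functor G F = \<lparr>Fo = (\<lambda>A. Fo G (Fo F A)), Fm = (\<lambda>f. Fm G (Fm F f))\<rparr>"

definition shift_functor :: "('o, 'm) tricat \<Rightarrow> ('o, 'm, 'o, 'm) funct" where
  "shift_functor C = \<lparr>Fo = Sho C, Fm = Shm C\<rparr>"

definition nat_iso ::
  "('o, 'm) tricat \<Rightarrow> ('p, 'q) tricat \<Rightarrow> ('o, 'm, 'p, 'q) funct \<Rightarrow> ('o, 'm, 'p, 'q) funct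
     \<Rightarrow> ('o \<Rightarrow> 'q) \<Rightarrow> bool" where
  "nat_iso C D F G \<eta> \<longleftrightarrow>
     (\<forall>A\<in>Ob C. iso_mor D (Fo F A) (Fo G A) (\<eta> A)) \<and>
     (\<forall>A\<in>Ob C. \<forall>B\<in>Ob C. \<forall>f\<in>Hom C A B. Cmp D (\<eta> B) (Fm F f) = Cmp D (Fm G f) (\<eta> A))"

definition naturally_isomorphic ::
  "('o, 'm) tricat \<Rightarrow> ('p, 'q) tricat \<Rightarrow> ('o, 'm, 'p, 'q) funct \<Rightarrow> ('o, 'm, 'p, 'q) funct
     \<Rightarrow> bool" where
  "naturally_isomorphic C D F G \<longleftrightarrow> (\<exists>\<eta>. nat_iso C D F G \<eta>)"

definition hom_group :: "('o, 'm) tricat \<Rightarrow> 'o \<Rightarrow> 'o \<Rightarrow> 'm monoid" where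
  "hom_group C A B = \<lparr>carrier = Hom C A B, mult = Add C, one = Zer C A B\<rparr>"

text \<open>Multiplication by \<open>n\<close> on \<open>A\<close>, i.e. the \<open>n\<close>-fold sum of the identity of \<open>A\<close>.\<close>

definition mult_by :: "('o, 'm) tricat \<Rightarrow> nat \<Rightarrow> 'o \<Rightarrow> 'm" where
  "mult_by C n A = Idn C A [^]\<^bsub>hom_group C A A\<^esub> n"

definition zero_object :: "('o, 'm) tricat \<Rightarrow> 'o \<Rightarrow> bool" where
  "zero_object C Z \<longleftrightarrow> Z \<in> Ob C \<and> Idn C Z = Zer C Z Z"

definition additive_category :: "('o, 'm) tricat \<Rightarrow> bool" where
  "additive_category C \<longleftrightarrow>
     category C \<and>
     (\<forall>A\<in>Ob C. \<forall>B\<in>Ob C. comm_group (hom_group C A B)) \<and>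
     (\<forall>A\<in>Ob C. \<forall>B\<in>Ob C. \<forall>D\<in>Ob C. \<forall>f\<in>Hom C A B. \<forall>f'\<in>Hom C A B. \<forall>g\<in>Hom C B D. \<forall>g'\<in>Hom C B D.
        Cmp C g (Add C f f') = Add C (Cmp C g f) (Cmp C g f') \<and>
        Cmp C (Add C g g') f = Add C (Cmp C g f) (Cmp C g' f)) \<and>
     (\<exists>Z. zero_object C Z) \<and>
     (\<forall>A\<in>Ob C. \<forall>B\<in>Ob C. \<exists>S\<in>Ob C. \<exists>i\<in>Hom C A S. \<exists>j\<in>Hom C B S. \<exists>p\<in>Hom C S A. \<exists>q\<in>Hom C S B.
        Cmp C p i = Idn C A \<and> Cmp C q j = Idn C B \<and> Cmp C q i = Zer C A B \<and> Cmp C p j = Zer C B A \<and>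
        Add C (Cmp C i p) (Cmp C j q) = Idn C S)"

definition triangle :: "('o, 'm) tricat \<Rightarrow> ('o \<times> 'o \<times> 'o \<times> 'm \<times> 'm \<times> 'm) \<Rightarrow> bool" where
  "triangle C = (\<lambda>(A, B, D, f, g, h).
     A \<in> Ob C \<and> B \<in> Ob C \<and> D \<in> Ob C \<and>
     f \<in> Hom C A B \<and> g \<in> Hom C B D \<and> h \<in> Hom C D (Sho C A))"

definition triangle_squares ::
  "('o, 'm) tricat \<Rightarrow> ('o \<times> 'o \<times> 'o \<times> 'm \<times> 'm \<times> 'm) \<Rightarrow> ('o \<times> 'o \<times> 'o \<times> 'm \<times> 'm \<times> 'm)
     \<Rightarrow> 'm \<Rightarrow> 'm \<Rightarrow> 'm \<Rightarrow> bool" where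
  "triangle_squares C = (\<lambda>(A, B, D, f, g, h) (A', B', D', f', g', h') a b d.
     Cmp C b f = Cmp C f' a \<and> Cmp C d g = Cmp C g' b \<and> Cmp C (Shm C a) h = Cmp C h' d)"

definition triangle_isomorphic ::
  "('o, 'm) tricat \<Rightarrow> ('o \<times> 'o \<times> 'o \<times> 'm \<times> 'm \<times> 'm) \<Rightarrow> ('o \<times> 'o \<times> 'o \<times> 'm \<times> 'm \<times> 'm)
     \<Rightarrow> bool" where
  "triangle_isomorphic C = (\<lambda>(A, B, D, f, g, h) (A', B', D', f', g', h').
     \<exists>a b d. iso_mor C A A' a \<and> iso_mor C B B' b \<and> iso_mor C D D' d \<and>
       triangle_squares C (A, B, D, f, g, h) (A', B', D', f', g', h') a b d)"

text \<open>Verdier's axioms; the last one is the octahedral axiom.\<close>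

locale triangulated_category =
  fixes C :: "('o, 'm) tricat"
  assumes additive: "additive_category C"
    and shift_additive: "additive_functor C C (shift_functor C)"
    and shift_fully_faithful:
      "\<And>A B. A \<in> Ob C \<Longrightarrow> B \<in> Ob C \<Longrightarrow> bij_betw (Shm C) (Hom C A B) (Hom C (Sho C A) (Sho C B))"
    and shift_ess_surj: "\<And>A. A \<in> Ob C \<Longrightarrow> \<exists>B\<in>Ob C. isomorphic_in C (Sho C B) A"
    and tri_triangle: "\<And>t. t \<in> Tri C \<Longrightarrow> triangle C t"
    and tri_iso: "\<And>t t'. t \<in> Tri C \<Longrightarrow> triangle C t' \<Longrightarrow> triangle_isomorphic C t t' \<Longrightarrow> t' \<in> Tri C"
    and tri_id: "\<And>A Z. A \<in> Ob C \<Longrightarrow> zero_object C Z \<Longrightarrow>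
      (A, A, Z, Idn C A, Zer C A Z, Zer C Z (Sho C A)) \<in> Tri C"
    and tri_exists: "\<And>A B f. A \<in> Ob C \<Longrightarrow> B \<in> Ob C \<Longrightarrow> f \<in> Hom C A B \<Longrightarrow>
      \<exists>D g h. (A, B, D, f, g, h) \<in> Tri C"
    and tri_rotate: "\<And>A B D f g h. triangle C (A, B, D, f, g, h) \<Longrightarrow>
      (A, B, D, f, g, h) \<in> Tri C \<longleftrightarrow>
      (B, D, Sho C A, g, h, inv\<^bsub>hom_group C (Sho C A) (Sho C B)\<^esub> (Shm C f)) \<in> Tri C"
    and tri_complete: "\<And>A B D f g h A' B' D' f' g' h' a b.
      (A, B, D, f, g, h) \<in> Tri C \<Longrightarrow> (A', B', D', f', g', h') \<in> Tri C \<Longrightarrow>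
      a \<in> Hom C A A' \<Longrightarrow> b \<in> Hom C B B' \<Longrightarrow> Cmp C b f = Cmp C f' a \<Longrightarrow>
      \<exists>d\<in>Hom C D D'. triangle_squares C (A, B, D, f, g, h) (A', B', D', f', g', h') a b d"
    and tri_octahedral: "\<And>A B D P Q R f g p p' q q' r r'.
      (A, B, P, f, p, p') \<in> Tri C \<Longrightarrow> (B, D, Q, g, q, q') \<in> Tri C \<Longrightarrow>
      (A, D, R, Cmp C g f, r, r') \<in> Tri C \<Longrightarrow>
      \<exists>u v. (P, R, Q, u, v, Cmp C (Shm C p) q') \<in> Tri C \<and>
        Cmp C u p = Cmp C r g \<and> Cmp C r' u = p' \<and>
        Cmp C v r = q \<and> Cmp C q' v = Cmp C (Shm C f) r'"

definition shift2 :: "('o, 'm) tricat \<Rightarrow> 'o \<Rightarrow> 'o" where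
  "shift2 C A = Sho C (Sho C A)"

definition is_cone :: "('o, 'm) tricat \<Rightarrow> 'o \<Rightarrow> 'o \<Rightarrow> 'm \<Rightarrow> 'o \<Rightarrow> bool" where
  "is_cone C A B f D \<longleftrightarrow> (\<exists>g h. (A, B, D, f, g, h) \<in> Tri C)"

definition triangulated_functor ::
  "('o, 'm) tricat \<Rightarrow> ('p, 'q) tricat \<Rightarrow> ('o, 'm, 'p, 'q) funct \<Rightarrow> bool" where
  "triangulated_functor C D F \<longleftrightarrow>
     additive_functor C D F \<and>
     (\<exists>\<eta>. nat_iso C D (comp_functor F (shift_functor C)) (comp_functor (shift_functor D) F) \<eta> \<and>
        (\<forall>A B E f g h. (A, B, E, f, g, h) \<in> Tri C \<longrightarrow>
           (Fo F A, Fo F B, Fo F E, Fm F f, Fm F g, Cmp D (\<eta> A) (Fm F h)) \<in> Tri D))"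

definition commutes_with_cones ::
  "('o, 'm) tricat \<Rightarrow> ('p, 'q) tricat \<Rightarrow> ('o, 'm, 'p, 'q) funct \<Rightarrow> bool" where
  "commutes_with_cones C D F \<longleftrightarrow>
     (\<forall>A\<in>Ob C. \<forall>B\<in>Ob C. \<forall>f\<in>Hom C A B. \<forall>E.
        is_cone C A B f E \<longrightarrow> is_cone D (Fo F A) (Fo F B) (Fm F f) (Fo F E))"

definition commutes_with_mult ::
  "nat \<Rightarrow> ('o, 'm) tricat \<Rightarrow> ('p, 'q) tricat \<Rightarrow> ('o, 'm, 'p, 'q) funct \<Rightarrow> bool" where
  "commutes_with_mult n C D F \<longleftrightarrow>
     (\<forall>A\<in>Ob C. Fm F (mult_by C n A) = mult_by D n (Fo F A))"

definition commutes_with_shifts ::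
  "('o, 'm) tricat \<Rightarrow> ('p, 'q) tricat \<Rightarrow> ('o, 'm, 'p, 'q) funct \<Rightarrow> bool" where
  "commutes_with_shifts C D F \<longleftrightarrow>
     naturally_isomorphic C D (comp_functor F (shift_functor C)) (comp_functor (shift_functor D) F)"


section \<open>The bounded constructible derived category\<close>

text \<open>
  The bounded derived category is the localization of the category of bounded complexes at the
  quasi-isomorphisms: morphisms are zigzags of chain maps and formal inverses of quasi-isomorphisms,
  modulo the congruence that makes these inverses inverse and respects composition of chain maps.
  \<open>Inv K s L\<close> is the inverse \<open>L \<rightarrow> K\<close> of \<open>s : K \<rightarrow> L\<close>; zigzags are composed from left to right.
\<close>

datatype ('c, 'f) letter = Fwd 'c 'f 'c | Inv 'c 'f 'c

type_synonym 'x letters = "('x cx, 'x cxmap) letter list"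

inductive zigzag :: "'x topology \<Rightarrow> 'x cx \<Rightarrow> 'x letters \<Rightarrow> 'x cx \<Rightarrow> bool" for T where
  nil: "bounded_complex T K \<Longrightarrow> zigzag T K [] K"
| fwd: "cx_hom T K L f \<Longrightarrow> zigzag T L w M \<Longrightarrow> zigzag T K (Fwd K f L # w) M"
| inv: "quasi_iso T K L s \<Longrightarrow> zigzag T K w M \<Longrightarrow> zigzag T L (Inv K s L # w) M"

inductive zigzag_eq :: "'x topology \<Rightarrow> 'x cx \<Rightarrow> 'x letters \<Rightarrow> 'x letters \<Rightarrow> 'x cx \<Rightarrow> bool" for T where
  refl: "zigzag T K w L \<Longrightarrow> zigzag_eq T K w w L"
| sym: "zigzag_eq T K v w L \<Longrightarrow> zigzag_eq T K w v L"
| trans: "zigzag_eq T K u v L \<Longrightarrow> zigzag_eq T K v w L \<Longrightarrow> zigzag_eq T K u w L"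
| cong: "zigzag T K u L \<Longrightarrow> zigzag_eq T L v v' M \<Longrightarrow> zigzag T M w N \<Longrightarrow>
    zigzag_eq T K (u @ v @ w) (u @ v' @ w) N"
| ext: "cx_hom T K L f \<Longrightarrow> cx_hom T K L g \<Longrightarrow>
    (\<And>n U s. openin T U \<Longrightarrow> s \<in> carrier (sec (trm K n) U) \<Longrightarrow> f n U s = g n U s) \<Longrightarrow>
    zigzag_eq T K [Fwd K f L] [Fwd K g L] L"
| ident: "bounded_complex T K \<Longrightarrow> zigzag_eq T K [Fwd K (\<lambda>n U s. s) K] [] K"
| comp: "cx_hom T K L f \<Longrightarrow> cx_hom T L M g \<Longrightarrow>
    zigzag_eq T K [Fwd K f L, Fwd L g M] [Fwd K (\<lambda>n U s. g n U (f n U s)) M] M"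
| inv_right: "quasi_iso T K L s \<Longrightarrow> zigzag_eq T K [Fwd K s L, Inv K s L] [] K"
| inv_left: "quasi_iso T K L s \<Longrightarrow> zigzag_eq T L [Inv K s L, Fwd K s L] [] L"

type_synonym 'x dmor = "('x cx \<times> 'x letters \<times> 'x cx) set"

definition zclass :: "'x topology \<Rightarrow> 'x cx \<Rightarrow> 'x letters \<Rightarrow> 'x cx \<Rightarrow> 'x dmor" where
  "zclass T K w L = {(K, v, L) | v. zigzag_eq T K w v L}"

definition d_comp :: "'x topology \<Rightarrow> 'x dmor \<Rightarrow> 'x dmor \<Rightarrow> 'x dmor" where
  "d_comp T \<beta> \<alpha> = \<Union>{zclass T K (v @ w) M | K v L w M. (K, v, L) \<in> \<alpha> \<and> (L, w, M) \<in> \<beta>}"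

text \<open>Morphisms are added after bringing them to a common denominator: \<open>f/s + g/s = (f + g)/s\<close>.\<close>

definition d_add :: "'x topology \<Rightarrow> 'x dmor \<Rightarrow> 'x dmor \<Rightarrow> 'x dmor" where
  "d_add T \<alpha> \<beta> = \<Union>{zclass T K [Inv M s K, Fwd M (cx_add L f g) L] L | K L M s f g.
     (K, [Inv M s K, Fwd M f L], L) \<in> \<alpha> \<and> (K, [Inv M s K, Fwd M g L], L) \<in> \<beta>}"

fun letter_map ::
  "('x cx \<Rightarrow> 'x cx) \<Rightarrow> ('x cxmap \<Rightarrow> 'x cxmap) \<Rightarrow> ('x cx, 'x cxmap) letter \<Rightarrow> ('x cx, 'x cxmap) letter"
where
  "letter_map \<Phi> \<phi> (Fwd K f L) = Fwd (\<Phi> K) (\<phi> f) (\<Phi> L)"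
| "letter_map \<Phi> \<phi> (Inv K f L) = Inv (\<Phi> K) (\<phi> f) (\<Phi> L)"

text \<open>The functor on derived categories induced by a functor on complexes that preserves
  quasi-isomorphisms; \<open>T\<close> is the target space.\<close>

definition d_map ::
  "'x topology \<Rightarrow> ('x cx \<Rightarrow> 'x cx) \<Rightarrow> ('x cxmap \<Rightarrow> 'x cxmap) \<Rightarrow> 'x dmor \<Rightarrow> 'x dmor" where
  "d_map T \<Phi> \<phi> \<alpha> = \<Union>{zclass T (\<Phi> K) (map (letter_map \<Phi> \<phi>) w) (\<Phi> L) | K w L. (K, w, L) \<in> \<alpha>}"

definition chain_mor :: "'x topology \<Rightarrow> 'x cx \<Rightarrow> 'x cxmap \<Rightarrow> 'x cx \<Rightarrow> 'x dmor" where
  "chain_mor T K f L = zclass T K [Fwd K f L] L"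

text \<open>
  The category without its distinguished triangles, which are then those isomorphic to the triangle
  of a mapping cone.
\<close>

definition Dbc_base :: "'x fspace \<Rightarrow> ('x cx, 'x dmor) tricat" where
  "Dbc_base X = (let T = analytic_top X in
     \<lparr>Ob = {K. bounded_complex T K \<and> (\<forall>n. constructible X (cohomology_sheaf T K n))},
      Hom = (\<lambda>K L. {zclass T K w L | w. zigzag T K w L}),
      Idn = (\<lambda>K. zclass T K [] K),
      Cmp = d_comp T,
      Add = d_add T,
      Zer = (\<lambda>K L. chain_mor T K (cx_zero L) L),
      Sho = cx_shift,
      Shm = d_map T cx_shift cx_shift_map,
      Tri = {}\<rparr>)"

definition Dbc :: "'x fspace \<Rightarrow> ('x cx, 'x dmor) tricat" where
  "Dbc X = (let T = analytic_top X in (Dbc_base X)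
     \<lparr>Tri := {t. triangle (Dbc_base X) t \<and>
        (\<exists>K L f. K \<in> Ob (Dbc_base X) \<and> L \<in> Ob (Dbc_base X) \<and> cx_hom T K L f \<and>
          triangle_isomorphic (Dbc_base X) t
            (K, L, mapping_cone K L f, chain_mor T K f L,
             chain_mor T L (mapping_cone_in K) (mapping_cone K L f),
             chain_mor T (mapping_cone K L f) mapping_cone_out (cx_shift K)))}\<rparr>)"

text \<open>Direct image along the inclusion of a closed subvariety \<open>S\<close> of \<open>Y\<close>.\<close>

definition Dbc_push :: "'x fspace \<Rightarrow> 'x set \<Rightarrow> ('x cx, 'x dmor, 'x cx, 'x dmor) funct" where
  "Dbc_push Y S =
     \<lparr>Fo = cx_push S, Fm = d_map (analytic_top Y) (cx_push S) (cx_push_map S)\<rparr>"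

definition const_usheaf :: "'x fspace \<Rightarrow> int monoid \<Rightarrow> ('x, 'x univ) presheaf" where
  "const_usheaf X G = to_univ (const_sheaf (analytic_top X) G)"


section \<open>Integral motivic sheaf formalisms\<close>

record ('x, 'o, 'm) motivic =
  mcat :: "'x fspace \<Rightarrow> ('o, 'm) tricat"
  munit :: "'x fspace \<Rightarrow> 'o"
  mpush :: "'x fspace \<Rightarrow> 'x fspace \<Rightarrow> ('x \<Rightarrow> 'x) \<Rightarrow> ('o, 'm, 'o, 'm) funct"
  mreal :: "'x fspace \<Rightarrow> ('o, 'm, 'x cx, 'x dmor) funct"

locale motivic_formalism =
  fixes M :: "('x, 'o, 'm) motivic"
  assumes mcat_triangulated: "\<And>X. variety X \<Longrightarrow> triangulated_category (mcat M X)"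
    and munit_object: "\<And>X. variety X \<Longrightarrow> munit M X \<in> Ob (mcat M X)"
    and mpush_triangulated: "\<And>X Y h. variety X \<Longrightarrow> variety Y \<Longrightarrow> proper_morphism X Y h \<Longrightarrow>
      triangulated_functor (mcat M X) (mcat M Y) (mpush M X Y h)"
    and mreal_functor: "\<And>X. variety X \<Longrightarrow> is_functor (mcat M X) (Dbc X) (mreal M X)"
    and mreal_unit: "\<And>X. variety X \<Longrightarrow>
      isomorphic_in (Dbc X) (Fo (mreal M X) (munit M X)) (degree_zero (const_usheaf X integer_group))"

text \<open>\<open>C\<close> is \<open>\<one>/n\<close> on \<open>X\<close>; cones being defined up to isomorphism, this is a predicate.\<close>

definition is_unit_mod :: "('x, 'o, 'm) motivic \<Rightarrow> 'x fspace \<Rightarrow> nat \<Rightarrow> 'o \<Rightarrow> bool" where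
  "is_unit_mod M X n C \<longleftrightarrow>
     is_cone (mcat M X) (munit M X) (munit M X) (mult_by (mcat M X) n (munit M X)) C"

text \<open>Proper pushforward along the inclusion of a closed subvariety \<open>S\<close> of \<open>Y\<close>.\<close>

definition mincl :: "('x, 'o, 'm) motivic \<Rightarrow> 'x fspace \<Rightarrow> 'x set \<Rightarrow> ('o, 'm, 'o, 'm) funct" where
  "mincl M Y S = mpush M (subvar Y S) Y (\<lambda>x. x)"

text \<open>The motivic object \<open>i\<^sub>* (\<one>/n) [2]\<close> for \<open>C = \<one>/n\<close>.\<close>

definition motivic_torsion :: "('x, 'o, 'm) motivic \<Rightarrow> 'x fspace \<Rightarrow> 'x set \<Rightarrow> 'o \<Rightarrow> 'o" where
  "motivic_torsion M Y S C = shift2 (mcat M Y) (Fo (mincl M Y S) C)"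

text \<open>\<open>i\<^sub>* F [2]\<close> for a sheaf \<open>F\<close> on \<open>S\<close>.\<close>

definition sheaf_term :: "'x fspace \<Rightarrow> 'x set \<Rightarrow> ('x, 'x univ) presheaf \<Rightarrow> 'x cx" where
  "sheaf_term Y S F = shift2 (Dbc Y) (Fo (Dbc_push Y S) (degree_zero F))"


section \<open>The local system of torsion in the cohomology of transverse links\<close>

definition cochain_group :: "nat \<Rightarrow> 'x topology \<Rightarrow> ('x chain \<Rightarrow> int) monoid" where
  "cochain_group p T =
     \<lparr>carrier = hom (chain_group p T) integer_group \<inter> extensional (carrier (chain_group p T)),
      mult = (\<lambda>c d. \<lambda>a\<in>carrier (chain_group p T). c a + d a),
      one = (\<lambda>a\<in>carrier (chain_group p T). 0)\<rparr>"

definition coboundary :: "nat \<Rightarrow> 'x topology \<Rightarrow> ('x chain \<Rightarrow> int) \<Rightarrow> ('x chain \<Rightarrow> int)" where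
  "coboundary p T c = (\<lambda>a\<in>carrier (chain_group (Suc p) T). c (chain_boundary (Suc p) a))"

definition singular_cocycles :: "nat \<Rightarrow> 'x topology \<Rightarrow> ('x chain \<Rightarrow> int) monoid" where
  "singular_cocycles p T = (cochain_group p T)
     \<lparr>carrier := {c \<in> carrier (cochain_group p T). coboundary p T c = \<one>\<^bsub>cochain_group (Suc p) T\<^esub>}\<rparr>"

definition singular_coboundaries :: "nat \<Rightarrow> 'x topology \<Rightarrow> ('x chain \<Rightarrow> int) set" where
  "singular_coboundaries p T =
     (if p = 0 then {\<one>\<^bsub>cochain_group p T\<^esub>}
      else coboundary (p - 1) T ` carrier (cochain_group (p - 1) T))"

definition singular_cohomology :: "nat \<Rightarrow> 'x topology \<Rightarrow> ('x chain \<Rightarrow> int) set monoid" where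
  "singular_cohomology p T = singular_cocycles p T Mod singular_coboundaries p T"

definition torsion_part :: "'g monoid \<Rightarrow> 'g monoid" where
  "torsion_part G = G\<lparr>carrier := {a \<in> carrier G. \<exists>k::nat. k > 0 \<and> a [^]\<^bsub>G\<^esub> k = \<one>\<^bsub>G\<^esub>}\<rparr>"

text \<open>
  \<open>V \<mapsto> H\<^sup>2(V - S, \<int>)\<^sub>t\<^sub>o\<^sub>r\<^sub>s\<close>.  For small neighbourhoods \<open>V\<close> of a point of \<open>S\<close> in the situation of
  \<open>transverse_quarter_11\<close> the complement \<open>V - S\<close> retracts onto the transverse link at that point,
  so that the stalks of the inverse image to \<open>S\<close> are the torsion groups of the links.
\<close>

definition link_presheaf :: "'x fspace \<Rightarrow> 'x set \<Rightarrow> ('x, ('x chain \<Rightarrow> int) set) presheaf" where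
  "link_presheaf Y S = (let T = (\<lambda>V. subtopology (analytic_top Y) (V - S)) in
     \<lparr>sec = (\<lambda>V. torsion_part (singular_cohomology 2 (T V))),
      res = (\<lambda>V W A. singular_coboundaries 2 (T W) <#>\<^bsub>cochain_group 2 (T W)\<^esub>
         ((\<lambda>c. restrict c (carrier (chain_group 2 (T W)))) ` A))\<rparr>)"

definition link_torsion_sheaf ::
  "'x fspace \<Rightarrow> 'x set \<Rightarrow> ('x, 'x \<Rightarrow> ('x, ('x chain \<Rightarrow> int) set) germ) presheaf" where
  "link_torsion_sheaf Y S = inverse_image (analytic_top Y) (link_presheaf Y S) S"

end

theory Submission
  imports Defs
begin

text \<open>
  Only the cohomology sheaves of the realization are needed, so no calculus of fractions enters.
  A zigzag of chain maps and inverted quasi-isomorphisms acts on the stalks of the cohomology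
  sheaves, and equivalent zigzags act alike.  Hence an isomorphism in \<open>D\<^sup>b\<^sub>c\<close> preserves the property
  that the cohomology in degree \<open>n\<close> is a given constant sheaf on \<open>\<Sigma>\<close>, extended by zero.  The object
  \<open>Real (i\<^sub>* \<one>)\<close> has cohomology \<open>i\<^sub>* \<int>\<close> in degree 0, on which the fourfold sum of the identity acts as
  multiplication by 4 because sums are formed over a common denominator; the long exact sequence of
  a mapping cone then gives \<open>i\<^sub>* \<int>/4\<close> as the only cohomology sheaf of \<open>Real (i\<^sub>* (\<one>/4))\<close>.  Finally a
  complex \<open>Q\<close> whose only cohomology sheaf is a constant sheaf in degree \<open>m\<close> is joined to that sheaf
  by the quasi-isomorphisms \<open>Q \<leftarrow> \<tau>\<^sub>\<le>\<^sub>m Q \<rightarrow> F[-m]\<close>.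
\<close>

section \<open>Germs and inverse images\<close>

text \<open>Two obstacles shape the argument. An inverted quasi-isomorphism acts on cohomology
  stalks but not on sections, and knowing every stalk would not show that a sheaf is constant. Hence
  the action of a zigzag on stalks is supplemented by \<open>wmap_open\<close>: the germs of one
  cocycle are carried, on a whole neighbourhood, to the germs of one cocycle. For the same reason a
  constant cohomology sheaf is described by values of cocycles that vary locally constantly with the
  point. The other obstacle is that the target, a constant sheaf on \<Sigma> placed in degree -2,
  has to be an object of the derived category. Its constructibility is inherited: the realization is
  an object by functoriality, and both legs of the final roof preserve constructible cohomology. The
  compatibilities with cones and with 4 concern the realization on the threefold. The cone over
  \<Sigma> is therefore pushed forward on the motivic side before it is realized, which requires
  that the closed inclusion be proper and that the analytic topology of \<Sigma> be the subspace
  topology.\<close>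

locale presheaf_on =
  fixes T :: "'x topology" and F :: "('x, 'u) presheaf"
  assumes is_presheaf: "is_presheaf T F"
begin

lemma sec_group: "openin T U \<Longrightarrow> comm_group (sec F U)"
  using is_presheaf by (auto simp: is_presheaf_def)

lemma sec_group': "openin T U \<Longrightarrow> group (sec F U)"
  using sec_group comm_group.axioms(2) by blast

lemma res_hom: "openin T U \<Longrightarrow> openin T V \<Longrightarrow> V \<subseteq> U \<Longrightarrow> res F U V \<in> hom (sec F U) (sec F V)"
  using is_presheaf by (auto simp: is_presheaf_def)

lemma res_closed:
  "openin T U \<Longrightarrow> openin T V \<Longrightarrow> V \<subseteq> U \<Longrightarrow> s \<in> carrier (sec F U) \<Longrightarrow> res F U V s \<in> carrier (sec F V)"
  by (rule hom_in_carrier[OF res_hom])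

lemma res_mult:
  "openin T U \<Longrightarrow> openin T V \<Longrightarrow> V \<subseteq> U \<Longrightarrow> s \<in> carrier (sec F U) \<Longrightarrow> t \<in> carrier (sec F U) \<Longrightarrow>
   res F U V (s \<otimes>\<^bsub>sec F U\<^esub> t) = res F U V s \<otimes>\<^bsub>sec F V\<^esub> res F U V t"
  by (rule hom_mult[OF res_hom])

lemma res_one:
  "openin T U \<Longrightarrow> openin T V \<Longrightarrow> V \<subseteq> U \<Longrightarrow> res F U V \<one>\<^bsub>sec F U\<^esub> = \<one>\<^bsub>sec F V\<^esub>"
  by (rule hom_one[OF res_hom sec_group' sec_group'])

lemma res_inv:
  "openin T U \<Longrightarrow> openin T V \<Longrightarrow> V \<subseteq> U \<Longrightarrow> s \<in> carrier (sec F U) \<Longrightarrow>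
   res F U V (inv\<^bsub>sec F U\<^esub> s) = inv\<^bsub>sec F V\<^esub> res F U V s"
  using group_hom.hom_inv[of "sec F U" "sec F V" "res F U V" s] res_hom sec_group'
  by (auto simp: group_hom_def group_hom_axioms_def)

lemma res_self: "openin T U \<Longrightarrow> s \<in> carrier (sec F U) \<Longrightarrow> res F U U s = s"
  using is_presheaf by (auto simp: is_presheaf_def)

lemma res_res:
  "openin T U \<Longrightarrow> openin T V \<Longrightarrow> openin T W \<Longrightarrow> W \<subseteq> V \<Longrightarrow> V \<subseteq> U \<Longrightarrow> s \<in> carrier (sec F U) \<Longrightarrow>
   res F V W (res F U V s) = res F U W s"
  using is_presheaf unfolding is_presheaf_def by blast

lemma mult_closed:
  "openin T U \<Longrightarrow> s \<in> carrier (sec F U) \<Longrightarrow> t \<in> carrier (sec F U) \<Longrightarrow> s \<otimes>\<^bsub>sec F U\<^esub> t \<in> carrier (sec F U)"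
  by (rule monoid.m_closed[OF group.is_monoid[OF sec_group']])

lemma one_closed: "openin T U \<Longrightarrow> \<one>\<^bsub>sec F U\<^esub> \<in> carrier (sec F U)"
  by (rule monoid.one_closed[OF group.is_monoid[OF sec_group']])

lemma inv_closed: "openin T U \<Longrightarrow> s \<in> carrier (sec F U) \<Longrightarrow> inv\<^bsub>sec F U\<^esub> s \<in> carrier (sec F U)"
  by (rule group.inv_closed[OF sec_group'])

lemma mem_germ_self:
  "openin T U \<Longrightarrow> x \<in> U \<Longrightarrow> s \<in> carrier (sec F U) \<Longrightarrow> (U, s) \<in> germ T F x U s"
  unfolding germ_def by auto

text \<open>Germs are encoded as whole equivalence classes, so their equality is an equality of
  sets. Transitivity of local agreement comes from shrinking to the intersection of two witnessing
  neighbourhoods.\<close>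

lemma germ_eqI:
  assumes "openin T U" "s \<in> carrier (sec F U)" "openin T V" "t \<in> carrier (sec F V)"
    and W: "openin T W" "x \<in> W" "W \<subseteq> U \<inter> V" "res F U W s = res F V W t"
  shows "germ T F x U s = germ T F x V t"
proof -
  have *: "germ T F x U s \<subseteq> germ T F x V t"
    if "openin T U" "s \<in> carrier (sec F U)" "openin T V" "t \<in> carrier (sec F V)"
      "W \<subseteq> U \<inter> V" "res F U W s = res F V W t" for U V s t
  proof
    fix p assume "p \<in> germ T F x U s"
    then obtain V' t' W' where p: "p = (V', t')" "openin T V'" "x \<in> V'" "t' \<in> carrier (sec F V')"
      and W': "openin T W'" "x \<in> W'" "W' \<subseteq> U \<inter> V'" "res F U W' s = res F V' W' t'"
      unfolding germ_def by auto
    have o: "openin T (W \<inter> W')" using W(1) W'(1) by blast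
    have "res F V (W \<inter> W') t = res F W (W \<inter> W') (res F V W t)"
      using that W(1) o by (intro res_res[symmetric]) auto
    also have "\<dots> = res F U (W \<inter> W') s"
      using that W(1) o by (simp flip: that(6)) (intro res_res, auto)
    also have "\<dots> = res F W' (W \<inter> W') (res F U W' s)"
      using that W' o by (intro res_res[symmetric]) auto
    also have "\<dots> = res F V' (W \<inter> W') t'"
      using p W' o by simp (intro res_res, auto)
    finally show "p \<in> germ T F x V t"
      unfolding germ_def using p that W' W(2) o by (auto intro!: exI[of _ "W \<inter> W'"])
  qed
  show ?thesis using *[of U s V t] *[of V t U s] assms by auto
qed

lemma germ_eqD:
  assumes "germ T F x U s = germ T F x V t" "openin T V" "x \<in> V" "t \<in> carrier (sec F V)"
  shows "\<exists>W. openin T W \<and> x \<in> W \<and> W \<subseteq> U \<inter> V \<and> res F U W s = res F V W t"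
  using mem_germ_self[OF assms(2-4)] unfolding assms(1)[symmetric] by (auto simp: germ_def)

lemma germ_mem_eq:
  assumes "(V, t) \<in> germ T F x U s" "openin T U" "s \<in> carrier (sec F U)"
  shows "germ T F x V t = germ T F x U s" "openin T V" "x \<in> V" "t \<in> carrier (sec F V)"
proof -
  show *: "openin T V" "x \<in> V" "t \<in> carrier (sec F V)" using assms by (auto simp: germ_def)
  obtain W where W: "openin T W" "x \<in> W" "W \<subseteq> U \<inter> V" "res F U W s = res F V W t"
    using assms by (auto simp: germ_def)
  then show "germ T F x V t = germ T F x U s"
    using * assms by (intro germ_eqI[of V t U s W]) auto
qed

lemma germ_res:
  assumes "openin T U" "s \<in> carrier (sec F U)" "openin T V" "x \<in> V" "V \<subseteq> U"
  shows "germ T F x V (res F U V s) = germ T F x U s"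
  using assms by (intro germ_eqI[of _ _ _ _ V]) (auto simp: res_closed res_self)

lemma germ_in_stalk:
  "openin T U \<Longrightarrow> x \<in> U \<Longrightarrow> s \<in> carrier (sec F U) \<Longrightarrow> germ T F x U s \<in> carrier (stalk T F x)"
  by (auto simp: stalk_def)

lemma stalkE:
  assumes "a \<in> carrier (stalk T F x)"
  obtains U s where "openin T U" "x \<in> U" "s \<in> carrier (sec F U)" "a = germ T F x U s"
  using assms by (auto simp: stalk_def)

text \<open>Restriction to the intersection gives both germs representatives over one open set, so
  binary operations on a stalk reduce to a single group of sections.\<close>

lemma stalkE2:
  assumes "a \<in> carrier (stalk T F x)" "b \<in> carrier (stalk T F x)"
  obtains U s t where "openin T U" "x \<in> U" "s \<in> carrier (sec F U)" "a = germ T F x U s"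
    "t \<in> carrier (sec F U)" "b = germ T F x U t"
proof -
  obtain U s where U: "openin T U" "x \<in> U" "s \<in> carrier (sec F U)" "a = germ T F x U s"
    using assms(1) by (rule stalkE)
  obtain V t where V: "openin T V" "x \<in> V" "t \<in> carrier (sec F V)" "b = germ T F x V t"
    using assms(2) by (rule stalkE)
  have "openin T (U \<inter> V)" using U V by blast
  with U V show ?thesis
    by (intro that[of "U \<inter> V" "res F U (U \<inter> V) s" "res F V (U \<inter> V) t"]) (auto simp: res_closed germ_res)
qed

text \<open>The product in the stalk is a union over all pairs of representatives. Since restriction
  is multiplicative, all pairs give the same germ and the family is a singleton.\<close>

lemma stalk_mult_germ:
  assumes U: "openin T U" "x \<in> U" "s \<in> carrier (sec F U)" "t \<in> carrier (sec F U)"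
  shows "germ T F x U s \<otimes>\<^bsub>stalk T F x\<^esub> germ T F x U t = germ T F x U (s \<otimes>\<^bsub>sec F U\<^esub> t)"
proof -
  have "germ T F x V (s' \<otimes>\<^bsub>sec F V\<^esub> t') = germ T F x U (s \<otimes>\<^bsub>sec F U\<^esub> t)"
    if "(V, s') \<in> germ T F x U s" "(V, t') \<in> germ T F x U t" for V s' t'
  proof -
    note s = germ_mem_eq[OF that(1) U(1,3)] and t = germ_mem_eq[OF that(2) U(1,4)]
    obtain W where W: "openin T W" "x \<in> W" "W \<subseteq> V \<inter> U" "res F V W s' = res F U W s"
      using germ_eqD[OF s(1)] U by auto
    obtain W' where W': "openin T W'" "x \<in> W'" "W' \<subseteq> V \<inter> U" "res F V W' t' = res F U W' t"
      using germ_eqD[OF t(1)] U by auto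
    let ?W = "W \<inter> W'"
    have o: "openin T ?W" using W W' by blast
    have "res F V ?W s' = res F U ?W s"
      using res_res[of V W ?W s'] res_res[of U W ?W s] W o s U by auto
    moreover have "res F V ?W t' = res F U ?W t"
      using res_res[of V W' ?W t'] res_res[of U W' ?W t] W' o t U by auto
    ultimately have "res F V ?W (s' \<otimes>\<^bsub>sec F V\<^esub> t') = res F U ?W (s \<otimes>\<^bsub>sec F U\<^esub> t)"
      using W W' o s t U by (subst (1 2) res_mult) auto
    then show ?thesis
      using W W' o s t U by (intro germ_eqI[of _ _ _ _ ?W]) (auto simp: mult_closed)
  qed
  then have "{germ T F x V (s' \<otimes>\<^bsub>sec F V\<^esub> t') | V s' t'. (V, s') \<in> germ T F x U s \<and> (V, t') \<in> germ T F x U t}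
    = {germ T F x U (s \<otimes>\<^bsub>sec F U\<^esub> t)}"
    using mem_germ_self[OF U(1,2,3)] mem_germ_self[OF U(1,2,4)] by blast
  then show ?thesis by (simp add: stalk_def)
qed

lemma stalk_one_germ:
  assumes "openin T U" "x \<in> U"
  shows "\<one>\<^bsub>stalk T F x\<^esub> = germ T F x U \<one>\<^bsub>sec F U\<^esub>"
proof -
  have "germ T F x (topspace T) \<one>\<^bsub>sec F (topspace T)\<^esub> = germ T F x U \<one>\<^bsub>sec F U\<^esub>"
    using assms openin_subset[OF assms(1)] by (intro germ_eqI[of _ _ _ _ U]) (simp_all add: one_closed res_one)
  then show ?thesis by (simp add: stalk_def)
qed

lemma stalk_comm_group:
  assumes x: "x \<in> topspace T"
  shows "comm_group (stalk T F x)"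
proof (rule comm_groupI)
  let ?S = "stalk T F x"
  show "\<one>\<^bsub>?S\<^esub> \<in> carrier ?S"
    using x by (simp add: stalk_one_germ[OF openin_topspace] germ_in_stalk one_closed)
  fix a assume a: "a \<in> carrier ?S"
  obtain U s where U: "openin T U" "x \<in> U" "s \<in> carrier (sec F U)" "a = germ T F x U s"
    using a by (rule stalkE)
  interpret G: comm_group "sec F U" using U sec_group by blast
  show "\<one>\<^bsub>?S\<^esub> \<otimes>\<^bsub>?S\<^esub> a = a"
    using U by (simp add: stalk_one_germ[of U] stalk_mult_germ)
  show "\<exists>b\<in>carrier ?S. b \<otimes>\<^bsub>?S\<^esub> a = \<one>\<^bsub>?S\<^esub>"
    using U by (intro bexI[of _ "germ T F x U (inv\<^bsub>sec F U\<^esub> s)"])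
      (simp_all add: stalk_one_germ[of U] stalk_mult_germ germ_in_stalk)
next
  let ?S = "stalk T F x"
  fix a b assume a: "a \<in> carrier ?S" "b \<in> carrier ?S"
  obtain U s t where U: "openin T U" "x \<in> U" "s \<in> carrier (sec F U)" "a = germ T F x U s"
    "t \<in> carrier (sec F U)" "b = germ T F x U t"
    using a by (rule stalkE2)
  interpret G: comm_group "sec F U" using U sec_group by blast
  show "a \<otimes>\<^bsub>?S\<^esub> b \<in> carrier ?S" using U by (simp add: stalk_mult_germ germ_in_stalk)
  show "a \<otimes>\<^bsub>?S\<^esub> b = b \<otimes>\<^bsub>?S\<^esub> a" using U by (simp add: stalk_mult_germ G.m_comm)
  fix c assume c: "c \<in> carrier ?S"
  obtain V r where V: "openin T V" "x \<in> V" "r \<in> carrier (sec F V)" "c = germ T F x V r"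
    using c by (rule stalkE)
  let ?W = "U \<inter> V"
  have o: "openin T ?W" using U V by blast
  interpret H: comm_group "sec F ?W" using o sec_group by blast
  have 1: "a = germ T F x ?W (res F U ?W s)" "b = germ T F x ?W (res F U ?W t)"
    "c = germ T F x ?W (res F V ?W r)"
    using U V o by (simp_all add: germ_res)
  have 2: "x \<in> ?W" "res F U ?W s \<in> carrier (sec F ?W)" "res F U ?W t \<in> carrier (sec F ?W)"
    "res F V ?W r \<in> carrier (sec F ?W)" using U V o by (auto intro!: res_closed)
  show "(a \<otimes>\<^bsub>?S\<^esub> b) \<otimes>\<^bsub>?S\<^esub> c = a \<otimes>\<^bsub>?S\<^esub> (b \<otimes>\<^bsub>?S\<^esub> c)"
    unfolding 1 using 2 o by (simp add: stalk_mult_germ H.m_assoc)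
qed

section \<open>Inverse images along a subset\<close>

lemma inverse_image_carrier:
  "s \<in> carrier (sec (inverse_image T F S) W) \<longleftrightarrow>
     s \<in> (\<Pi>\<^sub>E x\<in>W. carrier (stalk T F x)) \<and> (\<forall>x\<in>W. \<exists>U t. openin T U \<and> x \<in> U \<and> U \<inter> S \<subseteq> W \<and>
        t \<in> carrier (sec F U) \<and> (\<forall>y\<in>U \<inter> S. s y = germ T F y U t))"
  by (simp add: inverse_image_def)

lemma inverse_imageE:
  assumes "s \<in> carrier (sec (inverse_image T F S) W)" "x \<in> W"
  obtains U t where "openin T U" "x \<in> U" "U \<inter> S \<subseteq> W" "t \<in> carrier (sec F U)"
    "\<forall>y\<in>U \<inter> S. s y = germ T F y U t"
  using assms unfolding inverse_image_carrier by metis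

lemma inverse_image_mult:
  "s \<otimes>\<^bsub>sec (inverse_image T F S) W\<^esub> t = (\<lambda>x\<in>W. s x \<otimes>\<^bsub>stalk T F x\<^esub> t x)"
  by (simp add: inverse_image_def)

lemma inverse_image_one: "\<one>\<^bsub>sec (inverse_image T F S) W\<^esub> = (\<lambda>x\<in>W. \<one>\<^bsub>stalk T F x\<^esub>)"
  by (simp add: inverse_image_def)

lemma inverse_image_res: "res (inverse_image T F S) W W' s = restrict s W'"
  by (simp add: inverse_image_def)

lemma germ_section:
  assumes "openin T U" "t \<in> carrier (sec F U)"
  shows "(\<lambda>x\<in>U \<inter> S. germ T F x U t) \<in> carrier (sec (inverse_image T F S) (U \<inter> S))"
  using assms by (auto simp: inverse_image_carrier germ_in_stalk intro!: exI[of _ U] exI[of _ t])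

text \<open>Families of germs are multiplied pointwise, so the group laws come from the stalks. What
  takes an argument is that products and inverses are again locally the germs of a section.\<close>

lemma inverse_image_comm_group:
  assumes S: "S \<subseteq> topspace T" and W: "openin (subtopology T S) W"
  shows "comm_group (sec (inverse_image T F S) W)"
proof (rule comm_groupI)
  let ?G = "sec (inverse_image T F S) W"
  have WS: "W \<subseteq> S" "W \<subseteq> topspace T" using W S openin_subset by fastforce+
  obtain O' where O': "openin T O'" "W = O' \<inter> S" using W by (auto simp: openin_subtopology)
  have grp: "comm_group (stalk T F x)" if "x \<in> W" for x using that WS stalk_comm_group by blast
  have grp': "group (stalk T F x)" "monoid (stalk T F x)" if "x \<in> W" for x
    using grp[OF that] by (auto simp: comm_group_def group.is_monoid)
  have pi: "s x \<in> carrier (stalk T F x)" if "s \<in> carrier ?G" "x \<in> W" for s x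
    using that by (auto simp: inverse_image_carrier)
  have ext: "s \<in> extensional W" if "s \<in> carrier ?G" for s
    using that by (auto simp: inverse_image_carrier PiE_def)
  show one: "\<one>\<^bsub>?G\<^esub> \<in> carrier ?G"
    using O' by (auto simp: inverse_image_carrier inverse_image_one stalk_one_germ[of O'] germ_in_stalk one_closed
        intro!: exI[of _ O'] exI[of _ "\<one>\<^bsub>sec F O'\<^esub>"])
  fix s assume s: "s \<in> carrier ?G"
  show "\<one>\<^bsub>?G\<^esub> \<otimes>\<^bsub>?G\<^esub> s = s"
    using pi[OF s] ext[OF s] grp'(2) unfolding inverse_image_one inverse_image_mult
    by (intro extensionalityI[of _ W]) (auto simp: monoid.l_one)
  let ?i = "\<lambda>x\<in>W. inv\<^bsub>stalk T F x\<^esub> (s x)"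
  have "?i \<in> carrier ?G"
    unfolding inverse_image_carrier
  proof (intro conjI ballI)
    show "?i \<in> (\<Pi>\<^sub>E x\<in>W. carrier (stalk T F x))"
      using pi[OF s] grp'(1) by (auto simp: group.inv_closed)
    fix x assume x: "x \<in> W"
    from inverse_imageE[OF s x] obtain U t where U: "openin T U" "x \<in> U" "U \<inter> S \<subseteq> W" "t \<in> carrier (sec F U)"
      "\<forall>y\<in>U \<inter> S. s y = germ T F y U t" .
    interpret H: comm_group "sec F U" using U sec_group by blast
    have "?i y = germ T F y U (inv\<^bsub>sec F U\<^esub> t)" if y: "y \<in> U \<inter> S" for y
    proof -
      have yW: "y \<in> W" using y U by auto
      have "inv\<^bsub>stalk T F y\<^esub> (s y) = germ T F y U (inv\<^bsub>sec F U\<^esub> t)"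
        using U y grp' yW by (intro group.inv_equality)
          (auto simp: stalk_one_germ[of U] stalk_mult_germ germ_in_stalk)
      then show ?thesis using yW by simp
    qed
    then show "\<exists>U t. openin T U \<and> x \<in> U \<and> U \<inter> S \<subseteq> W \<and> t \<in> carrier (sec F U) \<and>
        (\<forall>y\<in>U \<inter> S. ?i y = germ T F y U t)"
      using U by (intro exI[of _ U] exI[of _ "inv\<^bsub>sec F U\<^esub> t"]) auto
  qed
  moreover have "?i \<otimes>\<^bsub>?G\<^esub> s = \<one>\<^bsub>?G\<^esub>"
    using pi[OF s] grp'(1) unfolding inverse_image_one inverse_image_mult
    by (intro extensionalityI[of _ W]) (auto simp: group.l_inv)
  ultimately show "\<exists>b\<in>carrier ?G. b \<otimes>\<^bsub>?G\<^esub> s = \<one>\<^bsub>?G\<^esub>" by blast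
  fix t assume t: "t \<in> carrier ?G"
  show "s \<otimes>\<^bsub>?G\<^esub> t \<in> carrier ?G"
    unfolding inverse_image_carrier
  proof (intro conjI ballI)
    show "s \<otimes>\<^bsub>?G\<^esub> t \<in> (\<Pi>\<^sub>E x\<in>W. carrier (stalk T F x))"
      using pi[OF s] pi[OF t] grp'(2) by (auto simp: monoid.m_closed inverse_image_mult)
    fix x assume x: "x \<in> W"
    obtain U a where U: "openin T U" "x \<in> U" "U \<inter> S \<subseteq> W" "a \<in> carrier (sec F U)"
      "\<forall>y\<in>U \<inter> S. s y = germ T F y U a" using s x by (rule inverse_imageE)
    obtain V b where V: "openin T V" "x \<in> V" "V \<inter> S \<subseteq> W" "b \<in> carrier (sec F V)"
      "\<forall>y\<in>V \<inter> S. t y = germ T F y V b" using t x by (rule inverse_imageE)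
    let ?W = "U \<inter> V"
    have o: "openin T ?W" using U V by blast
    have "(s \<otimes>\<^bsub>?G\<^esub> t) y = germ T F y ?W (res F U ?W a \<otimes>\<^bsub>sec F ?W\<^esub> res F V ?W b)"
      if y: "y \<in> ?W \<inter> S" for y
      using U V o y by (auto simp: inverse_image_mult germ_res res_closed simp flip: stalk_mult_germ)
    then show "\<exists>U a. openin T U \<and> x \<in> U \<and> U \<inter> S \<subseteq> W \<and> a \<in> carrier (sec F U) \<and>
        (\<forall>y\<in>U \<inter> S. (s \<otimes>\<^bsub>?G\<^esub> t) y = germ T F y U a)"
      using U V o by (intro exI[of _ ?W] exI[of _ "res F U ?W a \<otimes>\<^bsub>sec F ?W\<^esub> res F V ?W b"])
        (auto intro!: mult_closed res_closed)
  qed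
  show "s \<otimes>\<^bsub>?G\<^esub> t = t \<otimes>\<^bsub>?G\<^esub> s"
    using pi[OF s] pi[OF t] grp unfolding inverse_image_mult
    by (intro restrict_ext) (auto simp: comm_monoid.m_comm comm_group_def)
  fix r assume r: "r \<in> carrier ?G"
  show "s \<otimes>\<^bsub>?G\<^esub> t \<otimes>\<^bsub>?G\<^esub> r = s \<otimes>\<^bsub>?G\<^esub> (t \<otimes>\<^bsub>?G\<^esub> r)"
    using pi[OF s] pi[OF t] pi[OF r] grp' unfolding inverse_image_mult
    by (intro restrict_ext) (auto simp: monoid.m_assoc)
qed

text \<open>Needed to form stalks of a sheaf restricted to a stratum and, with the whole space as
  subset, to handle cohomology sheaves as presheaves.\<close>

lemma inverse_image_presheaf:
  assumes S: "S \<subseteq> topspace T"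
  shows "is_presheaf (subtopology T S) (inverse_image T F S)"
  unfolding is_presheaf_def
proof (intro conjI allI impI ballI)
  fix U V assume UV: "openin (subtopology T S) U \<and> openin (subtopology T S) V \<and> V \<subseteq> U"
  then obtain V' where V': "openin T V'" "V = V' \<inter> S" by (auto simp: openin_subtopology)
  show "res (inverse_image T F S) U V \<in> hom (sec (inverse_image T F S) U) (sec (inverse_image T F S) V)"
  proof (rule homI)
    fix s assume s: "s \<in> carrier (sec (inverse_image T F S) U)"
    show "res (inverse_image T F S) U V s \<in> carrier (sec (inverse_image T F S) V)"
      unfolding inverse_image_carrier inverse_image_res
    proof (intro conjI ballI)
      show "restrict s V \<in> (\<Pi>\<^sub>E x\<in>V. carrier (stalk T F x))"
        using s UV by (auto simp: inverse_image_carrier)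
      fix x assume x: "x \<in> V"
      then have "x \<in> U" using UV by blast
      with s obtain W t where W: "openin T W" "x \<in> W" "W \<inter> S \<subseteq> U" "t \<in> carrier (sec F W)"
        "\<forall>y\<in>W \<inter> S. s y = germ T F y W t" by (rule inverse_imageE)
      have o: "openin T (W \<inter> V')" using W V' by blast
      show "\<exists>U t. openin T U \<and> x \<in> U \<and> U \<inter> S \<subseteq> V \<and> t \<in> carrier (sec F U) \<and>
          (\<forall>y\<in>U \<inter> S. restrict s V y = germ T F y U t)"
        using W V' o x by (intro exI[of _ "W \<inter> V'"] exI[of _ "res F W (W \<inter> V') t"])
          (auto simp: res_closed germ_res)
    qed
  next
    fix s t
    show "res (inverse_image T F S) U V (s \<otimes>\<^bsub>sec (inverse_image T F S) U\<^esub> t) =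
      res (inverse_image T F S) U V s \<otimes>\<^bsub>sec (inverse_image T F S) V\<^esub> res (inverse_image T F S) U V t"
      using UV unfolding inverse_image_res inverse_image_mult
      by (intro extensionalityI[of _ V]) auto
  qed
qed (use S inverse_image_comm_group in \<open>auto simp: inverse_image_res inverse_image_carrier PiE_def extensional_restrict Int_absorb1\<close>)

end

lemma presheaf_homD:
  assumes "presheaf_hom T F G f" "openin T U"
  shows "f U \<in> hom (sec F U) (sec G U)"
    and "s \<in> carrier (sec F U) \<Longrightarrow> f U s \<in> carrier (sec G U)"
    and "s \<in> carrier (sec F U) \<Longrightarrow> t \<in> carrier (sec F U) \<Longrightarrow>
      f U (s \<otimes>\<^bsub>sec F U\<^esub> t) = f U s \<otimes>\<^bsub>sec G U\<^esub> f U t"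
    and "openin T V \<Longrightarrow> V \<subseteq> U \<Longrightarrow> s \<in> carrier (sec F U) \<Longrightarrow> f V (res F U V s) = res G U V (f U s)"
proof -
  show f: "f U \<in> hom (sec F U) (sec G U)" using assms unfolding presheaf_hom_def by blast
  show "s \<in> carrier (sec F U) \<Longrightarrow> f U s \<in> carrier (sec G U)" by (rule hom_in_carrier[OF f])
  show "s \<in> carrier (sec F U) \<Longrightarrow> t \<in> carrier (sec F U) \<Longrightarrow>
      f U (s \<otimes>\<^bsub>sec F U\<^esub> t) = f U s \<otimes>\<^bsub>sec G U\<^esub> f U t" by (rule hom_mult[OF f])
  show "openin T V \<Longrightarrow> V \<subseteq> U \<Longrightarrow> s \<in> carrier (sec F U) \<Longrightarrow> f V (res F U V s) = res G U V (f U s)"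
    using assms unfolding presheaf_hom_def by blast
qed

section \<open>Morphisms of presheaves up to sheafification\<close>

definition locally_injective ::
  "'x topology \<Rightarrow> ('x, 'u) presheaf \<Rightarrow> ('x set \<Rightarrow> 'u \<Rightarrow> 'v) \<Rightarrow> bool" where
  "locally_injective T F f \<longleftrightarrow>
     (\<forall>U x s t. openin T U \<and> x \<in> U \<and> s \<in> carrier (sec F U) \<and> t \<in> carrier (sec F U) \<and> f U s = f U t \<longrightarrow>
        (\<exists>W. openin T W \<and> x \<in> W \<and> W \<subseteq> U \<and> res F U W s = res F U W t))"

definition locally_surjective ::
  "'x topology \<Rightarrow> ('x, 'u) presheaf \<Rightarrow> ('x, 'v) presheaf \<Rightarrow> ('x set \<Rightarrow> 'u \<Rightarrow> 'v) \<Rightarrow> bool" where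
  "locally_surjective T F G f \<longleftrightarrow>
     (\<forall>U x t. openin T U \<and> x \<in> U \<and> t \<in> carrier (sec G U) \<longrightarrow>
        (\<exists>W s. openin T W \<and> x \<in> W \<and> W \<subseteq> U \<and> s \<in> carrier (sec F W) \<and> f W s = res G U W t))"

locale presheaf_morphism = F: presheaf_on T F + G: presheaf_on T G
  for T :: "'x topology" and F :: "('x, 'u) presheaf" and G :: "('x, 'v) presheaf" +
  fixes f :: "'x set \<Rightarrow> 'u \<Rightarrow> 'v"
  assumes presheaf_hom: "presheaf_hom T F G f"
begin

lemmas hom = presheaf_homD[OF presheaf_hom]

lemma stalk_map_germ:
  assumes U: "openin T U" "x \<in> U" "s \<in> carrier (sec F U)"
  shows "stalk_map T G f x (germ T F x U s) = germ T G x U (f U s)"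
proof -
  have "germ T G x V (f V t) = germ T G x U (f U s)" if "(V, t) \<in> germ T F x U s" for V t
  proof -
    note V = F.germ_mem_eq[OF that U(1,3)]
    obtain W where W: "openin T W" "x \<in> W" "W \<subseteq> V \<inter> U" "res F V W t = res F U W s"
      using F.germ_eqD[OF V(1) U] by auto
    then have "res G V W (f V t) = res G U W (f U s)"
      using hom(4)[of V W t] hom(4)[of U W s] V U by auto
    then show ?thesis using U V W by (intro G.germ_eqI[of _ _ _ _ W]) (auto simp: hom)
  qed
  then have "{germ T G x V (f V t) | V t. (V, t) \<in> germ T F x U s} = {germ T G x U (f U s)}"
    using F.mem_germ_self[OF U] by blast
  then show ?thesis by (simp add: stalk_map_def)
qed

lemma stalk_map_hom: "stalk_map T G f x \<in> hom (stalk T F x) (stalk T G x)"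
proof (rule homI)
  fix a assume "a \<in> carrier (stalk T F x)"
  then show "stalk_map T G f x a \<in> carrier (stalk T G x)"
    by (auto elim!: F.stalkE simp: stalk_map_germ hom intro!: G.germ_in_stalk)
next
  fix a b assume "a \<in> carrier (stalk T F x)" "b \<in> carrier (stalk T F x)"
  then obtain U s t where U: "openin T U" "x \<in> U" "s \<in> carrier (sec F U)" "a = germ T F x U s"
    "t \<in> carrier (sec F U)" "b = germ T F x U t" by (rule F.stalkE2)
  then show "stalk_map T G f x (a \<otimes>\<^bsub>stalk T F x\<^esub> b) =
      stalk_map T G f x a \<otimes>\<^bsub>stalk T G x\<^esub> stalk_map T G f x b"
    by (simp add: F.stalk_mult_germ G.stalk_mult_germ stalk_map_germ hom F.mult_closed)
qed

lemma stalk_map_iso: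
  assumes inj: "locally_injective T F f" and surj: "locally_surjective T F G f"
  shows "stalk_map T G f x \<in> iso (stalk T F x) (stalk T G x)"
proof (rule isoI[OF stalk_map_hom])
  show "bij_betw (stalk_map T G f x) (carrier (stalk T F x)) (carrier (stalk T G x))"
  proof (rule bij_betwI')
    fix a b assume ab: "a \<in> carrier (stalk T F x)" "b \<in> carrier (stalk T F x)"
    obtain U s t where U: "openin T U" "x \<in> U" "s \<in> carrier (sec F U)" "a = germ T F x U s"
      "t \<in> carrier (sec F U)" "b = germ T F x U t" using ab by (rule F.stalkE2)
    have "a = b" if "stalk_map T G f x a = stalk_map T G f x b"
    proof -
      have "germ T G x U (f U s) = germ T G x U (f U t)" using that U by (simp add: stalk_map_germ)
      then obtain W where W: "openin T W" "x \<in> W" "W \<subseteq> U" "res G U W (f U s) = res G U W (f U t)"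
        using G.germ_eqD[OF _ U(1,2) hom(2)[OF U(1,5)]] by (metis inf.idem)
      \<comment> \<open>Equality of the image germs holds only on a smaller \<open>W\<close>, so
        local injectivity is applied to the restrictions over \<open>W\<close> and shrinks the
        neighbourhood once more.\<close>
      then have "f W (res F U W s) = f W (res F U W t)" using U by (simp add: hom)
      then obtain W' where W': "openin T W'" "x \<in> W'" "W' \<subseteq> W"
        "res F W W' (res F U W s) = res F W W' (res F U W t)"
        using inj W U unfolding locally_injective_def by (meson F.res_closed)
      then have "res F U W' s = res F U W' t" using U W by (simp add: F.res_res)
      then have "germ T F x U s = germ T F x U t" using U W W' by (intro F.germ_eqI[of _ _ _ _ W']) auto
      then show "a = b" using U by simp
    qed
    then show "stalk_map T G f x a = stalk_map T G f x b \<longleftrightarrow> a = b" by blast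
  next
    fix b assume "b \<in> carrier (stalk T G x)"
    then obtain U t where U: "openin T U" "x \<in> U" "t \<in> carrier (sec G U)" "b = germ T G x U t"
      by (rule G.stalkE)
    then obtain W s where "openin T W" "x \<in> W" "W \<subseteq> U" "s \<in> carrier (sec F W)" "f W s = res G U W t"
      using surj unfolding locally_surjective_def by metis
    then show "\<exists>a\<in>carrier (stalk T F x). b = stalk_map T G f x a"
      using U by (intro bexI[of _ "germ T F x W s"]) (simp_all add: stalk_map_germ G.germ_res F.germ_in_stalk)
  qed (use stalk_map_hom in \<open>auto simp: hom_def\<close>)
qed

lemma sheafify_map_hom:
  "presheaf_hom (subtopology T S) (inverse_image T F S) (inverse_image T G S) (sheafify_map T G f)"
  unfolding presheaf_hom_def
proof (intro conjI allI impI ballI)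
  fix W assume W: "openin (subtopology T S) W"
  then have WS: "W \<subseteq> S" by (auto simp: openin_subtopology)
  show "sheafify_map T G f W \<in> hom (sec (inverse_image T F S) W) (sec (inverse_image T G S) W)"
  proof (rule homI)
    fix s assume s: "s \<in> carrier (sec (inverse_image T F S) W)"
    show "sheafify_map T G f W s \<in> carrier (sec (inverse_image T G S) W)"
      unfolding G.inverse_image_carrier sheafify_map_def
    proof (intro conjI ballI)
      show "(\<lambda>x\<in>W. stalk_map T G f x (s x)) \<in> (\<Pi>\<^sub>E x\<in>W. carrier (stalk T G x))"
        using s hom_in_carrier[OF stalk_map_hom] by (fastforce simp: F.inverse_image_carrier)
      fix x assume x: "x \<in> W"
      from F.inverse_imageE[OF s x] obtain U t where U: "openin T U" "x \<in> U" "U \<inter> S \<subseteq> W" "t \<in> carrier (sec F U)"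
        "\<forall>y\<in>U \<inter> S. s y = germ T F y U t" .
      then show "\<exists>U t. openin T U \<and> x \<in> U \<and> U \<inter> S \<subseteq> W \<and> t \<in> carrier (sec G U) \<and>
          (\<forall>y\<in>U \<inter> S. (\<lambda>x\<in>W. stalk_map T G f x (s x)) y = germ T G y U t)"
        by (intro exI[of _ U] exI[of _ "f U t"]) (auto simp: hom stalk_map_germ)
    qed
  next
    fix s t assume "s \<in> carrier (sec (inverse_image T F S) W)" "t \<in> carrier (sec (inverse_image T F S) W)"
    then have "s x \<in> carrier (stalk T F x)" "t x \<in> carrier (stalk T F x)" if "x \<in> W" for x
      using that by (auto simp: F.inverse_image_carrier)
    then show "sheafify_map T G f W (s \<otimes>\<^bsub>sec (inverse_image T F S) W\<^esub> t) =
      sheafify_map T G f W s \<otimes>\<^bsub>sec (inverse_image T G S) W\<^esub> sheafify_map T G f W t"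
      unfolding F.inverse_image_mult G.inverse_image_mult sheafify_map_def
      by (intro restrict_ext) (simp add: hom_mult[OF stalk_map_hom])
  qed
next
  fix U V s assume "openin (subtopology T S) U \<and> openin (subtopology T S) V \<and> V \<subseteq> U"
  then show "sheafify_map T G f V (res (inverse_image T F S) U V s) =
      res (inverse_image T G S) U V (sheafify_map T G f U s)"
    unfolding F.inverse_image_res G.inverse_image_res sheafify_map_def
    by (intro extensionalityI[of _ V]) auto
qed

text \<open>The subset \<open>S\<close> is arbitrary: the whole space gives sheafifications, a
  stratum gives the restrictions that occur in constructibility.\<close>

lemma sheafify_map_iso:
  assumes inj: "locally_injective T F f" and surj: "locally_surjective T F G f"
  shows "presheaf_iso (subtopology T S) (inverse_image T F S) (inverse_image T G S) (sheafify_map T G f)"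
  unfolding presheaf_iso_def
proof (intro conjI allI impI)
  show hom': "presheaf_hom (subtopology T S) (inverse_image T F S) (inverse_image T G S) (sheafify_map T G f)"
    by (rule sheafify_map_hom)
  fix W assume W: "openin (subtopology T S) W"
  let ?F = "sec (inverse_image T F S) W" and ?G = "sec (inverse_image T G S) W"
  let ?f = "\<lambda>x. stalk_map T G f x"
  have bij: "bij_betw (?f x) (carrier (stalk T F x)) (carrier (stalk T G x))" for x
    using stalk_map_iso[OF inj surj] by (auto simp: iso_def)
  show "sheafify_map T G f W \<in> iso ?F ?G"
  proof (rule isoI)
    show 1: "sheafify_map T G f W \<in> hom ?F ?G" using hom' W by (auto simp: presheaf_hom_def)
    show "bij_betw (sheafify_map T G f W) (carrier ?F) (carrier ?G)"
      unfolding bij_betw_def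
    proof (intro conjI inj_onI equalityI subsetI)
      fix s t assume s: "s \<in> carrier ?F" and t: "t \<in> carrier ?F"
        and eq: "sheafify_map T G f W s = sheafify_map T G f W t"
      have "s x = t x" if "x \<in> W" for x
      proof -
        have "?f x (s x) = ?f x (t x)" using fun_cong[OF eq, of x] that by (simp add: sheafify_map_def)
        moreover have "s x \<in> carrier (stalk T F x)" "t x \<in> carrier (stalk T F x)"
          using s t that by (auto simp: F.inverse_image_carrier)
        ultimately show ?thesis using bij[of x] by (auto simp: bij_betw_def dest: inj_onD)
      qed
      then show "s = t" using s t by (auto simp: F.inverse_image_carrier intro: PiE_ext)
    next
      fix t assume t: "t \<in> carrier ?G"
      \<comment> \<open>The preimage is taken stalk by stalk. Local surjectivity supplies one
        section near each point, and injectivity on stalks forces the pointwise preimages to be its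
        germs.\<close>
      let ?s = "\<lambda>x\<in>W. inv_into (carrier (stalk T F x)) (?f x) (t x)"
      have tx: "t x \<in> carrier (stalk T G x)" if "x \<in> W" for x
        using t that by (auto simp: G.inverse_image_carrier)
      have "?s \<in> carrier ?F"
        unfolding F.inverse_image_carrier
      proof (intro conjI ballI)
        show "?s \<in> (\<Pi>\<^sub>E x\<in>W. carrier (stalk T F x))"
          using tx bij by (auto simp: bij_betw_def intro!: inv_into_into)
        fix x assume x: "x \<in> W"
        from G.inverse_imageE[OF t x] obtain U b where U: "openin T U" "x \<in> U" "U \<inter> S \<subseteq> W" "b \<in> carrier (sec G U)"
          "\<forall>y\<in>U \<inter> S. t y = germ T G y U b" .
        then obtain V a where V: "openin T V" "x \<in> V" "V \<subseteq> U" "a \<in> carrier (sec F V)" "f V a = res G U V b"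
          using surj unfolding locally_surjective_def by metis
        have "?s y = germ T F y V a" if y: "y \<in> V \<inter> S" for y
        proof -
          have "?f y (germ T F y V a) = t y"
            using y U V by (auto simp: stalk_map_germ G.germ_res)
          then show ?thesis
            using y U V bij[of y] F.germ_in_stalk[of V y a]
            by (auto simp: bij_betw_def inv_into_f_eq)
        qed
        then show "\<exists>U a. openin T U \<and> x \<in> U \<and> U \<inter> S \<subseteq> W \<and> a \<in> carrier (sec F U) \<and>
            (\<forall>y\<in>U \<inter> S. ?s y = germ T F y U a)"
          using U V by (intro exI[of _ V] exI[of _ a]) auto
      qed
      moreover have "sheafify_map T G f W ?s = t"
      proof (rule extensionalityI[of _ W])
        show "t \<in> extensional W" using t by (auto simp: G.inverse_image_carrier PiE_def)
        fix x assume "x \<in> W"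
        then show "sheafify_map T G f W ?s x = t x"
          using bij[of x] tx[of x] by (simp add: sheafify_map_def bij_betw_def f_inv_into_f)
      qed (simp add: sheafify_map_def)
      ultimately show "t \<in> sheafify_map T G f W ` carrier ?F"
        using imageI[of ?s "carrier ?F" "sheafify_map T G f W"] by simp
    next
      fix t assume "t \<in> sheafify_map T G f W ` carrier ?F"
      then show "t \<in> carrier ?G" using 1 by (auto simp: hom_def)
    qed
  qed
qed

text \<open>Turns the condition on sheafified cohomology in the definition of a quasi-isomorphism
  into conditions on the presheaf map alone. In the forward direction a section of the presheaf is
  tested through its family of germs.\<close>

lemma sheafify_iso_iff:
  "presheaf_iso T (sheafify T F) (sheafify T G) (sheafify_map T G f) \<longleftrightarrow>
     locally_injective T F f \<and> locally_surjective T F G f"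
proof (intro iffI conjI)
  assume iso: "presheaf_iso T (sheafify T F) (sheafify T G) (sheafify_map T G f)"
  let ?F = "\<lambda>U. sec (inverse_image T F (topspace T)) U" and ?G = "\<lambda>U. sec (inverse_image T G (topspace T)) U"
  have bij: "bij_betw (sheafify_map T G f U) (carrier (?F U)) (carrier (?G U))" if "openin T U" for U
    using iso that by (auto simp: presheaf_iso_def sheafify_def iso_def)
  have top: "U \<inter> topspace T = U" if "openin T U" for U using openin_subset[OF that] by blast
  show "locally_injective T F f"
    unfolding locally_injective_def
  proof clarify
    fix U x s t assume U: "openin T U" "x \<in> U" and s: "s \<in> carrier (sec F U)" and t: "t \<in> carrier (sec F U)"
      and eq: "f U s = f U t"
    let ?g = "\<lambda>s. \<lambda>x\<in>U. germ T F x U s"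
    have "?g s \<in> carrier (?F U)" "?g t \<in> carrier (?F U)"
      using F.germ_section[of U s "topspace T"] F.germ_section[of U t "topspace T"] U s t by (auto simp: top)
    moreover have "sheafify_map T G f U (?g s) = sheafify_map T G f U (?g t)"
      unfolding sheafify_map_def using U s t eq by (intro restrict_ext) (auto simp: stalk_map_germ)
    ultimately have "?g s = ?g t" using bij[OF U(1)] by (auto simp: bij_betw_def dest: inj_onD)
    then have "germ T F x U s = germ T F x U t" using U by (metis restrict_apply')
    then show "\<exists>W. openin T W \<and> x \<in> W \<and> W \<subseteq> U \<and> res F U W s = res F U W t"
      using F.germ_eqD[of x U s U t] U t by auto
  qed
  show "locally_surjective T F G f"
    unfolding locally_surjective_def
  proof clarify
    fix U x t assume U: "openin T U" "x \<in> U" and t: "t \<in> carrier (sec G U)"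
    let ?g = "\<lambda>x\<in>U. germ T G x U t"
    have "?g \<in> carrier (?G U)"
      using G.germ_section[of U t "topspace T"] U t by (auto simp: top)
    then have "?g \<in> sheafify_map T G f U ` carrier (?F U)"
      unfolding bij_betw_imp_surj_on[OF bij[OF U(1)]] .
    then obtain \<sigma> where \<sigma>: "\<sigma> \<in> carrier (?F U)" "?g = sheafify_map T G f U \<sigma>" by (rule imageE)
    from F.inverse_imageE[OF \<sigma>(1) U(2)] obtain V s where V: "openin T V" "x \<in> V" "s \<in> carrier (sec F V)"
      "\<forall>y\<in>V \<inter> topspace T. \<sigma> y = germ T F y V s" .
    then have "\<sigma> x = germ T F x V s" using openin_subset[OF V(1)] by blast
    have "germ T G x V (f V s) = germ T G x U t"
      using fun_cong[OF \<sigma>(2)[symmetric], of x] U V \<open>\<sigma> x = _\<close> by (simp add: sheafify_map_def stalk_map_germ)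
    then obtain W where W: "openin T W" "x \<in> W" "W \<subseteq> V \<inter> U" "res G V W (f V s) = res G U W t"
      using G.germ_eqD[OF _ U t] by blast
    then show "\<exists>W s. openin T W \<and> x \<in> W \<and> W \<subseteq> U \<and> s \<in> carrier (sec F W) \<and> f W s = res G U W t"
      using V by (intro exI[of _ W] exI[of _ "res F V W s"]) (auto simp: hom F.res_closed)
  qed
next
  assume "locally_injective T F f \<and> locally_surjective T F G f"
  then show "presheaf_iso T (sheafify T F) (sheafify T G) (sheafify_map T G f)"
    using sheafify_map_iso[of "topspace T"] by (simp add: sheafify_def)
qed

end

section \<open>Cohomology presheaves and quasi-isomorphisms\<close>

lemma group_homI: "group G \<Longrightarrow> group H \<Longrightarrow> h \<in> hom G H \<Longrightarrow> group_hom G H h"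
  by (simp add: group_hom_def group_hom_axioms_def)

text \<open>Maps between quotients are encoded as \<open>B\<close> times the image of a coset. Since
  \<open>h\<close> maps \<open>A\<close> into \<open>B\<close>, this product is the coset of
  \<open>h s\<close>, so maps on cohomology can be computed on representatives.\<close>

lemma coset_image:
  assumes "group G" "group H" and h: "h \<in> hom G H" and A: "subgroup A G" and B: "subgroup B H"
    and AB: "h ` A \<subseteq> B" and s: "s \<in> carrier G"
  shows "B <#>\<^bsub>H\<^esub> (h ` (A #>\<^bsub>G\<^esub> s)) = B #>\<^bsub>H\<^esub> h s"
proof -
  interpret G: group G by fact
  interpret H: group H by fact
  have hs: "h s \<in> carrier H" using h s by (rule hom_in_carrier)
  have hA: "h a \<in> B" "h a \<in> carrier H" "h (a \<otimes>\<^bsub>G\<^esub> s) = h a \<otimes>\<^bsub>H\<^esub> h s" if "a \<in> A" for a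
    using that AB subgroup.mem_carrier[OF A] hom_mult[OF h _ s] hom_in_carrier[OF h] by auto
  show ?thesis
  proof (intro equalityI subsetI)
    fix y assume "y \<in> B <#>\<^bsub>H\<^esub> (h ` (A #>\<^bsub>G\<^esub> s))"
    then obtain b a where "b \<in> B" "a \<in> A" "y = b \<otimes>\<^bsub>H\<^esub> h (a \<otimes>\<^bsub>G\<^esub> s)"
      by (auto simp: set_mult_def r_coset_def)
    then have "y = (b \<otimes>\<^bsub>H\<^esub> h a) \<otimes>\<^bsub>H\<^esub> h s" "b \<otimes>\<^bsub>H\<^esub> h a \<in> B"
      using hA hs subgroup.mem_carrier[OF B] subgroup.m_closed[OF B] by (auto simp: H.m_assoc)
    then show "y \<in> B #>\<^bsub>H\<^esub> h s" by (auto simp: r_coset_def)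
  next
    fix y assume "y \<in> B #>\<^bsub>H\<^esub> h s"
    then obtain b where b: "b \<in> B" "y = b \<otimes>\<^bsub>H\<^esub> h s" by (auto simp: r_coset_def)
    have "h s \<in> h ` (A #>\<^bsub>G\<^esub> s)"
      using G.rcos_self[OF s A] by (rule imageI)
    then show "y \<in> B <#>\<^bsub>H\<^esub> (h ` (A #>\<^bsub>G\<^esub> s))" using b by (force simp: set_mult_def)
  qed
qed

lemma (in group) r_coset_eq_iff:
  assumes B: "subgroup B G" and s: "s \<in> carrier G" and t: "t \<in> carrier G"
  shows "B #> s = B #> t \<longleftrightarrow> s \<otimes> inv t \<in> B"
proof
  assume "B #> s = B #> t"
  then have "s \<in> B #> t" using rcos_self[OF s B] by simp
  then show "s \<otimes> inv t \<in> B" using subgroup.rcos_module[OF B is_group t s] by simp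
next
  assume "s \<otimes> inv t \<in> B"
  then have "s \<in> B #> t" using subgroup.rcos_module[OF B is_group t s] by simp
  then show "B #> s = B #> t" using repr_independence[OF _ t B] by simp
qed

locale complex_on =
  fixes T :: "'x topology" and K :: "'x cx"
  assumes bounded_complex: "bounded_complex T K"
begin

lemma term_sheaf: "is_sheaf T (trm K n)"
  using bounded_complex by (simp add: bounded_complex_def)

sublocale trm: presheaf_on T "trm K n" for n
  using term_sheaf[of n] by unfold_locales (simp add: is_sheaf_def)

lemma dif_hom: "presheaf_hom T (trm K n) (trm K (n + 1)) (dif K n)"
  using bounded_complex by (simp add: bounded_complex_def)

text \<open>Primed facts are instances at degree \<open>n - 1\<close> with \<open>n - 1 + 1\<close>
  already simplified to \<open>n\<close>, the form in which coboundaries of degree \<open>n\<close>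
  occur.\<close>

lemma dif_hom': "presheaf_hom T (trm K (n - 1)) (trm K n) (dif K (n - 1))"
  using dif_hom[of "n - 1"] by simp

lemmas d = presheaf_homD[OF dif_hom]
lemmas d' = presheaf_homD[OF dif_hom']

lemma d_one: "openin T U \<Longrightarrow> dif K n U \<one>\<^bsub>sec (trm K n) U\<^esub> = \<one>\<^bsub>sec (trm K (n + 1)) U\<^esub>"
  by (rule hom_one[OF d(1) trm.sec_group' trm.sec_group'])

lemma d_inv: "openin T U \<Longrightarrow> s \<in> carrier (sec (trm K n) U) \<Longrightarrow>
    dif K n U (inv\<^bsub>sec (trm K n) U\<^esub> s) = inv\<^bsub>sec (trm K (n + 1)) U\<^esub> (dif K n U s)"
  by (rule group_hom.hom_inv[OF group_homI[OF trm.sec_group' trm.sec_group' d(1)]])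

lemma d_inv': "openin T U \<Longrightarrow> s \<in> carrier (sec (trm K (n - 1)) U) \<Longrightarrow>
    dif K (n - 1) U (inv\<^bsub>sec (trm K (n - 1)) U\<^esub> s) = inv\<^bsub>sec (trm K n) U\<^esub> (dif K (n - 1) U s)"
  using d_inv[of U s "n - 1"] by simp

lemma d_d: "openin T U \<Longrightarrow> s \<in> carrier (sec (trm K n) U) \<Longrightarrow>
    dif K (n + 1) U (dif K n U s) = \<one>\<^bsub>sec (trm K (n + 1 + 1)) U\<^esub>"
  using bounded_complex by (simp add: bounded_complex_def)

lemma d_d': "openin T U \<Longrightarrow> s \<in> carrier (sec (trm K (n - 1)) U) \<Longrightarrow>
    dif K n U (dif K (n - 1) U s) = \<one>\<^bsub>sec (trm K (n + 1)) U\<^esub>"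
  using d_d[of U s "n - 1"] by simp

abbreviation Z :: "int \<Rightarrow> 'x set \<Rightarrow> 'x univ set" where
  "Z n U \<equiv> carrier (cx_cocycles K n U)"

lemma Z_iff: "s \<in> Z n U \<longleftrightarrow> s \<in> carrier (sec (trm K n) U) \<and> dif K n U s = \<one>\<^bsub>sec (trm K (n + 1)) U\<^esub>"
  by (simp add: cx_cocycles_def)

lemma ZD: "s \<in> Z n U \<Longrightarrow> s \<in> carrier (sec (trm K n) U)"
  by (simp add: Z_iff)

lemma Z_subgroup:
  assumes "openin T U"
  shows "subgroup (Z n U) (sec (trm K n) U)"
proof -
  interpret group_hom "sec (trm K n) U" "sec (trm K (n + 1)) U" "dif K n U"
    using assms by (intro group_homI trm.sec_group' d(1))
  have "Z n U = kernel (sec (trm K n) U) (sec (trm K (n + 1)) U) (dif K n U)"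
    by (auto simp: Z_iff kernel_def)
  then show ?thesis using subgroup_kernel by simp
qed

lemma cocycle_comm_group: "openin T U \<Longrightarrow> comm_group (cx_cocycles K n U)"
proof (rule group.group_comm_groupI)
  assume U: "openin T U"
  show "group (cx_cocycles K n U)"
    using subgroup.subgroup_is_group[OF Z_subgroup trm.sec_group', OF U U, of n] by (simp add: cx_cocycles_def)
  fix s t assume "s \<in> Z n U" "t \<in> Z n U"
  then show "s \<otimes>\<^bsub>cx_cocycles K n U\<^esub> t = t \<otimes>\<^bsub>cx_cocycles K n U\<^esub> s"
    using comm_groupE(4)[OF trm.sec_group[OF U]] by (simp add: cx_cocycles_def)
qed

lemma cocycle_group: "openin T U \<Longrightarrow> group (cx_cocycles K n U)"
  by (rule comm_group.axioms(2)[OF cocycle_comm_group])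

lemma cocycle_mult [simp]: "s \<otimes>\<^bsub>cx_cocycles K n U\<^esub> t = s \<otimes>\<^bsub>sec (trm K n) U\<^esub> t"
  by (simp add: cx_cocycles_def)

lemma cocycle_one [simp]: "\<one>\<^bsub>cx_cocycles K n U\<^esub> = \<one>\<^bsub>sec (trm K n) U\<^esub>"
  by (simp add: cx_cocycles_def)

lemma cocycle_inv [simp]:
  "openin T U \<Longrightarrow> s \<in> Z n U \<Longrightarrow> inv\<^bsub>cx_cocycles K n U\<^esub> s = inv\<^bsub>sec (trm K n) U\<^esub> s"
  using group.m_inv_consistent[OF trm.sec_group'[of U n] Z_subgroup[of U n], of s] by (simp add: cx_cocycles_def)

lemma cocycle_set_mult [simp]: "A <#>\<^bsub>cx_cocycles K n U\<^esub> B = A <#>\<^bsub>sec (trm K n) U\<^esub> B"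
  by (simp add: set_mult_def)

lemma Z_mult: "openin T U \<Longrightarrow> s \<in> Z n U \<Longrightarrow> t \<in> Z n U \<Longrightarrow> s \<otimes>\<^bsub>sec (trm K n) U\<^esub> t \<in> Z n U"
  by (rule subgroup.m_closed[OF Z_subgroup])

lemma Z_inv: "openin T U \<Longrightarrow> s \<in> Z n U \<Longrightarrow> inv\<^bsub>sec (trm K n) U\<^esub> s \<in> Z n U"
  by (rule subgroup.m_inv_closed[OF Z_subgroup])

lemma Z_one: "openin T U \<Longrightarrow> \<one>\<^bsub>sec (trm K n) U\<^esub> \<in> Z n U"
  by (rule subgroup.one_closed[OF Z_subgroup])

lemma Z_res:
  "openin T U \<Longrightarrow> openin T V \<Longrightarrow> V \<subseteq> U \<Longrightarrow> s \<in> Z n U \<Longrightarrow> res (trm K n) U V s \<in> Z n V"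
  by (auto simp: Z_iff trm.res_closed d(4) trm.res_one)

lemma Z_dif: "openin T U \<Longrightarrow> r \<in> carrier (sec (trm K (n - 1)) U) \<Longrightarrow> dif K (n - 1) U r \<in> Z n U"
  by (simp add: Z_iff d' d_d')

abbreviation B :: "int \<Rightarrow> 'x set \<Rightarrow> 'x univ set" where
  "B n U \<equiv> cx_coboundaries K n U"

lemma B_iff: "s \<in> B n U \<longleftrightarrow> (\<exists>r\<in>carrier (sec (trm K (n - 1)) U). s = dif K (n - 1) U r)"
  by (auto simp: cx_coboundaries_def)

lemma B_subset_Z: "openin T U \<Longrightarrow> B n U \<subseteq> Z n U"
  by (auto simp: B_iff Z_dif)

lemma B_one: "openin T U \<Longrightarrow> \<one>\<^bsub>sec (trm K n) U\<^esub> \<in> B n U"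
  using d_one[of U "n - 1"] trm.one_closed[of U "n - 1"] unfolding B_iff by (intro bexI) auto

lemma B_mult: "openin T U \<Longrightarrow> s \<in> B n U \<Longrightarrow> t \<in> B n U \<Longrightarrow> s \<otimes>\<^bsub>sec (trm K n) U\<^esub> t \<in> B n U"
  by (auto simp: B_iff trm.mult_closed simp flip: d'(3))

lemma B_inv: "openin T U \<Longrightarrow> s \<in> B n U \<Longrightarrow> inv\<^bsub>sec (trm K n) U\<^esub> s \<in> B n U"
  by (auto simp: B_iff trm.inv_closed simp flip: d_inv')

lemma B_subgroup: "openin T U \<Longrightarrow> subgroup (B n U) (cx_cocycles K n U)"
proof (rule group.subgroupI[OF cocycle_group])
  assume U: "openin T U"
  then show "B n U \<subseteq> Z n U" by (rule B_subset_Z)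
  show "B n U \<noteq> {}" using B_one[OF U] by blast
  fix s t assume s: "s \<in> B n U" and t: "t \<in> B n U"
  show "inv\<^bsub>cx_cocycles K n U\<^esub> s \<in> B n U" using B_inv[OF U s] U s B_subset_Z[OF U] by (auto simp: subset_iff)
  show "s \<otimes>\<^bsub>cx_cocycles K n U\<^esub> t \<in> B n U" using B_mult[OF U s t] by simp
qed

lemma B_res:
  "openin T U \<Longrightarrow> openin T V \<Longrightarrow> V \<subseteq> U \<Longrightarrow> s \<in> B n U \<Longrightarrow> res (trm K n) U V s \<in> B n V"
  by (auto simp: B_iff trm.res_closed simp flip: d'(4))

definition cls :: "int \<Rightarrow> 'x set \<Rightarrow> 'x univ \<Rightarrow> 'x univ set" where
  "cls n U s = B n U #>\<^bsub>cx_cocycles K n U\<^esub> s"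

lemma cls_carrier: "carrier (sec (cohomology_presheaf K n) U) = cls n U ` Z n U"
  by (simp add: cohomology_presheaf_def carrier_FactGroup cls_def[abs_def])

lemma cls_eq_iff:
  "openin T U \<Longrightarrow> s \<in> Z n U \<Longrightarrow> t \<in> Z n U \<Longrightarrow>
   cls n U s = cls n U t \<longleftrightarrow> s \<otimes>\<^bsub>sec (trm K n) U\<^esub> inv\<^bsub>sec (trm K n) U\<^esub> t \<in> B n U"
  using group.r_coset_eq_iff[OF cocycle_group[of U n] B_subgroup[of U n], of s t] by (simp add: cls_def)

lemma cls_mult:
  assumes "openin T U" "s \<in> Z n U" "t \<in> Z n U"
  shows "cls n U s \<otimes>\<^bsub>sec (cohomology_presheaf K n) U\<^esub> cls n U t = cls n U (s \<otimes>\<^bsub>sec (trm K n) U\<^esub> t)"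
proof -
  have "normal (B n U) (cx_cocycles K n U)"
    using comm_group.normal_iff_subgroup[OF cocycle_comm_group[OF assms(1)]] B_subgroup[OF assms(1)] by blast
  from normal.rcos_sum[OF this, of s t] show ?thesis
    using assms by (simp add: cls_def cohomology_presheaf_def)
qed

lemma cls_res:
  assumes "openin T U" "openin T V" "V \<subseteq> U" "s \<in> Z n U"
  shows "res (cohomology_presheaf K n) U V (cls n U s) = cls n V (res (trm K n) U V s)"
proof -
  have "res (trm K n) U V \<in> hom (cx_cocycles K n U) (cx_cocycles K n V)"
    using assms by (auto simp: hom_def Z_res trm.res_mult ZD)
  from coset_image[OF cocycle_group cocycle_group this B_subgroup B_subgroup] show ?thesis
    using assms by (auto simp: cls_def cohomology_presheaf_def image_subset_iff B_res)
qed

lemma cohomology_presheaf: "is_presheaf T (cohomology_presheaf K n)"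
  unfolding is_presheaf_def
proof (intro conjI allI impI ballI)
  fix U assume "openin T U"
  then show "comm_group (sec (cohomology_presheaf K n) U)"
    using comm_group.abelian_FactGroup[OF cocycle_comm_group B_subgroup] by (simp add: cohomology_presheaf_def)
next
  fix U V assume U: "openin T U \<and> openin T V \<and> V \<subseteq> U"
  show "res (cohomology_presheaf K n) U V \<in> hom (sec (cohomology_presheaf K n) U) (sec (cohomology_presheaf K n) V)"
    by (rule homI) (use U in \<open>auto simp: cls_carrier cls_res cls_mult Z_res Z_mult trm.res_mult ZD\<close>)
qed (auto simp: cls_carrier cls_res Z_res trm.res_self trm.res_res ZD)

sublocale coh: presheaf_on T "cohomology_presheaf K n" for n
  by unfold_locales (rule cohomology_presheaf)

end

section \<open>Chain maps and the classes of cocycles\<close>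

locale complex_morphism = K: complex_on T K + L: complex_on T L
  for T :: "'x topology" and K L :: "'x cx" +
  fixes f :: "'x cxmap"
  assumes hom: "\<And>n. presheaf_hom T (trm K n) (trm L n) (f n)"
    and commutes: "\<And>n U s. openin T U \<Longrightarrow> s \<in> carrier (sec (trm K n) U) \<Longrightarrow>
      f (n + 1) U (dif K n U s) = dif L n U (f n U s)"

lemma complex_morphism_iff: "cx_hom T K L f \<longleftrightarrow> complex_morphism T K L f"
  by (auto simp: cx_hom_def complex_morphism_def complex_morphism_axioms_def complex_on_def)

context complex_morphism
begin

lemmas f = presheaf_homD[OF hom]

lemma f_one: "openin T U \<Longrightarrow> f n U \<one>\<^bsub>sec (trm K n) U\<^esub> = \<one>\<^bsub>sec (trm L n) U\<^esub>"
  by (rule hom_one[OF f(1) K.trm.sec_group' L.trm.sec_group'])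

lemma f_inv: "openin T U \<Longrightarrow> s \<in> carrier (sec (trm K n) U) \<Longrightarrow>
    f n U (inv\<^bsub>sec (trm K n) U\<^esub> s) = inv\<^bsub>sec (trm L n) U\<^esub> (f n U s)"
  by (rule group_hom.hom_inv[OF group_homI[OF K.trm.sec_group' L.trm.sec_group' f(1)]])

lemma commutes': "openin T U \<Longrightarrow> s \<in> carrier (sec (trm K (n - 1)) U) \<Longrightarrow>
      f n U (dif K (n - 1) U s) = dif L (n - 1) U (f (n - 1) U s)"
  using commutes[of U s "n - 1"] by simp

lemma f_Z: "openin T U \<Longrightarrow> s \<in> K.Z n U \<Longrightarrow> f n U s \<in> L.Z n U"
  using commutes[of U s n] by (auto simp: K.Z_iff L.Z_iff f f_one)

lemma f_B: "openin T U \<Longrightarrow> s \<in> K.B n U \<Longrightarrow> f n U s \<in> L.B n U"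
  by (auto simp: K.B_iff L.B_iff commutes' f)

lemma coh_map_cls:
  assumes "openin T U" "s \<in> K.Z n U"
  shows "cohomology_presheaf_map L f n U (K.cls n U s) = L.cls n U (f n U s)"
proof -
  have "f n U \<in> hom (cx_cocycles K n U) (cx_cocycles L n U)"
    using assms by (auto simp: hom_def f_Z f K.ZD)
  from coset_image[OF K.cocycle_group L.cocycle_group this K.B_subgroup L.B_subgroup] show ?thesis
    using assms by (auto simp: K.cls_def L.cls_def cohomology_presheaf_map_def image_subset_iff f_B)
qed

lemma coh_map_hom:
  "presheaf_hom T (cohomology_presheaf K n) (cohomology_presheaf L n) (cohomology_presheaf_map L f n)"
  unfolding presheaf_hom_def
proof (intro conjI allI impI ballI)
  fix U assume U: "openin T U"
  show "cohomology_presheaf_map L f n U \<in> hom (sec (cohomology_presheaf K n) U) (sec (cohomology_presheaf L n) U)"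
    by (rule homI) (use U in \<open>auto simp: K.cls_carrier L.cls_carrier K.cls_mult L.cls_mult coh_map_cls
        f_Z K.Z_mult f K.ZD\<close>)
qed (auto simp: K.cls_carrier K.cls_res L.cls_res coh_map_cls f_Z K.Z_res f K.ZD)

sublocale coh: presheaf_morphism T "cohomology_presheaf K n" "cohomology_presheaf L n" "cohomology_presheaf_map L f n"
  for n
  by unfold_locales (rule coh_map_hom)

text \<open>Injectivity is tested at the trivial class, which suffices because the induced maps are
  homomorphisms; classes are replaced by cocycles.\<close>

definition coh_injective :: "int \<Rightarrow> bool" where
  "coh_injective n \<longleftrightarrow> (\<forall>U x s. openin T U \<longrightarrow> x \<in> U \<longrightarrow> s \<in> K.Z n U \<longrightarrow> f n U s \<in> L.B n U \<longrightarrow>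
     (\<exists>W. openin T W \<and> x \<in> W \<and> W \<subseteq> U \<and> res (trm K n) U W s \<in> K.B n W))"

text \<open>The coboundary \<open>b\<close> accounts for the difference between lifting a class and
  lifting a cocycle.\<close>

definition coh_surjective :: "int \<Rightarrow> bool" where
  "coh_surjective n \<longleftrightarrow> (\<forall>U x t. openin T U \<longrightarrow> x \<in> U \<longrightarrow> t \<in> L.Z n U \<longrightarrow>
     (\<exists>W s b. openin T W \<and> x \<in> W \<and> W \<subseteq> U \<and> s \<in> K.Z n W \<and> b \<in> L.B n W \<and>
        res (trm L n) U W t = f n W s \<otimes>\<^bsub>sec (trm L n) W\<^esub> b))"

lemma locally_injective_coh_iff:
  "locally_injective T (cohomology_presheaf K n) (cohomology_presheaf_map L f n) \<longleftrightarrow> coh_injective n"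
proof
  assume inj: "locally_injective T (cohomology_presheaf K n) (cohomology_presheaf_map L f n)"
  show "coh_injective n"
    unfolding coh_injective_def
  proof (intro allI impI)
    fix U x s assume U: "openin T U" "x \<in> U" and s: "s \<in> K.Z n U" "f n U s \<in> L.B n U"
    \<comment> \<open>Comparing with the class of the neutral section turns triviality of the image
      into an instance of local injectivity.\<close>
    let ?o = "\<one>\<^bsub>sec (trm K n) U\<^esub>"
    interpret G: group "sec (trm L n) U" by (rule L.trm.sec_group'[OF U(1)])
    have "cohomology_presheaf_map L f n U (K.cls n U s) = cohomology_presheaf_map L f n U (K.cls n U ?o)"
      using U s by (simp add: coh_map_cls K.Z_one L.cls_eq_iff f_Z f_one L.Z_one L.ZD)
    then obtain W where W: "openin T W" "x \<in> W" "W \<subseteq> U"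
      "res (cohomology_presheaf K n) U W (K.cls n U s) = res (cohomology_presheaf K n) U W (K.cls n U ?o)"
      using inj[unfolded locally_injective_def, rule_format, of U x "K.cls n U s" "K.cls n U ?o"]
        U s K.Z_one[of U n] by (auto simp: K.cls_carrier)
    interpret H: group "sec (trm K n) W" by (rule K.trm.sec_group'[OF W(1)])
    have "res (trm K n) U W s \<in> K.B n W"
      using W U s by (simp add: K.cls_res K.Z_one K.trm.res_one K.cls_eq_iff K.Z_res K.ZD K.trm.res_closed)
    then show "\<exists>W. openin T W \<and> x \<in> W \<and> W \<subseteq> U \<and> res (trm K n) U W s \<in> K.B n W" using W by blast
  qed
next
  assume inj: "coh_injective n"
  show "locally_injective T (cohomology_presheaf K n) (cohomology_presheaf_map L f n)"
    unfolding locally_injective_def K.cls_carrier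
  proof (clarify)
    fix U x s t assume U: "openin T U" "x \<in> U" and s: "s \<in> K.Z n U" and t: "t \<in> K.Z n U"
      and eq: "cohomology_presheaf_map L f n U (K.cls n U s) = cohomology_presheaf_map L f n U (K.cls n U t)"
    \<comment> \<open>Two classes agree when the difference of their cocycles is a coboundary, so
      the condition at the trivial class is applied to this difference.\<close>
    let ?u = "s \<otimes>\<^bsub>sec (trm K n) U\<^esub> inv\<^bsub>sec (trm K n) U\<^esub> t"
    have u: "?u \<in> K.Z n U" using U s t by (simp add: K.Z_mult K.Z_inv)
    have "f n U ?u \<in> L.B n U"
      using eq U s t by (simp add: coh_map_cls L.cls_eq_iff f_Z f f_inv K.ZD K.trm.inv_closed)
    then obtain W where W: "openin T W" "x \<in> W" "W \<subseteq> U" "res (trm K n) U W ?u \<in> K.B n W"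
      using inj[unfolded coh_injective_def, rule_format, OF U u] by blast
    then have "K.cls n W (res (trm K n) U W s) = K.cls n W (res (trm K n) U W t)"
      using U s t by (simp add: K.cls_eq_iff K.Z_res K.trm.res_mult K.trm.res_inv K.ZD K.trm.inv_closed)
    then show "\<exists>W. openin T W \<and> x \<in> W \<and> W \<subseteq> U \<and>
        res (cohomology_presheaf K n) U W (K.cls n U s) = res (cohomology_presheaf K n) U W (K.cls n U t)"
      using W U s t by (auto simp: K.cls_res)
  qed
qed

lemma locally_surjective_coh_iff:
  "locally_surjective T (cohomology_presheaf K n) (cohomology_presheaf L n) (cohomology_presheaf_map L f n)
     \<longleftrightarrow> coh_surjective n"
proof -
  \<comment> \<open>Equality of classes is unfolded once into equality up to a coboundary; the two
    directions below then only rearrange quantifiers.\<close>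
  have class_iff: "cohomology_presheaf_map L f n W (K.cls n W s) = res (cohomology_presheaf L n) U W (L.cls n U t) \<longleftrightarrow>
      (\<exists>b\<in>L.B n W. res (trm L n) U W t = f n W s \<otimes>\<^bsub>sec (trm L n) W\<^esub> b)"
    if "openin T W" "W \<subseteq> U" "openin T U" "t \<in> L.Z n U" "s \<in> K.Z n W" for U W s t
  proof -
    interpret G: comm_group "sec (trm L n) W" by (rule L.trm.sec_group[OF that(1)])
    have c: "res (trm L n) U W t \<in> carrier (sec (trm L n) W)" "f n W s \<in> carrier (sec (trm L n) W)"
      using that by (auto simp: f K.ZD L.ZD L.trm.res_closed)
    have B: "b \<in> carrier (sec (trm L n) W)" if "b \<in> L.B n W" for b
      using L.ZD[OF subsetD[OF L.B_subset_Z[OF \<open>openin T W\<close>] that]] .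
    have "cohomology_presheaf_map L f n W (K.cls n W s) = res (cohomology_presheaf L n) U W (L.cls n U t)
      \<longleftrightarrow> L.cls n W (res (trm L n) U W t) = L.cls n W (f n W s)"
      using that by (auto simp: coh_map_cls L.cls_res)
    also have "\<dots> \<longleftrightarrow> res (trm L n) U W t \<otimes>\<^bsub>sec (trm L n) W\<^esub> inv\<^bsub>sec (trm L n) W\<^esub> f n W s \<in> L.B n W"
      using that by (simp add: L.cls_eq_iff L.Z_res f_Z)
    also have "\<dots> \<longleftrightarrow> (\<exists>b\<in>L.B n W. res (trm L n) U W t = f n W s \<otimes>\<^bsub>sec (trm L n) W\<^esub> b)"
    proof safe
      assume "res (trm L n) U W t \<otimes>\<^bsub>sec (trm L n) W\<^esub> inv\<^bsub>sec (trm L n) W\<^esub> f n W s \<in> L.B n W"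
      then show "\<exists>b\<in>L.B n W. res (trm L n) U W t = f n W s \<otimes>\<^bsub>sec (trm L n) W\<^esub> b"
        using c by (intro bexI[of _ "res (trm L n) U W t \<otimes>\<^bsub>sec (trm L n) W\<^esub> inv\<^bsub>sec (trm L n) W\<^esub> f n W s"])
          (simp_all add: G.m_lcomm[of "f n W s"] G.r_inv)
    next
      fix b assume b: "b \<in> L.B n W" "res (trm L n) U W t = f n W s \<otimes>\<^bsub>sec (trm L n) W\<^esub> b"
      then have "res (trm L n) U W t \<otimes>\<^bsub>sec (trm L n) W\<^esub> inv\<^bsub>sec (trm L n) W\<^esub> f n W s = b"
        using G.inv_solve_right'[of b "res (trm L n) U W t" "f n W s"] c B[OF b(1)] G.m_comm[of b "f n W s"] by simp
      then show "res (trm L n) U W t \<otimes>\<^bsub>sec (trm L n) W\<^esub> inv\<^bsub>sec (trm L n) W\<^esub> f n W s \<in> L.B n W"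
        using b by simp
    qed
    finally show ?thesis .
  qed
  show ?thesis
    unfolding locally_surjective_def coh_surjective_def K.cls_carrier L.cls_carrier
  proof (intro iffI allI impI)
    fix U x t assume *: "\<forall>U x t. openin T U \<and> x \<in> U \<and> t \<in> L.cls n U ` L.Z n U \<longrightarrow>
       (\<exists>W s. openin T W \<and> x \<in> W \<and> W \<subseteq> U \<and> s \<in> K.cls n W ` K.Z n W \<and>
          cohomology_presheaf_map L f n W s = res (cohomology_presheaf L n) U W t)"
      and U: "openin T U" "x \<in> U" "t \<in> L.Z n U"
    obtain W s where W: "openin T W" "x \<in> W" "W \<subseteq> U" "s \<in> K.Z n W"
      "cohomology_presheaf_map L f n W (K.cls n W s) = res (cohomology_presheaf L n) U W (L.cls n U t)"
      using *[rule_format, of U x "L.cls n U t"] U by auto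
    then obtain b where "b \<in> L.B n W" "res (trm L n) U W t = f n W s \<otimes>\<^bsub>sec (trm L n) W\<^esub> b"
      using class_iff[of W U t s] U by blast
    then show "\<exists>W s b. openin T W \<and> x \<in> W \<and> W \<subseteq> U \<and> s \<in> K.Z n W \<and> b \<in> L.B n W \<and>
        res (trm L n) U W t = f n W s \<otimes>\<^bsub>sec (trm L n) W\<^esub> b" using W by blast
  next
    fix U x t' assume surj: "\<forall>U x t. openin T U \<longrightarrow> x \<in> U \<longrightarrow> t \<in> L.Z n U \<longrightarrow>
       (\<exists>W s b. openin T W \<and> x \<in> W \<and> W \<subseteq> U \<and> s \<in> K.Z n W \<and> b \<in> L.B n W \<and>
        res (trm L n) U W t = f n W s \<otimes>\<^bsub>sec (trm L n) W\<^esub> b)"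
      and "openin T U \<and> x \<in> U \<and> t' \<in> L.cls n U ` L.Z n U"
    then obtain t where U: "openin T U" "x \<in> U" "t \<in> L.Z n U" "t' = L.cls n U t" by blast
    then obtain W s b where W: "openin T W" "x \<in> W" "W \<subseteq> U" "s \<in> K.Z n W" "b \<in> L.B n W"
      "res (trm L n) U W t = f n W s \<otimes>\<^bsub>sec (trm L n) W\<^esub> b" using surj[rule_format, OF U(1-3)] by blast
    then have "cohomology_presheaf_map L f n W (K.cls n W s) = res (cohomology_presheaf L n) U W t'"
      using class_iff[of W U t s] U by auto
    then show "\<exists>W s. openin T W \<and> x \<in> W \<and> W \<subseteq> U \<and> s \<in> K.cls n W ` K.Z n W \<and>
          cohomology_presheaf_map L f n W s = res (cohomology_presheaf L n) U W t'"
      using W by (intro exI[of _ W] exI[of _ "K.cls n W s"]) simp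
  qed
qed

lemma cx_hom: "cx_hom T K L f"
  using complex_morphism_axioms by (simp add: complex_morphism_iff)

lemma quasi_iso_iff: "quasi_iso T K L f \<longleftrightarrow> (\<forall>n. coh_injective n \<and> coh_surjective n)"
  unfolding quasi_iso_def cohomology_sheaf_def coh.sheafify_iso_iff locally_injective_coh_iff locally_surjective_coh_iff
  by (simp add: cx_hom)

end

text \<open>Bijectivity on sections allows every lift to be made over the given open set, so
  \<open>U\<close> itself always serves as the neighbourhood.\<close>

lemma presheaf_iso_quasi_iso:
  assumes f: "cx_hom T K L f" and iso: "\<And>n. presheaf_iso T (trm K n) (trm L n) (f n)"
  shows "quasi_iso T K L f"
proof -
  interpret complex_morphism T K L f using f by (simp add: complex_morphism_iff)
  have bij: "bij_betw (f n U) (carrier (sec (trm K n) U)) (carrier (sec (trm L n) U))" if "openin T U" for n U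
    using iso[of n] that by (auto simp: presheaf_iso_def iso_def)
  have inj: "s = t" if "openin T U" "s \<in> carrier (sec (trm K n) U)" "t \<in> carrier (sec (trm K n) U)" "f n U s = f n U t"
    for n U s t using bij_betw_imp_inj_on[OF bij[OF that(1)]] that(2-4) by (auto dest: inj_onD)
  have surj: "\<exists>s\<in>carrier (sec (trm K n) U). t = f n U s" if "openin T U" "t \<in> carrier (sec (trm L n) U)" for n U t
    using bij_betw_imp_surj_on[OF bij[OF that(1), of n]] that(2) by auto
  have "coh_injective n" for n
    unfolding coh_injective_def
  proof (intro allI impI)
    fix U x s assume U: "openin T U" "x \<in> U" and s: "s \<in> K.Z n U" and B: "f n U s \<in> L.B n U"
    obtain r where r: "r \<in> carrier (sec (trm L (n - 1)) U)" "f n U s = dif L (n - 1) U r" using B by (auto simp: L.B_iff)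
    \<comment> \<open>The bounding cochain is lifted in degree \<open>n - 1\<close>; injectivity in
      degree \<open>n\<close> then shows that its lift bounds \<open>s\<close>.\<close>
    obtain r' where r': "r' \<in> carrier (sec (trm K (n - 1)) U)" "r = f (n - 1) U r'" using surj[OF U(1) r(1)] by blast
    have "s = dif K (n - 1) U r'"
      using inj[OF U(1) K.ZD[OF s] K.ZD[OF K.Z_dif[OF U(1) r'(1)]]] r r' U by (simp add: commutes')
    then have "s \<in> K.B n U" using r' by (auto simp: K.B_iff)
    then show "\<exists>W. openin T W \<and> x \<in> W \<and> W \<subseteq> U \<and> res (trm K n) U W s \<in> K.B n W"
      using U s by (intro exI[of _ U]) (simp add: K.trm.res_self K.ZD)
  qed
  moreover have "coh_surjective n" for n
    unfolding coh_surjective_def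
  proof (intro allI impI)
    fix U x t assume U: "openin T U" "x \<in> U" and t: "t \<in> L.Z n U"
    interpret G: group "sec (trm L n) U" by (rule L.trm.sec_group'[OF U(1)])
    obtain s where s: "s \<in> carrier (sec (trm K n) U)" "t = f n U s" using surj[OF U(1) L.ZD[OF t]] by blast
    \<comment> \<open>That the lift is a cocycle is reflected by injectivity in degree
      \<open>n + 1\<close>.\<close>
    have "f (n + 1) U (dif K n U s) = f (n + 1) U \<one>\<^bsub>sec (trm K (n + 1)) U\<^esub>"
      using t s U by (simp add: commutes f_one L.Z_iff)
    then have "dif K n U s = \<one>\<^bsub>sec (trm K (n + 1)) U\<^esub>"
      by (rule inj[OF U(1) K.d(2)[OF U(1) s(1)] K.trm.one_closed[OF U(1)]])
    then have "s \<in> K.Z n U" using s by (simp add: K.Z_iff)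
    then show "\<exists>W s b. openin T W \<and> x \<in> W \<and> W \<subseteq> U \<and> s \<in> K.Z n W \<and> b \<in> L.B n W \<and>
        res (trm L n) U W t = f n W s \<otimes>\<^bsub>sec (trm L n) W\<^esub> b"
      using U s t L.B_one[OF U(1), of n]
      by (intro exI[of _ U] exI[of _ s] exI[of _ "\<one>\<^bsub>sec (trm L n) U\<^esub>"]) (simp add: L.trm.res_self L.ZD)
  qed
  ultimately show ?thesis by (simp add: quasi_iso_iff)
qed

section \<open>Cohomology stalks and zigzags\<close>

abbreviation cstalk :: "'x topology \<Rightarrow> 'x cx \<Rightarrow> int \<Rightarrow> 'x \<Rightarrow> ('x, 'x univ set) germ monoid" where
  "cstalk T K n x \<equiv> stalk T (cohomology_presheaf K n) x"

definition cgerm :: "'x topology \<Rightarrow> 'x cx \<Rightarrow> int \<Rightarrow> 'x \<Rightarrow> 'x set \<Rightarrow> 'x univ \<Rightarrow> ('x, 'x univ set) germ" where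
  "cgerm T K n x U s =
     germ T (cohomology_presheaf K n) x U (cx_coboundaries K n U #>\<^bsub>cx_cocycles K n U\<^esub> s)"

definition cmap :: "'x topology \<Rightarrow> 'x cx \<Rightarrow> 'x cxmap \<Rightarrow> int \<Rightarrow> 'x \<Rightarrow> ('x, 'x univ set) germ \<Rightarrow> ('x, 'x univ set) germ"
  where "cmap T L f n x = stalk_map T (cohomology_presheaf L n) (cohomology_presheaf_map L f n) x"

context complex_on
begin

lemma cgerm_cls: "cgerm T K n x U s = germ T (cohomology_presheaf K n) x U (cls n U s)"
  by (simp add: cgerm_def cls_def)

lemma cls_in: "s \<in> Z n U \<Longrightarrow> cls n U s \<in> carrier (sec (cohomology_presheaf K n) U)"
  by (simp add: cls_carrier)

lemma cgerm_in: "openin T U \<Longrightarrow> x \<in> U \<Longrightarrow> s \<in> Z n U \<Longrightarrow> cgerm T K n x U s \<in> carrier (cstalk T K n x)"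
  by (simp add: cgerm_cls coh.germ_in_stalk cls_in)

lemma cstalkE:
  assumes "a \<in> carrier (cstalk T K n x)"
  obtains U s where "openin T U" "x \<in> U" "s \<in> Z n U" "a = cgerm T K n x U s"
  using assms by (elim coh.stalkE) (auto simp: cls_carrier cgerm_cls)

lemma cgerm_mult:
  "openin T U \<Longrightarrow> x \<in> U \<Longrightarrow> s \<in> Z n U \<Longrightarrow> t \<in> Z n U \<Longrightarrow>
   cgerm T K n x U s \<otimes>\<^bsub>cstalk T K n x\<^esub> cgerm T K n x U t = cgerm T K n x U (s \<otimes>\<^bsub>sec (trm K n) U\<^esub> t)"
  by (simp add: cgerm_cls coh.stalk_mult_germ cls_in cls_mult)

lemma cgerm_res:
  "openin T U \<Longrightarrow> s \<in> Z n U \<Longrightarrow> openin T V \<Longrightarrow> x \<in> V \<Longrightarrow> V \<subseteq> U \<Longrightarrow>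
   cgerm T K n x V (res (trm K n) U V s) = cgerm T K n x U s"
  by (simp add: cgerm_cls coh.germ_res cls_in flip: cls_res)

lemma cstalkE2:
  assumes "a \<in> carrier (cstalk T K n x)" "b \<in> carrier (cstalk T K n x)"
  obtains U s t where "openin T U" "x \<in> U" "s \<in> Z n U" "a = cgerm T K n x U s"
    "t \<in> Z n U" "b = cgerm T K n x U t"
proof -
  obtain U s where U: "openin T U" "x \<in> U" "s \<in> Z n U" "a = cgerm T K n x U s"
    using assms(1) by (rule cstalkE)
  obtain V t where V: "openin T V" "x \<in> V" "t \<in> Z n V" "b = cgerm T K n x V t"
    using assms(2) by (rule cstalkE)
  have "openin T (U \<inter> V)" using U V by blast
  with U V show ?thesis
    by (intro that[of "U \<inter> V" "res (trm K n) U (U \<inter> V) s" "res (trm K n) V (U \<inter> V) t"]) (simp_all add: Z_res cgerm_res)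
qed

lemma cls_one:
  assumes "openin T U"
  shows "cls n U \<one>\<^bsub>sec (trm K n) U\<^esub> = \<one>\<^bsub>sec (cohomology_presheaf K n) U\<^esub>"
  using group.coset_mult_one[OF cocycle_group[OF assms] B_subset_Z[OF assms]]
  by (simp add: cls_def cohomology_presheaf_def)

lemma cgerm_one: "openin T U \<Longrightarrow> x \<in> U \<Longrightarrow> cgerm T K n x U \<one>\<^bsub>sec (trm K n) U\<^esub> = \<one>\<^bsub>cstalk T K n x\<^esub>"
  by (simp add: cgerm_cls cls_one coh.stalk_one_germ)

lemma cstalk_comm_group: "x \<in> topspace T \<Longrightarrow> comm_group (cstalk T K n x)"
  by (rule coh.stalk_comm_group)

lemma cstalk_group: "x \<in> topspace T \<Longrightarrow> group (cstalk T K n x)"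
  by (rule comm_group.axioms(2)[OF cstalk_comm_group])

lemma cgerm_inv:
  assumes U: "openin T U" "x \<in> U" "s \<in> Z n U"
  shows "cgerm T K n x U (inv\<^bsub>sec (trm K n) U\<^esub> s) = inv\<^bsub>cstalk T K n x\<^esub> cgerm T K n x U s"
proof -
  interpret G: group "cstalk T K n x" using U openin_subset by (blast intro: cstalk_group)
  interpret H: group "sec (trm K n) U" by (rule trm.sec_group'[OF U(1)])
  have "cgerm T K n x U (inv\<^bsub>sec (trm K n) U\<^esub> s) \<otimes>\<^bsub>cstalk T K n x\<^esub> cgerm T K n x U s = \<one>\<^bsub>cstalk T K n x\<^esub>"
    using U by (simp add: cgerm_mult Z_inv ZD cgerm_one)
  then show ?thesis
    using U by (intro G.inv_equality[symmetric]) (auto simp: cgerm_in Z_inv)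
qed

text \<open>The bridge between stalks, on which zigzags act, and neighbourhoods, on which bounding
  cochains are found.\<close>

lemma cgerm_eq_one_iff:
  assumes U: "openin T U" "x \<in> U" "s \<in> Z n U"
  shows "cgerm T K n x U s = \<one>\<^bsub>cstalk T K n x\<^esub> \<longleftrightarrow>
    (\<exists>W. openin T W \<and> x \<in> W \<and> W \<subseteq> U \<and> res (trm K n) U W s \<in> B n W)"
proof -
  have *: "cls n W (res (trm K n) U W s) = \<one>\<^bsub>sec (cohomology_presheaf K n) W\<^esub> \<longleftrightarrow> res (trm K n) U W s \<in> B n W"
    if W: "openin T W" "W \<subseteq> U" for W
  proof -
    interpret H: group "sec (trm K n) W" by (rule trm.sec_group'[OF W(1)])
    show ?thesis using W U
      by (simp add: Z_one cls_eq_iff[OF _ Z_res] trm.res_closed ZD flip: cls_one)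
  qed
  have one: "\<one>\<^bsub>sec (cohomology_presheaf K n) U\<^esub> \<in> carrier (sec (cohomology_presheaf K n) U)"
    using U by (simp add: coh.one_closed)
  have "cgerm T K n x U s = \<one>\<^bsub>cstalk T K n x\<^esub> \<longleftrightarrow>
    (\<exists>W. openin T W \<and> x \<in> W \<and> W \<subseteq> U \<and> cls n W (res (trm K n) U W s) = \<one>\<^bsub>sec (cohomology_presheaf K n) W\<^esub>)"
    (is "?l \<longleftrightarrow> ?r")
  proof
    assume ?l
    then have "germ T (cohomology_presheaf K n) x U (cls n U s) =
      germ T (cohomology_presheaf K n) x U \<one>\<^bsub>sec (cohomology_presheaf K n) U\<^esub>"
      using U by (simp add: cgerm_cls coh.stalk_one_germ)
    from coh.germ_eqD[OF this U(1,2) one] show ?r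
      using U by (auto simp: cls_res coh.res_one)
  next
    assume ?r
    then obtain W where W: "openin T W" "x \<in> W" "W \<subseteq> U"
      "cls n W (res (trm K n) U W s) = \<one>\<^bsub>sec (cohomology_presheaf K n) W\<^esub>" by blast
    have "cgerm T K n x U s = cgerm T K n x W (res (trm K n) U W s)" using U W by (simp add: cgerm_res)
    then show ?l using W U by (simp add: cgerm_cls coh.stalk_one_germ[of W])
  qed
  also have "\<dots> \<longleftrightarrow> (\<exists>W. openin T W \<and> x \<in> W \<and> W \<subseteq> U \<and> res (trm K n) U W s \<in> B n W)"
    using * by blast
  finally show ?thesis .
qed

lemma cgerm_coboundary: "openin T U \<Longrightarrow> x \<in> U \<Longrightarrow> b \<in> B n U \<Longrightarrow> cgerm T K n x U b = \<one>\<^bsub>cstalk T K n x\<^esub>"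
  using B_subset_Z[of U n] by (subst cgerm_eq_one_iff) (auto simp: B_res intro!: exI[of _ U])

end

context complex_morphism
begin

lemma cmap_cgerm:
  "openin T U \<Longrightarrow> x \<in> U \<Longrightarrow> s \<in> K.Z n U \<Longrightarrow> cmap T L f n x (cgerm T K n x U s) = cgerm T L n x U (f n U s)"
  by (simp add: cmap_def K.cgerm_cls L.cgerm_cls coh.stalk_map_germ K.cls_in coh_map_cls)

lemma cmap_hom: "cmap T L f n x \<in> Group.hom (cstalk T K n x) (cstalk T L n x)"
  unfolding cmap_def by (rule coh.stalk_map_hom)

lemma cmap_iso: "quasi_iso T K L f \<Longrightarrow> cmap T L f n x \<in> iso (cstalk T K n x) (cstalk T L n x)"
  unfolding cmap_def
  by (rule coh.stalk_map_iso) (simp_all add: quasi_iso_iff locally_injective_coh_iff locally_surjective_coh_iff)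

end

lemma cx_hom_id: "bounded_complex T K \<Longrightarrow> cx_hom T K K (\<lambda>n U s. s)"
  by (auto simp: cx_hom_def presheaf_hom_def hom_def)

lemma cx_hom_comp:
  assumes "cx_hom T K L f" "cx_hom T L M g"
  shows "cx_hom T K M (\<lambda>n U s. g n U (f n U s))"
proof -
  interpret f: complex_morphism T K L f using assms by (simp add: complex_morphism_iff)
  interpret g: complex_morphism T L M g using assms by (simp add: complex_morphism_iff)
  show ?thesis
    unfolding cx_hom_def presheaf_hom_def
    using f.K.bounded_complex g.L.bounded_complex
    by (auto simp: hom_def f.f g.f f.commutes g.commutes)
qed

lemma quasi_isoD: "quasi_iso T K L f \<Longrightarrow> cx_hom T K L f"
  by (simp add: quasi_iso_def)

section \<open>The action of zigzags on cohomology stalks\<close>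

lemma zigzag_bounded: "zigzag T K w L \<Longrightarrow> bounded_complex T K \<and> bounded_complex T L"
  by (induction rule: zigzag.induct) (auto simp: cx_hom_def quasi_iso_def)

lemma zigzag_append: "zigzag T K v L \<Longrightarrow> zigzag T L w M \<Longrightarrow> zigzag T K (v @ w) M"
  by (induction rule: zigzag.induct) (auto intro: zigzag.intros)

lemma zigzag_singleton:
  "cx_hom T K L f \<Longrightarrow> zigzag T K [Fwd K f L] L" "quasi_iso T K L f \<Longrightarrow> zigzag T L [Inv K f L] K"
  by (auto intro!: zigzag.intros simp: cx_hom_def quasi_iso_def)

lemma zigzag_eq_zigzag: "zigzag_eq T K v w L \<Longrightarrow> zigzag T K v L \<and> zigzag T K w L"
proof (induction rule: zigzag_eq.induct)
  case (comp K L f M g)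
  then show ?case using cx_hom_comp[OF comp] by (auto intro!: zigzag.intros simp: cx_hom_def)
next
  case (inv_right K L s)
  then have "bounded_complex T K" by (simp add: cx_hom_def quasi_iso_def)
  then show ?case using zigzag.fwd[OF quasi_isoD zigzag_singleton(2)] inv_right by (blast intro: zigzag.nil)
next
  case (inv_left K L s)
  then have "bounded_complex T L" by (simp add: cx_hom_def quasi_iso_def)
  then show ?case using zigzag.inv[OF _ zigzag_singleton(1)[OF quasi_isoD]] inv_left by (blast intro: zigzag.nil)
qed (auto intro: zigzag_append zigzag.intros zigzag_singleton cx_hom_id simp: cx_hom_def quasi_iso_def)

text \<open>Taking a cohomology stalk inverts quasi-isomorphisms and hence extends from chain maps
  to zigzags. An \<open>Inv\<close> letter acts by the inverse map on the carrier; off the carrier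
  the value of \<open>inv_into\<close> carries no meaning.\<close>

fun wmap :: "'x topology \<Rightarrow> int \<Rightarrow> 'x \<Rightarrow> 'x letters \<Rightarrow> ('x, 'x univ set) germ \<Rightarrow> ('x, 'x univ set) germ" where
  "wmap T n x [] a = a"
| "wmap T n x (Fwd K f L # w) a = wmap T n x w (cmap T L f n x a)"
| "wmap T n x (Inv K f L # w) a = wmap T n x w (inv_into (carrier (cstalk T K n x)) (cmap T L f n x) a)"

lemma wmap_append: "wmap T n x (v @ w) a = wmap T n x w (wmap T n x v a)"
  by (induction T n x v a rule: wmap.induct) auto

lemma cmap_hom: "cx_hom T K L f \<Longrightarrow> cmap T L f n x \<in> hom (cstalk T K n x) (cstalk T L n x)"
  unfolding complex_morphism_iff by (rule complex_morphism.cmap_hom)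

lemma cmap_iso: "quasi_iso T K L f \<Longrightarrow> cmap T L f n x \<in> iso (cstalk T K n x) (cstalk T L n x)"
  by (rule complex_morphism.cmap_iso[OF quasi_isoD[unfolded complex_morphism_iff]])

lemma cmap_inv_iso:
  assumes "quasi_iso T K L f" "x \<in> topspace T"
  shows "inv_into (carrier (cstalk T K n x)) (cmap T L f n x) \<in> iso (cstalk T L n x) (cstalk T K n x)"
proof -
  interpret complex_on T K using assms by (simp add: quasi_iso_def cx_hom_def complex_on_def)
  show ?thesis by (rule group.iso_set_sym[OF cstalk_group[OF assms(2)] cmap_iso[OF assms(1)]])
qed

lemma wmap_hom: "zigzag T K w L \<Longrightarrow> x \<in> topspace T \<Longrightarrow> wmap T n x w \<in> hom (cstalk T K n x) (cstalk T L n x)"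
proof (induction rule: zigzag.induct)
  case (nil K)
  then show ?case by (auto simp: hom_def)
next
  case (fwd K L f w M)
  have "wmap T n x w \<circ> cmap T L f n x \<in> hom (cstalk T K n x) (cstalk T M n x)"
    using cmap_hom[OF fwd(1)] fwd.IH[OF fwd.prems] by (rule hom_compose)
  moreover have "wmap T n x (Fwd K f L # w) = wmap T n x w \<circ> cmap T L f n x" by (rule HOL.ext) simp
  ultimately show ?case by (simp only:)
next
  case (inv K L f w M)
  have "wmap T n x w \<circ> inv_into (carrier (cstalk T K n x)) (cmap T L f n x) \<in> hom (cstalk T L n x) (cstalk T M n x)"
    using iso_imp_homomorphism[OF cmap_inv_iso[OF inv(1) inv.prems]] inv.IH[OF inv.prems] by (rule hom_compose)
  moreover have "wmap T n x (Inv K f L # w) =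
      wmap T n x w \<circ> inv_into (carrier (cstalk T K n x)) (cmap T L f n x)" by (rule HOL.ext) simp
  ultimately show ?case by (simp only:)
qed

text \<open>Descent to morphisms of the localization: each generator of \<open>zigzag_eq\<close>
  becomes an identity of stalk maps. In the case \<open>cong\<close>, membership in the carrier is
  passed on by \<open>wmap_hom\<close>.\<close>

lemma wmap_cong: 
  "zigzag_eq T K v w L \<Longrightarrow> x \<in> topspace T \<Longrightarrow> a \<in> carrier (cstalk T K n x) \<Longrightarrow> wmap T n x v a = wmap T n x w a"
proof (induction arbitrary: a rule: zigzag_eq.induct)
  case (cong K u L v v' M w N)
  then have "wmap T n x u a \<in> carrier (cstalk T L n x)" using hom_in_carrier[OF wmap_hom[OF cong(1)]] by blast
  then show ?case using cong by (simp add: wmap_append)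
next
  case (ext K L f g)
  interpret f: complex_morphism T K L f using ext by (simp add: complex_morphism_iff)
  interpret g: complex_morphism T K L g using ext by (simp add: complex_morphism_iff)
  show ?case using \<open>a \<in> _\<close>
    by (elim f.K.cstalkE) (simp add: f.cmap_cgerm g.cmap_cgerm ext.hyps(3) f.K.ZD)
next
  case (ident K)
  then interpret complex_morphism T K K "\<lambda>n U s. s" using cx_hom_id by (simp add: complex_morphism_iff)
  show ?case using \<open>a \<in> _\<close> by (elim K.cstalkE) (simp add: cmap_cgerm)
next
  case (comp K L f M g)
  interpret f: complex_morphism T K L f using comp by (simp add: complex_morphism_iff)
  interpret g: complex_morphism T L M g using comp by (simp add: complex_morphism_iff)
  interpret gf: complex_morphism T K M "\<lambda>n U s. g n U (f n U s)"
    using cx_hom_comp[OF comp(1,2)] by (simp add: complex_morphism_iff)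
  show ?case using \<open>a \<in> _\<close>
    by (elim f.K.cstalkE) (simp add: f.cmap_cgerm g.cmap_cgerm gf.cmap_cgerm f.f_Z)
next
  case (inv_right K L s)
  then show ?case using cmap_iso[OF inv_right(1), of n x] by (auto simp: iso_def bij_betw_def)
next
  case (inv_left K L s)
  then show ?case using cmap_iso[OF inv_left(1), of n x] by (auto simp: iso_def bij_betw_def f_inv_into_f)
qed auto

text \<open>The action on stalks forgets how classes vary with the point. Here a single cocycle
  represents the images at all nearby points, which is what preserves local constancy of
  values.\<close>

lemma wmap_open:
  "zigzag T K w L \<Longrightarrow> openin T U \<Longrightarrow> x \<in> U \<Longrightarrow> s \<in> carrier (cx_cocycles K n U) \<Longrightarrow>
   \<exists>W t. openin T W \<and> x \<in> W \<and> W \<subseteq> U \<and> t \<in> carrier (cx_cocycles L n W) \<and>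
     (\<forall>y\<in>W. wmap T n y w (cgerm T K n y U s) = cgerm T L n y W t)"
proof (induction arbitrary: U s rule: zigzag.induct)
  case (nil K)
  then show ?case by auto
next
  case (fwd K L f w M)
  interpret complex_morphism T K L f using fwd by (simp add: complex_morphism_iff)
  obtain W t where W: "openin T W" "x \<in> W" "W \<subseteq> U" "t \<in> carrier (cx_cocycles M n W)"
    "\<forall>y\<in>W. wmap T n y w (cgerm T L n y U (f n U s)) = cgerm T M n y W t"
    using fwd.IH[of U "f n U s"] fwd.prems f_Z by blast
  then have "\<forall>y\<in>W. wmap T n y (Fwd K f L # w) (cgerm T K n y U s) = cgerm T M n y W t"
    using fwd.prems by (auto simp: cmap_cgerm subset_iff)
  with W show ?case by blast
next
  case (inv K L f w M)
  interpret complex_morphism T K L f using quasi_isoD[OF inv(1)] by (simp add: complex_morphism_iff)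
  \<comment> \<open>A quasi-isomorphism cannot be inverted on sections. The cocycle is instead
    lifted near \<open>x\<close> up to a coboundary, which is trivial in all stalks, so that one
    lift \<open>k\<close> serves at every point of \<open>V\<close>.\<close>
  have "coh_surjective n" using inv(1) by (simp add: quasi_iso_iff)
  then obtain V k b where V: "openin T V" "x \<in> V" "V \<subseteq> U" "k \<in> K.Z n V" "b \<in> L.B n V"
     "res (trm L n) U V s = f n V k \<otimes>\<^bsub>sec (trm L n) V\<^esub> b"
    using \<open>coh_surjective n\<close>[unfolded coh_surjective_def, rule_format, OF inv.prems] by blast
  have *: "inv_into (carrier (cstalk T K n y)) (cmap T L f n y) (cgerm T L n y U s) = cgerm T K n y V k"
    if y: "y \<in> V" for y
  proof -
    interpret G: group "cstalk T L n y"
      using L.cstalk_group[of y n] openin_subset[OF V(1)] y by blast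
    have bZ: "b \<in> L.Z n V" using V L.B_subset_Z by blast
    have "cgerm T L n y U s = cgerm T L n y V (res (trm L n) U V s)"
      using y V(1-3) inv.prems by (simp add: L.cgerm_res)
    also have "\<dots> = cgerm T L n y V (f n V k)"
      using V y bZ by (simp add: f_Z L.cgerm_coboundary L.cgerm_in flip: L.cgerm_mult)
    also have "\<dots> = cmap T L f n y (cgerm T K n y V k)"
      using V y by (simp add: cmap_cgerm)
    finally have "cgerm T L n y U s = cmap T L f n y (cgerm T K n y V k)" .
    then show ?thesis
      using cmap_iso[OF inv(1), of n y] K.cgerm_in[OF V(1) y V(4)] by (auto simp: iso_def bij_betw_def)
  qed
  obtain W t where W: "openin T W" "x \<in> W" "W \<subseteq> V" "t \<in> carrier (cx_cocycles M n W)"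
    "\<forall>y\<in>W. wmap T n y w (cgerm T K n y V k) = cgerm T M n y W t"
    using inv.IH[OF V(1,2,4)] by blast
  have "\<forall>y\<in>W. wmap T n y (Inv K f L # w) (cgerm T L n y U s) = cgerm T M n y W t"
    using W * by (simp add: subset_iff)
  with W V show ?case by (meson order_trans)
qed

section \<open>Isomorphisms in the derived category\<close>

lemma zclass_mem: "(K', v, L') \<in> zclass T K w L \<longleftrightarrow> K' = K \<and> L' = L \<and> zigzag_eq T K w v L"
  by (auto simp: zclass_def)

lemma zclass_eqI: "zigzag_eq T K v w L \<Longrightarrow> zclass T K v L = zclass T K w L"
  unfolding zclass_def by (auto intro: zigzag_eq.sym zigzag_eq.trans)

text \<open>Composition is a union over all representatives of both classes. Congruence on either
  side makes all concatenations equivalent, so the union is over one class.\<close>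

lemma d_comp_zclass:
  assumes "zigzag T K v L" "zigzag T L w M"
  shows "d_comp T (zclass T L w M) (zclass T K v L) = zclass T K (v @ w) M"
proof -
  have "zclass T K (v' @ w') M = zclass T K (v @ w) M"
    if "zigzag_eq T K v v' L" "zigzag_eq T L w w' M" for v' w'
  proof -
    have bdd: "bounded_complex T K" "bounded_complex T M" using assms zigzag_bounded by auto
    have v': "zigzag T K v' L" using that zigzag_eq_zigzag by blast
    have "zigzag_eq T K ([] @ v @ w) ([] @ v' @ w) M"
      by (rule zigzag_eq.cong[OF zigzag.nil[OF bdd(1)] that(1) assms(2)])
    moreover have "zigzag_eq T K (v' @ w @ []) (v' @ w' @ []) M"
      by (rule zigzag_eq.cong[OF v' that(2) zigzag.nil[OF bdd(2)]])
    ultimately show ?thesis by (auto intro!: zclass_eqI[OF zigzag_eq.sym] intro: zigzag_eq.trans)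
  qed
  then have "{zclass T K' (v' @ w') M' | K' v' L' w' M'. (K', v', L') \<in> zclass T K v L \<and> (L', w', M') \<in> zclass T L w M}
    \<subseteq> {zclass T K (v @ w) M}"
    by (auto simp: zclass_mem)
  moreover have "(K, v, L) \<in> zclass T K v L" "(L, w, M) \<in> zclass T L w M"
    using assms by (simp_all add: zclass_mem zigzag_eq.refl)
  then have "zclass T K (v @ w) M \<in>
      {zclass T K' (v' @ w') M' | K' v' L' w' M'. (K', v', L') \<in> zclass T K v L \<and> (L', w', M') \<in> zclass T L w M}"
    by blast
  ultimately have "{zclass T K' (v' @ w') M' | K' v' L' w' M'. (K', v', L') \<in> zclass T K v L \<and> (L', w', M') \<in> zclass T L w M}
    = {zclass T K (v @ w) M}" by (intro equalityI) (simp_all only: insert_subset empty_subsetI simp_thms)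
  then show ?thesis by (simp add: d_comp_def)
qed

lemma Dbc_simps [simp]:
  "Ob (Dbc X) = {K. bounded_complex (analytic_top X) K \<and>
     (\<forall>n. constructible X (cohomology_sheaf (analytic_top X) K n))}"
  "Hom (Dbc X) K L = {zclass (analytic_top X) K w L | w. zigzag (analytic_top X) K w L}"
  "Idn (Dbc X) K = zclass (analytic_top X) K [] K"
  "Cmp (Dbc X) = d_comp (analytic_top X)"
  "Add (Dbc X) = d_add (analytic_top X)"
  "Zer (Dbc X) K L = chain_mor (analytic_top X) K (cx_zero L) L"
  "Sho (Dbc X) = cx_shift"
  "Hom (Dbc_base X) K L = {zclass (analytic_top X) K w L | w. zigzag (analytic_top X) K w L}"
  "Idn (Dbc_base X) K = zclass (analytic_top X) K [] K"
  "Cmp (Dbc_base X) = d_comp (analytic_top X)"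
  by (auto simp: Dbc_def Dbc_base_def Let_def)

text \<open>Distinguished triangles are characterized by isomorphisms in the record without
  triangles, which has the same morphisms and the same composition.\<close>

lemma iso_mor_Dbc_base: "iso_mor (Dbc_base X) = iso_mor (Dbc X)"
  by (intro HOL.ext) (simp add: iso_mor_def)

lemma iso_mor_sym: "iso_mor C A B f \<Longrightarrow> \<exists>g. iso_mor C B A g"
  by (auto simp: iso_mor_def)

lemma isomorphic_in_sym: "isomorphic_in C A B \<Longrightarrow> isomorphic_in C B A"
  using iso_mor_sym unfolding isomorphic_in_def by metis

text \<open>Both words are returned explicitly, since the computation of a cone follows classes in
  both directions along an isomorphism.\<close>

lemma iso_mor_DbcE:
  assumes "iso_mor (Dbc X) K L \<alpha>"
  obtains v w where "zigzag (analytic_top X) K v L" "zigzag (analytic_top X) L w K"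
    "\<alpha> = zclass (analytic_top X) K v L"
    "\<And>n x a. x \<in> topspace (analytic_top X) \<Longrightarrow> a \<in> carrier (cstalk (analytic_top X) K n x) \<Longrightarrow>
        wmap (analytic_top X) n x w (wmap (analytic_top X) n x v a) = a"
    "\<And>n x a. x \<in> topspace (analytic_top X) \<Longrightarrow> a \<in> carrier (cstalk (analytic_top X) L n x) \<Longrightarrow>
        wmap (analytic_top X) n x v (wmap (analytic_top X) n x w a) = a"
proof -
  let ?T = "analytic_top X"
  obtain v w where v: "zigzag ?T K v L" "\<alpha> = zclass ?T K v L" and w: "zigzag ?T L w K"
    and 1: "d_comp ?T (zclass ?T L w K) \<alpha> = zclass ?T K [] K" "d_comp ?T \<alpha> (zclass ?T L w K) = zclass ?T L [] L"
    using assms by (auto simp: iso_mor_def)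
  have "zclass ?T K (v @ w) K = zclass ?T K [] K" "zclass ?T L (w @ v) L = zclass ?T L [] L"
    using 1 v w by (simp_all add: d_comp_zclass)
  \<comment> \<open>Equality of classes yields equivalence of words by following one member from one
    class to the other.\<close>
  moreover have "(K, v @ w, K) \<in> zclass ?T K (v @ w) K" "(L, w @ v, L) \<in> zclass ?T L (w @ v) L"
    using v w by (auto simp: zclass_mem intro!: zigzag_eq.refl zigzag_append)
  ultimately have eq: "zigzag_eq ?T K [] (v @ w) K" "zigzag_eq ?T L [] (w @ v) L"
    by (simp_all add: zclass_mem)
  show ?thesis
    using wmap_cong[OF eq(1)] wmap_cong[OF eq(2)] v w by (intro that[of v w]) (auto simp: wmap_append)
qed

text \<open>All that the transport of cohomology retains of an isomorphism in the derived category;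
  no inverse zigzag is recorded.\<close>

definition coh_iso_word :: "'x topology \<Rightarrow> 'x cx \<Rightarrow> 'x letters \<Rightarrow> 'x cx \<Rightarrow> bool" where
  "coh_iso_word T K w L \<longleftrightarrow> zigzag T K w L \<and>
     (\<forall>n. \<forall>x\<in>topspace T. wmap T n x w \<in> iso (cstalk T K n x) (cstalk T L n x))"

lemma coh_iso_wordI:
  assumes "zigzag T K v L" "zigzag T L w K"
    and "\<And>n x a. x \<in> topspace T \<Longrightarrow> a \<in> carrier (cstalk T K n x) \<Longrightarrow> wmap T n x w (wmap T n x v a) = a"
    and "\<And>n x a. x \<in> topspace T \<Longrightarrow> a \<in> carrier (cstalk T L n x) \<Longrightarrow> wmap T n x v (wmap T n x w a) = a"
  shows "coh_iso_word T K v L"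
  unfolding coh_iso_word_def
proof (intro conjI allI ballI)
  show "zigzag T K v L" by fact
  fix n x assume x: "x \<in> topspace T"
  have "wmap T n x v \<in> carrier (cstalk T K n x) \<rightarrow> carrier (cstalk T L n x)"
    "wmap T n x w \<in> carrier (cstalk T L n x) \<rightarrow> carrier (cstalk T K n x)"
    using hom_in_carrier[OF wmap_hom[OF assms(1) x]] hom_in_carrier[OF wmap_hom[OF assms(2) x]] by auto
  then have "bij_betw (wmap T n x v) (carrier (cstalk T K n x)) (carrier (cstalk T L n x))"
    using assms(3,4)[OF x] by (rule bij_betwI)
  then show "wmap T n x v \<in> iso (cstalk T K n x) (cstalk T L n x)"
    using wmap_hom[OF assms(1) x] by (rule isoI[rotated])
qed

lemma iso_mor_coh_iso_wordE:
  assumes iso: "iso_mor (Dbc X) K L \<alpha>"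
  obtains w where "coh_iso_word (analytic_top X) K w L"
proof -
  show ?thesis
  proof (rule iso_mor_DbcE[OF iso], goal_cases)
    case (1 v w)
    show ?case by (rule that, rule coh_iso_wordI[OF 1(1,2)]) (simp_all add: 1(4,5))
  qed
qed

lemma isomorphic_in_DbcE:
  assumes "isomorphic_in (Dbc X) K L"
  obtains w where "coh_iso_word (analytic_top X) K w L"
proof -
  obtain \<alpha> where "iso_mor (Dbc X) K L \<alpha>" using assms by (auto simp: isomorphic_in_def)
  then show ?thesis by (rule iso_mor_coh_iso_wordE) (rule that)
qed

text \<open>The inverse of a roof is the reversed roof: in the composite the two inner letters
  cancel by \<open>inv_right\<close>, and the remaining outer pair by
  \<open>inv_left\<close>.\<close>

lemma quasi_iso_roof_isomorphic:
  assumes K: "K \<in> Ob (Dbc X)" and L: "L \<in> Ob (Dbc X)"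
    and s: "quasi_iso (analytic_top X) M K s" and f: "quasi_iso (analytic_top X) M L f"
  shows "isomorphic_in (Dbc X) K L"
proof -
  let ?T = "analytic_top X"
  have roof: "d_comp ?T (zclass ?T L [Inv M f L, Fwd M s K] K) (zclass ?T K [Inv M s K, Fwd M f L] L) = zclass ?T K [] K"
    if s: "quasi_iso ?T M K s" and f: "quasi_iso ?T M L f" for K L s f
  proof -
    have z: "zigzag ?T K [Inv M s K, Fwd M f L] L" "zigzag ?T L [Inv M f L, Fwd M s K] K"
      using s f by (auto intro!: zigzag.intros simp: quasi_iso_def cx_hom_def)
    have "zigzag_eq ?T K ([Inv M s K] @ [Fwd M f L, Inv M f L] @ [Fwd M s K]) ([Inv M s K] @ [] @ [Fwd M s K]) K"
      by (rule zigzag_eq.cong[OF zigzag_singleton(2)[OF s] zigzag_eq.inv_right[OF f]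
            zigzag_singleton(1)[OF quasi_isoD[OF s]]])
    moreover have "zigzag_eq ?T K [Inv M s K, Fwd M s K] [] K" using s by (rule zigzag_eq.inv_left)
    ultimately show ?thesis
      using z by (auto simp: d_comp_zclass intro!: zclass_eqI intro: zigzag_eq.trans)
  qed
  have z: "zigzag ?T K [Inv M s K, Fwd M f L] L" "zigzag ?T L [Inv M f L, Fwd M s K] K"
    using s f by (auto intro!: zigzag.intros simp: quasi_iso_def cx_hom_def)
  have "iso_mor (Dbc X) K L (zclass ?T K [Inv M s K, Fwd M f L] L)"
    unfolding iso_mor_def using roof[OF s f] roof[OF f s] z
    by (auto intro!: bexI[of _ "zclass ?T L [Inv M f L, Fwd M s K] K"])
  then show ?thesis using K L unfolding isomorphic_in_def by blast
qed

text \<open>The argument works with words: in the concatenation of both isomorphisms with their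
  inverses, the inner pair is cancelled in its context by \<open>cong\<close>, then the outer
  one.\<close>

lemma isomorphic_in_Dbc_trans:
  assumes "isomorphic_in (Dbc X) K L" "isomorphic_in (Dbc X) L N"
  shows "isomorphic_in (Dbc X) K N"
proof -
  let ?T = "analytic_top X"
  have inverse: "\<exists>v w. zigzag ?T K v L \<and> zigzag ?T L w K \<and> zigzag_eq ?T K (v @ w) [] K \<and> zigzag_eq ?T L (w @ v) [] L"
    if iso: "isomorphic_in (Dbc X) K L" for K L
  proof -
    obtain v w where v: "zigzag ?T K v L" and w: "zigzag ?T L w K"
      and 1: "d_comp ?T (zclass ?T L w K) (zclass ?T K v L) = zclass ?T K [] K"
        "d_comp ?T (zclass ?T K v L) (zclass ?T L w K) = zclass ?T L [] L"
      using iso by (auto simp: isomorphic_in_def iso_mor_def)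
    have "(K, [], K) \<in> zclass ?T K (v @ w) K" "(L, [], L) \<in> zclass ?T L (w @ v) L"
      using 1 zigzag_bounded[OF v] v w
      by (auto simp: d_comp_zclass) (auto simp: zclass_mem intro: zigzag_eq.refl zigzag.nil)
    then show ?thesis using v w by (auto simp: zclass_mem)
  qed
  obtain v v' where v: "zigzag ?T K v L" "zigzag ?T L v' K" "zigzag_eq ?T K (v @ v') [] K" "zigzag_eq ?T L (v' @ v) [] L"
    using inverse[OF assms(1)] by blast
  obtain w w' where w: "zigzag ?T L w N" "zigzag ?T N w' L" "zigzag_eq ?T L (w @ w') [] L" "zigzag_eq ?T N (w' @ w) [] N"
    using inverse[OF assms(2)] by blast
  have "zigzag_eq ?T K (v @ (w @ w') @ v') (v @ [] @ v') K"
    by (rule zigzag_eq.cong[OF v(1) w(3) v(2)])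
  then have 1: "zigzag_eq ?T K ((v @ w) @ (w' @ v')) [] K" using v(3) by (auto intro: zigzag_eq.trans)
  have "zigzag_eq ?T N (w' @ (v' @ v) @ w) (w' @ [] @ w) N"
    by (rule zigzag_eq.cong[OF w(2) v(4) w(1)])
  then have 2: "zigzag_eq ?T N ((w' @ v') @ (v @ w)) [] N" using w(4) by (auto intro: zigzag_eq.trans)
  have z: "zigzag ?T K (v @ w) N" "zigzag ?T N (w' @ v') K" using v w zigzag_append by blast+
  have "d_comp ?T (zclass ?T N (w' @ v') K) (zclass ?T K (v @ w) N) = zclass ?T K [] K"
    "d_comp ?T (zclass ?T K (v @ w) N) (zclass ?T N (w' @ v') K) = zclass ?T N [] N"
    using z 1 2 by (simp_all only: d_comp_zclass zclass_eqI)
  then have "iso_mor (Dbc X) K N (zclass ?T K (v @ w) N)"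
    unfolding iso_mor_def Dbc_simps using z by blast
  then show ?thesis using assms by (auto simp: isomorphic_in_def)
qed

inductive_cases zigzag_FwdE: "zigzag T K (Fwd K' f L' # w) M"
inductive_cases zigzag_InvE: "zigzag T K (Inv K' f L' # w) M"

section \<open>Multiplication by an integer\<close>

lemma cmap_zero:
  assumes "cx_hom T K L (cx_zero L)" "x \<in> topspace T" "a \<in> carrier (cstalk T K n x)"
  shows "cmap T L (cx_zero L) n x a = \<one>\<^bsub>cstalk T L n x\<^esub>"
proof -
  interpret complex_morphism T K L "cx_zero L" using assms by (simp add: complex_morphism_iff)
  show ?thesis using assms(3) by (elim K.cstalkE) (simp add: cmap_cgerm, simp add: cx_zero_def L.cgerm_one)
qed

lemma cmap_add:
  assumes f: "cx_hom T K L f" and g: "cx_hom T K L g" and fg: "cx_hom T K L (cx_add L f g)"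
    and a: "a \<in> carrier (cstalk T K n x)"
  shows "cmap T L (cx_add L f g) n x a = cmap T L f n x a \<otimes>\<^bsub>cstalk T L n x\<^esub> cmap T L g n x a"
proof -
  interpret f: complex_morphism T K L f using f by (simp add: complex_morphism_iff)
  interpret g: complex_morphism T K L g using g by (simp add: complex_morphism_iff)
  interpret fg: complex_morphism T K L "cx_add L f g" using fg by (simp add: complex_morphism_iff)
  show ?thesis using a
    by (elim f.K.cstalkE)
      (simp add: f.cmap_cgerm g.cmap_cgerm fg.cmap_cgerm f.L.cgerm_mult f.f_Z g.f_Z, simp add: cx_add_def)
qed

text \<open>Quantifying over every member of the class suits the definition of addition as a union:
  a sum is represented by roofs \<open>(f + g)/s\<close>, where \<open>f/s\<close> is covered by the
  induction hypothesis and \<open>g/s\<close> represents the identity.\<close>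

lemma mult_by_acts:
  assumes A: "bounded_complex (analytic_top X) A"
    and w: "(K, w, L) \<in> mult_by (Dbc X) k A" and x: "x \<in> topspace (analytic_top X)"
    and a: "a \<in> carrier (cstalk (analytic_top X) A n x)"
  shows "K = A \<and> L = A \<and> zigzag (analytic_top X) A w A \<and>
    wmap (analytic_top X) n x w a = a [^]\<^bsub>cstalk (analytic_top X) A n x\<^esub> k"
  using w unfolding mult_by_def
proof (induction k arbitrary: K w L)
  let ?T = "analytic_top X"
  interpret complex_on ?T A using A by (simp add: complex_on_def)
  interpret G: group "cstalk ?T A n x" by (rule cstalk_group[OF x])
  {
    case 0
    then have KL: "K = A" "L = A" and eq: "zigzag_eq ?T A [Fwd A (cx_zero A) A] w A"
      by (auto simp: nat_pow_def hom_group_def chain_mor_def zclass_mem)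
    then have z: "zigzag ?T A [Fwd A (cx_zero A) A] A" "zigzag ?T A w A" using zigzag_eq_zigzag[OF eq] by auto
    then have "cx_hom ?T A A (cx_zero A)" by (auto elim: zigzag_FwdE)
    then show ?case using KL z wmap_cong[OF eq x a] x a by (simp add: cmap_zero)
  next
    case (Suc k)
    let ?F = "Idn (Dbc X) A [^]\<^bsub>hom_group (Dbc X) A A\<^esub> k"
    have "(K, w, L) \<in> d_add ?T ?F (zclass ?T A [] A)"
      using Suc.prems by (simp add: nat_pow_def hom_group_def)
    then obtain M s f g where f: "(K, [Inv M s K, Fwd M f L], L) \<in> ?F"
      and g: "(K, [Inv M s K, Fwd M g L], L) \<in> zclass ?T A [] A"
      and eq: "zigzag_eq ?T K [Inv M s K, Fwd M (cx_add L f g) L] w L"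
      by (auto simp: d_add_def zclass_mem)
    note IH = Suc.IH[OF f]
    then have KL: "K = A" "L = A" by auto
    have z: "zigzag ?T A [Inv M s A, Fwd M f A] A" "zigzag ?T A [Inv M s A, Fwd M g A] A"
      "zigzag ?T A [Inv M s A, Fwd M (cx_add A f g) A] A" "zigzag ?T A w A"
      using IH g zigzag_eq_zigzag[OF eq] unfolding KL zclass_mem by (auto dest: zigzag_eq_zigzag)
    have s: "quasi_iso ?T M A s" and hom: "cx_hom ?T M A f" "cx_hom ?T M A g" "cx_hom ?T M A (cx_add A f g)"
      using z by (auto elim!: zigzag_InvE zigzag_FwdE)
    \<comment> \<open>Pulling \<open>a\<close> back through the common denominator gives one element
      on which both numerators are evaluated: \<open>g\<close> returns \<open>a\<close>, and
      \<open>f\<close> returns its \<open>k\<close>-th power.\<close>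
    let ?c = "inv_into (carrier (cstalk ?T M n x)) (cmap ?T A s n x) a"
    have c: "?c \<in> carrier (cstalk ?T M n x)"
      using hom_in_carrier[OF iso_imp_homomorphism[OF cmap_inv_iso[OF s x]] a] .
    have "cmap ?T A g n x ?c = a"
      using g wmap_cong[OF _ x a, of "[]" "[Inv M s A, Fwd M g A]" A] unfolding KL zclass_mem by simp
    moreover have "cmap ?T A f n x ?c = a [^]\<^bsub>cstalk ?T A n x\<^esub> k"
      using IH unfolding KL by simp
    ultimately have "wmap ?T n x w a = a [^]\<^bsub>cstalk ?T A n x\<^esub> k \<otimes>\<^bsub>cstalk ?T A n x\<^esub> a"
      using wmap_cong[OF eq[unfolded KL] x a] cmap_add[OF hom c] by simp
    then show ?case using KL z by simp
  }
qed

section \<open>Complexes whose cohomology is a constant sheaf on a subset\<close>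

definition locally_exact :: "'x topology \<Rightarrow> 'x cx \<Rightarrow> int \<Rightarrow> 'x \<Rightarrow> 'x set \<Rightarrow> 'x univ \<Rightarrow> bool" where
  "locally_exact T K n x U s \<longleftrightarrow>
     (\<exists>W. openin T W \<and> x \<in> W \<and> W \<subseteq> U \<and> res (trm K n) U W s \<in> cx_coboundaries K n W)"

definition acyclic_at :: "'x topology \<Rightarrow> 'x cx \<Rightarrow> int \<Rightarrow> bool" where
  "acyclic_at T K n \<longleftrightarrow>
     (\<forall>U x s. openin T U \<longrightarrow> x \<in> U \<longrightarrow> s \<in> carrier (cx_cocycles K n U) \<longrightarrow> locally_exact T K n x U s)"

lemma (in complex_on) cgerm_one_iff:
  "openin T U \<Longrightarrow> x \<in> U \<Longrightarrow> s \<in> Z n U \<Longrightarrow>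
   cgerm T K n x U s = \<one>\<^bsub>cstalk T K n x\<^esub> \<longleftrightarrow> locally_exact T K n x U s"
  by (simp add: cgerm_eq_one_iff locally_exact_def)

text \<open>The values \<open>\<phi> x U s\<close> of cocycles identify the cohomology sheaf in degree \<open>n\<close> with the extension
  by zero of the constant sheaf \<open>G\<close> on \<open>S\<close>.\<close>

locale constant_cohomology = complex_on T K for T :: "'x topology" and K +
  fixes S :: "'x set" and n :: int and G :: "'g monoid" and \<phi> :: "'x \<Rightarrow> 'x set \<Rightarrow> 'x univ \<Rightarrow> 'g"
  assumes G: "group G"
    and support: "S \<subseteq> topspace T"
    and val_closed: "\<And>U x s. openin T U \<Longrightarrow> x \<in> U \<Longrightarrow> x \<in> S \<Longrightarrow> s \<in> Z n U \<Longrightarrow> \<phi> x U s \<in> carrier G"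
    and val_mult: "\<And>U x s t. openin T U \<Longrightarrow> x \<in> U \<Longrightarrow> x \<in> S \<Longrightarrow> s \<in> Z n U \<Longrightarrow> t \<in> Z n U \<Longrightarrow>
      \<phi> x U (s \<otimes>\<^bsub>sec (trm K n) U\<^esub> t) = \<phi> x U s \<otimes>\<^bsub>G\<^esub> \<phi> x U t"
    and val_res: "\<And>U V x s. openin T U \<Longrightarrow> openin T V \<Longrightarrow> V \<subseteq> U \<Longrightarrow> x \<in> V \<Longrightarrow> x \<in> S \<Longrightarrow> s \<in> Z n U \<Longrightarrow>
      \<phi> x V (res (trm K n) U V s) = \<phi> x U s"
    and val_one_iff: "\<And>U x s. openin T U \<Longrightarrow> x \<in> U \<Longrightarrow> x \<in> S \<Longrightarrow> s \<in> Z n U \<Longrightarrow>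
      \<phi> x U s = \<one>\<^bsub>G\<^esub> \<longleftrightarrow> locally_exact T K n x U s"
    and val_surj: "\<And>x g. x \<in> S \<Longrightarrow> g \<in> carrier G \<Longrightarrow> \<exists>U s. openin T U \<and> x \<in> U \<and> s \<in> Z n U \<and> \<phi> x U s = g"
    and val_const: "\<And>U x s. openin T U \<Longrightarrow> x \<in> U \<Longrightarrow> x \<in> S \<Longrightarrow> s \<in> Z n U \<Longrightarrow>
      \<exists>W. openin T W \<and> x \<in> W \<and> W \<subseteq> U \<and> (\<forall>y\<in>W \<inter> S. \<phi> y U s = \<phi> x U s)"
    and outside: "\<And>U x s. openin T U \<Longrightarrow> x \<in> U \<Longrightarrow> x \<notin> S \<Longrightarrow> s \<in> Z n U \<Longrightarrow> locally_exact T K n x U s"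
begin

lemma val_one: "openin T U \<Longrightarrow> x \<in> U \<Longrightarrow> x \<in> S \<Longrightarrow> \<phi> x U \<one>\<^bsub>sec (trm K n) U\<^esub> = \<one>\<^bsub>G\<^esub>"
  by (subst val_one_iff) (auto simp: Z_one locally_exact_def trm.res_one B_one)

lemma val_inv:
  assumes "openin T U" "x \<in> U" "x \<in> S" "s \<in> Z n U"
  shows "\<phi> x U (inv\<^bsub>sec (trm K n) U\<^esub> s) = inv\<^bsub>G\<^esub> \<phi> x U s"
proof -
  interpret G: group G by (rule G)
  interpret H: group "sec (trm K n) U" by (rule trm.sec_group'[OF assms(1)])
  have "\<phi> x U (inv\<^bsub>sec (trm K n) U\<^esub> s) \<otimes>\<^bsub>G\<^esub> \<phi> x U s = \<one>\<^bsub>G\<^esub>"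
    using assms by (simp add: Z_inv ZD val_one flip: val_mult)
  then show ?thesis using assms by (intro G.inv_equality[symmetric]) (auto simp: val_closed Z_inv)
qed

lemma val_coboundary: "openin T U \<Longrightarrow> x \<in> U \<Longrightarrow> x \<in> S \<Longrightarrow> s \<in> B n U \<Longrightarrow> \<phi> x U s = \<one>\<^bsub>G\<^esub>"
  using B_subset_Z[of U n] by (subst val_one_iff) (auto simp: locally_exact_def B_res intro!: exI[of _ U])

text \<open>Values are given on cocycles. Applying \<open>val_one_iff\<close> to a difference over
  the common domain shows that they depend only on the class in the stalk.\<close>

lemma val_cong:
  assumes U: "openin T U" "x \<in> U" "s \<in> Z n U" and V: "openin T V" "x \<in> V" "t \<in> Z n V"
    and x: "x \<in> S" and eq: "cgerm T K n x U s = cgerm T K n x V t"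
  shows "\<phi> x U s = \<phi> x V t"
proof -
  interpret G: group G by (rule G)
  let ?W = "U \<inter> V"
  let ?s = "res (trm K n) U ?W s" and ?t = "res (trm K n) V ?W t"
  have W: "openin T ?W" "x \<in> ?W" using U V by auto
  have st: "?s \<in> Z n ?W" "?t \<in> Z n ?W" using U V W by (auto simp: Z_res)
  interpret C: group "cstalk T K n x" using openin_subset[OF U(1)] U(2) by (intro cstalk_group) auto
  let ?u = "?s \<otimes>\<^bsub>sec (trm K n) ?W\<^esub> inv\<^bsub>sec (trm K n) ?W\<^esub> ?t"
  have "cgerm T K n x ?W ?s = cgerm T K n x ?W ?t" using eq U V W by (simp add: cgerm_res)
  then have "cgerm T K n x ?W ?u = \<one>\<^bsub>cstalk T K n x\<^esub>"
    using W st by (simp add: cgerm_inv Z_inv cgerm_in flip: cgerm_mult)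
  then have "locally_exact T K n x ?W ?u" using W st by (simp add: cgerm_one_iff Z_mult Z_inv)
  then have "\<phi> x ?W ?u = \<one>\<^bsub>G\<^esub>" using W st x by (simp add: val_one_iff Z_mult Z_inv)
  then have "\<phi> x ?W ?s \<otimes>\<^bsub>G\<^esub> inv\<^bsub>G\<^esub> \<phi> x ?W ?t = \<one>\<^bsub>G\<^esub>"
    using W st x by (simp add: val_mult val_inv Z_inv)
  then have "\<phi> x ?W ?s = \<phi> x ?W ?t"
    using W st x by (simp add: G.inv_solve_right' val_closed)
  then show ?thesis using U V W x by (simp add: val_res)
qed

end

text \<open>Acyclicity is the case of empty support, where no value is ever taken. Transport, shift
  and direct image can thus be treated once for constant cohomology and then specialized to acyclic
  degrees.\<close>

lemma constant_cohomology_empty_iff: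
  "constant_cohomology T K {} n G \<phi> \<longleftrightarrow> group G \<and> bounded_complex T K \<and> acyclic_at T K n"
  by (auto simp: constant_cohomology_def constant_cohomology_axioms_def complex_on_def acyclic_at_def)

text \<open>Values on \<open>K\<close> are read off after moving a class along \<open>w\<close> to
  \<open>L\<close>. The second conclusion fixes them through any representative there; this later
  makes the values at both ends of a cone morphism comparable.\<close>

theorem constant_cohomology_transport:
  assumes rep: "constant_cohomology T L S n G \<phi>" and w: "coh_iso_word T K w L"
  obtains \<psi> where "constant_cohomology T K S n G \<psi>"
    "\<And>U x s V t. openin T U \<Longrightarrow> x \<in> U \<Longrightarrow> x \<in> S \<Longrightarrow> s \<in> carrier (cx_cocycles K n U) \<Longrightarrow>
      openin T V \<Longrightarrow> x \<in> V \<Longrightarrow> t \<in> carrier (cx_cocycles L n V) \<Longrightarrow>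
      wmap T n x w (cgerm T K n x U s) = cgerm T L n x V t \<Longrightarrow> \<psi> x U s = \<phi> x V t"
proof -
  interpret L: constant_cohomology T L S n G \<phi> by fact
  interpret K: complex_on T K using w zigzag_bounded by (auto simp: coh_iso_word_def complex_on_def)
  interpret G: group G by (rule L.G)
  have z: "zigzag T K w L" and iso: "wmap T n x w \<in> iso (cstalk T K n x) (cstalk T L n x)" if "x \<in> topspace T" for x
    using w that by (auto simp: coh_iso_word_def)
  \<comment> \<open>\<open>P\<close> collects the cocycles of \<open>L\<close> that represent the
    image of the class of \<open>s\<close>; by \<open>val_cong\<close> the choice among them does
    not affect the value.\<close>
  define P where "P x U s = (\<lambda>(V, t). openin T V \<and> x \<in> V \<and> t \<in> L.Z n V \<and>
    wmap T n x w (cgerm T K n x U s) = cgerm T L n x V t)" for x U s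
  define \<psi> where "\<psi> x U s = (let (V, t) = (SOME p. P x U s p) in \<phi> x V t)" for x U s
  have exP: "\<exists>V t. P x U s (V, t)" if "openin T U" "x \<in> U" "s \<in> K.Z n U" for x U s
  proof -
    have "x \<in> topspace T" using that openin_subset by blast
    then have "wmap T n x w (cgerm T K n x U s) \<in> carrier (cstalk T L n x)"
      using hom_in_carrier[OF iso_imp_homomorphism[OF iso]] K.cgerm_in that by blast
    then show ?thesis by (elim L.cstalkE) (auto simp: P_def)
  qed
  have eq: "\<psi> x U s = \<phi> x V t" if "openin T U" "x \<in> U" "x \<in> S" "s \<in> K.Z n U" "P x U s (V, t)" for x U s V t
  proof -
    obtain V' t' where "(SOME p. P x U s p) = (V', t')" by (cases "SOME p. P x U s p")
    moreover have "P x U s (SOME p. P x U s p)" using that(5) by (rule someI)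
    ultimately show ?thesis using that
      by (auto simp: P_def \<psi>_def intro!: L.val_cong)
  qed
  \<comment> \<open>Injectivity on stalks lets triviality of classes pass in both directions;
    \<open>exact\<close> rephrases it as local exactness.\<close>
  have one: "cgerm T L n x V t = \<one>\<^bsub>cstalk T L n x\<^esub> \<longleftrightarrow> cgerm T K n x U s = \<one>\<^bsub>cstalk T K n x\<^esub>"
    if "openin T U" "x \<in> U" "s \<in> K.Z n U" "P x U s (V, t)" for x U s V t
  proof -
    have x: "x \<in> topspace T" using that openin_subset by blast
    interpret A: group "cstalk T K n x" by (rule K.cstalk_group[OF x])
    interpret B: group "cstalk T L n x" by (rule L.cstalk_group[OF x])
    interpret h: group_hom "cstalk T K n x" "cstalk T L n x" "wmap T n x w"
      by (rule group_homI[OF A.is_group B.is_group iso_imp_homomorphism[OF iso[OF x]]])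
    have "inj_on (wmap T n x w) (carrier (cstalk T K n x))" using iso[OF x] by (auto simp: iso_def bij_betw_def)
    then show ?thesis using h.inj_on_one_iff that K.cgerm_in[OF that(1-3)] by (auto simp: P_def)
  qed
  have exact: "locally_exact T L n x V t \<longleftrightarrow> locally_exact T K n x U s"
    if "openin T U" "x \<in> U" "s \<in> K.Z n U" "P x U s (V, t)" for x U s V t
    using one[OF that] that by (auto simp: P_def K.cgerm_one_iff L.cgerm_one_iff)
  have "constant_cohomology T K S n G \<psi>"
  proof unfold_locales
    show "S \<subseteq> topspace T" by (rule L.support)
    fix U x s assume U: "openin T U" "x \<in> U" and s: "s \<in> K.Z n U"
    have x: "x \<in> topspace T" using U openin_subset by blast
    obtain V t where P: "P x U s (V, t)" using exP U s by blast
    note Pd = P[unfolded P_def prod.case]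
    show "locally_exact T K n x U s" if "x \<notin> S"
      using exact[OF U s P] L.outside[of V x t] Pd that by blast
    assume xS: "x \<in> S"
    note e = eq[OF U xS s P]
    show "\<psi> x U s \<in> carrier G" using e Pd xS by (simp add: L.val_closed)
    show "(\<psi> x U s = \<one>\<^bsub>G\<^esub>) = locally_exact T K n x U s"
      using e Pd xS exact[OF U s P] by (simp add: L.val_one_iff)
    show "\<psi> x U (s \<otimes>\<^bsub>sec (trm K n) U\<^esub> s') = \<psi> x U s \<otimes>\<^bsub>G\<^esub> \<psi> x U s'" if s': "s' \<in> K.Z n U" for s'
    proof -
      have c: "wmap T n x w (cgerm T K n x U s) \<in> carrier (cstalk T L n x)"
        "wmap T n x w (cgerm T K n x U s') \<in> carrier (cstalk T L n x)"
        using hom_in_carrier[OF iso_imp_homomorphism[OF iso[OF x]]] K.cgerm_in U s s' by blast+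
      obtain V t t' where V: "openin T V" "x \<in> V" "t \<in> L.Z n V" "wmap T n x w (cgerm T K n x U s) = cgerm T L n x V t"
        "t' \<in> L.Z n V" "wmap T n x w (cgerm T K n x U s') = cgerm T L n x V t'"
        using c by (rule L.cstalkE2)
      have "P x U s (V, t)" "P x U s' (V, t')" using V by (simp_all add: P_def)
      moreover have "P x U (s \<otimes>\<^bsub>sec (trm K n) U\<^esub> s') (V, t \<otimes>\<^bsub>sec (trm L n) V\<^esub> t')"
        using V U s s' unfolding P_def
        by (simp add: L.Z_mult K.cgerm_in hom_mult[OF iso_imp_homomorphism[OF iso[OF x]]] flip: K.cgerm_mult L.cgerm_mult)
      ultimately show ?thesis
        using eq U xS s s' V by (simp add: K.Z_mult L.val_mult)
    qed
    \<comment> \<open>Local constancy requires one representative for all points near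
      \<open>x\<close>, as supplied by \<open>wmap_open\<close>; representatives chosen separately
      at each point would not yield it.\<close>
    show "\<exists>W. openin T W \<and> x \<in> W \<and> W \<subseteq> U \<and> (\<forall>y\<in>W \<inter> S. \<psi> y U s = \<psi> x U s)"
    proof -
      obtain W t where W: "openin T W" "x \<in> W" "W \<subseteq> U" "t \<in> L.Z n W"
        "\<forall>y\<in>W. wmap T n y w (cgerm T K n y U s) = cgerm T L n y W t"
        using wmap_open[OF z[OF x] U s] by blast
      obtain W' where W': "openin T W'" "x \<in> W'" "W' \<subseteq> W" "\<forall>y\<in>W' \<inter> S. \<phi> y W t = \<phi> x W t"
        using L.val_const[OF W(1,2) xS W(4)] by blast
      have val: "\<psi> y U s = \<phi> y W t" if "y \<in> W" "y \<in> S" for y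
        using eq[of U y s W t] that U s W by (auto simp: P_def)
      have "\<psi> y U s = \<psi> x U s" if y: "y \<in> W' \<inter> S" for y
        using val[of y] val[OF W(2) xS] W'(3,4) y by (simp add: subset_iff)
      then show ?thesis using W'(1-3) W(3) by blast
    qed
  next
    fix U U' x s assume U: "openin T U" "openin T U'" "U' \<subseteq> U" "x \<in> U'" and xS: "x \<in> S" and s: "s \<in> K.Z n U"
    obtain V t where P: "P x U s (V, t)" using exP[of U x s] U s by blast
    have "P x U' (res (trm K n) U U' s) (V, t)" using P U s by (simp add: P_def K.cgerm_res)
    then show "\<psi> x U' (res (trm K n) U U' s) = \<psi> x U s"
      using eq[of U x s V t] eq[of U' x "res (trm K n) U U' s" V t] P U s xS by (auto simp: K.Z_res)
  next
    fix x g assume xS: "x \<in> S" and g: "g \<in> carrier G"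
    have x: "x \<in> topspace T" using L.support xS by blast
    obtain V t where V: "openin T V" "x \<in> V" "t \<in> L.Z n V" "\<phi> x V t = g" using L.val_surj[OF xS g] by blast
    have "cgerm T L n x V t \<in> wmap T n x w ` carrier (cstalk T K n x)"
      using iso[OF x] L.cgerm_in[OF V(1-3)] by (simp add: iso_def bij_betw_def)
    then obtain a where a: "a \<in> carrier (cstalk T K n x)" "cgerm T L n x V t = wmap T n x w a" by (rule imageE)
    obtain U s where U: "openin T U" "x \<in> U" "s \<in> K.Z n U" "a = cgerm T K n x U s"
      using a(1) by (rule K.cstalkE)
    then have "P x U s (V, t)" using V a by (simp add: P_def)
    then have "\<psi> x U s = g" using eq U V xS by simp
    then show "\<exists>U s. openin T U \<and> x \<in> U \<and> s \<in> K.Z n U \<and> \<psi> x U s = g" using U by blast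
  qed
  then show ?thesis using eq by (intro that) (auto simp: P_def)
qed

lemma acyclic_at_transport:
  assumes "acyclic_at T L n" "coh_iso_word T K w L"
  shows "acyclic_at T K n"
proof -
  have "bounded_complex T L" using assms zigzag_bounded by (auto simp: coh_iso_word_def)
  then have "constant_cohomology T L {} n integer_group (\<lambda>_ _ _. 0)"
    using assms by (simp add: constant_cohomology_empty_iff)
  then show ?thesis using assms(2)
    by (rule constant_cohomology_transport) (simp add: constant_cohomology_empty_iff)
qed

section \<open>Shifts and direct images\<close>

text \<open>Degrees stay in the form \<open>n + 1 + 1\<close> produced by the definitions.\<close>

declare [[simproc del: int_combine_numerals]]

text \<open>Commutativity is what makes the negated differential of a shifted complex a
  homomorphism.\<close>

lemma comm_group_hom_inv:
  assumes "comm_group G" "comm_group H" "h \<in> hom G H"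
  shows "(\<lambda>x. inv\<^bsub>H\<^esub> h x) \<in> hom G H"
proof -
  interpret H: comm_group H by fact
  show ?thesis using assms(3) by (auto simp: hom_def Pi_iff H.inv_mult)
qed

context complex_on
begin

lemma bounded:
  obtains N where "\<And>n U. N < \<bar>n\<bar> \<Longrightarrow> openin T U \<Longrightarrow> carrier (sec (trm K n) U) = {\<one>\<^bsub>sec (trm K n) U\<^esub>}"
proof -
  have "\<exists>N. \<forall>n U. N < \<bar>n\<bar> \<and> openin T U \<longrightarrow> carrier (sec (trm K n) U) = {\<one>\<^bsub>sec (trm K n) U\<^esub>}"
    using bounded_complex by (simp add: bounded_complex_def)
  then show ?thesis using that by blast
qed

lemma shift_bounded: "bounded_complex T (cx_shift K)"
  unfolding bounded_complex_def
proof (intro conjI allI impI ballI)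
  show "is_sheaf T (trm (cx_shift K) n)" for n by (simp add: cx_shift_def term_sheaf)
  show "presheaf_hom T (trm (cx_shift K) n) (trm (cx_shift K) (n + 1)) (dif (cx_shift K) n)" for n
    unfolding presheaf_hom_def
  proof (intro conjI allI impI ballI)
    fix U assume U: "openin T U"
    show "dif (cx_shift K) n U \<in> hom (sec (trm (cx_shift K) n) U) (sec (trm (cx_shift K) (n + 1)) U)"
      using comm_group_hom_inv[OF trm.sec_group[OF U] trm.sec_group[OF U] d(1)[OF U, of "n + 1"]]
      by (simp add: cx_shift_def)
  next
    fix U V s assume "openin T U \<and> openin T V \<and> V \<subseteq> U" "s \<in> carrier (sec (trm (cx_shift K) n) U)"
    then show "dif (cx_shift K) n V (res (trm (cx_shift K) n) U V s) =
        res (trm (cx_shift K) (n + 1)) U V (dif (cx_shift K) n U s)"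
      by (simp add: cx_shift_def d trm.res_inv)
  qed
  show "dif (cx_shift K) (n + 1) U (dif (cx_shift K) n U s) = \<one>\<^bsub>sec (trm (cx_shift K) (n + 1 + 1)) U\<^esub>"
    if U: "openin T U" and s: "s \<in> carrier (sec (trm (cx_shift K) n) U)" for n U s
  proof -
    interpret group "sec (trm K (n + 1 + 1 + 1)) U" by (rule trm.sec_group'[OF U])
    show ?thesis using U s by (simp add: cx_shift_def d_inv d d_d)
  qed
  obtain N where N: "\<And>n U. \<bar>n\<bar> > N \<Longrightarrow> openin T U \<Longrightarrow> carrier (sec (trm K n) U) = {\<one>\<^bsub>sec (trm K n) U\<^esub>}"
    using bounded by blast
  \<comment> \<open>Degree \<open>n\<close> of the shift is degree \<open>n + 1\<close> of
    \<open>K\<close>, so the bound is enlarged by one.\<close>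
  show "\<exists>N. \<forall>n U. N < \<bar>n\<bar> \<and> openin T U \<longrightarrow>
      carrier (sec (trm (cx_shift K) n) U) = {\<one>\<^bsub>sec (trm (cx_shift K) n) U\<^esub>}"
    by (rule exI[of _ "N + 1"]) (auto simp: cx_shift_def intro!: N[THEN equalityD1, THEN subsetD, THEN singletonD] trm.one_closed)
qed

lemma shift_Z:
  assumes "openin T U"
  shows "carrier (cx_cocycles (cx_shift K) n U) = Z (n + 1) U"
proof -
  interpret group "sec (trm K (n + 1 + 1)) U" by (rule trm.sec_group'[OF assms])
  show ?thesis using assms by (auto simp: cx_cocycles_def cx_shift_def d inv_eq_1_iff)
qed

text \<open>The sign of the shifted differential inverts each coboundary, and coboundaries form a
  subgroup.\<close>

lemma shift_B:
  assumes "openin T U"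
  shows "cx_coboundaries (cx_shift K) n U = B (n + 1) U"
proof -
  have "cx_coboundaries (cx_shift K) n U = (\<lambda>s. inv\<^bsub>sec (trm K (n + 1)) U\<^esub> s) ` B (n + 1) U"
    by (simp add: cx_coboundaries_def cx_shift_def image_image)
  also have "\<dots> = B (n + 1) U"
  proof -
    interpret group "sec (trm K (n + 1)) U" by (rule trm.sec_group'[OF assms])
    have "b \<in> carrier (sec (trm K (n + 1)) U)" if "b \<in> B (n + 1) U" for b
      using ZD[OF subsetD[OF B_subset_Z[OF assms] that]] .
    then show ?thesis using B_inv[OF assms] by (auto intro!: image_eqI[of b _ "inv\<^bsub>sec (trm K (n + 1)) U\<^esub> b" for b])
  qed
  finally show ?thesis .
qed

lemma shift_locally_exact: "locally_exact T (cx_shift K) n x U s \<longleftrightarrow> locally_exact T K (n + 1) x U s"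
  unfolding locally_exact_def using shift_B by (auto simp: cx_shift_def)

end

lemma constant_cohomology_shift:
  assumes "constant_cohomology T K S (n + 1) G \<phi>"
  shows "constant_cohomology T (cx_shift K) S n G \<phi>"
proof -
  interpret constant_cohomology T K S "n + 1" G \<phi> by fact
  have sec: "sec (trm (cx_shift K) n) = sec (trm K (n + 1))" "res (trm (cx_shift K) n) = res (trm K (n + 1))"
    by (simp_all add: cx_shift_def)
  show ?thesis
  proof (rule constant_cohomology.intro)
    show "complex_on T (cx_shift K)" by (simp add: complex_on_def shift_bounded)
    show "constant_cohomology_axioms T (cx_shift K) S n G \<phi>"
    proof (rule constant_cohomology_axioms.intro, goal_cases)
      case (7 x g)
      then obtain U s where "openin T U" "x \<in> U" "s \<in> Z (n + 1) U" "\<phi> x U s = g" using val_surj by blast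
      then show ?case using shift_Z by blast
    qed (use G support in \<open>simp_all add: shift_Z sec shift_locally_exact val_closed val_mult val_res val_one_iff
          val_const outside\<close>)
  qed
qed

lemma acyclic_at_shift: "bounded_complex T K \<Longrightarrow> acyclic_at T K (n + 1) \<Longrightarrow> acyclic_at T (cx_shift K) n"
  using constant_cohomology_shift[of T K "{}" n integer_group "\<lambda>_ _ _. 0"]
  by (simp add: constant_cohomology_empty_iff)

text \<open>Gluing along the empty cover of the empty set leaves exactly one section. This makes a
  direct image vanish off the closed set.\<close>

lemma sheaf_empty:
  assumes "is_sheaf T F" shows "\<exists>a. carrier (sec F {}) = {a}"
proof -
  have "\<exists>!t. t \<in> carrier (sec F {})" using assms unfolding is_sheaf_def by (elim conjE allE[of _ "{}"]) simp
  then show ?thesis by auto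
qed

lemma sheaf_push:
  assumes F: "is_sheaf (subtopology T S) F"
  shows "is_sheaf T \<lparr>sec = (\<lambda>V. sec F (V \<inter> S)), res = (\<lambda>V W. res F (V \<inter> S) (W \<inter> S))\<rparr>"
proof -
  interpret presheaf_on "subtopology T S" F using F by unfold_locales (simp add: is_sheaf_def)
  have o: "openin (subtopology T S) (V \<inter> S)" if "openin T V" for V
    using that by (auto simp: openin_subtopology)
  have m: "W \<inter> S \<subseteq> V \<inter> S" if "W \<subseteq> V" for V W using that by blast
  show ?thesis
    unfolding is_sheaf_def
  proof (intro conjI allI impI)
    show "is_presheaf T \<lparr>sec = (\<lambda>V. sec F (V \<inter> S)), res = (\<lambda>V W. res F (V \<inter> S) (W \<inter> S))\<rparr>"
      unfolding is_presheaf_def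
    proof (intro conjI allI impI ballI, goal_cases)
      case (2 U V)
      then show ?case using res_hom[OF o[of U] o[of V] m] by simp
    next
      case (4 U V W s)
      then show ?case using res_res[OF o[of U] o[of V] o[of W] m m] by simp
    qed (simp_all add: o sec_group res_self)
    fix \<U> s
    assume A: "(\<forall>U\<in>\<U>. openin T U \<and>
           s U \<in> carrier (sec \<lparr>sec = \<lambda>V. sec F (V \<inter> S), res = \<lambda>V W. res F (V \<inter> S) (W \<inter> S)\<rparr> U)) \<and>
       (\<forall>U\<in>\<U>. \<forall>V\<in>\<U>.
           res \<lparr>sec = \<lambda>V. sec F (V \<inter> S), res = \<lambda>V W. res F (V \<inter> S) (W \<inter> S)\<rparr> U (U \<inter> V) (s U) =
           res \<lparr>sec = \<lambda>V. sec F (V \<inter> S), res = \<lambda>V W. res F (V \<inter> S) (W \<inter> S)\<rparr> V (U \<inter> V) (s V))"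
    have s: "openin T U" "s U \<in> carrier (sec F (U \<inter> S))" if "U \<in> \<U>" for U using A that by auto
    have glue: "res F (U \<inter> S) (U \<inter> V \<inter> S) (s U) = res F (V \<inter> S) (U \<inter> V \<inter> S) (s V)"
      if "U \<in> \<U>" "V \<in> \<U>" for U V using A that by auto
    \<comment> \<open>Different members of the cover may have the same trace on \<open>S\<close>,
      while gluing on the subspace expects one section per trace. A member is chosen for each trace,
      and agreement on overlaps shows that its section does not depend on the choice.\<close>
    define c where "c W = (SOME U. U \<in> \<U> \<and> U \<inter> S = W)" for W
    have c: "c W \<in> \<U>" "c W \<inter> S = W" if "W \<in> (\<lambda>U. U \<inter> S) ` \<U>" for W
    proof -
      have "\<exists>U. U \<in> \<U> \<and> U \<inter> S = W" using that by blast
      then have "c W \<in> \<U> \<and> c W \<inter> S = W" unfolding c_def by (rule someI_ex)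
      then show "c W \<in> \<U>" "c W \<inter> S = W" by auto
    qed
    define s' where "s' W = s (c W)" for W
    have s'_eq: "s' (U \<inter> S) = s U" if U: "U \<in> \<U>" for U
    proof -
      have cU: "c (U \<inter> S) \<in> \<U>" "c (U \<inter> S) \<inter> S = U \<inter> S" using c[of "U \<inter> S"] U by auto
      have e: "c (U \<inter> S) \<inter> U \<inter> S = U \<inter> S" using cU by blast
      have "res F (U \<inter> S) (U \<inter> S) (s (c (U \<inter> S))) = res F (U \<inter> S) (U \<inter> S) (s U)"
        using glue[OF cU(1) U] unfolding e cU(2) .
      then show ?thesis using s[OF cU(1)] s[OF U] cU(2) o[OF s(1)[OF U]] by (simp add: s'_def res_self)
    qed
    have "\<exists>!t. t \<in> carrier (sec F (\<Union>((\<lambda>U. U \<inter> S) ` \<U>))) \<and>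
        (\<forall>W\<in>(\<lambda>U. U \<inter> S) ` \<U>. res F (\<Union>((\<lambda>U. U \<inter> S) ` \<U>)) W t = s' W)"
    proof -
      have 1: "\<forall>W\<in>(\<lambda>U. U \<inter> S) ` \<U>. openin (subtopology T S) W \<and> s' W \<in> carrier (sec F W)"
        using s o s'_eq by auto
      have 2: "\<forall>W\<in>(\<lambda>U. U \<inter> S) ` \<U>. \<forall>W'\<in>(\<lambda>U. U \<inter> S) ` \<U>. res F W (W \<inter> W') (s' W) = res F W' (W \<inter> W') (s' W')"
      proof clarify
        fix U V assume UV: "U \<in> \<U>" "V \<in> \<U>"
        have "U \<inter> S \<inter> (V \<inter> S) = U \<inter> V \<inter> S" by blast
        then show "res F (U \<inter> S) (U \<inter> S \<inter> (V \<inter> S)) (s' (U \<inter> S)) = res F (V \<inter> S) (U \<inter> S \<inter> (V \<inter> S)) (s' (V \<inter> S))"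
          using glue[OF UV] s'_eq UV by simp
      qed
      show ?thesis
        using F 1 2 unfolding is_sheaf_def by (elim conjE allE[of _ "(\<lambda>U. U \<inter> S) ` \<U>"] allE[of _ s']) simp
    qed
    moreover have "\<Union>((\<lambda>U. U \<inter> S) ` \<U>) = \<Union>\<U> \<inter> S" by blast
    moreover have "(\<forall>W\<in>(\<lambda>U. U \<inter> S) ` \<U>. res F (\<Union>\<U> \<inter> S) W t = s' W) \<longleftrightarrow>
        (\<forall>U\<in>\<U>. res F (\<Union>\<U> \<inter> S) (U \<inter> S) t = s U)" for t using s'_eq by auto
    ultimately show "\<exists>!t. t \<in> carrier (sec \<lparr>sec = \<lambda>V. sec F (V \<inter> S), res = \<lambda>V W. res F (V \<inter> S) (W \<inter> S)\<rparr> (\<Union>\<U>)) \<and>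
        (\<forall>U\<in>\<U>. res \<lparr>sec = \<lambda>V. sec F (V \<inter> S), res = \<lambda>V W. res F (V \<inter> S) (W \<inter> S)\<rparr> (\<Union>\<U>) U t = s U)"
      by simp
  qed
qed

lemma push_bounded:
  assumes "bounded_complex (subtopology T S) K"
  shows "bounded_complex T (cx_push S K)"
proof -
  interpret complex_on "subtopology T S" K using assms by (simp add: complex_on_def)
  have o: "openin (subtopology T S) (V \<inter> S)" if "openin T V" for V
    using that by (auto simp: openin_subtopology)
  have m: "W \<inter> S \<subseteq> V \<inter> S" if "W \<subseteq> V" for V W using that by blast
  obtain N where N: "\<And>n U. \<bar>n\<bar> > N \<Longrightarrow> openin (subtopology T S) U \<Longrightarrow> carrier (sec (trm K n) U) = {\<one>\<^bsub>sec (trm K n) U\<^esub>}"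
    using bounded by blast
  show ?thesis
    unfolding bounded_complex_def
  proof (intro conjI allI)
    show "is_sheaf T (trm (cx_push S K) n)" for n
      using sheaf_push[OF term_sheaf] by (simp add: cx_push_def)
    show "presheaf_hom T (trm (cx_push S K) n) (trm (cx_push S K) (n + 1)) (dif (cx_push S K) n)" for n
      unfolding presheaf_hom_def
    proof (intro conjI allI impI ballI, goal_cases)
      case (2 U V s)
      then show ?case using d(4)[OF o[of U] o[of V] m, of s n] by (simp add: cx_push_def)
    qed (simp add: cx_push_def o d)
    show "\<exists>N. \<forall>n U. N < \<bar>n\<bar> \<and> openin T U \<longrightarrow>
      carrier (sec (trm (cx_push S K) n) U) = {\<one>\<^bsub>sec (trm (cx_push S K) n) U\<^esub>}"
      by (rule exI[of _ N]) (auto simp: cx_push_def N o)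
  qed (simp add: cx_push_def o d_d)
qed

lemma push_Z: "carrier (cx_cocycles (cx_push S K) n U) = carrier (cx_cocycles K n (U \<inter> S))"
  by (simp add: cx_cocycles_def cx_push_def)

lemma push_B: "cx_coboundaries (cx_push S K) n U = cx_coboundaries K n (U \<inter> S)"
  by (simp add: cx_coboundaries_def cx_push_def)

lemma push_locally_exact:
  assumes U: "openin T U" and x: "x \<in> S"
  shows "locally_exact T (cx_push S K) n x U s \<longleftrightarrow> locally_exact (subtopology T S) K n x (U \<inter> S) s"
proof
  assume "locally_exact T (cx_push S K) n x U s"
  then obtain W where W: "openin T W" "x \<in> W" "W \<subseteq> U"
    "res (trm K n) (U \<inter> S) (W \<inter> S) s \<in> cx_coboundaries K n (W \<inter> S)"
    by (auto simp: locally_exact_def push_B) (auto simp: cx_push_def)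
  then show "locally_exact (subtopology T S) K n x (U \<inter> S) s"
    unfolding locally_exact_def using x by (intro exI[of _ "W \<inter> S"]) (auto simp: openin_subtopology)
next
  assume "locally_exact (subtopology T S) K n x (U \<inter> S) s"
  then obtain V where V: "openin T V" "x \<in> V" "V \<inter> S \<subseteq> U \<inter> S"
    "res (trm K n) (U \<inter> S) (V \<inter> S) s \<in> cx_coboundaries K n (V \<inter> S)"
    by (auto simp: locally_exact_def openin_subtopology)
  \<comment> \<open>The witness in the subspace is the trace of an open \<open>V\<close> that may
    leave \<open>U\<close>; cutting with \<open>U\<close> keeps the trace.\<close>
  have "(V \<inter> U) \<inter> S = V \<inter> S" using V by blast
  then show "locally_exact T (cx_push S K) n x U s"
    unfolding locally_exact_def push_B using V U x
    by (intro exI[of _ "V \<inter> U"]) (auto simp: cx_push_def)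
qed

text \<open>At points of \<open>S\<close> local exactness is that of the original complex. A point
  off \<open>S\<close> has a neighbourhood with empty trace, on which all sections are neutral. The
  support \<open>S'\<close> is a separate parameter so that the empty support is included.\<close>

lemma constant_cohomology_push:
  assumes rep: "constant_cohomology (subtopology T S) K S' n G \<phi>"
    and S: "\<And>U. openin T U \<Longrightarrow> openin T (U - S)"
  shows "constant_cohomology T (cx_push S K) S' n G (\<lambda>x U. \<phi> x (U \<inter> S))"
proof -
  interpret constant_cohomology "subtopology T S" K S' n G \<phi> by fact
  have S': "S' \<subseteq> S" "S' \<subseteq> topspace T" using support by auto
  have o: "openin (subtopology T S) (V \<inter> S)" if "openin T V" for V
    using that by (auto simp: openin_subtopology)
  have m: "W \<inter> S \<subseteq> V \<inter> S" if "W \<subseteq> V" for V W using that by blast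
  have sec: "sec (trm (cx_push S K) n) U = sec (trm K n) (U \<inter> S)"
    "res (trm (cx_push S K) n) U V = res (trm K n) (U \<inter> S) (V \<inter> S)" for U V
    by (simp_all add: cx_push_def)
  show ?thesis
  proof (rule constant_cohomology.intro)
    show "complex_on T (cx_push S K)" by (simp add: complex_on_def push_bounded[OF bounded_complex])
    show "constant_cohomology_axioms T (cx_push S K) S' n G (\<lambda>x U. \<phi> x (U \<inter> S))"
    proof (rule constant_cohomology_axioms.intro, goal_cases)
      case 1
      show ?case by (rule G)
    next
      case 2
      show ?case by (rule S'(2))
    next
      case (3 U x s)
      then show ?case using S' by (auto simp: push_Z o intro!: val_closed)
    next
      case (4 U x s t)
      then show ?case using S' val_mult[OF o[of U], of x s t] by (auto simp: push_Z sec)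
    next
      case (5 U V x s)
      then show ?case using S' val_res[OF o[of U] o[of V] m, of x s] by (auto simp: push_Z sec)
    next
      case (6 U x s)
      then have "x \<in> S" using S' by blast
      with 6 show ?case using val_one_iff[OF o[of U], of x s] by (auto simp: push_Z push_locally_exact)
    next
      case (7 x g)
      obtain W s where W: "openin (subtopology T S) W" "x \<in> W" "s \<in> Z n W" "\<phi> x W s = g"
        using val_surj[OF 7] by blast
      then obtain V where "openin T V" "W = V \<inter> S" by (auto simp: openin_subtopology)
      with W show ?case by (intro exI[of _ V] exI[of _ s]) (auto simp: push_Z)
    next
      case (8 U x s)
      then have x: "x \<in> U \<inter> S" using S' by blast
      have s: "s \<in> Z n (U \<inter> S)" using 8 by (simp add: push_Z)
      obtain W where W: "openin (subtopology T S) W" "x \<in> W" "W \<subseteq> U \<inter> S"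
        "\<forall>y\<in>W \<inter> S'. \<phi> y (U \<inter> S) s = \<phi> x (U \<inter> S) s"
        using val_const[OF o[OF 8(1)] x 8(3) s] by (elim exE conjE) (rule that)
      then obtain V where V: "openin T V" "W = V \<inter> S" by (auto simp: openin_subtopology)
      have "y \<in> W \<inter> S'" if "y \<in> V \<inter> U \<inter> S'" for y using that V S' by blast
      then have "\<forall>y\<in>V \<inter> U \<inter> S'. \<phi> y (U \<inter> S) s = \<phi> x (U \<inter> S) s" using W(4) by blast
      moreover have "openin T (V \<inter> U)" "x \<in> V \<inter> U" using V 8(1) x W(2) by auto
      ultimately show ?case by blast
    next
      case (9 U x s)
      have s: "s \<in> Z n (U \<inter> S)" using 9 by (simp add: push_Z)
      show ?case
      proof (cases "x \<in> S")
        case True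
        then show ?thesis using outside[OF o[OF 9(1)] _ 9(3) s] 9 by (auto simp: push_locally_exact)
      next
        case False
        let ?W = "U - S"
        have W: "openin T ?W" by (rule S[OF 9(1)])
        have e: "?W \<inter> S = {}" by blast
        have oe: "openin (subtopology T S) {}" by simp
        obtain a where a: "carrier (sec (trm K n) {}) = {a}" using sheaf_empty[OF term_sheaf] by blast
        have "res (trm K n) (U \<inter> S) {} s \<in> carrier (sec (trm K n) {})"
          using trm.res_closed[OF o[OF 9(1)] oe _ ZD[OF s]] by blast
        then have "res (trm K n) (U \<inter> S) {} s = \<one>\<^bsub>sec (trm K n) {}\<^esub>"
          using trm.one_closed[OF oe, of n] a by simp
        then have "res (trm K n) (U \<inter> S) (?W \<inter> S) s \<in> B n (?W \<inter> S)"
          unfolding e using B_one[OF oe] by simp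
        then show ?thesis unfolding locally_exact_def push_B sec
          using W False 9 by (intro exI[of _ ?W]) auto
      qed
    qed
  qed
qed

lemma acyclic_at_push:
  "bounded_complex (subtopology T S) K \<Longrightarrow> (\<And>U. openin T U \<Longrightarrow> openin T (U - S)) \<Longrightarrow> acyclic_at (subtopology T S) K n \<Longrightarrow>
   acyclic_at T (cx_push S K) n"
  using constant_cohomology_push[of T S K "{}" n integer_group "\<lambda>_ _ _. 0"]
  by (simp add: constant_cohomology_empty_iff)

section \<open>Constant sheaves\<close>

lemma zero_sheaf: "is_sheaf T zero_sheaf"
  unfolding is_sheaf_def is_presheaf_def zero_sheaf_def
  by (auto intro!: comm_groupI simp: hom_def)

lemma zero_sheaf_simps [simp]:
  "carrier (sec zero_sheaf U) = {\<lambda>n x. 0}" "\<one>\<^bsub>sec zero_sheaf U\<^esub> = (\<lambda>n x. 0)" "res zero_sheaf U V a = (\<lambda>n x. 0)"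
  "a \<otimes>\<^bsub>sec zero_sheaf U\<^esub> b = (\<lambda>n x. 0)"
  by (simp_all add: zero_sheaf_def)

lemma degree_zero_bounded:
  assumes F: "is_sheaf T F"
  shows "bounded_complex T (degree_zero F)"
proof -
  interpret presheaf_on T F using F by unfold_locales (simp add: is_sheaf_def)
  have 1: "openin T U \<Longrightarrow> group (sec F U)" for U by (rule sec_group')
  show ?thesis
    unfolding bounded_complex_def degree_zero_def presheaf_hom_def
    using F zero_sheaf
    by (auto simp: hom_def one_closed res_one mult_closed monoid.l_one[OF group.is_monoid[OF 1]]
        intro!: exI[of _ 0])
qed

definition const_section :: "'x topology \<Rightarrow> int monoid \<Rightarrow> 'x set \<Rightarrow> ('x \<Rightarrow> int) \<Rightarrow> bool" where
  "const_section T G U c \<longleftrightarrow> c \<in> (\<Pi>\<^sub>E x\<in>U. carrier G) \<and>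
     (\<forall>x\<in>U. \<exists>W. openin T W \<and> x \<in> W \<and> W \<subseteq> U \<and> (\<forall>y\<in>W. c y = c x))"

lemma const_sectionE:
  assumes "const_section T G U c" "x \<in> U"
  obtains W where "openin T W" "x \<in> W" "W \<subseteq> U" "\<And>y. y \<in> W \<Longrightarrow> c y = c x"
proof -
  have "\<exists>W. openin T W \<and> x \<in> W \<and> W \<subseteq> U \<and> (\<forall>y\<in>W. c y = c x)"
    using assms unfolding const_section_def by simp
  then show ?thesis using that by blast
qed

text \<open>\<open>to_univ\<close> stores an integer-valued function as a constant sequence, so
  \<open>a 0\<close> recovers the function.\<close>

lemma const_univ_simps:
  "carrier (sec (to_univ (const_sheaf T G)) U) = (\<lambda>c n. c) ` {c. const_section T G U c}"
  "a \<otimes>\<^bsub>sec (to_univ (const_sheaf T G)) U\<^esub> b = (\<lambda>n. \<lambda>x\<in>U. a 0 x \<otimes>\<^bsub>G\<^esub> b 0 x)"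
  "\<one>\<^bsub>sec (to_univ (const_sheaf T G)) U\<^esub> = (\<lambda>n. \<lambda>x\<in>U. \<one>\<^bsub>G\<^esub>)"
  "res (to_univ (const_sheaf T G)) U V a = (\<lambda>n. restrict (a 0) V)"
  by (auto simp: to_univ_def const_sheaf_def const_section_def)

lemma const_section_restrict:
  assumes "const_section T G U c" "openin T V" "V \<subseteq> U"
  shows "const_section T G V (restrict c V)"
  unfolding const_section_def
proof (intro conjI ballI)
  show "restrict c V \<in> (\<Pi>\<^sub>E x\<in>V. carrier G)" using assms by (auto simp: const_section_def)
  fix x assume x: "x \<in> V"
  then have "x \<in> U" using assms(3) by blast
  with assms(1) obtain W where W: "openin T W" "x \<in> W" "\<And>y. y \<in> W \<Longrightarrow> c y = c x"
    by (rule const_sectionE) blast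
  have "restrict c V y = restrict c V x" if "y \<in> W \<inter> V" for y
    using W(3)[of y] that x by simp
  then show "\<exists>W. openin T W \<and> x \<in> W \<and> W \<subseteq> V \<and> (\<forall>y\<in>W. restrict c V y = restrict c V x)"
    using x W(1,2) assms(2) by (intro exI[of _ "W \<inter> V"] conjI ballI openin_Int) blast+
qed

lemma const_section_binary:
  assumes "const_section T G U c" "const_section T G U d"
    and cl: "\<And>x. x \<in> U \<Longrightarrow> h (c x) (d x) \<in> carrier G"
  shows "const_section T G U (\<lambda>x\<in>U. h (c x) (d x))"
  unfolding const_section_def
proof (intro conjI ballI)
  show "(\<lambda>x\<in>U. h (c x) (d x)) \<in> (\<Pi>\<^sub>E x\<in>U. carrier G)" using cl by auto
  fix x assume x: "x \<in> U"
  obtain V where V: "openin T V" "x \<in> V" "V \<subseteq> U" "\<And>y. y \<in> V \<Longrightarrow> c y = c x"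
    using assms(1) x by (rule const_sectionE) blast
  obtain W where W: "openin T W" "x \<in> W" "W \<subseteq> U" "\<And>y. y \<in> W \<Longrightarrow> d y = d x"
    using assms(2) x by (rule const_sectionE) blast
  have "(\<lambda>x\<in>U. h (c x) (d x)) y = (\<lambda>x\<in>U. h (c x) (d x)) x" if y: "y \<in> V \<inter> W" for y
  proof -
    have "y \<in> U" using y V(3) by blast
    then show ?thesis using V(4)[of y] W(4)[of y] y x by simp
  qed
  then show "\<exists>W. openin T W \<and> x \<in> W \<and> W \<subseteq> U \<and> (\<forall>y\<in>W. (\<lambda>x\<in>U. h (c x) (d x)) y = (\<lambda>x\<in>U. h (c x) (d x)) x)"
    using V(1-3) W(1,2) by (intro exI[of _ "V \<inter> W"] conjI ballI openin_Int) blast+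
qed

lemma const_section_const: "openin T U \<Longrightarrow> g \<in> carrier G \<Longrightarrow> const_section T G U (\<lambda>x\<in>U. g)"
  unfolding const_section_def by auto

lemma const_univ_comm_group:
  assumes G: "comm_group G" and U: "openin T U"
  shows "comm_group (sec (to_univ (const_sheaf T G)) U)"
proof (rule comm_groupI)
  let ?F = "sec (to_univ (const_sheaf T G)) U"
  interpret G: comm_group G by fact
  show "\<one>\<^bsub>?F\<^esub> \<in> carrier ?F"
    using U by (auto simp: const_univ_simps const_section_const)
  fix a assume "a \<in> carrier ?F"
  then obtain c where c: "const_section T G U c" "a = (\<lambda>n. c)" by (auto simp: const_univ_simps)
  then have cc: "x \<in> U \<Longrightarrow> c x \<in> carrier G" and ce: "c \<in> extensional U" for x by (auto simp: const_section_def PiE_def)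
  show "\<one>\<^bsub>?F\<^esub> \<otimes>\<^bsub>?F\<^esub> a = a"
    unfolding const_univ_simps c(2) using cc ce by (intro HOL.ext[of "\<lambda>n. _ n"] extensionalityI[of _ U]) auto
  have "const_section T G U (\<lambda>x\<in>U. inv\<^bsub>G\<^esub> c x)"
    using const_section_binary[OF c(1) c(1), of "\<lambda>u v. inv\<^bsub>G\<^esub> u"] cc by auto
  then show "\<exists>b\<in>carrier ?F. b \<otimes>\<^bsub>?F\<^esub> a = \<one>\<^bsub>?F\<^esub>"
    unfolding const_univ_simps c(2) using cc
    by (intro bexI[of _ "\<lambda>n. \<lambda>x\<in>U. inv\<^bsub>G\<^esub> c x"]) (auto cong: restrict_cong)
  fix b assume "b \<in> carrier ?F"
  then obtain d where d: "const_section T G U d" "b = (\<lambda>n. d)" by (auto simp: const_univ_simps)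
  then have dc: "x \<in> U \<Longrightarrow> d x \<in> carrier G" for x by (auto simp: const_section_def)
  show "a \<otimes>\<^bsub>?F\<^esub> b \<in> carrier ?F"
    unfolding const_univ_simps c(2) d(2) using const_section_binary[OF c(1) d(1), of "\<lambda>u v. u \<otimes>\<^bsub>G\<^esub> v"] cc dc by auto
  show "a \<otimes>\<^bsub>?F\<^esub> b = b \<otimes>\<^bsub>?F\<^esub> a"
    unfolding const_univ_simps c(2) d(2) using cc dc by (auto simp: G.m_comm cong: restrict_cong)
  fix r assume "r \<in> carrier ?F"
  then obtain e where e: "const_section T G U e" "r = (\<lambda>n. e)" by (auto simp: const_univ_simps)
  then have ec: "x \<in> U \<Longrightarrow> e x \<in> carrier G" for x by (auto simp: const_section_def)
  show "(a \<otimes>\<^bsub>?F\<^esub> b) \<otimes>\<^bsub>?F\<^esub> r = a \<otimes>\<^bsub>?F\<^esub> (b \<otimes>\<^bsub>?F\<^esub> r)"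
    unfolding const_univ_simps c(2) d(2) e(2) using cc dc ec by (auto simp: G.m_assoc cong: restrict_cong)
qed

lemma const_univ_sheaf:
  assumes G: "comm_group G"
  shows "is_sheaf T (to_univ (const_sheaf T G))"
  unfolding is_sheaf_def
proof (intro conjI allI impI)
  let ?F = "to_univ (const_sheaf T G)"
  show "is_presheaf T ?F"
    unfolding is_presheaf_def
  proof (intro conjI allI impI ballI)
    fix U V assume UV: "openin T U \<and> openin T V \<and> V \<subseteq> U"
    show "res ?F U V \<in> hom (sec ?F U) (sec ?F V)"
    proof (rule homI)
      fix a assume "a \<in> carrier (sec ?F U)"
      then show "res ?F U V a \<in> carrier (sec ?F V)"
        using UV by (auto simp: const_univ_simps const_section_restrict)
    next
      fix a b
      show "res ?F U V (a \<otimes>\<^bsub>sec ?F U\<^esub> b) = res ?F U V a \<otimes>\<^bsub>sec ?F V\<^esub> res ?F U V b"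
        unfolding const_univ_simps using UV by (intro HOL.ext[of "\<lambda>n. _ n"] extensionalityI[of _ V]) auto
    qed
  qed (auto simp: const_univ_comm_group[OF G] const_univ_simps const_section_def PiE_def extensional_restrict Int_absorb1)
  fix \<U> s
  assume A: "(\<forall>U\<in>\<U>. openin T U \<and> s U \<in> carrier (sec ?F U)) \<and>
    (\<forall>U\<in>\<U>. \<forall>V\<in>\<U>. res ?F U (U \<inter> V) (s U) = res ?F V (U \<inter> V) (s V))"
  have o: "openin T U" and s: "const_section T G U (s U 0)" "s U = (\<lambda>n. s U 0)" if "U \<in> \<U>" for U
    using A that by (auto simp: const_univ_simps)
  have agree: "s U 0 x = s V 0 x" if "U \<in> \<U>" "V \<in> \<U>" "x \<in> U" "x \<in> V" for U V x
  proof -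
    have "res ?F U (U \<inter> V) (s U) 0 x = res ?F V (U \<inter> V) (s V) 0 x"
      by (rule fun_cong[OF fun_cong[OF A[THEN conjunct2, rule_format, OF that(1,2)]]])
    then show ?thesis using that by (simp add: const_univ_simps)
  qed
  \<comment> \<open>Any member of the cover through \<open>x\<close> may supply the value at
    \<open>x\<close>, because of \<open>agree\<close>. Over each member the glued function coincides
    with the given section, which yields local constancy.\<close>
  define p where "p x = (SOME U. U \<in> \<U> \<and> x \<in> U)" for x
  have p: "p x \<in> \<U>" "x \<in> p x" if "x \<in> \<Union>\<U>" for x
  proof -
    have "p x \<in> \<U> \<and> x \<in> p x" unfolding p_def by (rule someI_ex) (use that in blast)
    then show "p x \<in> \<U>" "x \<in> p x" by auto
  qed
  define c where "c = (\<lambda>x\<in>\<Union>\<U>. s (p x) 0 x)"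
  have c: "c x = s U 0 x" if "U \<in> \<U>" "x \<in> U" for U x
    using agree[OF p(1) that(1) p(2) that(2)] that by (auto simp: c_def)
  have "const_section T G (\<Union>\<U>) c"
    unfolding const_section_def
  proof (intro conjI ballI)
    show "c \<in> (\<Pi>\<^sub>E x\<in>\<Union>\<U>. carrier G)"
    proof (rule PiE_I)
      fix x assume "x \<in> \<Union>\<U>"
      then obtain U where U: "U \<in> \<U>" "x \<in> U" by blast
      then show "c x \<in> carrier G" using s(1)[OF U(1)] c[OF U] by (auto simp: const_section_def)
    qed (simp add: c_def)
    fix x assume "x \<in> \<Union>\<U>"
    then obtain U where U: "U \<in> \<U>" "x \<in> U" by blast
    obtain W where W: "openin T W" "x \<in> W" "W \<subseteq> U" "\<And>y. y \<in> W \<Longrightarrow> s U 0 y = s U 0 x"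
      using s(1)[OF U(1)] U(2) by (rule const_sectionE) blast
    have "c y = c x" if "y \<in> W" for y
      using c[OF U(1) subsetD[OF W(3) that]] c[OF U] W(4)[OF that] by simp
    then show "\<exists>W. openin T W \<and> x \<in> W \<and> W \<subseteq> \<Union>\<U> \<and> (\<forall>y\<in>W. c y = c x)" using W(1-3) U by blast
  qed
  show "\<exists>!t. t \<in> carrier (sec ?F (\<Union>\<U>)) \<and> (\<forall>U\<in>\<U>. res ?F (\<Union>\<U>) U t = s U)"
  proof (rule ex1I[of _ "\<lambda>n. c"], intro conjI ballI)
    show "(\<lambda>n. c) \<in> carrier (sec ?F (\<Union>\<U>))" using \<open>const_section T G (\<Union>\<U>) c\<close> by (auto simp: const_univ_simps)
    fix U assume U: "U \<in> \<U>"
    have "restrict c U = s U 0"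
      by (rule extensionalityI[of _ U]) (use c[OF U] s(1)[OF U] in \<open>simp_all add: const_section_def PiE_def\<close>)
    then show "res ?F (\<Union>\<U>) U (\<lambda>n. c) = s U" using s(2)[OF U] by (simp add: const_univ_simps)
  next
    fix t assume t: "t \<in> carrier (sec ?F (\<Union>\<U>)) \<and> (\<forall>U\<in>\<U>. res ?F (\<Union>\<U>) U t = s U)"
    then obtain d where d: "const_section T G (\<Union>\<U>) d" "t = (\<lambda>n. d)" by (auto simp: const_univ_simps)
    have "d = c"
    proof (rule extensionalityI[of _ "\<Union>\<U>"])
      show "d \<in> extensional (\<Union>\<U>)" using d by (auto simp: const_section_def PiE_def)
      show "c \<in> extensional (\<Union>\<U>)" by (simp add: c_def)
      fix x assume "x \<in> \<Union>\<U>"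
      then obtain U where U: "U \<in> \<U>" "x \<in> U" by blast
      have "res ?F (\<Union>\<U>) U t 0 x = s U 0 x" using t U by simp
      then show "d x = c x" using U c d by (simp add: const_univ_simps)
    qed
    then show "t = (\<lambda>n. c)" using d by simp
  qed
qed

lemma degree_zero_simps:
  "trm (degree_zero F) 0 = F" "n \<noteq> 0 \<Longrightarrow> trm (degree_zero F) n = zero_sheaf"
  "n \<noteq> -1 \<Longrightarrow> dif (degree_zero F) n U s = (\<lambda>n x. 0)"
  "dif (degree_zero F) (-1) U s = \<one>\<^bsub>sec F U\<^esub>"
  by (auto simp: degree_zero_def)

lemma degree_zero_Z: "carrier (cx_cocycles (degree_zero F) 0 U) = carrier (sec F U)"
  by (simp add: cx_cocycles_def degree_zero_simps)

lemma degree_zero_B: "cx_coboundaries (degree_zero F) 0 U = {\<one>\<^bsub>sec F U\<^esub>}"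
  by (auto simp: cx_coboundaries_def degree_zero_simps)

lemma degree_zero_acyclic: "n \<noteq> 0 \<Longrightarrow> is_sheaf T F \<Longrightarrow> acyclic_at T (degree_zero F) n"
proof -
  assume n: "n \<noteq> 0" and F: "is_sheaf T F"
  interpret complex_on T "degree_zero F" by (simp add: complex_on_def degree_zero_bounded F)
  show ?thesis unfolding acyclic_at_def locally_exact_def
    using n B_one[of _ n] by (auto simp: degree_zero_simps)
qed

text \<open>The source of all later values: in degree 0 the cocycles are the sections and the only
  coboundary is neutral, so evaluation at a point already identifies a class.\<close>

lemma constant_cohomology_const:
  assumes G: "comm_group G"
  shows "constant_cohomology T (degree_zero (to_univ (const_sheaf T G))) (topspace T) 0 G (\<lambda>x U s. s 0 x)"
proof (rule constant_cohomology.intro)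
  let ?F = "to_univ (const_sheaf T G)"
  show "complex_on T (degree_zero ?F)"
    by (simp add: complex_on_def degree_zero_bounded const_univ_sheaf G)
  interpret G: comm_group G by fact
  show "constant_cohomology_axioms T (degree_zero ?F) (topspace T) 0 G (\<lambda>x U s. s 0 x)"
  proof (rule constant_cohomology_axioms.intro, unfold degree_zero_Z degree_zero_simps, goal_cases)
    case (3 U x s)
    then show ?case by (auto simp: const_univ_simps const_section_def)
  next
    case (6 U x s)
    then obtain c where c: "const_section T G U c" "s = (\<lambda>n. c)" by (auto simp: const_univ_simps)
    show ?case
    proof
      assume "s 0 x = \<one>\<^bsub>G\<^esub>"
      then have cx: "c x = \<one>\<^bsub>G\<^esub>" using c by simp
      \<comment> \<open>Local constancy spreads the neutral value from \<open>x\<close> to a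
        neighbourhood, on which the section becomes the neutral one.\<close>
      obtain W where W: "openin T W" "x \<in> W" "W \<subseteq> U" "\<And>y. y \<in> W \<Longrightarrow> c y = c x"
        using c(1) 6(2) by (rule const_sectionE) blast
      have "c y = \<one>\<^bsub>G\<^esub>" if "y \<in> W" for y using W(4)[OF that] cx by (rule HOL.trans)
      then have "restrict c W = (\<lambda>x\<in>W. \<one>\<^bsub>G\<^esub>)" by (rule restrict_ext)
      then show "locally_exact T (degree_zero ?F) 0 x U s"
        unfolding locally_exact_def degree_zero_B degree_zero_simps using W(1-3) c
        by (intro exI[of _ W]) (simp add: const_univ_simps)
    next
      assume "locally_exact T (degree_zero ?F) 0 x U s"
      then obtain W where W: "x \<in> W" "(\<lambda>n::nat. restrict c W) = (\<lambda>n. \<lambda>x\<in>W. \<one>\<^bsub>G\<^esub>)"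
        unfolding locally_exact_def degree_zero_B degree_zero_simps using c by (auto simp: const_univ_simps)
      then have "restrict c W x = (\<lambda>x\<in>W. \<one>\<^bsub>G\<^esub>) x" by (intro fun_cong[OF fun_cong[OF W(2)]])
      then show "s 0 x = \<one>\<^bsub>G\<^esub>" using W c by simp
    qed
  next
    case (7 x g)
    then show ?case
      by (intro exI[of _ "topspace T"] exI[of _ "\<lambda>n. \<lambda>x\<in>topspace T. g"])
        (auto simp: const_univ_simps const_section_const)
  next
    case (8 U x s)
    then obtain c where c: "const_section T G U c" "s = (\<lambda>n. c)" by (auto simp: const_univ_simps)
    obtain W where "openin T W" "x \<in> W" "W \<subseteq> U" "\<And>y. y \<in> W \<Longrightarrow> c y = c x"
      using c(1) 8(2) by (rule const_sectionE) blast
    then show ?case using c(2) by blast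
  qed (use G.is_group openin_subset in \<open>auto simp: const_univ_simps\<close>)
qed

section \<open>Mapping cones\<close>

lemma upair_simps [simp]: "ufst (upair a b) = a" "usnd (upair a b) = b" "upair (ufst p) (usnd p) = p"
  by (auto simp: ufst_def usnd_def upair_def fun_eq_iff)

lemma upair_eq_iff: "p = q \<longleftrightarrow> ufst p = ufst q \<and> usnd p = usnd q"
  by (metis upair_simps(3))

lemma upair_inject [simp]: "upair a b = upair c d \<longleftrightarrow> a = c \<and> b = d"
  by (metis upair_simps(1,2))

lemma sheaf_sum_simps:
  "p \<in> carrier (sec (sheaf_sum F G) U) \<longleftrightarrow> ufst p \<in> carrier (sec F U) \<and> usnd p \<in> carrier (sec G U)"
  "p \<otimes>\<^bsub>sec (sheaf_sum F G) U\<^esub> q = upair (ufst p \<otimes>\<^bsub>sec F U\<^esub> ufst q) (usnd p \<otimes>\<^bsub>sec G U\<^esub> usnd q)"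
  "\<one>\<^bsub>sec (sheaf_sum F G) U\<^esub> = upair \<one>\<^bsub>sec F U\<^esub> \<one>\<^bsub>sec G U\<^esub>"
  "res (sheaf_sum F G) U V p = upair (res F U V (ufst p)) (res G U V (usnd p))"
proof -
  have "p \<in> {upair a b | a b. P a \<and> Q b} \<longleftrightarrow> P (ufst p) \<and> Q (usnd p)" for P Q
    by (auto, metis upair_simps(3))
  then show "p \<in> carrier (sec (sheaf_sum F G) U) \<longleftrightarrow> ufst p \<in> carrier (sec F U) \<and> usnd p \<in> carrier (sec G U)"
    by (simp add: sheaf_sum_def)
qed (simp_all add: sheaf_sum_def)

text \<open>Boundedness of the cone is assumed here because, where the locale is used, the cone is
  an end of a zigzag and therefore already known to be a bounded complex.\<close>

locale mapping_cone_complex = complex_morphism +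
  assumes cone_bounded: "bounded_complex T (mapping_cone K L f)"
begin

abbreviation "D \<equiv> mapping_cone K L f"

sublocale D: complex_on T "mapping_cone K L f"
  using cone_bounded by unfold_locales

lemma cone_trm: "trm D n = sheaf_sum (trm K (n + 1)) (trm L n)"
  by (simp add: mapping_cone_def)

lemma cone_Z:
  assumes U: "openin T U"
  shows "p \<in> D.Z n U \<longleftrightarrow> ufst p \<in> K.Z (n + 1) U \<and> usnd p \<in> carrier (sec (trm L n) U) \<and>
    f (n + 1) U (ufst p) \<otimes>\<^bsub>sec (trm L (n + 1)) U\<^esub> dif L n U (usnd p) = \<one>\<^bsub>sec (trm L (n + 1)) U\<^esub>"
proof -
  interpret G: group "sec (trm K (n + 1 + 1)) U" by (rule K.trm.sec_group'[OF U])
  show ?thesis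
    unfolding D.Z_iff K.Z_iff cone_trm sheaf_sum_simps
    using K.d(2)[OF U, of "ufst p" "n + 1"] by (auto simp: mapping_cone_def)
qed

lemma cone_B:
  "p \<in> D.B n U \<longleftrightarrow> (\<exists>a\<in>carrier (sec (trm K n) U). \<exists>b\<in>carrier (sec (trm L (n - 1)) U).
     ufst p = inv\<^bsub>sec (trm K (n + 1)) U\<^esub> (dif K n U a) \<and>
     usnd p = f n U a \<otimes>\<^bsub>sec (trm L n) U\<^esub> dif L (n - 1) U b)" (is "_ \<longleftrightarrow> ?r")
proof
  assume "p \<in> D.B n U"
  then obtain q where "q \<in> carrier (sec (trm D (n - 1)) U)" "p = dif D (n - 1) U q" by (auto simp: D.B_iff)
  then show ?r by (auto simp: cone_trm sheaf_sum_simps mapping_cone_def)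
next
  assume ?r
  then obtain a b where ab: "a \<in> carrier (sec (trm K n) U)" "b \<in> carrier (sec (trm L (n - 1)) U)"
     "ufst p = inv\<^bsub>sec (trm K (n + 1)) U\<^esub> (dif K n U a)"
     "usnd p = f n U a \<otimes>\<^bsub>sec (trm L n) U\<^esub> dif L (n - 1) U b" by blast
  have "p = dif D (n - 1) U (upair a b)" using ab by (subst upair_eq_iff) (simp add: mapping_cone_def)
  moreover have "upair a b \<in> carrier (sec (trm D (n - 1)) U)"
    using ab by (simp add: cone_trm sheaf_sum_simps)
  ultimately show "p \<in> D.B n U" by (auto simp: D.B_iff)
qed

text \<open>A bounding cochain \<open>a\<close> of the first component near \<open>x\<close> moves the cocycle \<open>p\<close> of the cone into
  the second component, where it becomes \<open>cone_value\<close>.\<close>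

definition cone_lift :: "int \<Rightarrow> 'a \<Rightarrow> 'a set \<Rightarrow> 'a univ \<Rightarrow> 'a set \<Rightarrow> 'a univ \<Rightarrow> bool" where
  "cone_lift n x U p W a \<longleftrightarrow> openin T W \<and> x \<in> W \<and> W \<subseteq> U \<and> a \<in> carrier (sec (trm K n) W) \<and>
     res (trm K (n + 1)) U W (ufst p) = dif K n W a"

definition cone_value :: "int \<Rightarrow> 'a set \<Rightarrow> 'a univ \<Rightarrow> 'a set \<Rightarrow> 'a univ \<Rightarrow> 'a univ" where
  "cone_value n U p W a = res (trm L n) U W (usnd p) \<otimes>\<^bsub>sec (trm L n) W\<^esub> f n W a"

text \<open>In the cone, the boundary of \<open>(a, 0)\<close> is \<open>(- d a, f a)\<close>.
  Adding it to \<open>p = (d a, b)\<close> over \<open>W\<close> gives \<open>(0, b + f a)\<close>,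
  whose second component is \<open>cone_value\<close>.\<close>

lemma cone_value_cocycle:
  assumes U: "openin T U" and p: "p \<in> D.Z n U" and l: "cone_lift n x U p W a"
  shows "cone_value n U p W a \<in> L.Z n W"
proof -
  have W: "openin T W" "W \<subseteq> U" "a \<in> carrier (sec (trm K n) W)"
    "res (trm K (n + 1)) U W (ufst p) = dif K n W a" using l by (auto simp: cone_lift_def)
  note p' = p[unfolded cone_Z[OF U]]
  have c: "usnd p \<in> carrier (sec (trm L n) U)" "ufst p \<in> carrier (sec (trm K (n + 1)) U)"
    using p' K.ZD by auto
  interpret G: comm_group "sec (trm L (n + 1)) W" by (rule L.trm.sec_group[OF W(1)])
  have "dif L n W (cone_value n U p W a) =
    res (trm L (n + 1)) U W (dif L n U (usnd p)) \<otimes>\<^bsub>sec (trm L (n + 1)) W\<^esub> f (n + 1) W (dif K n W a)"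
    unfolding cone_value_def using U W(1-3) c by (simp add: L.d L.trm.res_closed f commutes)
  also have "\<dots> = res (trm L (n + 1)) U W (f (n + 1) U (ufst p) \<otimes>\<^bsub>sec (trm L (n + 1)) U\<^esub> dif L n U (usnd p))"
    using U W(1,2) c by (simp add: f L.trm.res_mult L.d G.m_comm L.trm.res_closed flip: W(4))
  also have "\<dots> = \<one>\<^bsub>sec (trm L (n + 1)) W\<^esub>" using p' U W by (simp add: L.trm.res_one)
  finally show ?thesis
    unfolding L.Z_iff cone_value_def using U W c by (simp add: L.trm.mult_closed L.trm.res_closed f)
qed

lemma cone_exactI:
  assumes U: "openin T U" and p: "p \<in> D.Z n U" and l: "cone_lift n x U p W a"
    and B: "cone_value n U p W a \<in> L.B n W"
  shows "res (trm D n) U W p \<in> D.B n W"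
proof -
  have W: "openin T W" "W \<subseteq> U" "a \<in> carrier (sec (trm K n) W)"
    "res (trm K (n + 1)) U W (ufst p) = dif K n W a" using l by (auto simp: cone_lift_def)
  note p' = p[unfolded cone_Z[OF U]]
  have c: "res (trm L n) U W (usnd p) \<in> carrier (sec (trm L n) W)"
    using p' U W by (simp add: L.trm.res_closed)
  obtain b where b: "b \<in> carrier (sec (trm L (n - 1)) W)" "cone_value n U p W a = dif L (n - 1) W b"
    using B by (auto simp: L.B_iff)
  interpret G: comm_group "sec (trm L n) W" by (rule L.trm.sec_group[OF W(1)])
  interpret H: group "sec (trm K (n + 1)) W" by (rule K.trm.sec_group'[OF W(1)])
  have fa: "f n W a \<in> carrier (sec (trm L n) W)" using W by (simp add: f)
  have "inv\<^bsub>sec (trm L n) W\<^esub> (f n W a) \<otimes>\<^bsub>sec (trm L n) W\<^esub> cone_value n U p W a = res (trm L n) U W (usnd p)"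
    unfolding cone_value_def using c fa by (simp add: G.m_lcomm)
  \<comment> \<open>If the value is \<open>d b\<close>, then \<open>(- a, b)\<close> bounds
    \<open>p\<close>: its boundary is \<open>(d a, - f a + d b)\<close>, and
    \<open>d b - f a\<close> is the second component of \<open>p\<close>.\<close>
  then show ?thesis
    unfolding cone_B cone_trm sheaf_sum_simps using b W
    by (intro bexI[of _ "inv\<^bsub>sec (trm K n) W\<^esub> a"] bexI[of _ b])
      (auto simp: K.d_inv K.d f_inv K.trm.inv_closed)
qed

lemma cone_lift_res:
  assumes l: "cone_lift n x U p W a" and U: "openin T U" and p: "p \<in> D.Z n U"
    and V: "openin T V" "x \<in> V" "V \<subseteq> W"
  shows "cone_lift n x U p V (res (trm K n) W V a)"
    "cone_value n U p V (res (trm K n) W V a) = res (trm L n) W V (cone_value n U p W a)"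
proof -
  have W: "openin T W" "W \<subseteq> U" "a \<in> carrier (sec (trm K n) W)"
    "res (trm K (n + 1)) U W (ufst p) = dif K n W a" using l by (auto simp: cone_lift_def)
  note p' = p[unfolded cone_Z[OF U]]
  have c: "usnd p \<in> carrier (sec (trm L n) U)" "ufst p \<in> carrier (sec (trm K (n + 1)) U)"
    using p' K.ZD by auto
  have "res (trm K (n + 1)) U V (ufst p) = res (trm K (n + 1)) W V (res (trm K (n + 1)) U W (ufst p))"
    using c U W V by (intro K.trm.res_res[symmetric]) auto
  also have "\<dots> = dif K n V (res (trm K n) W V a)"
    unfolding W(4) using W V by (simp add: K.d)
  finally show "cone_lift n x U p V (res (trm K n) W V a)"
    unfolding cone_lift_def using V W by (auto simp: K.trm.res_closed)
  show "cone_value n U p V (res (trm K n) W V a) = res (trm L n) W V (cone_value n U p W a)"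
    unfolding cone_value_def using V W U c by (simp add: L.trm.res_mult L.trm.res_closed f L.trm.res_res)
qed

lemma cone_locally_exactI:
  assumes U: "openin T U" and p: "p \<in> D.Z n U" and l: "cone_lift n x U p W a"
    and ex: "locally_exact T L n x W (cone_value n U p W a)"
  shows "locally_exact T D n x U p"
proof -
  obtain V where V: "openin T V" "x \<in> V" "V \<subseteq> W" "res (trm L n) W V (cone_value n U p W a) \<in> L.B n V"
    using ex by (auto simp: locally_exact_def)
  note r = cone_lift_res[OF l U p V(1-3)]
  have "W \<subseteq> U" using l by (simp add: cone_lift_def)
  then show ?thesis unfolding locally_exact_def
    using cone_exactI[OF U p r(1)] V r(2) by (intro exI[of _ V]) auto
qed

text \<open>A bounding cochain \<open>(a, b)\<close> of \<open>p\<close> yields the lift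
  \<open>- a\<close>, whose value is \<open>d b\<close>.\<close>

lemma cone_locally_exactD:
  assumes U: "openin T U" and p: "p \<in> D.Z n U" and ex: "locally_exact T D n x U p"
  obtains W a where "cone_lift n x U p W a" "cone_value n U p W a \<in> L.B n W"
proof -
  obtain W where W: "openin T W" "x \<in> W" "W \<subseteq> U" "res (trm D n) U W p \<in> D.B n W"
    using ex by (auto simp: locally_exact_def)
  obtain a b where ab: "a \<in> carrier (sec (trm K n) W)" "b \<in> carrier (sec (trm L (n - 1)) W)"
     "res (trm K (n + 1)) U W (ufst p) = inv\<^bsub>sec (trm K (n + 1)) W\<^esub> (dif K n W a)"
     "res (trm L n) U W (usnd p) = f n W a \<otimes>\<^bsub>sec (trm L n) W\<^esub> dif L (n - 1) W b"
    using W(4) unfolding cone_B cone_trm sheaf_sum_simps by auto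
  interpret G: comm_group "sec (trm L n) W" by (rule L.trm.sec_group[OF W(1)])
  let ?a = "inv\<^bsub>sec (trm K n) W\<^esub> a"
  have c: "f n W a \<in> carrier (sec (trm L n) W)" "dif L (n - 1) W b \<in> carrier (sec (trm L n) W)"
    using W ab by (auto simp: f L.d')
  have "cone_lift n x U p W ?a"
    unfolding cone_lift_def using W ab by (simp add: K.d_inv K.trm.inv_closed)
  moreover have "cone_value n U p W ?a = dif L (n - 1) W b"
    unfolding cone_value_def ab(4) using W ab c by (simp add: f_inv G.m_comm[of "f n W a"] G.m_assoc)
  ultimately show ?thesis using that ab by (auto simp: L.B_iff)
qed

lemma cone_lift_exists:
  assumes "locally_exact T K (n + 1) x U (ufst p)"
  obtains W a where "cone_lift n x U p W a"
proof -
  obtain W where W: "openin T W" "x \<in> W" "W \<subseteq> U" "res (trm K (n + 1)) U W (ufst p) \<in> K.B (n + 1) W"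
    using assms by (auto simp: locally_exact_def)
  then obtain a where "a \<in> carrier (sec (trm K n) W)" "res (trm K (n + 1)) U W (ufst p) = dif K n W a"
    by (auto simp: K.B_iff)
  then show ?thesis using W by (intro that[of W a]) (auto simp: cone_lift_def)
qed

text \<open>Together with \<open>cone_lift_diff\<close> this measures the ambiguity of
  \<open>cone_value\<close>: lifts differ by cocycles of \<open>K\<close>, so the value is
  determined up to their images under \<open>f\<close>.\<close>

lemma cone_lift_add_cocycle:
  assumes l: "cone_lift n x U p W a" and U: "openin T U" and p: "p \<in> D.Z n U" and k: "k \<in> K.Z n W"
  shows "cone_lift n x U p W (a \<otimes>\<^bsub>sec (trm K n) W\<^esub> k)"
    "cone_value n U p W (a \<otimes>\<^bsub>sec (trm K n) W\<^esub> k) = cone_value n U p W a \<otimes>\<^bsub>sec (trm L n) W\<^esub> f n W k"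
proof -
  have W: "openin T W" "W \<subseteq> U" "x \<in> W" "a \<in> carrier (sec (trm K n) W)"
    "res (trm K (n + 1)) U W (ufst p) = dif K n W a" using l by (auto simp: cone_lift_def)
  note p' = p[unfolded cone_Z[OF U]]
  have c: "res (trm L n) U W (usnd p) \<in> carrier (sec (trm L n) W)"
    using p' U W by (simp add: L.trm.res_closed)
  interpret G: comm_group "sec (trm L n) W" by (rule L.trm.sec_group[OF W(1)])
  interpret H: group "sec (trm K (n + 1)) W" by (rule K.trm.sec_group'[OF W(1)])
  show "cone_lift n x U p W (a \<otimes>\<^bsub>sec (trm K n) W\<^esub> k)"
    unfolding cone_lift_def using W k by (simp add: K.trm.mult_closed K.d K.Z_iff)
  show "cone_value n U p W (a \<otimes>\<^bsub>sec (trm K n) W\<^esub> k) = cone_value n U p W a \<otimes>\<^bsub>sec (trm L n) W\<^esub> f n W k"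
    unfolding cone_value_def using W k c by (simp add: f K.ZD G.m_assoc)
qed

lemma cone_lift_diff:
  assumes l: "cone_lift n x U p W a" "cone_lift n x U p W a'" and U: "openin T U" and p: "p \<in> D.Z n U"
  obtains k where "k \<in> K.Z n W" "a = a' \<otimes>\<^bsub>sec (trm K n) W\<^esub> k"
proof
  have W: "openin T W" "a \<in> carrier (sec (trm K n) W)" "a' \<in> carrier (sec (trm K n) W)"
    "dif K n W a = dif K n W a'" using l by (auto simp: cone_lift_def)
  interpret G: comm_group "sec (trm K n) W" by (rule K.trm.sec_group[OF W(1)])
  interpret H: group "sec (trm K (n + 1)) W" by (rule K.trm.sec_group'[OF W(1)])
  show "inv\<^bsub>sec (trm K n) W\<^esub> a' \<otimes>\<^bsub>sec (trm K n) W\<^esub> a \<in> K.Z n W"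
    using W by (simp add: K.Z_iff K.d K.d_inv)
  show "a = a' \<otimes>\<^bsub>sec (trm K n) W\<^esub> (inv\<^bsub>sec (trm K n) W\<^esub> a' \<otimes>\<^bsub>sec (trm K n) W\<^esub> a)"
    using W by (simp add: G.m_assoc[symmetric])
qed

lemma cone_lift_mult:
  assumes l: "cone_lift n x U p W a" "cone_lift n x U q W b" and U: "openin T U"
    and p: "p \<in> D.Z n U" and q: "q \<in> D.Z n U"
  shows "cone_lift n x U (p \<otimes>\<^bsub>sec (trm D n) U\<^esub> q) W (a \<otimes>\<^bsub>sec (trm K n) W\<^esub> b)"
    "cone_value n U (p \<otimes>\<^bsub>sec (trm D n) U\<^esub> q) W (a \<otimes>\<^bsub>sec (trm K n) W\<^esub> b) =
     cone_value n U p W a \<otimes>\<^bsub>sec (trm L n) W\<^esub> cone_value n U q W b"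
proof -
  have W: "openin T W" "W \<subseteq> U" "x \<in> W" "a \<in> carrier (sec (trm K n) W)" "b \<in> carrier (sec (trm K n) W)"
    "res (trm K (n + 1)) U W (ufst p) = dif K n W a"  "res (trm K (n + 1)) U W (ufst q) = dif K n W b"
    using l by (auto simp: cone_lift_def)
  have c: "usnd p \<in> carrier (sec (trm L n) U)" "ufst p \<in> carrier (sec (trm K (n + 1)) U)"
    "usnd q \<in> carrier (sec (trm L n) U)" "ufst q \<in> carrier (sec (trm K (n + 1)) U)"
    using p[unfolded cone_Z[OF U]] q[unfolded cone_Z[OF U]] K.ZD by auto
  interpret G: comm_group "sec (trm L n) W" by (rule L.trm.sec_group[OF W(1)])
  show "cone_lift n x U (p \<otimes>\<^bsub>sec (trm D n) U\<^esub> q) W (a \<otimes>\<^bsub>sec (trm K n) W\<^esub> b)"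
    unfolding cone_lift_def cone_trm sheaf_sum_simps
    using W U c by (simp add: K.trm.mult_closed K.d K.trm.res_mult)
  have cc: "res (trm L n) U W (usnd p) \<in> carrier (sec (trm L n) W)"
    "res (trm L n) U W (usnd q) \<in> carrier (sec (trm L n) W)"
    "f n W a \<in> carrier (sec (trm L n) W)" "f n W b \<in> carrier (sec (trm L n) W)"
    using W U c by (simp_all add: f L.trm.res_closed)
  show "cone_value n U (p \<otimes>\<^bsub>sec (trm D n) U\<^esub> q) W (a \<otimes>\<^bsub>sec (trm K n) W\<^esub> b) =
     cone_value n U p W a \<otimes>\<^bsub>sec (trm L n) W\<^esub> cone_value n U q W b"
    unfolding cone_value_def cone_trm sheaf_sum_simps
    using W U c cc by (simp add: L.trm.res_mult f G.m_ac)
qed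

text \<open>A piece of the long exact sequence: the first component of a cocycle of the cone has an
  exact image in \<open>L\<close>, hence is locally exact in \<open>K\<close> by injectivity. A lift
  then moves the cocycle into \<open>L\<close>, where it is locally exact.\<close>

lemma cone_acyclic:
  assumes inj: "coh_injective (n + 1)" and L: "acyclic_at T L n"
  shows "acyclic_at T D n"
  unfolding acyclic_at_def
proof (intro allI impI)
  fix U x p assume U: "openin T U" "x \<in> U" and p: "p \<in> D.Z n U"
  note p' = p[unfolded cone_Z[OF U(1)]]
  interpret G: group "sec (trm L (n + 1)) U" by (rule L.trm.sec_group'[OF U(1)])
  have c: "f (n + 1) U (ufst p) \<in> carrier (sec (trm L (n + 1)) U)"
    "dif L n U (usnd p) \<in> carrier (sec (trm L (n + 1)) U)" using p' U by (auto simp: f L.d K.ZD)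
  then have "f (n + 1) U (ufst p) = inv\<^bsub>sec (trm L (n + 1)) U\<^esub> dif L n U (usnd p)"
    using p' by (intro G.inv_equality[symmetric]) auto
  also have "\<dots> \<in> L.B (n + 1) U"
    using L.B_inv[OF U(1), of "dif L n U (usnd p)" "n + 1"] p' by (auto simp: L.B_iff)
  finally have "locally_exact T K (n + 1) x U (ufst p)"
    unfolding locally_exact_def using inj[unfolded coh_injective_def, rule_format, OF U] p' by blast
  then obtain W a where l: "cone_lift n x U p W a" by (rule cone_lift_exists)
  then have W: "openin T W" "x \<in> W" by (auto simp: cone_lift_def)
  show "locally_exact T D n x U p"
    using L[unfolded acyclic_at_def, rule_format, OF W cone_value_cocycle[OF U(1) p l]]
    by (rule cone_locally_exactI[OF U(1) p l])
qed

text \<open>As \<open>K\<close> has no cohomology in degree \<open>n + 1\<close>, the long exact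
  sequence presents the cohomology of the cone in degree \<open>n\<close> as the cokernel of
  \<open>f\<close>, which on values is the cokernel of multiplication by \<open>m\<close> on the
  integers.\<close>

theorem constant_cohomology_cone:
  assumes m: "m > 0" and K1: "acyclic_at T K (n + 1)"
    and repK: "constant_cohomology T K S n integer_group \<phi>"
    and repL: "constant_cohomology T L S n integer_group \<psi>"
    and mult: "\<And>U x s. openin T U \<Longrightarrow> x \<in> U \<Longrightarrow> x \<in> S \<Longrightarrow> s \<in> K.Z n U \<Longrightarrow> \<psi> x U (f n U s) = int m * \<phi> x U s"
  shows "\<exists>\<theta>. constant_cohomology T D S n (integer_mod_group m) \<theta>"
proof -
  interpret A: constant_cohomology T K S n integer_group \<phi> by fact
  interpret B: constant_cohomology T L S n integer_group \<psi> by fact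
  \<comment> \<open>The value of a lift is ambiguous by values of images under \<open>f\<close>,
    which are multiples of \<open>m\<close>; only its residue is meaningful.\<close>
  define \<theta> where "\<theta> x U p = (let (W, a) = (SOME (W, a). cone_lift n x U p W a)
    in \<psi> x W (cone_value n U p W a) mod int m)" for x U p
  have ex: "\<exists>W a. cone_lift n x U p W a" if "openin T U" "x \<in> U" "p \<in> D.Z n U" for x U p
  proof -
    have "ufst p \<in> K.Z (n + 1) U" using that by (simp add: cone_Z)
    then have "locally_exact T K (n + 1) x U (ufst p)"
      using K1[unfolded acyclic_at_def, rule_format, OF that(1,2)] by simp
    then show ?thesis by (rule cone_lift_exists) blast
  qed
  \<comment> \<open>Lifts over different neighbourhoods are compared on the intersection. There they
    differ by a cocycle of \<open>K\<close>, and \<open>mult\<close> shows that the value changes by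
    a multiple of \<open>m\<close>.\<close>
  have well: "\<psi> x W (cone_value n U p W a) mod int m = \<psi> x W' (cone_value n U p W' a') mod int m"
    if U: "openin T U" and x: "x \<in> S" and p: "p \<in> D.Z n U"
      and l: "cone_lift n x U p W a" "cone_lift n x U p W' a'" for x U p W a W' a'
  proof -
    have W: "openin T W" "openin T W'" "x \<in> W" "x \<in> W'" using l by (auto simp: cone_lift_def)
    let ?V = "W \<inter> W'"
    have V: "openin T ?V" "x \<in> ?V" "?V \<subseteq> W" "?V \<subseteq> W'" using W by auto
    note r = cone_lift_res[OF l(1) U p V(1-3)] and r' = cone_lift_res[OF l(2) U p V(1,2,4)]
    note z = cone_value_cocycle[OF U p l(1)] and z' = cone_value_cocycle[OF U p l(2)]
    obtain k where k: "k \<in> K.Z n ?V" "res (trm K n) W ?V a = res (trm K n) W' ?V a' \<otimes>\<^bsub>sec (trm K n) ?V\<^esub> k"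
      using cone_lift_diff[OF r(1) r'(1) U p] by blast
    have "\<psi> x W (cone_value n U p W a) = \<psi> x ?V (res (trm L n) W ?V (cone_value n U p W a))"
      using B.val_res[OF W(1) V(1,3,2) x z] by simp
    also have "res (trm L n) W ?V (cone_value n U p W a) =
        res (trm L n) W' ?V (cone_value n U p W' a') \<otimes>\<^bsub>sec (trm L n) ?V\<^esub> f n ?V k"
      using r(2) r'(2) k(2) cone_lift_add_cocycle(2)[OF r'(1) U p k(1)] by simp
    also have "\<psi> x ?V \<dots> = \<psi> x ?V (res (trm L n) W' ?V (cone_value n U p W' a')) + \<psi> x ?V (f n ?V k)"
      using B.val_mult[OF V(1,2) x L.Z_res[OF W(2) V(1,4) z'] f_Z[OF V(1) k(1)]] by simp
    also have "\<dots> = \<psi> x W' (cone_value n U p W' a') + int m * \<phi> x ?V k"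
      using B.val_res[OF W(2) V(1,4,2) x z'] mult[OF V(1,2) x k(1)] by simp
    finally show ?thesis by simp
  qed
  have eq: "\<theta> x U p = \<psi> x W (cone_value n U p W a) mod int m"
    if "openin T U" "x \<in> S" "p \<in> D.Z n U" "cone_lift n x U p W a" for x U p W a
  proof -
    obtain W' a' where wa: "(SOME (W, a). cone_lift n x U p W a) = (W', a')"
      by (cases "SOME (W, a). cone_lift n x U p W a")
    have "case (SOME (W, a). cone_lift n x U p W a) of (W, a) \<Rightarrow> cone_lift n x U p W a"
      using that(4) by (intro someI[of "\<lambda>(W, a). cone_lift n x U p W a" "(W, a)"]) simp
    then have "cone_lift n x U p W' a'" by (simp add: wa)
    then show ?thesis using well[OF that(1-3) _ that(4)] by (simp add: \<theta>_def wa)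
  qed
  show ?thesis
  proof (rule exI[of _ \<theta>], rule constant_cohomology.intro[OF _ constant_cohomology_axioms.intro])
    show "complex_on T D" by (rule D.complex_on_axioms)
    show "group (integer_mod_group m)" by simp
    show "S \<subseteq> topspace T" by (rule A.support)
  next
    fix U x p assume U: "openin T U" "x \<in> U" and x: "x \<in> S" and p: "p \<in> D.Z n U"
    obtain W a where l: "cone_lift n x U p W a" using ex U p by blast
    have W: "openin T W" "x \<in> W" "W \<subseteq> U" "a \<in> carrier (sec (trm K n) W)" using l by (auto simp: cone_lift_def)
    note e = eq[OF U(1) x p l] and z = cone_value_cocycle[OF U(1) p l]
    show "\<theta> x U p \<in> carrier (integer_mod_group m)"
      using m by (simp add: e carrier_integer_mod_group)
    show "\<exists>W'. openin T W' \<and> x \<in> W' \<and> W' \<subseteq> U \<and> (\<forall>y\<in>W' \<inter> S. \<theta> y U p = \<theta> x U p)"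
    proof -
      obtain V where V: "openin T V" "x \<in> V" "V \<subseteq> W"
        "\<forall>y\<in>V \<inter> S. \<psi> y W (cone_value n U p W a) = \<psi> x W (cone_value n U p W a)"
        using B.val_const[OF W(1,2) x z] by (elim exE conjE) (rule that)
      have "\<theta> y U p = \<theta> x U p" if y: "y \<in> V \<inter> S" for y
      proof -
        have "cone_lift n y U p W a" using l y V unfolding cone_lift_def by blast
        then have "\<theta> y U p = \<psi> y W (cone_value n U p W a) mod int m" using eq[OF U(1) _ p] y by blast
        also have "\<psi> y W (cone_value n U p W a) = \<psi> x W (cone_value n U p W a)" using V(4) y by blast
        finally show ?thesis by (simp add: e)
      qed
      then show ?thesis using V W by blast
    qed
    show "(\<theta> x U p = \<one>\<^bsub>integer_mod_group m\<^esub>) = locally_exact T D n x U p"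
    proof
      assume "\<theta> x U p = \<one>\<^bsub>integer_mod_group m\<^esub>"
      then have "int m dvd \<psi> x W (cone_value n U p W a)" by (simp add: e mod_eq_0_iff_dvd)
      \<comment> \<open>A value \<open>m * j\<close> is cancelled by adding to the lift a cocycle of
        \<open>K\<close> with value \<open>- j\<close>; the corrected value is 0 and therefore comes
        from a locally exact cocycle of \<open>L\<close>.\<close>
      then obtain j where j: "\<psi> x W (cone_value n U p W a) = int m * j" by (auto simp: dvd_def)
      obtain V0 k0 where k0: "openin T V0" "x \<in> V0" "k0 \<in> K.Z n V0" "\<phi> x V0 k0 = - j"
        using A.val_surj[OF x, of "- j"] by auto
      let ?V = "V0 \<inter> W"
      have V: "openin T ?V" "x \<in> ?V" "?V \<subseteq> V0" "?V \<subseteq> W" using k0 W by auto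
      let ?k = "res (trm K n) V0 ?V k0"
      have k: "?k \<in> K.Z n ?V" by (rule K.Z_res[OF k0(1) V(1,3) k0(3)])
      have "\<phi> x ?V ?k = - j" using A.val_res[OF k0(1) V(1,3,2) x k0(3)] k0(4) by simp
      then have fk: "\<psi> x ?V (f n ?V ?k) = - (int m * j)" using mult[OF V(1,2) x k] by simp
      note r = cone_lift_res[OF l U(1) p V(1,2,4)]
      note a = cone_lift_add_cocycle[OF r(1) U(1) p k]
      have zr: "res (trm L n) W ?V (cone_value n U p W a) \<in> L.Z n ?V" by (rule L.Z_res[OF W(1) V(1,4) z])
      have "\<psi> x ?V (cone_value n U p ?V (res (trm K n) W ?V a \<otimes>\<^bsub>sec (trm K n) ?V\<^esub> ?k)) = 0"
        unfolding a(2) r(2) using B.val_mult[OF V(1,2) x zr f_Z[OF V(1) k]] B.val_res[OF W(1) V(1,4,2) x z] fk j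
        by simp
      then have "locally_exact T L n x ?V (cone_value n U p ?V (res (trm K n) W ?V a \<otimes>\<^bsub>sec (trm K n) ?V\<^esub> ?k))"
        using B.val_one_iff[OF V(1,2) x cone_value_cocycle[OF U(1) p a(1)]] by simp
      then show "locally_exact T D n x U p" by (rule cone_locally_exactI[OF U(1) p a(1)])
    next
      assume "locally_exact T D n x U p"
      then obtain W' a' where l': "cone_lift n x U p W' a'" "cone_value n U p W' a' \<in> L.B n W'"
        using cone_locally_exactD[OF U(1) p] by blast
      then have W': "openin T W'" "x \<in> W'" by (auto simp: cone_lift_def)
      show "\<theta> x U p = \<one>\<^bsub>integer_mod_group m\<^esub>"
        using eq[OF U(1) x p l'(1)] B.val_coboundary[OF W' x l'(2)] by simp
    qed
    fix q assume q: "q \<in> D.Z n U"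
    obtain W' b where l': "cone_lift n x U q W' b" using ex U q by blast
    have W': "openin T W'" "x \<in> W'" using l' by (auto simp: cone_lift_def)
    let ?V = "W \<inter> W'"
    have V: "openin T ?V" "x \<in> ?V" "?V \<subseteq> W" "?V \<subseteq> W'" using W W' by auto
    note r = cone_lift_res[OF l U(1) p V(1-3)] and r' = cone_lift_res[OF l' U(1) q V(1,2,4)]
    note lm = cone_lift_mult[OF r(1) r'(1) U(1) p q]
    have pq: "p \<otimes>\<^bsub>sec (trm D n) U\<^esub> q \<in> D.Z n U" by (rule D.Z_mult[OF U(1) p q])
    show "\<theta> x U (p \<otimes>\<^bsub>sec (trm D n) U\<^esub> q) = \<theta> x U p \<otimes>\<^bsub>integer_mod_group m\<^esub> \<theta> x U q"
      using eq[OF U(1) x pq lm(1)] eq[OF U(1) x p r(1)] eq[OF U(1) x q r'(1)] lm(2)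
        B.val_mult[OF V(1,2) x cone_value_cocycle[OF U(1) p r(1)] cone_value_cocycle[OF U(1) q r'(1)]]
      by (simp add: mod_add_eq)
  next
    fix U V x p assume U: "openin T U" and V: "openin T V" "V \<subseteq> U" "x \<in> V" and x: "x \<in> S" and p: "p \<in> D.Z n U"
    have pV: "res (trm D n) U V p \<in> D.Z n V" by (rule D.Z_res[OF U V(1,2) p])
    obtain W a where l: "cone_lift n x V (res (trm D n) U V p) W a" using ex[OF V(1,3) pV] by blast
    have W: "openin T W" "x \<in> W" "W \<subseteq> V" using l by (auto simp: cone_lift_def)
    have c: "usnd p \<in> carrier (sec (trm L n) U)" "ufst p \<in> carrier (sec (trm K (n + 1)) U)"
      using p[unfolded cone_Z[OF U]] K.ZD by auto
    \<comment> \<open>A lift of the restricted cocycle is also a lift of the original one, with the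
      same value, so both residues are computed from it.\<close>
    have "cone_lift n x U p W a"
      using l U V W c unfolding cone_lift_def cone_trm sheaf_sum_simps by (auto simp: K.trm.res_res)
    moreover have "cone_value n V (res (trm D n) U V p) W a = cone_value n U p W a"
      using U V W c unfolding cone_value_def cone_trm sheaf_sum_simps by (auto simp: L.trm.res_res)
    ultimately show "\<theta> x V (res (trm D n) U V p) = \<theta> x U p"
      using eq[OF V(1) x pV l] eq[OF U x p] by simp
  next
    fix x g assume x: "x \<in> S" and g: "g \<in> carrier (integer_mod_group m)"
    obtain U y where y: "openin T U" "x \<in> U" "y \<in> L.Z n U" "\<psi> x U y = g" using B.val_surj[OF x, of g] by auto
    \<comment> \<open>A cocycle \<open>y\<close> of \<open>L\<close> enters the cone as
      \<open>(0, y)\<close>, with neutral lift and value \<open>y\<close>. Elements of the residue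
      group are integers from 0 to \<open>m - 1\<close>, so \<open>g\<close> is its own
      residue.\<close>
    let ?p = "upair \<one>\<^bsub>sec (trm K (n + 1)) U\<^esub> y" and ?a = "\<one>\<^bsub>sec (trm K n) U\<^esub>"
    interpret G: group "sec (trm L n) U" by (rule L.trm.sec_group'[OF y(1)])
    interpret H: group "sec (trm L (n + 1)) U" by (rule L.trm.sec_group'[OF y(1)])
    have p: "?p \<in> D.Z n U"
      unfolding cone_Z[OF y(1)] using y K.Z_one[OF y(1)] by (simp add: f_one L.Z_iff)
    have "cone_lift n x U ?p U ?a"
      unfolding cone_lift_def using y by (simp add: K.trm.one_closed K.trm.res_one K.d_one)
    moreover have "cone_value n U ?p U ?a = y"
      unfolding cone_value_def using y by (simp add: f_one L.trm.res_self L.ZD)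
    ultimately have "\<theta> x U ?p = g"
      using eq[OF y(1) x p] y(4) g m by (simp add: carrier_integer_mod_group)
    then show "\<exists>U p. openin T U \<and> x \<in> U \<and> p \<in> D.Z n U \<and> \<theta> x U p = g" using y p by blast
  next
    fix U x p assume U: "openin T U" "x \<in> U" and x: "x \<notin> S" and p: "p \<in> D.Z n U"
    obtain W a where l: "cone_lift n x U p W a" using ex U p by blast
    have W: "openin T W" "x \<in> W" using l by (auto simp: cone_lift_def)
    show "locally_exact T D n x U p"
      using B.outside[OF W x cone_value_cocycle[OF U(1) p l]] by (rule cone_locally_exactI[OF U(1) p l])
  qed
qed

end

section \<open>Truncation\<close>

definition cocycle_sheaf :: "'x cx \<Rightarrow> int \<Rightarrow> ('x, 'x univ) presheaf" where
  "cocycle_sheaf K n = \<lparr>sec = cx_cocycles K n, res = res (trm K n)\<rparr>"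

text \<open>The canonical truncation: the top term consists of cocycles, so that the cohomology in
  degree \<open>m\<close> survives.\<close>

definition truncation :: "int \<Rightarrow> 'x cx \<Rightarrow> 'x cx" where
  "truncation m K =
     \<lparr>trm = (\<lambda>n. if n < m then trm K n else if n = m then cocycle_sheaf K m else zero_sheaf),
      dif = (\<lambda>n U s. if n < m then dif K n U s else (\<lambda>n x. 0))\<rparr>"

definition truncation_in :: "int \<Rightarrow> 'x cx \<Rightarrow> 'x cxmap" where
  "truncation_in m K = (\<lambda>n U s. if n \<le> m then s else \<one>\<^bsub>sec (trm K n) U\<^esub>)"

lemma cocycle_sheaf_simps:
  "sec (cocycle_sheaf K n) = cx_cocycles K n" "res (cocycle_sheaf K n) = res (trm K n)"
  by (simp_all add: cocycle_sheaf_def)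

lemma sheaf_eqI:
  assumes F: "is_sheaf T F" and o: "\<forall>U\<in>\<U>. openin T U"
    and s: "s \<in> carrier (sec F (\<Union>\<U>))" "t \<in> carrier (sec F (\<Union>\<U>))"
    and eq: "\<And>U. U \<in> \<U> \<Longrightarrow> res F (\<Union>\<U>) U s = res F (\<Union>\<U>) U t"
  shows "s = t"
proof -
  interpret presheaf_on T F using F by unfold_locales (simp add: is_sheaf_def)
  have U: "openin T (\<Union>\<U>)" using o by blast
  define r where "r U = res F (\<Union>\<U>) U s" for U
  have 1: "\<forall>U\<in>\<U>. openin T U \<and> r U \<in> carrier (sec F U)"
    using o U s by (auto simp: r_def intro!: res_closed)
  have "res F V (V \<inter> W) (r V) = res F W (V \<inter> W) (r W)" if VW: "V \<in> \<U>" "W \<in> \<U>" for V W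
  proof -
    have "openin T V" "openin T W" "openin T (V \<inter> W)" "V \<subseteq> \<Union>\<U>" "W \<subseteq> \<Union>\<U>" using VW o by auto
    then show ?thesis unfolding r_def using s U by (simp add: res_res)
  qed
  then have 2: "\<forall>V\<in>\<U>. \<forall>W\<in>\<U>. res F V (V \<inter> W) (r V) = res F W (V \<inter> W) (r W)" by blast
  have "\<exists>!t. t \<in> carrier (sec F (\<Union>\<U>)) \<and> (\<forall>U\<in>\<U>. res F (\<Union>\<U>) U t = r U)"
    using F 1 2 unfolding is_sheaf_def by (elim conjE allE[of _ \<U>] allE[of _ r]) simp
  then show ?thesis using s eq by (elim ex1E) (metis r_def)
qed

context complex_on
begin

text \<open>The kernel of a map of sheaves is a sheaf: cocycles glue to a section of the term, and
  its differential is neutral on a cover, hence neutral since sections of the next term are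
  determined locally.\<close>

lemma cocycle_sheaf: "is_sheaf T (cocycle_sheaf K n)"
  unfolding is_sheaf_def
proof (intro conjI allI impI)
  show "is_presheaf T (cocycle_sheaf K n)"
    unfolding is_presheaf_def
  proof (intro conjI allI impI ballI, goal_cases)
    case (1 U)
    then show ?case by (simp add: cocycle_sheaf_def cocycle_comm_group)
  next
    case (2 U V)
    then show ?case
      by (auto simp: cocycle_sheaf_def hom_def Z_res trm.res_mult ZD)
  next
    case (3 U s)
    then show ?case by (simp add: cocycle_sheaf_def trm.res_self ZD)
  next
    case (4 U V W s)
    then show ?case by (simp add: cocycle_sheaf_def trm.res_res ZD)
  qed
  fix \<U> s
  assume A: "(\<forall>U\<in>\<U>. openin T U \<and> s U \<in> carrier (sec (cocycle_sheaf K n) U)) \<and>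
    (\<forall>U\<in>\<U>. \<forall>V\<in>\<U>. res (cocycle_sheaf K n) U (U \<inter> V) (s U) = res (cocycle_sheaf K n) V (U \<inter> V) (s V))"
  have o: "openin T U" and s: "s U \<in> Z n U" if "U \<in> \<U>" for U using A that by (auto simp: cocycle_sheaf_def)
  have U: "openin T (\<Union>\<U>)" using o by blast
  have "\<exists>!t. t \<in> carrier (sec (trm K n) (\<Union>\<U>)) \<and> (\<forall>U\<in>\<U>. res (trm K n) (\<Union>\<U>) U t = s U)"
  proof -
    have 1: "\<forall>U\<in>\<U>. openin T U \<and> s U \<in> carrier (sec (trm K n) U)" using o s ZD by blast
    have 2: "\<forall>U\<in>\<U>. \<forall>V\<in>\<U>. res (trm K n) U (U \<inter> V) (s U) = res (trm K n) V (U \<inter> V) (s V)"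
      using conjunct2[OF A] by (simp only: cocycle_sheaf_simps)
    show ?thesis using term_sheaf[of n] 1 2 unfolding is_sheaf_def by (elim conjE allE[of _ \<U>] allE[of _ s]) simp
  qed
  then obtain t where t: "t \<in> carrier (sec (trm K n) (\<Union>\<U>))" "\<forall>U\<in>\<U>. res (trm K n) (\<Union>\<U>) U t = s U"
    and uniq: "\<And>t'. t' \<in> carrier (sec (trm K n) (\<Union>\<U>)) \<Longrightarrow> \<forall>U\<in>\<U>. res (trm K n) (\<Union>\<U>) U t' = s U \<Longrightarrow> t' = t"
    by (elim ex1E) blast
  have "dif K n (\<Union>\<U>) t = \<one>\<^bsub>sec (trm K (n + 1)) (\<Union>\<U>)\<^esub>"
  proof (rule sheaf_eqI[OF term_sheaf[of "n + 1"]])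
    show "\<forall>U\<in>\<U>. openin T U" using o by blast
    show "dif K n (\<Union>\<U>) t \<in> carrier (sec (trm K (n + 1)) (\<Union>\<U>))" using d(2)[OF U t(1)] .
    show "\<one>\<^bsub>sec (trm K (n + 1)) (\<Union>\<U>)\<^esub> \<in> carrier (sec (trm K (n + 1)) (\<Union>\<U>))" using trm.one_closed[OF U] .
    fix V assume V: "V \<in> \<U>"
    have "res (trm K (n + 1)) (\<Union>\<U>) V (dif K n (\<Union>\<U>) t) = dif K n V (s V)"
      using d(4)[OF U o[OF V] Union_upper[OF V] t(1)] t(2) V by simp
    also have "\<dots> = \<one>\<^bsub>sec (trm K (n + 1)) V\<^esub>" using s[OF V] by (simp add: Z_iff)
    also have "\<dots> = res (trm K (n + 1)) (\<Union>\<U>) V \<one>\<^bsub>sec (trm K (n + 1)) (\<Union>\<U>)\<^esub>"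
      using trm.res_one[OF U o[OF V] Union_upper[OF V]] by simp
    finally show "res (trm K (n + 1)) (\<Union>\<U>) V (dif K n (\<Union>\<U>) t) =
      res (trm K (n + 1)) (\<Union>\<U>) V \<one>\<^bsub>sec (trm K (n + 1)) (\<Union>\<U>)\<^esub>" .
  qed
  then have "t \<in> Z n (\<Union>\<U>)" using t by (simp add: Z_iff)
  then show "\<exists>!t. t \<in> carrier (sec (cocycle_sheaf K n) (\<Union>\<U>)) \<and>
      (\<forall>U\<in>\<U>. res (cocycle_sheaf K n) (\<Union>\<U>) U t = s U)"
    unfolding cocycle_sheaf_simps using t(2) uniq[OF ZD] by (intro ex1I[of _ t] conjI) blast+
qed

lemma truncation_trm:
  "n < m \<Longrightarrow> trm (truncation m K) n = trm K n"
  "trm (truncation m K) m = cocycle_sheaf K m"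
  "n > m \<Longrightarrow> trm (truncation m K) n = zero_sheaf"
  "n < m \<Longrightarrow> dif (truncation m K) n = dif K n"
  "n \<ge> m \<Longrightarrow> dif (truncation m K) n = (\<lambda>U s n x. 0)"
  by (auto simp: truncation_def)

lemma truncation_bounded: "bounded_complex T (truncation m K)"
  unfolding bounded_complex_def
proof (intro conjI allI impI ballI)
  show "is_sheaf T (trm (truncation m K) n)" for n
    by (simp add: truncation_def term_sheaf cocycle_sheaf zero_sheaf)
  show "presheaf_hom T (trm (truncation m K) n) (trm (truncation m K) (n + 1)) (dif (truncation m K) n)" for n
  proof -
    consider "n + 1 < m" | "n + 1 = m" | "n \<ge> m" by linarith
    then show ?thesis
    proof cases
      case 1
      then show ?thesis using dif_hom[of n] by (simp add: truncation_trm)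
    next
      case 2
      have "presheaf_hom T (trm K n) (cocycle_sheaf K (n + 1)) (dif K n)"
        using dif_hom[of n] d_d[of _ _ n] unfolding presheaf_hom_def
        by (auto simp: cocycle_sheaf_simps hom_def Pi_iff Z_iff)
      then show ?thesis using truncation_trm(1,4)[of n m] truncation_trm(2)[of m] 2 by auto
    next
      case 3
      then show ?thesis by (simp add: truncation_trm presheaf_hom_def hom_def)
    qed
  qed
  show "dif (truncation m K) (n + 1) U (dif (truncation m K) n U s) = \<one>\<^bsub>sec (trm (truncation m K) (n + 1 + 1)) U\<^esub>"
    if U: "openin T U" and s: "s \<in> carrier (sec (trm (truncation m K) n) U)" for n U s
  proof -
    consider "n + 1 + 1 < m" | "n + 1 + 1 = m" | "n + 1 \<ge> m" by linarith
    then show ?thesis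
    proof cases
      case 1
      then show ?thesis using d_d[OF U, of s n] s by (simp add: truncation_trm)
    next
      case 2
      then have "n < m" "n + 1 < m" by auto
      then show ?thesis using d_d[OF U, of s n] s truncation_trm(2)[of m]
        by (simp add: truncation_trm 2 cocycle_sheaf_simps)
    next
      case 3
      then show ?thesis by (simp add: truncation_trm)
    qed
  qed
  obtain N where N: "\<And>n U. N < \<bar>n\<bar> \<Longrightarrow> openin T U \<Longrightarrow> carrier (sec (trm K n) U) = {\<one>\<^bsub>sec (trm K n) U\<^esub>}"
    using bounded by blast
  have "carrier (sec (trm (truncation m K) n) U) = {\<one>\<^bsub>sec (trm (truncation m K) n) U\<^esub>}"
    if n: "N + \<bar>m\<bar> + 1 < \<bar>n\<bar>" "openin T U" for n U
  proof -
    consider "n < m" "N < \<bar>n\<bar>" | "n > m" | "n = m" "N < \<bar>n\<bar>" using n by linarith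
    then show ?thesis
    proof cases
      case 3
      have "Z m U \<subseteq> {\<one>\<^bsub>sec (trm K m) U\<^esub>}" using N[OF 3(2) n(2)] ZD[of _ m U] 3(1) by blast
      then show ?thesis unfolding 3(1) using Z_one[OF n(2), of m] by (auto simp: truncation_trm cocycle_sheaf_simps)
    qed (use n N in \<open>simp_all add: truncation_trm\<close>)
  qed
  then show "\<exists>N. \<forall>n U. N < \<bar>n\<bar> \<and> openin T U \<longrightarrow>
      carrier (sec (trm (truncation m K) n) U) = {\<one>\<^bsub>sec (trm (truncation m K) n) U\<^esub>}" by blast
qed

lemma truncation_Z: "n \<le> m \<Longrightarrow> carrier (cx_cocycles (truncation m K) n U) = Z n U"
proof -
  assume "n \<le> m"
  then consider "n + 1 < m" | "n + 1 = m" | "n = m" by linarith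
  then show ?thesis
  proof cases
    \<comment> \<open>In degree \<open>m - 1\<close> the differential lands in the cocycle sheaf,
      whose neutral sections are those of the full term, so the condition for a cocycle is
      unchanged.\<close>
    case 2
    then have "trm (truncation m K) n = trm K n" "dif (truncation m K) n = dif K n"
      "trm (truncation m K) (n + 1) = cocycle_sheaf K (n + 1)"
      using truncation_trm(1,4)[of n m] truncation_trm(2)[of m] by auto
    then show ?thesis unfolding cx_cocycles_def[of "truncation m K" n]
      by (simp add: cocycle_sheaf_simps Z_iff set_eq_iff)
  next
    case 3
    have "m < m + 1" by simp
    then show ?thesis unfolding 3 by (simp add: cx_cocycles_def[of "truncation m K"] truncation_trm cocycle_sheaf_simps)
  qed (auto simp: cx_cocycles_def truncation_trm)
qed

lemma truncation_B: "n \<le> m \<Longrightarrow> cx_coboundaries (truncation m K) n U = B n U"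
  by (simp add: cx_coboundaries_def truncation_trm)

lemma truncation_res: "n \<le> m \<Longrightarrow> res (trm (truncation m K) n) = res (trm K n)"
  by (auto simp: truncation_def cocycle_sheaf_simps)

lemma truncation_locally_exact:
  "n \<le> m \<Longrightarrow> locally_exact T (truncation m K) n x U s \<longleftrightarrow> locally_exact T K n x U s"
  by (simp add: locally_exact_def truncation_B truncation_res)

lemma truncation_carrier: "n \<le> m \<Longrightarrow> s \<in> carrier (sec (trm (truncation m K) n) U) \<Longrightarrow> s \<in> carrier (sec (trm K n) U)"
  by (auto simp: truncation_def cocycle_sheaf_simps Z_iff split: if_splits)

lemma truncation_mult: "n \<le> m \<Longrightarrow> s \<otimes>\<^bsub>sec (trm (truncation m K) n) U\<^esub> t = s \<otimes>\<^bsub>sec (trm K n) U\<^esub> t"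
  by (auto simp: truncation_def cocycle_sheaf_simps)

lemma truncation_in_hom: "cx_hom T (truncation m K) K (truncation_in m K)"
  unfolding cx_hom_def
proof (intro conjI allI impI ballI)
  show "bounded_complex T (truncation m K)" "bounded_complex T K" by (rule truncation_bounded, rule bounded_complex)
  show "presheaf_hom T (trm (truncation m K) n) (trm K n) (truncation_in m K n)" for n
  proof (cases "n \<le> m")
    case True
    then show ?thesis unfolding presheaf_hom_def
      by (auto simp: truncation_in_def hom_def truncation_mult truncation_res truncation_carrier)
  next
    case False
    have "monoid (sec (trm K n) U)" if "openin T U" for U
      using trm.sec_group'[OF that] by (rule group.is_monoid)
    then show ?thesis unfolding presheaf_hom_def using False
      by (auto simp: truncation_in_def hom_def truncation_trm trm.one_closed trm.res_one monoid.l_one monoid.one_closed)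
  qed
  fix n U s assume U: "openin T U" and s: "s \<in> carrier (sec (trm (truncation m K) n) U)"
  consider "n < m" | "n = m" | "n > m" by linarith
  then show "truncation_in m K (n + 1) U (dif (truncation m K) n U s) = dif K n U (truncation_in m K n U s)"
  proof cases
    case 2
    then show ?thesis using s by (simp add: truncation_in_def truncation_trm cocycle_sheaf_simps Z_iff)
  qed (use U in \<open>simp_all add: truncation_in_def truncation_trm d_one\<close>)
qed

lemma truncation_zero_Z:
  "n > m \<Longrightarrow> s \<in> carrier (cx_cocycles (truncation m K) n U) \<Longrightarrow> s = \<one>\<^bsub>sec (trm (truncation m K) n) U\<^esub>"
  by (simp add: cx_cocycles_def truncation_trm)

text \<open>Up to degree \<open>m\<close> the truncation has the same cocycles and coboundaries as
  \<open>K\<close>. Above it the truncation is zero, and the classes of \<open>K\<close> die locally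
  by assumption.\<close>

lemma truncation_in_quasi_iso:
  assumes "\<And>n. n > m \<Longrightarrow> acyclic_at T K n"
  shows "quasi_iso T (truncation m K) K (truncation_in m K)"
proof -
  interpret i: complex_morphism T "truncation m K" K "truncation_in m K"
    using truncation_in_hom by (simp add: complex_morphism_iff)
  have "i.coh_injective n" for n
    unfolding i.coh_injective_def
  proof (intro allI impI)
    fix U x s assume U: "openin T U" "x \<in> U" and s: "s \<in> i.K.Z n U" "truncation_in m K n U s \<in> B n U"
    show "\<exists>W. openin T W \<and> x \<in> W \<and> W \<subseteq> U \<and> res (trm (truncation m K) n) U W s \<in> i.K.B n W"
    proof (cases "n \<le> m")
      case True
      then show ?thesis using U s
        by (intro exI[of _ U]) (simp add: truncation_in_def truncation_B truncation_res truncation_Z trm.res_self ZD)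
    next
      case False
      then show ?thesis using U s(1) truncation_zero_Z[of m n s U] i.K.B_one[OF U(1), of n]
        by (intro exI[of _ U]) (simp add: i.K.trm.res_one)
    qed
  qed
  moreover have "i.coh_surjective n" for n
    unfolding i.coh_surjective_def
  proof (intro allI impI)
    fix U x t assume U: "openin T U" "x \<in> U" and t: "t \<in> Z n U"
    interpret G: group "sec (trm K n) U" by (rule trm.sec_group'[OF U(1)])
    show "\<exists>W s b. openin T W \<and> x \<in> W \<and> W \<subseteq> U \<and> s \<in> i.K.Z n W \<and> b \<in> B n W \<and>
        res (trm K n) U W t = truncation_in m K n W s \<otimes>\<^bsub>sec (trm K n) W\<^esub> b"
    proof (cases "n \<le> m")
      case True
      then show ?thesis using U t B_one[OF U(1), of n]
        by (intro exI[of _ U] exI[of _ t] exI[of _ "\<one>\<^bsub>sec (trm K n) U\<^esub>"])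
          (simp add: truncation_in_def truncation_Z trm.res_self ZD)
    next
      case False
      then have "locally_exact T K n x U t"
        using assms[of n, unfolded acyclic_at_def, rule_format, OF _ U t] by simp
      then obtain W where W: "openin T W" "x \<in> W" "W \<subseteq> U" "res (trm K n) U W t \<in> B n W"
        by (auto simp: locally_exact_def)
      interpret H: group "sec (trm K n) W" by (rule trm.sec_group'[OF W(1)])
      show ?thesis using False W i.K.Z_one[OF W(1), of n] ZD[OF Z_res[OF U(1) W(1,3) t]]
        by (intro exI[of _ W] exI[of _ "\<one>\<^bsub>sec (trm (truncation m K) n) W\<^esub>"] exI[of _ "res (trm K n) U W t"])
          (simp add: truncation_in_def)
    qed
  qed
  ultimately show ?thesis by (simp add: i.quasi_iso_iff)
qed

end

section \<open>Constructibility is invariant under isomorphism\<close>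

lemma presheaf_iso_locally:
  shows "presheaf_iso T F G f \<Longrightarrow> locally_injective T F f"
    and "is_presheaf T G \<Longrightarrow> presheaf_iso T F G f \<Longrightarrow> locally_surjective T F G f"
proof -
  assume f: "presheaf_iso T F G f"
  have bij: "bij_betw (f U) (carrier (sec F U)) (carrier (sec G U))" if "openin T U" for U
    using f that by (auto simp: presheaf_iso_def iso_def)
  show "locally_injective T F f"
    unfolding locally_injective_def
  proof (intro allI impI)
    fix U x s t assume A: "openin T U \<and> x \<in> U \<and> s \<in> carrier (sec F U) \<and> t \<in> carrier (sec F U) \<and> f U s = f U t"
    then have "s = t" using bij[of U] by (auto simp: bij_betw_def dest: inj_onD)
    then show "\<exists>W. openin T W \<and> x \<in> W \<and> W \<subseteq> U \<and> res F U W s = res F U W t" using A by blast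
  qed
  assume G: "is_presheaf T G"
  show "locally_surjective T F G f"
    unfolding locally_surjective_def
  proof (intro allI impI)
    fix U x t assume A: "openin T U \<and> x \<in> U \<and> t \<in> carrier (sec G U)"
    then have "t \<in> f U ` carrier (sec F U)" using bij_betw_imp_surj_on[OF bij] by simp
    then obtain s where s: "t = f U s" "s \<in> carrier (sec F U)" by (rule imageE)
    have "res G U U t = t" using G A by (simp add: is_presheaf_def)
    then show "\<exists>W s. openin T W \<and> x \<in> W \<and> W \<subseteq> U \<and> s \<in> carrier (sec F W) \<and> f W s = res G U W t"
      using A s by (intro exI[of _ U] exI[of _ s]) simp
  qed
qed

lemma presheaf_iso_sym:
  assumes F: "is_presheaf T F" and f: "presheaf_iso T F G f"
  shows "presheaf_iso T G F (\<lambda>U. inv_into (carrier (sec F U)) (f U))"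
proof -
  interpret presheaf_on T F using F by unfold_locales
  have iso: "f U \<in> iso (sec F U) (sec G U)" if "openin T U" for U using f that by (simp add: presheaf_iso_def)
  have g: "inv_into (carrier (sec F U)) (f U) \<in> iso (sec G U) (sec F U)" if "openin T U" for U
    by (rule group.iso_set_sym[OF sec_group'[OF that] iso[OF that]])
  show ?thesis
    unfolding presheaf_iso_def presheaf_hom_def
  proof (intro conjI allI impI ballI)
    fix U V t assume U: "openin T U \<and> openin T V \<and> V \<subseteq> U" and t: "t \<in> carrier (sec G U)"
    have bij: "bij_betw (f W) (carrier (sec F W)) (carrier (sec G W))" if "openin T W" for W
      using iso[OF that] by (simp add: iso_def)
    let ?s = "inv_into (carrier (sec F U)) (f U) t"
    have s: "?s \<in> carrier (sec F U)" "f U ?s = t"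
      using bij[of U] t U by (auto simp: bij_betw_def inv_into_into f_inv_into_f)
    have "f V (res F U V ?s) = res G U V t"
      using f U s by (simp add: presheaf_iso_def presheaf_hom_def)
    moreover have "res F U V ?s \<in> carrier (sec F V)" using U s by (simp add: res_closed)
    ultimately show "inv_into (carrier (sec F V)) (f V) (res G U V t) = res F U V ?s"
      using bij[of V] U by (auto simp: bij_betw_def inv_into_f_eq)
  qed (use g iso_imp_homomorphism in blast)+
qed

lemma presheaf_iso_trans:
  assumes f: "presheaf_iso T F G f" and g: "presheaf_iso T G H g"
  shows "presheaf_iso T F H (\<lambda>U. g U \<circ> f U)"
proof -
  have fi: "f U \<in> iso (sec F U) (sec G U)" and gi: "g U \<in> iso (sec G U) (sec H U)" if "openin T U" for U
    using f g that by (auto simp: presheaf_iso_def)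
  have i: "g U \<circ> f U \<in> iso (sec F U) (sec H U)" if "openin T U" for U
    using iso_set_trans[OF fi[OF that] gi[OF that]] by (simp add: compose_def o_def)
  show ?thesis
    unfolding presheaf_iso_def presheaf_hom_def
  proof (intro conjI allI impI ballI)
    fix U V s assume U: "openin T U \<and> openin T V \<and> V \<subseteq> U" and s: "s \<in> carrier (sec F U)"
    then have "f U s \<in> carrier (sec G U)" using hom_in_carrier[OF iso_imp_homomorphism[OF fi]] by blast
    then show "(g V \<circ> f V) (res F U V s) = res H U V ((g U \<circ> f U) s)"
      using f g U s by (simp add: presheaf_iso_def presheaf_hom_def)
  qed (use i iso_imp_homomorphism in blast)+
qed

lemma presheaf_iso_subtopology:
  "presheaf_iso T F G f \<Longrightarrow> openin T V \<Longrightarrow> presheaf_iso (subtopology T V) F G f"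
  unfolding presheaf_iso_def presheaf_hom_def by (simp add: openin_open_subtopology)

lemma const_sheaf_carrier:
  "c \<in> carrier (sec (const_sheaf T A) U) \<longleftrightarrow> c \<in> (\<Pi>\<^sub>E x\<in>U. carrier A) \<and>
     (\<forall>x\<in>U. \<exists>W. openin T W \<and> x \<in> W \<and> W \<subseteq> U \<and> (\<forall>y\<in>W. c y = c x))"
  by (simp add: const_sheaf_def)

lemma const_sheaf_map:
  assumes c: "c \<in> carrier (sec (const_sheaf T A) U)" and h: "\<And>a. a \<in> carrier A \<Longrightarrow> h a \<in> carrier B"
  shows "(\<lambda>x\<in>U. h (c x)) \<in> carrier (sec (const_sheaf T B) U)"
  unfolding const_sheaf_carrier
proof (intro conjI ballI)
  show "(\<lambda>x\<in>U. h (c x)) \<in> (\<Pi>\<^sub>E x\<in>U. carrier B)"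
    using c h by (auto simp: const_sheaf_carrier)
  fix x assume x: "x \<in> U"
  obtain W where W: "openin T W" "x \<in> W" "W \<subseteq> U" "\<forall>y\<in>W. c y = c x"
    using c[unfolded const_sheaf_carrier, THEN conjunct2, rule_format, OF x] by (elim exE conjE) (rule that)
  have "(\<lambda>x\<in>U. h (c x)) y = (\<lambda>x\<in>U. h (c x)) x" if y: "y \<in> W" for y
    using W(4)[rule_format, OF y] subsetD[OF W(3) y] x by simp
  then show "\<exists>W. openin T W \<and> x \<in> W \<and> W \<subseteq> U \<and> (\<forall>y\<in>W. (\<lambda>x\<in>U. h (c x)) y = (\<lambda>x\<in>U. h (c x)) x)"
    using W(1-3) by blast
qed

lemma const_sheaf_iso:
  assumes e: "e \<in> iso A B"
  shows "presheaf_iso T (const_sheaf T A) (const_sheaf T B) (\<lambda>U c. \<lambda>x\<in>U. e (c x))"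
proof -
  have eA: "e a \<in> carrier B" if "a \<in> carrier A" for a
    using hom_in_carrier[OF iso_imp_homomorphism[OF e] that] .
  have bij: "bij_betw e (carrier A) (carrier B)" using e by (simp add: iso_def)
  let ?i = "inv_into (carrier A) e"
  have iA: "?i b \<in> carrier A" "e (?i b) = b" if "b \<in> carrier B" for b
    using bij that by (auto simp: bij_betw_def inv_into_into f_inv_into_f)
  have ie: "?i (e a) = a" if "a \<in> carrier A" for a
    using bij that by (auto simp: bij_betw_def)
  have iso: "(\<lambda>c. \<lambda>x\<in>U. e (c x)) \<in> iso (sec (const_sheaf T A) U) (sec (const_sheaf T B) U)" for U
  proof (rule isoI)
    show "(\<lambda>c. \<lambda>x\<in>U. e (c x)) \<in> hom (sec (const_sheaf T A) U) (sec (const_sheaf T B) U)"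
    proof (rule homI)
      fix c d assume "c \<in> carrier (sec (const_sheaf T A) U)" "d \<in> carrier (sec (const_sheaf T A) U)"
      then have "c x \<in> carrier A" "d x \<in> carrier A" if "x \<in> U" for x using that by (auto simp: const_sheaf_carrier)
      then show "(\<lambda>x\<in>U. e ((c \<otimes>\<^bsub>sec (const_sheaf T A) U\<^esub> d) x)) =
        (\<lambda>x\<in>U. e (c x)) \<otimes>\<^bsub>sec (const_sheaf T B) U\<^esub> (\<lambda>x\<in>U. e (d x))"
        by (simp add: const_sheaf_def hom_mult[OF iso_imp_homomorphism[OF e]] cong: restrict_cong)
    qed (rule const_sheaf_map[OF _ eA])
    show "bij_betw (\<lambda>c. \<lambda>x\<in>U. e (c x)) (carrier (sec (const_sheaf T A) U)) (carrier (sec (const_sheaf T B) U))"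
    proof (rule bij_betwI[where g = "\<lambda>c. \<lambda>x\<in>U. ?i (c x)"])
      fix c assume "c \<in> carrier (sec (const_sheaf T A) U)"
      then have "c \<in> (\<Pi>\<^sub>E x\<in>U. carrier A)" by (simp add: const_sheaf_carrier)
      then show "(\<lambda>x\<in>U. ?i ((\<lambda>x\<in>U. e (c x)) x)) = c"
        by (intro extensionalityI[of _ U]) (auto simp: PiE_def Pi_iff ie)
    next
      fix c assume "c \<in> carrier (sec (const_sheaf T B) U)"
      then have "c \<in> (\<Pi>\<^sub>E x\<in>U. carrier B)" by (simp add: const_sheaf_carrier)
      then show "(\<lambda>x\<in>U. e ((\<lambda>x\<in>U. ?i (c x)) x)) = c"
        by (intro extensionalityI[of _ U]) (auto simp: PiE_def Pi_iff iA)
    qed (auto intro!: const_sheaf_map[OF _ eA] const_sheaf_map[OF _ iA(1)])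
  qed
  show ?thesis
    unfolding presheaf_iso_def presheaf_hom_def
  proof (intro conjI allI impI ballI)
    fix U V c assume "openin T U \<and> openin T V \<and> V \<subseteq> U"
    then show "(\<lambda>x\<in>V. e (res (const_sheaf T A) U V c x)) = res (const_sheaf T B) U V (\<lambda>x\<in>U. e (c x))"
      by (intro extensionalityI[of _ V]) (auto simp: const_sheaf_def)
  qed (use iso iso_imp_homomorphism in blast)+
qed

lemma finitely_generated_iso:
  assumes G: "group G" and H: "group H" and h: "h \<in> iso G H" and fg: "finitely_generated_group G"
  shows "finitely_generated_group H"
proof -
  interpret group_hom G H h by (rule group_homI[OF G H iso_imp_homomorphism[OF h]])
  obtain A where A: "finite A" "A \<subseteq> carrier G" "generate G A = carrier G"
    using fg by (auto simp: finitely_generated_group_def)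
  have "generate H (h ` A) = h ` carrier G" using generate_img[OF A(2)] A(3) by simp
  also have "\<dots> = carrier H" using h by (simp add: iso_def bij_betw_def)
  finally show ?thesis unfolding finitely_generated_group_def
    using A by (intro exI[of _ "h ` A"]) (use hom_in_carrier[OF iso_imp_homomorphism[OF h]] in auto)
qed

text \<open>This is how the constant sheaf term becomes an object of \<open>Dbc\<close>: its
  constructibility is inherited from the realization. The same stratification works, with
  restrictions and stalks compared along the isomorphism.\<close>

lemma constructible_cong:
  assumes F: "is_presheaf (analytic_top X) F" and G: "is_presheaf (analytic_top X) G"
    and iso: "presheaf_isomorphic (analytic_top X) F G" and c: "constructible X F"
  shows "constructible X G"
proof -
  let ?T = "analytic_top X"
  obtain h where h: "presheaf_iso ?T F G h" using iso by (auto simp: presheaf_isomorphic_def)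
  interpret presheaf_morphism ?T F G h
    using F G h by unfold_locales (auto simp: presheaf_iso_def)
  note li = presheaf_iso_locally(1)[OF h] and ls = presheaf_iso_locally(2)[OF G h]
  obtain \<S> where \<S>: "finite \<S>" "\<Union>\<S> = pts X" "pairwise disjnt \<S>"
    and all: "\<forall>S\<in>\<S>. (\<exists>U C. openin (zar X) U \<and> closedin (zar X) C \<and> S = U \<inter> C) \<and>
      locally_constant_sheaf (subtopology ?T S) (inverse_image ?T F S) \<and>
      (\<forall>x\<in>S. finitely_generated_group (stalk ?T F x))"
    using c unfolding constructible_def by (elim exE conjE) (rule that)
  have strat: "\<exists>U C. openin (zar X) U \<and> closedin (zar X) C \<and> S = U \<inter> C"
    and lc: "locally_constant_sheaf (subtopology ?T S) (inverse_image ?T F S)"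
    and fg: "\<And>x. x \<in> S \<Longrightarrow> finitely_generated_group (stalk ?T F x)" if "S \<in> \<S>" for S
    using bspec[OF all that] by simp_all
  \<comment> \<open>Off the topological space a stalk has empty carrier, whereas a generated
    subgroup contains the neutral element; finite generation of stalks thus places the strata inside
    the analytic space.\<close>
  have top: "x \<in> topspace ?T" if gen: "finitely_generated_group (stalk ?T F x)" for x
  proof -
    obtain A where "generate (stalk ?T F x) A = carrier (stalk ?T F x)"
      using gen unfolding finitely_generated_group_def by blast
    then have "\<one>\<^bsub>stalk ?T F x\<^esub> \<in> carrier (stalk ?T F x)" using generate.one by metis
    then show ?thesis using openin_subset by (elim F.stalkE) blast
  qed
  have "locally_constant_sheaf (subtopology ?T S) (inverse_image ?T G S) \<and>
      (\<forall>x\<in>S. finitely_generated_group (stalk ?T G x))" if S: "S \<in> \<S>" for S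
  proof (intro conjI ballI)
    have ST: "S \<subseteq> topspace ?T" using fg[OF S] top by blast
    show "finitely_generated_group (stalk ?T G x)" if "x \<in> S" for x
    proof (rule finitely_generated_iso[OF _ _ stalk_map_iso[OF li ls] fg[OF S that]])
      have "x \<in> topspace ?T" using ST that by blast
      then show "group (stalk ?T F x)" "group (stalk ?T G x)"
        using F.stalk_comm_group G.stalk_comm_group comm_group.axioms(2) by blast+
    qed
    let ?TS = "subtopology ?T S" and ?F = "inverse_image ?T F S" and ?G = "inverse_image ?T G S"
    have FS: "is_presheaf ?TS ?F" and GS: "is_presheaf ?TS ?G"
      using F.inverse_image_presheaf[OF ST] G.inverse_image_presheaf[OF ST] by auto
    have k: "presheaf_iso ?TS ?F ?G (sheafify_map ?T G h)" by (rule sheafify_map_iso[OF li ls])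
    interpret k: presheaf_morphism ?TS ?F ?G "sheafify_map ?T G h"
      using FS GS k by unfold_locales (auto simp: presheaf_iso_def)
    show "locally_constant_sheaf ?TS ?G"
      unfolding locally_constant_sheaf_def
    proof
      fix x assume x: "x \<in> topspace ?TS"
      obtain V where V: "openin ?TS V" "x \<in> V"
        "presheaf_isomorphic (subtopology ?TS V) ?F (const_sheaf (subtopology ?TS V) (stalk ?TS ?F x))"
        using lc[OF S, unfolded locally_constant_sheaf_def, rule_format, OF x] by blast
      then obtain a where a: "presheaf_iso (subtopology ?TS V) ?F (const_sheaf (subtopology ?TS V) (stalk ?TS ?F x)) a"
        by (auto simp: presheaf_isomorphic_def)
      note k1 = presheaf_iso_subtopology[OF presheaf_iso_sym[OF FS k] V(1)]
      have e: "stalk_map ?TS ?G (sheafify_map ?T G h) x \<in> iso (stalk ?TS ?F x) (stalk ?TS ?G x)"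
        by (rule k.stalk_map_iso[OF presheaf_iso_locally(1)[OF k] presheaf_iso_locally(2)[OF GS k]])
      \<comment> \<open>The trivialization is conjugated: from \<open>?G\<close> back to
        \<open>?F\<close>, then to the constant sheaf on the stalk of \<open>?F\<close>, and finally
        to the stalk of \<open>?G\<close> by the stalk isomorphism.\<close>
      have "presheaf_isomorphic (subtopology ?TS V) ?G (const_sheaf (subtopology ?TS V) (stalk ?TS ?G x))"
        unfolding presheaf_isomorphic_def
        using presheaf_iso_trans[OF presheaf_iso_trans[OF k1 a] const_sheaf_iso[OF e]] by blast
      then show "\<exists>V. openin ?TS V \<and> x \<in> V \<and>
          presheaf_isomorphic (subtopology ?TS V) ?G (const_sheaf (subtopology ?TS V) (stalk ?TS ?G x))"
        using V by blast
    qed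
  qed
  then show ?thesis unfolding constructible_def using \<S> strat by (intro exI[of _ \<S>]) simp
qed

lemma cohomology_sheaf_presheaf:
  assumes "bounded_complex T K"
  shows "is_presheaf T (cohomology_sheaf T K n)"
proof -
  interpret complex_on T K using assms by unfold_locales
  show ?thesis
    using coh.inverse_image_presheaf[of "topspace T" n] by (simp add: cohomology_sheaf_def sheafify_def)
qed

text \<open>Moves membership among the objects along the legs of a roof.\<close>

lemma quasi_iso_Ob_iff:
  assumes "quasi_iso (analytic_top X) K L f"
  shows "K \<in> Ob (Dbc X) \<longleftrightarrow> L \<in> Ob (Dbc X)"
proof -
  have b: "bounded_complex (analytic_top X) K" "bounded_complex (analytic_top X) L"
    using assms by (auto simp: quasi_iso_def cx_hom_def)
  note g = assms[unfolded quasi_iso_def, THEN conjunct2, rule_format]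
  have iso: "presheaf_isomorphic (analytic_top X) (cohomology_sheaf (analytic_top X) K n) (cohomology_sheaf (analytic_top X) L n)"
    "presheaf_isomorphic (analytic_top X) (cohomology_sheaf (analytic_top X) L n) (cohomology_sheaf (analytic_top X) K n)" for n
    using g presheaf_iso_sym[OF cohomology_sheaf_presheaf[OF b(1)] g] unfolding presheaf_isomorphic_def by blast+
  then show ?thesis
    using b constructible_cong[OF cohomology_sheaf_presheaf[OF b(1)] cohomology_sheaf_presheaf[OF b(2)] iso(1)]
      constructible_cong[OF cohomology_sheaf_presheaf[OF b(2)] cohomology_sheaf_presheaf[OF b(1)] iso(2)]
    by (simp only: Dbc_simps mem_Collect_eq) blast
qed

section \<open>Complexes with constant cohomology in a single degree\<close>

text \<open>Such a complex \<open>Q\<close> is linked to the shifted constant sheaf \<open>P\<close> by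
  \<open>Q \<leftarrow> \<tau>\<^sub>\<le>\<^sub>m Q \<rightarrow> P\<close>, the second map sending a cocycle to its values.\<close>

theorem constant_cohomology_roof:
  fixes G :: "int monoid"
  assumes rep: "constant_cohomology T Q (topspace T \<inter> S) m G \<phi>"
    and acyc: "\<And>n. n \<noteq> m \<Longrightarrow> acyclic_at T Q n"
    and S: "\<And>U. openin T U \<Longrightarrow> openin T (U - S)"
    and P: "bounded_complex T P"
    and P_zero: "\<And>n U. n \<noteq> m \<Longrightarrow> openin T U \<Longrightarrow> carrier (sec (trm P n) U) = {\<one>\<^bsub>sec (trm P n) U\<^esub>}"
    and P_sec: "\<And>U. sec (trm P m) U = sec (to_univ (const_sheaf (subtopology T S) G)) (U \<inter> S)"
    and P_res: "\<And>U V. res (trm P m) U V = res (to_univ (const_sheaf (subtopology T S) G)) (U \<inter> S) (V \<inter> S)"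
  shows "\<exists>M s p. quasi_iso T M Q s \<and> quasi_iso T M P p"
proof -
  interpret Q: constant_cohomology T Q "topspace T \<inter> S" m G \<phi> by fact
  interpret P: complex_on T P using P by unfold_locales
  let ?M = "truncation m Q"
  interpret M: complex_on T ?M by unfold_locales (rule Q.truncation_bounded)
  define val where "val U s = (\<lambda>k::nat. \<lambda>x\<in>U \<inter> S. \<phi> x U s)" for U s
  define p where "p n U s = (if n = m then val U s else \<one>\<^bsub>sec (trm P n) U\<^esub>)" for n U s
  have xT: "x \<in> topspace T \<inter> S" if "openin T U" "x \<in> U \<inter> S" for x U using that openin_subset by blast
  have val_sec: "val U s \<in> carrier (sec (trm P m) U)" if U: "openin T U" and s: "s \<in> Q.Z m U" for U s
  proof -
    have "const_section (subtopology T S) G (U \<inter> S) (\<lambda>x\<in>U \<inter> S. \<phi> x U s)"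
      unfolding const_section_def
    proof (intro conjI ballI)
      show "(\<lambda>x\<in>U \<inter> S. \<phi> x U s) \<in> (\<Pi>\<^sub>E x\<in>U \<inter> S. carrier G)"
        using Q.val_closed[OF U _ xT[OF U] s] by auto
      fix x assume x: "x \<in> U \<inter> S"
      obtain W where W: "openin T W" "x \<in> W" "W \<subseteq> U" "\<forall>y\<in>W \<inter> (topspace T \<inter> S). \<phi> y U s = \<phi> x U s"
        using Q.val_const[OF U _ xT[OF U x] s] x by blast
      have "(\<lambda>x\<in>U \<inter> S. \<phi> x U s) y = (\<lambda>x\<in>U \<inter> S. \<phi> x U s) x" if y: "y \<in> W \<inter> S" for y
      proof -
        have "y \<in> W \<inter> (topspace T \<inter> S)" "y \<in> U \<inter> S" using y W(3) xT[OF W(1) y] by auto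
        then show ?thesis using bspec[OF W(4), of y] x by simp
      qed
      moreover have "openin (subtopology T S) (W \<inter> S)" using W(1) by (auto simp: openin_subtopology)
      ultimately show "\<exists>W. openin (subtopology T S) W \<and> x \<in> W \<and> W \<subseteq> U \<inter> S \<and>
          (\<forall>y\<in>W. (\<lambda>x\<in>U \<inter> S. \<phi> x U s) y = (\<lambda>x\<in>U \<inter> S. \<phi> x U s) x)"
        using W(2,3) x by (intro exI[of _ "W \<inter> S"]) blast
    qed
    then show ?thesis unfolding P_sec const_univ_simps val_def by blast
  qed
  have P_mult: "a \<otimes>\<^bsub>sec (trm P m) U\<^esub> b = (\<lambda>k. \<lambda>x\<in>U \<inter> S. a 0 x \<otimes>\<^bsub>G\<^esub> b 0 x)" for U a b
    unfolding P_sec const_univ_simps ..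
  have P_one: "\<one>\<^bsub>sec (trm P m) U\<^esub> = (\<lambda>k. \<lambda>x\<in>U \<inter> S. \<one>\<^bsub>G\<^esub>)" for U
    unfolding P_sec const_univ_simps ..
  have P_restr: "res (trm P m) U V a = (\<lambda>k. restrict (a 0) (V \<inter> S))" for U V a
    unfolding P_res const_univ_simps ..
  have M_m: "sec (trm ?M m) U = cx_cocycles Q m U" "res (trm ?M m) = res (trm Q m)" for U
    by (simp_all add: Q.truncation_trm cocycle_sheaf_simps)
  have hom: "presheaf_hom T (trm ?M n) (trm P n) (p n)" for n
  proof (cases "n = m")
    case True
    show ?thesis
      unfolding True presheaf_hom_def
    proof (intro conjI allI impI ballI)
      fix U assume U: "openin T U"
      show "p m U \<in> Group.hom (sec (trm ?M m) U) (sec (trm P m) U)"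
      proof (rule homI)
        fix s t assume st: "s \<in> carrier (sec (trm ?M m) U)" "t \<in> carrier (sec (trm ?M m) U)"
        show "p m U (s \<otimes>\<^bsub>sec (trm ?M m) U\<^esub> t) = p m U s \<otimes>\<^bsub>sec (trm P m) U\<^esub> p m U t"
          unfolding P_mult using st Q.val_mult[OF U _ xT[OF U]]
          by (auto simp: p_def val_def M_m cong: restrict_cong)
      qed (use val_sec[OF U] in \<open>simp add: p_def M_m\<close>)
    next
      fix U V s assume UV: "openin T U \<and> openin T V \<and> V \<subseteq> U" and s: "s \<in> carrier (sec (trm ?M m) U)"
      have "\<phi> x V (res (trm Q m) U V s) = \<phi> x U s" if "x \<in> V \<inter> S" for x
        using Q.val_res[of U V x s] UV s that xT[of V x] by (simp add: M_m)
      then show "p m V (res (trm ?M m) U V s) = res (trm P m) U V (p m U s)"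
        unfolding P_restr using UV
        by (auto simp: p_def val_def M_m intro!: HOL.ext[of "\<lambda>n. _ n"] extensionalityI[of _ "V \<inter> S"])
    qed
  next
    case False
    have "monoid (sec (trm P n) U)" if "openin T U" for U
      using P.trm.sec_group'[OF that] by (rule group.is_monoid)
    then show ?thesis unfolding presheaf_hom_def using False
      by (auto simp: p_def hom_def P.trm.one_closed P.trm.res_one monoid.l_one monoid.one_closed)
  qed
  \<comment> \<open>Coboundaries have neutral values, which gives compatibility with the
    differential entering degree \<open>m\<close>. Into every other degree compatibility holds
    because the term of \<open>P\<close> there is trivial.\<close>
  have cob: "val U (dif Q (m - 1) U s) = \<one>\<^bsub>sec (trm P m) U\<^esub>"
    if U: "openin T U" and s: "s \<in> carrier (sec (trm Q (m - 1)) U)" for U s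
  proof -
    have "dif Q (m - 1) U s \<in> Q.B m U" using s by (auto simp: Q.B_iff)
    then show ?thesis unfolding P_one val_def using Q.val_coboundary[OF U _ xT[OF U]] by (auto cong: restrict_cong)
  qed
  have cx: "cx_hom T ?M P p"
    unfolding complex_morphism_iff
  proof (unfold_locales, rule hom)
    fix n U s assume U: "openin T U" and s: "s \<in> carrier (sec (trm ?M n) U)"
    consider "n + 1 = m" | "n + 1 \<noteq> m" by blast
    then show "p (n + 1) U (dif ?M n U s) = dif P n U (p n U s)"
    proof cases
      case 1
      then have n: "n = m - 1" "n < m" by auto
      have "dif P n U (p n U s) = \<one>\<^bsub>sec (trm P m) U\<^esub>"
        using P.d_one[OF U, of n] n by (simp add: p_def)
      moreover have "s \<in> carrier (sec (trm Q (m - 1)) U)" using s n by (simp add: Q.truncation_trm)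
      ultimately show ?thesis using cob[OF U] n by (simp add: p_def Q.truncation_trm)
    next
      case 2
      have "p n U s \<in> carrier (sec (trm P n) U)" using presheaf_homD(2)[OF hom U s] .
      then have "dif P n U (p n U s) \<in> carrier (sec (trm P (n + 1)) U)" by (rule P.d(2)[OF U])
      then have "dif P n U (p n U s) = \<one>\<^bsub>sec (trm P (n + 1)) U\<^esub>" using P_zero[OF 2 U] by simp
      then show ?thesis using 2 by (simp add: p_def)
    qed
  qed
  interpret p: complex_morphism T ?M P p using cx by (simp add: complex_morphism_iff)
  \<comment> \<open>The term of \<open>P\<close> in degree \<open>m - 1\<close> is trivial, so in
    degree \<open>m\<close> only the neutral section is a coboundary and classes are
    sections.\<close>
  have PB: "P.B m U = {\<one>\<^bsub>sec (trm P m) U\<^esub>}" if "openin T U" for U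
    using P_zero[of "m - 1" U] P.d_one[OF that, of "m - 1"] that by (auto simp: P.B_iff)
  have "p.coh_injective n" for n
    unfolding p.coh_injective_def
  proof (intro allI impI)
    fix U x s assume U: "openin T U" "x \<in> U" and s: "s \<in> M.Z n U" and pB: "p n U s \<in> P.B n U"
    consider "n < m" | "n = m" | "n > m" by linarith
    then show "\<exists>W. openin T W \<and> x \<in> W \<and> W \<subseteq> U \<and> res (trm ?M n) U W s \<in> M.B n W"
    proof cases
      case 1
      then have "locally_exact T Q n x U s"
        using acyc[of n, unfolded acyclic_at_def, rule_format, OF _ U, of s] s by (simp add: Q.truncation_Z)
      then have "locally_exact T ?M n x U s" using 1 by (simp add: Q.truncation_locally_exact)
      then show ?thesis by (simp add: locally_exact_def)
    next
      case 2
      have sZ: "s \<in> Q.Z m U" using s 2 by (simp add: Q.truncation_Z)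
      have v: "val U s = (\<lambda>k. \<lambda>x\<in>U \<inter> S. \<one>\<^bsub>G\<^esub>)" using pB PB[OF U(1)] 2 by (simp add: p_def P_one)
      have "locally_exact T Q m x U s"
      proof (cases "x \<in> S")
        case True
        have "\<phi> x U s = \<one>\<^bsub>G\<^esub>"
          using fun_cong[OF fun_cong[OF v, of 0], of x] True U(2) by (simp add: val_def)
        then show ?thesis using Q.val_one_iff[OF U xT[OF U(1)] sZ] True U by simp
      next
        case False
        then show ?thesis using Q.outside[OF U _ sZ] by simp
      qed
      then have "locally_exact T ?M n x U s" using 2 by (simp add: Q.truncation_locally_exact)
      then show ?thesis by (simp add: locally_exact_def)
    next
      case 3
      then show ?thesis using U s Q.truncation_zero_Z[of m n s U] M.B_one[OF U(1), of n]
        by (intro exI[of _ U]) (simp add: M.trm.res_one)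
    qed
  qed
  moreover have "p.coh_surjective n" for n
    unfolding p.coh_surjective_def
  proof (intro allI impI)
    fix U x t assume U: "openin T U" "x \<in> U" and t: "t \<in> P.Z n U"
    have "\<exists>W s. openin T W \<and> x \<in> W \<and> W \<subseteq> U \<and> s \<in> M.Z n W \<and> res (trm P n) U W t = p n W s"
    proof (cases "n = m")
      case False
      have "res (trm P n) U U t = p n U \<one>\<^bsub>sec (trm ?M n) U\<^esub>"
        using P_zero[OF False U(1)] P.ZD[OF t] U(1) False by (simp add: p_def P.trm.res_one)
      then show ?thesis using U M.Z_one[OF U(1), of n] by blast
    next
      case True
      obtain c where c: "const_section (subtopology T S) G (U \<inter> S) c" "t = (\<lambda>k. c)"
        using P.ZD[OF t] unfolding True P_sec const_univ_simps by blast
      show ?thesis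
      proof (cases "x \<in> S")
        case False
        \<comment> \<open>Over the complement of \<open>S\<close> the trace is empty and
          \<open>P\<close> has a single section, which is the image of the neutral cocycle.\<close>
        have W: "openin T (U - S)" by (rule S[OF U(1)])
        have "res (trm P n) U (U - S) t = p n (U - S) \<one>\<^bsub>sec (trm ?M n) (U - S)\<^esub>"
        proof -
          have e: "(U - S) \<inter> S = {}" by blast
          show ?thesis unfolding True P_restr p_def val_def e by (simp add: restrict_def)
        qed
        then show ?thesis using W U False M.Z_one[OF W, of n] by blast
      next
        case xS: True
        then have x: "x \<in> U \<inter> S" using U by blast
        have cx: "c x \<in> carrier G" using c(1) x by (auto simp: const_section_def)
        \<comment> \<open>A cocycle with the value of \<open>c\<close> at \<open>x\<close> is
          restricted until both its values and \<open>c\<close> are constant on the trace; they then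
          agree there.\<close>
        obtain V s where V: "openin T V" "x \<in> V" "s \<in> Q.Z m V" "\<phi> x V s = c x"
          using Q.val_surj[OF xT[OF U(1) x] cx] by blast
        obtain W1 where W1: "openin T W1" "x \<in> W1" "W1 \<subseteq> V" "\<forall>y\<in>W1 \<inter> (topspace T \<inter> S). \<phi> y V s = \<phi> x V s"
          using Q.val_const[OF V(1,2) xT[OF U(1) x] V(3)] by (elim exE conjE) (rule that)
        obtain W2' where W2': "openin (subtopology T S) W2'" "x \<in> W2'" "\<And>y. y \<in> W2' \<Longrightarrow> c y = c x"
          using c(1) x by (rule const_sectionE) blast
        obtain W2 where W2: "openin T W2" "W2' = W2 \<inter> S" using W2'(1) by (auto simp: openin_subtopology)
        let ?W = "U \<inter> W1 \<inter> W2"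
        have W: "openin T ?W" "x \<in> ?W" "?W \<subseteq> U" "?W \<subseteq> V" using U W1(1-3) W2 W2'(2) by auto
        have "c y = \<phi> y ?W (res (trm Q m) V ?W s)" if y: "y \<in> ?W \<inter> S" for y
        proof -
          have "y \<in> W2'" "y \<in> W1 \<inter> (topspace T \<inter> S)" using y W2 xT[OF W(1) y] by auto
          then have "c y = c x" "\<phi> y V s = \<phi> x V s" using W2'(3) bspec[OF W1(4)] by auto
          moreover have "\<phi> y ?W (res (trm Q m) V ?W s) = \<phi> y V s"
            using Q.val_res[OF V(1) W(1,4) _ xT[OF W(1) y] V(3)] y by blast
          ultimately show ?thesis using V(4) by simp
        qed
        then have "restrict c (?W \<inter> S) = (\<lambda>y\<in>?W \<inter> S. \<phi> y ?W (res (trm Q m) V ?W s))"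
          by (rule restrict_ext)
        then have "res (trm P n) U ?W t = p n ?W (res (trm Q m) V ?W s)"
          unfolding True P_restr c(2) p_def val_def by simp
        moreover have "res (trm Q m) V ?W s \<in> M.Z n ?W"
          using Q.Z_res[OF V(1) W(1,4) V(3)] True by (simp add: Q.truncation_Z)
        ultimately show ?thesis using W(1-3) by blast
      qed
    qed
    then obtain W s where W: "openin T W" "x \<in> W" "W \<subseteq> U" "s \<in> M.Z n W" "res (trm P n) U W t = p n W s"
      by (elim exE conjE) (rule that)
    interpret H: group "sec (trm P n) W" by (rule P.trm.sec_group'[OF W(1)])
    have "p n W s \<in> carrier (sec (trm P n) W)" using presheaf_homD(2)[OF hom W(1) M.ZD[OF W(4)]] .
    then show "\<exists>W s b. openin T W \<and> x \<in> W \<and> W \<subseteq> U \<and> s \<in> M.Z n W \<and> b \<in> P.B n W \<and>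
        res (trm P n) U W t = p n W s \<otimes>\<^bsub>sec (trm P n) W\<^esub> b"
      using W P.B_one[OF W(1), of n]
      by (intro exI[of _ W] exI[of _ s] exI[of _ "\<one>\<^bsub>sec (trm P n) W\<^esub>"]) simp
  qed
  ultimately have "quasi_iso T ?M P p" by (simp add: p.quasi_iso_iff)
  moreover have "quasi_iso T ?M Q (truncation_in m Q)"
    using acyc by (intro Q.truncation_in_quasi_iso) auto
  ultimately show ?thesis by blast
qed

text \<open>Terms outside degree \<open>m\<close> are trivial on both sides, so neutral maps extend
  an isomorphism in degree \<open>m\<close> to a termwise isomorphism of complexes.\<close>

lemma concentrated_quasi_iso:
  assumes K: "bounded_complex T K" and L: "bounded_complex T L"
    and K0: "\<And>n U. n \<noteq> m \<Longrightarrow> openin T U \<Longrightarrow> carrier (sec (trm K n) U) = {\<one>\<^bsub>sec (trm K n) U\<^esub>}"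
    and L0: "\<And>n U. n \<noteq> m \<Longrightarrow> openin T U \<Longrightarrow> carrier (sec (trm L n) U) = {\<one>\<^bsub>sec (trm L n) U\<^esub>}"
    and e: "presheaf_iso T (trm K m) (trm L m) e"
  shows "\<exists>f. quasi_iso T K L f"
proof -
  interpret K: complex_on T K using K by unfold_locales
  interpret L: complex_on T L using L by unfold_locales
  define f where "f n = (if n = m then e else (\<lambda>U s. \<one>\<^bsub>sec (trm L n) U\<^esub>))" for n
  have iso: "presheaf_iso T (trm K n) (trm L n) (f n)" for n
  proof (cases "n = m")
    case False
    have "monoid (sec (trm L n) U)" if "openin T U" for U
      using L.trm.sec_group'[OF that] by (rule group.is_monoid)
    then show ?thesis unfolding presheaf_iso_def presheaf_hom_def using False
      by (auto simp: f_def hom_def iso_def K0 L0 L.trm.res_one monoid.l_one monoid.one_closed bij_betw_def)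
  qed (use e in \<open>simp add: f_def\<close>)
  have h: "presheaf_hom T (trm K n) (trm L n) (f n)" for n using iso by (simp add: presheaf_iso_def)
  have "cx_hom T K L f"
    unfolding complex_morphism_iff
  proof (unfold_locales, rule h)
    fix n U s assume U: "openin T U" and s: "s \<in> carrier (sec (trm K n) U)"
    have c: "f (n + 1) U (dif K n U s) \<in> carrier (sec (trm L (n + 1)) U)"
      "dif L n U (f n U s) \<in> carrier (sec (trm L (n + 1)) U)"
      using presheaf_homD(2)[OF h U] K.d(2)[OF U] L.d(2)[OF U] s by blast+
    show "f (n + 1) U (dif K n U s) = dif L n U (f n U s)"
    proof (cases "n = m")
      case True
      then have "n + 1 \<noteq> m" by simp
      then show ?thesis using c L0[OF _ U] by auto
    next
      case False
      have "s = \<one>\<^bsub>sec (trm K n) U\<^esub>" using s K0[OF False U] by simp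
      moreover have "f k U \<one>\<^bsub>sec (trm K k) U\<^esub> = \<one>\<^bsub>sec (trm L k) U\<^esub>" for k
        by (rule hom_one[OF presheaf_homD(1)[OF h U] K.trm.sec_group'[OF U] L.trm.sec_group'[OF U]])
      ultimately show ?thesis using U by (simp add: K.d_one L.d_one)
    qed
  qed
  then show ?thesis using presheaf_iso_quasi_iso iso by blast
qed

section \<open>Sheaves placed in degree \<open>-2\<close>\<close>

lemma sheaf_term_bounded:
  assumes "is_sheaf (subtopology (analytic_top Y) S) F"
  shows "bounded_complex (analytic_top Y) (sheaf_term Y S F)"
proof -
  have 1: "bounded_complex (analytic_top Y) (cx_push S (degree_zero F))"
    by (intro push_bounded degree_zero_bounded assms)
  interpret complex_on "analytic_top Y" "cx_push S (degree_zero F)" using 1 by unfold_locales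
  interpret s: complex_on "analytic_top Y" "cx_shift (cx_push S (degree_zero F))"
    using shift_bounded by unfold_locales
  show ?thesis using s.shift_bounded by (simp add: sheaf_term_def shift2_def Dbc_push_def)
qed

lemma sheaf_term_trm:
  "trm (sheaf_term Y S F) n =
     \<lparr>sec = (\<lambda>V. sec (trm (degree_zero F) (n + 2)) (V \<inter> S)),
      res = (\<lambda>V W. res (trm (degree_zero F) (n + 2)) (V \<inter> S) (W \<inter> S))\<rparr>"
  by (simp add: sheaf_term_def shift2_def Dbc_push_def cx_shift_def cx_push_def add.assoc)

lemma sheaf_term_trivial:
  "n \<noteq> -2 \<Longrightarrow> carrier (sec (trm (sheaf_term Y S F) n) U) = {\<one>\<^bsub>sec (trm (sheaf_term Y S F) n) U\<^esub>}"
  by (simp add: sheaf_term_trm degree_zero_simps)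

text \<open>The isomorphism of sheaves induces an actual chain map, and the identity serves as the
  other leg of the roof. Along this map the source inherits membership among the objects from the
  target.\<close>

lemma sheaf_term_cong:
  assumes E: "is_sheaf (analytic_top (subvar Y S)) E" and F: "is_sheaf (analytic_top (subvar Y S)) F"
    and T: "analytic_top (subvar Y S) = subtopology (analytic_top Y) S"
    and iso: "presheaf_isomorphic (analytic_top (subvar Y S)) E F"
    and Ob: "sheaf_term Y S F \<in> Ob (Dbc Y)"
  shows "isomorphic_in (Dbc Y) (sheaf_term Y S E) (sheaf_term Y S F)"
proof -
  let ?T = "analytic_top Y" and ?E = "sheaf_term Y S E" and ?F = "sheaf_term Y S F"
  obtain e where e: "presheaf_iso (subtopology ?T S) E F e" using iso T by (auto simp: presheaf_isomorphic_def)
  have o: "openin (subtopology ?T S) (V \<inter> S)" if "openin ?T V" for V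
    using that by (auto simp: openin_subtopology)
  have b: "bounded_complex ?T ?E" "bounded_complex ?T ?F" using E F T sheaf_term_bounded by auto
  have "presheaf_iso ?T (trm ?E (-2)) (trm ?F (-2)) (\<lambda>V. e (V \<inter> S))"
    unfolding presheaf_iso_def presheaf_hom_def
  proof (intro conjI allI impI ballI, goal_cases)
    case (2 U V s)
    then have "V \<inter> S \<subseteq> U \<inter> S" by blast
    then show ?case using e 2 o[of U] o[of V] unfolding presheaf_iso_def presheaf_hom_def
      by (simp add: sheaf_term_trm degree_zero_simps)
  qed (use e o in \<open>simp_all add: sheaf_term_trm degree_zero_simps presheaf_iso_def presheaf_hom_def\<close>)
  from concentrated_quasi_iso[OF b sheaf_term_trivial sheaf_term_trivial this]
  obtain f where f: "quasi_iso ?T ?E ?F f" by blast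
  have i: "quasi_iso ?T ?E ?E (\<lambda>n U s. s)"
    by (rule presheaf_iso_quasi_iso[OF cx_hom_id[OF b(1)]])
      (auto simp: presheaf_iso_def presheaf_hom_def iso_def hom_def bij_betw_def)
  show ?thesis
    by (rule quasi_iso_roof_isomorphic[OF _ Ob i f]) (use Ob f quasi_iso_Ob_iff in blast)
qed

section \<open>The cohomology of the cone of multiplication by \<open>n\<close>\<close>

text \<open>Value and germ are kept together in one witness: the multiplication morphism is known by
  its action on germs, while the cone computation needs its effect on values.\<close>

lemma integer_cohomology_power:
  assumes "constant_cohomology T K S n integer_group \<phi>"
    and U: "openin T U" "x \<in> U" "x \<in> S" and s: "s \<in> carrier (cx_cocycles K n U)"
  shows "\<exists>t\<in>carrier (cx_cocycles K n U). \<phi> x U t = int k * \<phi> x U s \<and>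
    cgerm T K n x U t = cgerm T K n x U s [^]\<^bsub>cstalk T K n x\<^esub> k"
proof (induction k)
  interpret constant_cohomology T K S n integer_group \<phi> by fact
  {
    case 0
    show ?case
      using U val_one by (intro bexI[of _ "\<one>\<^bsub>sec (trm K n) U\<^esub>"]) (auto simp: nat_pow_def cgerm_one Z_one)
  next
    case (Suc k)
    then obtain t where t: "t \<in> Z n U" "\<phi> x U t = int k * \<phi> x U s"
      "cgerm T K n x U t = cgerm T K n x U s [^]\<^bsub>cstalk T K n x\<^esub> k" by blast
    have "\<phi> x U (t \<otimes>\<^bsub>sec (trm K n) U\<^esub> s) = int (Suc k) * \<phi> x U s"
      using val_mult[OF U t(1) s] t(2) by (simp add: algebra_simps)
    moreover have "cgerm T K n x U (t \<otimes>\<^bsub>sec (trm K n) U\<^esub> s) = cgerm T K n x U s [^]\<^bsub>cstalk T K n x\<^esub> Suc k"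
      using cgerm_mult[OF U(1,2) t(1) s] t(3) by (simp add: nat_pow_def)
    ultimately show ?case using Z_mult[OF U(1) t(1) s] by blast
  }
qed

text \<open>A distinguished triangle is only isomorphic to that of a mapping cone of some
  \<open>f\<close>, and the isomorphisms identifying its ends \<open>K\<close> and \<open>L\<close>
  with \<open>A\<close> may differ. Transporting the values of \<open>A\<close> separately along
  each makes \<open>f\<close> act as multiplication by \<open>k\<close>.\<close>

theorem cone_mult_cohomology:
  fixes Y :: "'x fspace" and S :: "'x set"
  defines "T \<equiv> analytic_top Y"
  assumes k: "k > 0" and cone: "is_cone (Dbc Y) A A (mult_by (Dbc Y) k A) C"
    and rep: "constant_cohomology T A S 0 integer_group \<phi>" and acyc: "\<And>n. n \<noteq> 0 \<Longrightarrow> acyclic_at T A n"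
  shows "\<exists>\<theta>. constant_cohomology T C S 0 (integer_mod_group k) \<theta>" "n \<noteq> 0 \<Longrightarrow> acyclic_at T C n"
proof -
  interpret A: constant_cohomology T A S 0 integer_group \<phi> by fact
  let ?F = "mult_by (Dbc Y) k A"
  obtain g h where "(A, A, C, ?F, g, h) \<in> Tri (Dbc Y)" using cone by (auto simp: is_cone_def)
  then obtain K L f where tri: "triangle (Dbc_base Y) (A, A, C, ?F, g, h)" and f: "cx_hom T K L f"
    and iso: "triangle_isomorphic (Dbc_base Y) (A, A, C, ?F, g, h)
            (K, L, mapping_cone K L f, chain_mor T K f L,
             chain_mor T L (mapping_cone_in K) (mapping_cone K L f),
             chain_mor T (mapping_cone K L f) mapping_cone_out (cx_shift K))"
    unfolding Dbc_def Let_def T_def by auto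
  obtain a b c where a: "iso_mor (Dbc Y) A K a" and b: "iso_mor (Dbc Y) A L b"
    and c: "iso_mor (Dbc Y) C (mapping_cone K L f) c"
    and sq: "d_comp T b ?F = d_comp T (chain_mor T K f L) a"
    using iso unfolding triangle_isomorphic_def triangle_squares_def iso_mor_Dbc_base T_def by auto
  obtain F where F: "zigzag T A F A" "?F = zclass T A F A"
    using tri unfolding triangle_def T_def by auto
  obtain v v' where v: "zigzag T A v K" "zigzag T K v' A" "a = zclass T A v K"
    and vv: "\<And>n x \<alpha>. x \<in> topspace T \<Longrightarrow> \<alpha> \<in> carrier (cstalk T A n x) \<Longrightarrow> wmap T n x v' (wmap T n x v \<alpha>) = \<alpha>"
    and vv': "\<And>n x \<alpha>. x \<in> topspace T \<Longrightarrow> \<alpha> \<in> carrier (cstalk T K n x) \<Longrightarrow> wmap T n x v (wmap T n x v' \<alpha>) = \<alpha>"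
    using iso_mor_DbcE[OF a, folded T_def] by blast
  obtain w w' where w: "zigzag T A w L" "zigzag T L w' A" "b = zclass T A w L"
    and ww: "\<And>n x \<alpha>. x \<in> topspace T \<Longrightarrow> \<alpha> \<in> carrier (cstalk T A n x) \<Longrightarrow> wmap T n x w' (wmap T n x w \<alpha>) = \<alpha>"
    and ww': "\<And>n x \<alpha>. x \<in> topspace T \<Longrightarrow> \<alpha> \<in> carrier (cstalk T L n x) \<Longrightarrow> wmap T n x w (wmap T n x w' \<alpha>) = \<alpha>"
    using iso_mor_DbcE[OF b, folded T_def] by blast
  have iv: "coh_iso_word T K v' A" using v(2,1) vv' vv by (rule coh_iso_wordI)
  have iw: "coh_iso_word T L w' A" using w(2,1) ww' ww by (rule coh_iso_wordI)
  obtain u where u: "coh_iso_word T C u (mapping_cone K L f)"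
    and u': "bounded_complex T (mapping_cone K L f)"
  proof (rule iso_mor_coh_iso_wordE[OF c, folded T_def])
    fix u assume u: "coh_iso_word T C u (mapping_cone K L f)"
    then have "zigzag T C u (mapping_cone K L f)" by (simp add: coh_iso_word_def)
    from conjunct2[OF zigzag_bounded[OF this]] show ?thesis by (rule that[OF u])
  qed
  interpret mapping_cone_complex T K L f
    using f u' by (simp add: mapping_cone_complex_def mapping_cone_complex_axioms_def complex_morphism_iff)
  \<comment> \<open>The first square of the isomorphism of triangles, evaluated on stalks through a
    pair of equivalent words.\<close>
  have square: "wmap T n x w (wmap T n x F \<alpha>) = cmap T L f n x (wmap T n x v \<alpha>)"
    if "x \<in> topspace T" "\<alpha> \<in> carrier (cstalk T A n x)" for n x \<alpha>
  proof -
    have "d_comp T (zclass T K [Fwd K f L] L) (zclass T A v K) = zclass T A (v @ [Fwd K f L]) L"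
      using v(1) zigzag_singleton(1)[OF cx_hom] by (rule d_comp_zclass)
    moreover have "d_comp T (zclass T A w L) (zclass T A F A) = zclass T A (F @ w) L"
      using F(1) w(1) by (rule d_comp_zclass)
    ultimately have "zclass T A (F @ w) L = zclass T A (v @ [Fwd K f L]) L"
      using sq F(2) v(3) w(3) by (simp add: chain_mor_def)
    moreover have "(A, F @ w, L) \<in> zclass T A (F @ w) L"
      using zigzag_append[OF F(1) w(1)] by (simp add: zclass_mem zigzag_eq.refl)
    ultimately have "zigzag_eq T A (v @ [Fwd K f L]) (F @ w) L" by (simp add: zclass_mem)
    from wmap_cong[OF this that] show ?thesis by (simp add: wmap_append)
  qed
  obtain \<phi>K where repK: "constant_cohomology T K S 0 integer_group \<phi>K"
    and \<phi>K: "\<And>U x s V t. openin T U \<Longrightarrow> x \<in> U \<Longrightarrow> x \<in> S \<Longrightarrow> s \<in> K.Z 0 U \<Longrightarrow> openin T V \<Longrightarrow> x \<in> V \<Longrightarrow> t \<in> A.Z 0 V \<Longrightarrow>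
      wmap T 0 x v' (cgerm T K 0 x U s) = cgerm T A 0 x V t \<Longrightarrow> \<phi>K x U s = \<phi> x V t"
    using constant_cohomology_transport[OF rep iv] by blast
  obtain \<phi>L where repL: "constant_cohomology T L S 0 integer_group \<phi>L"
    and \<phi>L: "\<And>U x s V t. openin T U \<Longrightarrow> x \<in> U \<Longrightarrow> x \<in> S \<Longrightarrow> s \<in> L.Z 0 U \<Longrightarrow> openin T V \<Longrightarrow> x \<in> V \<Longrightarrow> t \<in> A.Z 0 V \<Longrightarrow>
      wmap T 0 x w' (cgerm T L 0 x U s) = cgerm T A 0 x V t \<Longrightarrow> \<phi>L x U s = \<phi> x V t"
    using constant_cohomology_transport[OF rep iw] by blast
  interpret RK: constant_cohomology T K S 0 integer_group \<phi>K by (rule repK)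
  interpret RL: constant_cohomology T L S 0 integer_group \<phi>L by (rule repL)
  \<comment> \<open>A class of \<open>K\<close> is brought to \<open>A\<close> by \<open>v'\<close>,
    multiplied by \<open>k\<close> there, and sent on to \<open>L\<close> by \<open>w\<close>. By
    the square the result is its image under \<open>f\<close>, while the transported values are
    those computed in \<open>A\<close>.\<close>
  have mult: "\<phi>L x U (f 0 U s) = int k * \<phi>K x U s" if U: "openin T U" "x \<in> U" "x \<in> S" and s: "s \<in> K.Z 0 U" for U x s
  proof -
    have x: "x \<in> topspace T" using U openin_subset by blast
    let ?\<alpha> = "wmap T 0 x v' (cgerm T K 0 x U s)"
    have \<alpha>: "?\<alpha> \<in> carrier (cstalk T A 0 x)"
      using hom_in_carrier[OF wmap_hom[OF v(2) x] K.cgerm_in[OF U(1,2) s]] .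
    then obtain V t where V: "openin T V" "x \<in> V" "t \<in> A.Z 0 V" "?\<alpha> = cgerm T A 0 x V t" by (rule A.cstalkE)
    obtain t' where t': "t' \<in> A.Z 0 V" "\<phi> x V t' = int k * \<phi> x V t"
      "cgerm T A 0 x V t' = ?\<alpha> [^]\<^bsub>cstalk T A 0 x\<^esub> k"
      using integer_cohomology_power[OF rep V(1,2) U(3) V(3), of k] V(4) by auto
    have "(A, F, A) \<in> ?F" using F by (simp add: zclass_mem zigzag_eq.refl)
    then have F\<alpha>: "wmap T 0 x F ?\<alpha> = cgerm T A 0 x V t'"
      using mult_by_acts[of Y A A F A k x ?\<alpha> 0] A.bounded_complex x \<alpha> t'(3) unfolding T_def by simp
    have "cgerm T L 0 x U (f 0 U s) = cmap T L f 0 x (wmap T 0 x v ?\<alpha>)"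
      using vv'[OF x K.cgerm_in[OF U(1,2) s]] cmap_cgerm[OF U(1,2) s] by simp
    also have "\<dots> = wmap T 0 x w (cgerm T A 0 x V t')" using square[OF x \<alpha>] F\<alpha> by simp
    finally have "wmap T 0 x w' (cgerm T L 0 x U (f 0 U s)) = cgerm T A 0 x V t'"
      using ww[OF x A.cgerm_in[OF V(1,2) t'(1)]] by simp
    then have "\<phi>L x U (f 0 U s) = \<phi> x V t'" by (rule \<phi>L[OF U f_Z[OF U(1) s] V(1,2) t'(1)])
    also have "\<dots> = int k * \<phi>K x U s" using t'(2) \<phi>K[OF U s V(1-4)] by simp
    finally show ?thesis .
  qed
  have K0: "acyclic_at T K n" if "n \<noteq> 0" for n using acyclic_at_transport[OF acyc[OF that] iv] .
  have L0: "acyclic_at T L n" if "n \<noteq> 0" for n using acyclic_at_transport[OF acyc[OF that] iw] .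
  \<comment> \<open>In degree 0 the map is multiplication by \<open>k > 0\<close> on the integers,
    which have no torsion. This is what keeps the cone acyclic in degree -1.\<close>
  have inj: "coh_injective n" for n
    unfolding coh_injective_def locally_exact_def[symmetric]
  proof (intro allI impI)
    fix U x s assume U: "openin T U" "x \<in> U" and s: "s \<in> K.Z n U" and B: "f n U s \<in> L.B n U"
    show "locally_exact T K n x U s"
    proof (cases "n = 0")
      case False
      show ?thesis using K0[OF False, unfolded acyclic_at_def, rule_format, OF U s] .
    next
      case True
      show ?thesis
      proof (cases "x \<in> S")
        case xS: True
        have "int k * \<phi>K x U s = 0"
          using mult[OF U xS s[unfolded True]] RL.val_coboundary[OF U xS B[unfolded True]] by simp
        then have "\<phi>K x U s = 0" using k by simp
        then show ?thesis using RK.val_one_iff[OF U xS] s True by simp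
      next
        case False
        then show ?thesis using RK.outside[OF U False] s True by simp
      qed
    qed
  qed
  have "acyclic_at T K (0 + 1)" by (rule K0) simp
  from k this repK repL have "\<exists>\<theta>. constant_cohomology T D S 0 (integer_mod_group k) \<theta>"
    by (rule constant_cohomology_cone) (rule mult)
  then obtain \<theta> where "constant_cohomology T D S 0 (integer_mod_group k) \<theta>" ..
  then obtain \<theta>' where "constant_cohomology T C S 0 (integer_mod_group k) \<theta>'"
    using u by (rule constant_cohomology_transport)
  then show "\<exists>\<theta>. constant_cohomology T C S 0 (integer_mod_group k) \<theta>" by (intro exI)
  show "acyclic_at T C n" if "n \<noteq> 0"
    using cone_acyclic[OF inj L0[OF that]] u by (rule acyclic_at_transport)
qed

section \<open>Closed subvarieties\<close>

text \<open>Induction over the generation of open sets, for an operation that commutes with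
  intersections and unions. It is applied to the identity and to intersection with a subset.\<close>

lemma openin_topology_generated_by_le:
  assumes "openin (topology_generated_by \<B>) U" and "\<And>B. B \<in> \<B> \<Longrightarrow> openin T (h B)"
    and "h {} = {}" "\<And>A B. h (A \<inter> B) = h A \<inter> h B" "\<And>\<A>. h (\<Union>\<A>) = (\<Union>A\<in>\<A>. h A)"
  shows "openin T (h U)"
proof -
  have "generate_topology_on \<B> U" using assms(1) by (simp add: openin_topology_generated_by_iff)
  then show ?thesis
    by induction (use assms in auto)
qed

text \<open>The restriction clause of \<open>variety\<close>, isolated because comparisons with an
  ambient space repeatedly shrink the domain of a regular function.\<close>

definition restricts_regular :: "'x fspace \<Rightarrow> bool" where
  "restricts_regular X \<longleftrightarrow> (\<forall>U V f. openin (zar X) U \<and> openin (zar X) V \<and> V \<subseteq> U \<and> f \<in> reg X U \<longrightarrow> restrict f V \<in> reg X V)"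

lemma variety_restricts: "variety X \<Longrightarrow> restricts_regular X"
  unfolding variety_def restricts_regular_def by (elim conjE)

lemma restrictsD:
  "restricts_regular X \<Longrightarrow> openin (zar X) U \<Longrightarrow> openin (zar X) V \<Longrightarrow> V \<subseteq> U \<Longrightarrow> f \<in> reg X U \<Longrightarrow> restrict f V \<in> reg X V"
  unfolding restricts_regular_def by blast

lemma analytic_basis:
  "openin (zar X) U \<Longrightarrow> f \<in> reg X U \<Longrightarrow> open D \<Longrightarrow> openin (analytic_top X) {x \<in> U. f x \<in> D}"
  unfolding analytic_top_def by (intro topology_generated_by_Basis) blast

lemma topspace_analyticE:
  assumes "x \<in> topspace (analytic_top X)"
  obtains U f where "openin (zar X) U" "f \<in> reg X U" "x \<in> U"
  using assms unfolding analytic_top_def topology_generated_by_topspace by blast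

lemma subvar_simps: "zar (subvar X S) = subtopology (zar X) S" "pts (subvar X S) = pts X \<inter> S"
  by (simp_all add: subvar_def)

lemma subvar_reg_restrict:
  assumes "openin (zar X) U" "f \<in> reg X U"
  shows "restrict f (U \<inter> S) \<in> reg (subvar X S) (U \<inter> S)"
  using assms unfolding subvar_def by (auto intro!: exI[of _ U] exI[of _ f])

lemma subvar_regE:
  assumes "f \<in> reg (subvar X S) W" "x \<in> W"
  obtains U g where "openin (zar X) U" "x \<in> U" "g \<in> reg X U" "\<And>y. y \<in> U \<Longrightarrow> y \<in> W \<Longrightarrow> f y = g y"
proof -
  have "\<exists>U g. openin (zar X) U \<and> x \<in> U \<and> g \<in> reg X U \<and> (\<forall>y\<in>U \<inter> W. f y = g y)"
    using assms unfolding subvar_def by simp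
  then show ?thesis using that by blast
qed

text \<open>A regular function on the subspace extends to the ambient space only locally, so one
  inclusion is checked around each point; for the other, ambient regular functions are
  restricted.\<close>

lemma analytic_subvar:
  assumes X: "restricts_regular X"
  shows "analytic_top (subvar X S) = subtopology (analytic_top X) S"
proof (rule topology_eq[THEN iffD2], intro allI iffI)
  fix W assume "openin (analytic_top (subvar X S)) W"
  then show "openin (subtopology (analytic_top X) S) W"
    unfolding analytic_top_def[of "subvar X S"]
  proof (rule openin_topology_generated_by_le[where h = "\<lambda>A. A"])
    fix B assume "B \<in> {{x \<in> U. f x \<in> D} | U f D. openin (zar (subvar X S)) U \<and> f \<in> reg (subvar X S) U \<and> open D}"
    then obtain U f D where B: "B = {x \<in> U. f x \<in> D}" "openin (zar (subvar X S)) U" "f \<in> reg (subvar X S) U" "open D"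
      by blast
    obtain U0 where U0: "openin (zar X) U0" "U = U0 \<inter> S" using B(2) by (auto simp: subvar_simps openin_subtopology)
    show "openin (subtopology (analytic_top X) S) B"
    proof (subst openin_subopen, intro ballI)
      fix x assume x: "x \<in> B"
      then have "x \<in> U" using B by simp
      with B(3) obtain U1 g where U1: "openin (zar X) U1" "x \<in> U1" "g \<in> reg X U1"
        "\<And>y. y \<in> U1 \<Longrightarrow> y \<in> U \<Longrightarrow> f y = g y" by (rule subvar_regE) blast
      let ?V = "{y \<in> U0 \<inter> U1. restrict g (U0 \<inter> U1) y \<in> D}"
      have "openin (analytic_top X) ?V"
        using U0 U1 B(4) by (intro analytic_basis restrictsD[OF X U1(1)]) auto
      then have "openin (subtopology (analytic_top X) S) (?V \<inter> S)" by (auto simp: openin_subtopology)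
      moreover have "x \<in> ?V \<inter> S" "?V \<inter> S \<subseteq> B" using x U0 U1(2) U1(4) B(1) by auto
      ultimately show "\<exists>T'. openin (subtopology (analytic_top X) S) T' \<and> x \<in> T' \<and> T' \<subseteq> B" by blast
    qed
  qed auto
next
  fix W assume "openin (subtopology (analytic_top X) S) W"
  then obtain V where V: "openin (analytic_top X) V" "W = V \<inter> S" by (auto simp: openin_subtopology)
  have "openin (analytic_top (subvar X S)) (V \<inter> S)"
    using V(1) unfolding analytic_top_def[of X]
  proof (rule openin_topology_generated_by_le[where h = "\<lambda>A. A \<inter> S"])
    fix B assume "B \<in> {{x \<in> U. f x \<in> D} | U f D. openin (zar X) U \<and> f \<in> reg X U \<and> open D}"
    then obtain U f D where B: "B = {x \<in> U. f x \<in> D}" "openin (zar X) U" "f \<in> reg X U" "open D" by blast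
    have "openin (analytic_top (subvar X S)) {x \<in> U \<inter> S. restrict f (U \<inter> S) x \<in> D}"
      using B by (intro analytic_basis subvar_reg_restrict) (auto simp: subvar_simps openin_subtopology)
    moreover have "B \<inter> S = {x \<in> U \<inter> S. restrict f (U \<inter> S) x \<in> D}" using B(1) by auto
    ultimately show "openin (analytic_top (subvar X S)) (B \<inter> S)" by simp
  qed auto
  then show "openin (analytic_top (subvar X S)) W" using V(2) by simp
qed

text \<open>Every point of the analytic space lies in a Zariski open set carrying a regular
  function. Restricting this function off \<open>S\<close>, with \<open>UNIV\<close> as the
  condition on its values, makes the complement of \<open>S\<close> a basic analytic
  neighbourhood.\<close>

lemma analytic_open_diff:
  assumes X: "restricts_regular X" and S: "closedin (zar X) S" and U: "openin (analytic_top X) U"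
  shows "openin (analytic_top X) (U - S)"
proof (subst openin_subopen, intro ballI)
  fix x assume x: "x \<in> U - S"
  then have "x \<in> topspace (analytic_top X)" using openin_subset[OF U] by blast
  then obtain O' f where O': "openin (zar X) O'" "f \<in> reg X O'" "x \<in> O'" by (rule topspace_analyticE)
  have "openin (analytic_top X) {y \<in> O' - S. restrict f (O' - S) y \<in> UNIV}"
    using O' S by (intro analytic_basis restrictsD[OF X O'(1)]) (auto intro: openin_diff)
  moreover have "{y \<in> O' - S. restrict f (O' - S) y \<in> UNIV} = O' - S" by auto
  ultimately have "openin (analytic_top X) (U \<inter> (O' - S))" using openin_Int[OF U] by metis
  then show "\<exists>T'. openin (analytic_top X) T' \<and> x \<in> T' \<and> T' \<subseteq> U - S" using x O' by blast
qed

section \<open>Products with a closed subvariety\<close>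

lemma zprod_basis:
  fixes k :: nat
  assumes "openin (zar X) U" "openin (zar Y) V" "\<And>i. i < k \<Longrightarrow> f i \<in> reg X U" "\<And>i. i < k \<Longrightarrow> g i \<in> reg Y V"
  shows "openin (zprod X Y) {(x, y). x \<in> U \<and> y \<in> V \<and> (\<Sum>i<k. f i x * g i y) \<noteq> 0}"
  unfolding zprod_def using assms by (intro topology_generated_by_Basis) blast

lemma zprod_subvar:
  assumes X: "restricts_regular X"
  shows "zprod (subvar X S) Z = subtopology (zprod X Z) (S \<times> UNIV)"
proof (rule topology_eq[THEN iffD2], intro allI iffI)
  fix W assume "openin (zprod (subvar X S) Z) W"
  then show "openin (subtopology (zprod X Z) (S \<times> UNIV)) W"
    unfolding zprod_def[of "subvar X S"]
  proof (rule openin_topology_generated_by_le[where h = "\<lambda>A. A"])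
    fix B assume "B \<in> {{(x, y). x \<in> U \<and> y \<in> V \<and> (\<Sum>i<k. f i x * g i y) \<noteq> 0} | U V (k::nat) f g.
        openin (zar (subvar X S)) U \<and> openin (zar Z) V \<and> (\<forall>i<k. f i \<in> reg (subvar X S) U \<and> g i \<in> reg Z V)}"
    then obtain U V f g and k :: nat where B: "B = {(x, y). x \<in> U \<and> y \<in> V \<and> (\<Sum>i<k. f i x * g i y) \<noteq> 0}"
      "openin (zar (subvar X S)) U" "openin (zar Z) V" "\<And>i. i < k \<Longrightarrow> f i \<in> reg (subvar X S) U"
      "\<And>i. i < k \<Longrightarrow> g i \<in> reg Z V" by blast
    obtain U0 where U0: "openin (zar X) U0" "U = U0 \<inter> S" using B(2) by (auto simp: subvar_simps openin_subtopology)
    show "openin (subtopology (zprod X Z) (S \<times> UNIV)) B"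
    proof (subst openin_subopen, intro ballI)
      fix p assume p: "p \<in> B"
      obtain x y where xy: "p = (x, y)" by (cases p)
      have x: "x \<in> U" using p B(1) xy by simp
      \<comment> \<open>Each of the finitely many functions extends to a neighbourhood of its own;
        the extensions are chosen together and then restricted to a common neighbourhood.\<close>
      have "\<forall>i. \<exists>U1 h. i < k \<longrightarrow> openin (zar X) U1 \<and> x \<in> U1 \<and> h \<in> reg X U1 \<and> (\<forall>z\<in>U1 \<inter> U. f i z = h z)"
      proof
        fix i
        show "\<exists>U1 h. i < k \<longrightarrow> openin (zar X) U1 \<and> x \<in> U1 \<and> h \<in> reg X U1 \<and> (\<forall>z\<in>U1 \<inter> U. f i z = h z)"
        proof (cases "i < k")
          case True
          from B(4)[OF True] x show ?thesis by (rule subvar_regE) blast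
        qed blast
      qed
      then obtain U1 h where U1: "\<And>i. i < k \<Longrightarrow> openin (zar X) (U1 i)" "\<And>i. i < k \<Longrightarrow> x \<in> U1 i"
        "\<And>i. i < k \<Longrightarrow> h i \<in> reg X (U1 i)" "\<And>i z. i < k \<Longrightarrow> z \<in> U1 i \<inter> U \<Longrightarrow> f i z = h i z"
        by (metis (no_types, lifting))
      \<comment> \<open>Including \<open>U0\<close> keeps the common neighbourhood inside
        \<open>U0\<close>, so that its trace on \<open>S\<close> lies in \<open>U\<close>, where the
        extensions agree with the given functions.\<close>
      define U' where "U' = \<Inter>(insert U0 (U1 ` {..<k}))"
      have "openin (zar X) U'"
        unfolding U'_def using U0(1) U1(1) by (intro openin_Inter) auto
      moreover have "x \<in> U'" "U' \<subseteq> U0" "\<And>i. i < k \<Longrightarrow> U' \<subseteq> U1 i"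
        using U0 U1(2) x unfolding U'_def by auto
      ultimately have U': "openin (zar X) U'" "x \<in> U'" "U' \<subseteq> U0" "\<And>i. i < k \<Longrightarrow> U' \<subseteq> U1 i" by auto
      let ?V = "{(x, y). x \<in> U' \<and> y \<in> V \<and> (\<Sum>i<k. restrict (h i) U' x * g i y) \<noteq> 0}"
      have "openin (zprod X Z) ?V"
        using U'(1) B(3,5) by (intro zprod_basis restrictsD[OF X U1(1) U'(1,4) U1(3)]) auto
      then have o: "openin (subtopology (zprod X Z) (S \<times> UNIV)) (?V \<inter> (S \<times> UNIV))" by (auto simp: openin_subtopology)
      have eq: "(\<Sum>i<k. restrict (h i) U' z * g i w) = (\<Sum>i<k. f i z * g i w)" if "z \<in> U'" "z \<in> S" for z w
      proof (rule sum.cong[OF HOL.refl])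
        fix i assume "i \<in> {..<k}"
        then have "i < k" by simp
        then show "restrict (h i) U' z * g i w = f i z * g i w"
          using U1(4)[of i z] U'(3) U'(4)[of i] U0(2) that by (simp add: subset_iff)
      qed
      have "p \<in> ?V \<inter> (S \<times> UNIV)" using p B(1) xy eq[of x y] U' U0 x by auto
      moreover have "?V \<inter> (S \<times> UNIV) \<subseteq> B" using B(1) eq U'(3) U0(2) by auto
      ultimately show "\<exists>T'. openin (subtopology (zprod X Z) (S \<times> UNIV)) T' \<and> p \<in> T' \<and> T' \<subseteq> B" using o by blast
    qed
  qed auto
next
  fix W assume "openin (subtopology (zprod X Z) (S \<times> UNIV)) W"
  then obtain V' where V': "openin (zprod X Z) V'" "W = V' \<inter> (S \<times> UNIV)" by (auto simp: openin_subtopology)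
  have "openin (zprod (subvar X S) Z) (V' \<inter> (S \<times> UNIV))"
    using V'(1) unfolding zprod_def[of X]
  proof (rule openin_topology_generated_by_le[where h = "\<lambda>A. A \<inter> (S \<times> UNIV)"])
    fix B assume "B \<in> {{(x, y). x \<in> U \<and> y \<in> V \<and> (\<Sum>i<k. f i x * g i y) \<noteq> 0} | U V (k::nat) f g.
        openin (zar X) U \<and> openin (zar Z) V \<and> (\<forall>i<k. f i \<in> reg X U \<and> g i \<in> reg Z V)}"
    then obtain U V f g and k :: nat where B: "B = {(x, y). x \<in> U \<and> y \<in> V \<and> (\<Sum>i<k. f i x * g i y) \<noteq> 0}"
      "openin (zar X) U" "openin (zar Z) V" "\<And>i. i < k \<Longrightarrow> f i \<in> reg X U" "\<And>i. i < k \<Longrightarrow> g i \<in> reg Z V" by blast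
    have "openin (zprod (subvar X S) Z)
        {(x, y). x \<in> U \<inter> S \<and> y \<in> V \<and> (\<Sum>i<k. restrict (f i) (U \<inter> S) x * g i y) \<noteq> 0}"
      using B(2-5) by (intro zprod_basis subvar_reg_restrict) (auto simp: subvar_simps openin_subtopology)
    moreover have "B \<inter> (S \<times> UNIV) =
        {(x, y). x \<in> U \<inter> S \<and> y \<in> V \<and> (\<Sum>i<k. restrict (f i) (U \<inter> S) x * g i y) \<noteq> 0}"
      using B(1) by auto
    ultimately show "openin (zprod (subvar X S) Z) (B \<inter> (S \<times> UNIV))" by simp
  qed auto
  then show "openin (zprod (subvar X S) Z) W" using V'(2) by simp
qed

text \<open>A basic open set of the product stays basic when \<open>S\<close> is removed from its
  first factor, so the complement of the preimage of \<open>S\<close> is open.\<close>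

lemma zprod_closed:
  assumes X: "restricts_regular X" and S: "closedin (zar X) S"
  shows "closedin (zprod X Z) (topspace (zprod X Z) \<inter> (S \<times> UNIV))"
proof -
  have "openin (zprod X Z) (topspace (zprod X Z) - (S \<times> UNIV))"
  proof (subst openin_subopen, intro ballI)
    fix p assume p: "p \<in> topspace (zprod X Z) - (S \<times> UNIV)"
    obtain x y where xy: "p = (x, y)" by (cases p)
    have "p \<in> \<Union>{{(x, y). x \<in> U \<and> y \<in> V \<and> (\<Sum>i<k. f i x * g i y) \<noteq> 0} | U V (k::nat) f g.
        openin (zar X) U \<and> openin (zar Z) V \<and> (\<forall>i<k. f i \<in> reg X U \<and> g i \<in> reg Z V)}"
      using DiffD1[OF p] unfolding zprod_def topology_generated_by_topspace .
    then obtain U V f g and k :: nat where B: "x \<in> U" "y \<in> V" "(\<Sum>i<k. f i x * g i y) \<noteq> 0"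
      "openin (zar X) U" "openin (zar Z) V" "\<And>i. i < k \<Longrightarrow> f i \<in> reg X U" "\<And>i. i < k \<Longrightarrow> g i \<in> reg Z V"
      using xy by blast
    let ?V = "{(x, y). x \<in> U - S \<and> y \<in> V \<and> (\<Sum>i<k. restrict (f i) (U - S) x * g i y) \<noteq> 0}"
    have o: "openin (zprod X Z) ?V"
      using B S by (intro zprod_basis restrictsD[OF X B(4)]) (auto intro: openin_diff)
    moreover have "p \<in> ?V" using B p xy by auto
    moreover have "?V \<subseteq> topspace (zprod X Z) - (S \<times> UNIV)" using openin_subset[OF o] by auto
    ultimately show "\<exists>T'. openin (zprod X Z) T' \<and> p \<in> T' \<and> T' \<subseteq> topspace (zprod X Z) - (S \<times> UNIV)" by blast
  qed
  moreover have "topspace (zprod X Z) - topspace (zprod X Z) \<inter> (S \<times> UNIV) = topspace (zprod X Z) - (S \<times> UNIV)" by blast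
  ultimately show ?thesis by (simp add: closedin_def)
qed

text \<open>The product of a closed inclusion with any \<open>Z\<close> is the inclusion of a closed
  subspace, hence a closed map. Properness is the condition under which a motivic pushforward is
  triangulated.\<close>

lemma proper_closed_inclusion:
  assumes X: "restricts_regular X" and S: "closedin (zar X) S"
  shows "proper_morphism (subvar X S) X (\<lambda>x. x)"
  unfolding proper_morphism_def
proof (intro conjI allI impI)
  show "fs_morphism (subvar X S) X (\<lambda>x. x)"
    unfolding fs_morphism_def
  proof (intro conjI allI impI)
    show "continuous_map (zar (subvar X S)) (zar X) (\<lambda>x. x)"
      unfolding subvar_simps by (rule continuous_map_from_subtopology) simp
    fix V f assume V: "openin (zar X) V \<and> f \<in> reg X V"
    have "{x \<in> pts (subvar X S). x \<in> V} = V \<inter> S"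
      using openin_subset[OF conjunct1[OF V]] unfolding subvar_simps by auto
    then show "restrict (f \<circ> (\<lambda>x. x)) {x \<in> pts (subvar X S). x \<in> V} \<in>
        reg (subvar X S) {x \<in> pts (subvar X S). x \<in> V}"
      using subvar_reg_restrict[of X V f S] V by (simp add: o_def)
  qed
  fix Z :: "(nat \<Rightarrow> complex) fspace"
  have id: "(\<lambda>(x, z). (x, z)) = (\<lambda>p. p)" by auto
  show "closed_map (zprod (subvar X S) Z) (zprod X Z) (\<lambda>(x, z). (x, z))"
    unfolding closed_map_def id zprod_subvar[OF X]
  proof (intro allI impI)
    fix C assume "closedin (subtopology (zprod X Z) (S \<times> UNIV)) C"
    then obtain C' where C': "closedin (zprod X Z) C'" "C = C' \<inter> (S \<times> UNIV)" by (auto simp: closedin_subtopology)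
    then have "C = C' \<inter> (topspace (zprod X Z) \<inter> (S \<times> UNIV))" using closedin_subset by blast
    then show "closedin (zprod X Z) ((\<lambda>p. p) ` C)"
      using closedin_Int[OF C'(1) zprod_closed[OF X S]] by simp
  qed
qed

section \<open>Functors and multiplication\<close>

text \<open>The image of a zero morphism equals its own double, and in a group only the neutral
  element does.\<close>

lemma additive_functor_zero:
  assumes F: "additive_functor C D F" and C: "additive_category C" and D: "additive_category D"
    and A: "A \<in> Ob C" and B: "B \<in> Ob C"
  shows "Fm F (Zer C A B) = Zer D (Fo F A) (Fo F B)"
proof -
  have F': "is_functor C D F" using F by (simp add: additive_functor_def)
  have FA: "Fo F A \<in> Ob D" "Fo F B \<in> Ob D" using F' A B by (auto simp: is_functor_def)
  interpret C: comm_group "hom_group C A B" using C A B by (simp add: additive_category_def)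
  interpret D: comm_group "hom_group D (Fo F A) (Fo F B)" using D FA by (simp add: additive_category_def)
  have z: "Zer C A B \<in> Hom C A B" using C.one_closed by (simp add: hom_group_def)
  then have Fz: "Fm F (Zer C A B) \<in> carrier (hom_group D (Fo F A) (Fo F B))"
    using F' A B by (simp add: is_functor_def hom_group_def)
  have "Add C (Zer C A B) (Zer C A B) = Zer C A B" using C.l_one[OF C.one_closed] by (simp add: hom_group_def)
  then have "Add D (Fm F (Zer C A B)) (Fm F (Zer C A B)) = Fm F (Zer C A B)"
    using F A B z by (metis additive_functor_def)
  then show ?thesis using D.l_cancel_one[OF Fz Fz] by (simp add: hom_group_def)
qed

lemma mult_by_Hom:
  assumes C: "additive_category C" and A: "A \<in> Ob C"
  shows "mult_by C n A \<in> Hom C A A"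
proof -
  interpret comm_group "hom_group C A A" using C A by (simp add: additive_category_def)
  have "Idn C A \<in> carrier (hom_group C A A)"
    using C A by (simp add: additive_category_def category_def hom_group_def)
  then have "Idn C A [^]\<^bsub>hom_group C A A\<^esub> n \<in> carrier (hom_group C A A)" by (rule nat_pow_closed)
  then show ?thesis by (simp add: mult_by_def) (simp add: hom_group_def)
qed

text \<open>Allows the cone of multiplication by 4 to be pushed forward along the inclusion; for the
  realization the corresponding property is the hypothesis \<open>real_mult\<close>.\<close>

lemma additive_functor_mult_by:
  assumes F: "additive_functor C D F" and C: "additive_category C" and D: "additive_category D"
    and A: "A \<in> Ob C"
  shows "Fm F (mult_by C n A) = mult_by D n (Fo F A)"
proof (induction n)
  case 0
  then show ?case using additive_functor_zero[OF F C D A A] by (simp add: mult_by_def nat_pow_def hom_group_def)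
next
  case (Suc n)
  have id: "Idn C A \<in> Hom C A A" "Fm F (Idn C A) = Idn D (Fo F A)"
    using C A F by (auto simp: additive_category_def category_def additive_functor_def is_functor_def)
  have "mult_by C (Suc n) A = Add C (mult_by C n A) (Idn C A)"
    "mult_by D (Suc n) (Fo F A) = Add D (mult_by D n (Fo F A)) (Idn D (Fo F A))"
    by (simp_all add: mult_by_def nat_pow_def hom_group_def)
  moreover have "Fm F (Add C (mult_by C n A) (Idn C A)) = Add D (Fm F (mult_by C n A)) (Fm F (Idn C A))"
    using F A mult_by_Hom[OF C A, of n] id(1) by (simp add: additive_functor_def)
  ultimately show ?case using Suc id by simp
qed

theorem proposition9p8:
  fixes Y :: "'x fspace"
    and \<Sigma> :: "'x set"
    and M :: "('x, 'o, 'm) motivic"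
    and C :: 'o
    and E :: "('x, 'x univ) presheaf"
  assumes threefold: "variety Y" "pure_dimension Y 3"
    and stratum: "closedin (zar Y) \<Sigma>" "variety (subvar Y \<Sigma>)" "pure_dimension (subvar Y \<Sigma>) 1"
    and singularity: "transverse_quarter_11 Y \<Sigma>"
    and formalism: "motivic_formalism M"
    and unit_mod_4: "is_unit_mod M (subvar Y \<Sigma>) 4 C"
    and real_cones: "commutes_with_cones (mcat M Y) (Dbc Y) (mreal M Y)"
    and real_mult: "commutes_with_mult 4 (mcat M Y) (Dbc Y) (mreal M Y)"
    and real_shifts: "commutes_with_shifts (mcat M Y) (Dbc Y) (mreal M Y)"
    and real_push: "naturally_isomorphic (mcat M (subvar Y \<Sigma>)) (Dbc Y)
                      (comp_functor (mreal M Y) (mincl M Y \<Sigma>))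
                      (comp_functor (Dbc_push Y \<Sigma>) (mreal M (subvar Y \<Sigma>)))"
    and E_sheaf: "is_sheaf (analytic_top (subvar Y \<Sigma>)) E"
    and E_link: "presheaf_isomorphic (analytic_top (subvar Y \<Sigma>)) E (link_torsion_sheaf Y \<Sigma>)"
    and E_const: "presheaf_isomorphic (analytic_top (subvar Y \<Sigma>)) E
                    (const_usheaf (subvar Y \<Sigma>) (integer_mod_group 4))"
  shows "isomorphic_in (Dbc Y) (Fo (mreal M Y) (motivic_torsion M Y \<Sigma> C))
           (sheaf_term Y \<Sigma> (const_usheaf (subvar Y \<Sigma>) (integer_mod_group 4))) \<and>
         isomorphic_in (Dbc Y) (sheaf_term Y \<Sigma> E)
           (sheaf_term Y \<Sigma> (const_usheaf (subvar Y \<Sigma>) (integer_mod_group 4))) \<and>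
         isomorphic_in (Dbc Y) (Fo (mreal M Y) (motivic_torsion M Y \<Sigma> C)) (sheaf_term Y \<Sigma> E)"
proof -
  interpret motivic_formalism M by fact
  let ?T = "analytic_top Y" and ?X = "subvar Y \<Sigma>" and ?U = "munit M (subvar Y \<Sigma>)"
  \<comment> \<open>The support is the set of points of the subspace topology on \<Sigma>, hence the
    intersection with the analytic space.\<close>
  let ?S = "topspace ?T \<inter> \<Sigma>" and ?R = "Fo (mreal M Y)" and ?i = "Fo (mincl M Y \<Sigma>)"
  have rY: "restricts_regular Y" using threefold(1) by (rule variety_restricts)
  have T: "analytic_top ?X = subtopology ?T \<Sigma>" by (rule analytic_subvar[OF rY])
  have diff: "openin ?T (V - \<Sigma>)" if "openin ?T V" for V by (rule analytic_open_diff[OF rY stratum(1) that])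

  have tX: "triangulated_category (mcat M ?X)" and tY: "triangulated_category (mcat M Y)"
    using mcat_triangulated threefold(1) stratum(2) by auto
  have addX: "additive_category (mcat M ?X)" and addY: "additive_category (mcat M Y)"
    using tX tY triangulated_category.additive by auto
  have U: "?U \<in> Ob (mcat M ?X)" using munit_object[OF stratum(2)] .
  have "proper_morphism ?X Y (\<lambda>x. x)" by (rule proper_closed_inclusion[OF rY stratum(1)])
  then have push: "triangulated_functor (mcat M ?X) (mcat M Y) (mincl M Y \<Sigma>)"
    unfolding mincl_def by (rule mpush_triangulated[OF stratum(2) threefold(1)])
  then have addp: "additive_functor (mcat M ?X) (mcat M Y) (mincl M Y \<Sigma>)"
    by (simp add: triangulated_functor_def)
  have obp: "?i A \<in> Ob (mcat M Y)" if "A \<in> Ob (mcat M ?X)" for A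
    using addp that by (simp add: additive_functor_def is_functor_def)
  have obR: "?R A \<in> Ob (Dbc Y)" if "A \<in> Ob (mcat M Y)" for A
    using mreal_functor[OF threefold(1)] that by (simp add: is_functor_def del: Dbc_simps)
  have shY: "Sho (mcat M Y) A \<in> Ob (mcat M Y)" if "A \<in> Ob (mcat M Y)" for A
    using triangulated_category.shift_additive[OF tY] that
    by (simp add: additive_functor_def is_functor_def shift_functor_def)

  obtain g h where tri: "(?U, ?U, C, mult_by (mcat M ?X) 4 ?U, g, h) \<in> Tri (mcat M ?X)"
    using unit_mod_4 unfolding is_unit_mod_def is_cone_def by blast
  have C: "C \<in> Ob (mcat M ?X)"
    using triangulated_category.tri_triangle[OF tX tri] by (simp add: triangle_def)
  \<comment> \<open>The assumptions about cones and multiplication by 4 concern the realization on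
    \<open>Y\<close>, so the cone over \<Sigma> is first pushed forward by a triangulated functor
    and only then realized.\<close>
  have "is_cone (mcat M Y) (?i ?U) (?i ?U) (Fm (mincl M Y \<Sigma>) (mult_by (mcat M ?X) 4 ?U)) (?i C)"
    using push tri unfolding triangulated_functor_def is_cone_def by blast
  then have "is_cone (mcat M Y) (?i ?U) (?i ?U) (mult_by (mcat M Y) 4 (?i ?U)) (?i C)"
    by (simp add: additive_functor_mult_by[OF addp addX addY U])
  then have "is_cone (Dbc Y) (?R (?i ?U)) (?R (?i ?U)) (Fm (mreal M Y) (mult_by (mcat M Y) 4 (?i ?U))) (?R (?i C))"
    using real_cones obp[OF U] mult_by_Hom[OF addY obp[OF U]] unfolding commutes_with_cones_def by blast
  then have cone: "is_cone (Dbc Y) (?R (?i ?U)) (?R (?i ?U)) (mult_by (Dbc Y) 4 (?R (?i ?U))) (?R (?i C))"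
    using real_mult obp[OF U] by (simp add: commutes_with_mult_def)

  \<comment> \<open>The integers enter here: the realization of the unit on \<Sigma> is the constant
    sheaf in degree 0, and the isomorphism is kept as a word acting on stalks.\<close>
  obtain w where w: "coh_iso_word (subtopology ?T \<Sigma>) (Fo (mreal M ?X) ?U)  w
      (degree_zero (to_univ (const_sheaf (subtopology ?T \<Sigma>) integer_group)))"
    using isomorphic_in_DbcE[OF mreal_unit[OF stratum(2)]] unfolding const_usheaf_def T by blast
  have bU: "bounded_complex (subtopology ?T \<Sigma>) (Fo (mreal M ?X) ?U)"
    using w zigzag_bounded by (auto simp: coh_iso_word_def)
  have sZ: "is_sheaf (subtopology ?T \<Sigma>) (to_univ (const_sheaf (subtopology ?T \<Sigma>) integer_group))"
    by (rule const_univ_sheaf) (rule abelian_integer_group)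
  obtain \<eta> where "nat_iso (mcat M ?X) (Dbc Y) (comp_functor (mreal M Y) (mincl M Y \<Sigma>))
      (comp_functor (Dbc_push Y \<Sigma>) (mreal M ?X)) \<eta>"
    using real_push unfolding naturally_isomorphic_def by blast
  \<comment> \<open>Compatibility with the direct image, evaluated at the unit, carries the integral
    computation from \<Sigma> to \<open>Y\<close>.\<close>
  then have "iso_mor (Dbc Y) (?R (?i ?U)) (cx_push \<Sigma> (Fo (mreal M ?X) ?U)) (\<eta> ?U)"
    using U by (simp add: nat_iso_def comp_functor_def Dbc_push_def del: Dbc_simps)
  then obtain v where v: "coh_iso_word ?T (?R (?i ?U)) v (cx_push \<Sigma> (Fo (mreal M ?X) ?U))"
    by (rule iso_mor_coh_iso_wordE)
  have "constant_cohomology (subtopology ?T \<Sigma>)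
      (degree_zero (to_univ (const_sheaf (subtopology ?T \<Sigma>) integer_group))) ?S 0 integer_group (\<lambda>x V s. s 0 x)"
    using constant_cohomology_const[OF abelian_integer_group] by (simp flip: topspace_subtopology)
  then obtain \<phi>1 where "constant_cohomology (subtopology ?T \<Sigma>) (Fo (mreal M ?X) ?U) ?S 0 integer_group \<phi>1"
    using w by (rule constant_cohomology_transport)
  then have "constant_cohomology ?T (cx_push \<Sigma> (Fo (mreal M ?X) ?U)) ?S 0 integer_group (\<lambda>x V. \<phi>1 x (V \<inter> \<Sigma>))"
    using diff by (rule constant_cohomology_push)
  then obtain \<phi> where rep: "constant_cohomology ?T (?R (?i ?U)) ?S 0 integer_group \<phi>"
    using v by (rule constant_cohomology_transport)
  have acyc: "acyclic_at ?T (?R (?i ?U)) n" if "n \<noteq> 0" for n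
    using acyclic_at_transport[OF acyclic_at_push[OF bU diff
      acyclic_at_transport[OF degree_zero_acyclic[OF that sZ] w]] v] .

  obtain \<theta> where rep0: "constant_cohomology ?T (?R (?i C)) ?S 0 (integer_mod_group 4) \<theta>"
    using cone_mult_cohomology(1)[OF _ cone rep acyc] by auto
  have acyc0: "acyclic_at ?T (?R (?i C)) n" if "n \<noteq> 0" for n
    using cone_mult_cohomology(2)[OF _ cone rep acyc that] by simp

  obtain \<sigma> where \<sigma>: "nat_iso (mcat M Y) (Dbc Y) (comp_functor (mreal M Y) (shift_functor (mcat M Y)))
      (comp_functor (shift_functor (Dbc Y)) (mreal M Y)) \<sigma>"
    using real_shifts unfolding commutes_with_shifts_def naturally_isomorphic_def by blast
  have shift: "\<exists>w. coh_iso_word ?T (?R (Sho (mcat M Y) A)) w (cx_shift (?R A))" if A: "A \<in> Ob (mcat M Y)" for A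
  proof -
    have "iso_mor (Dbc Y) (?R (Sho (mcat M Y) A)) (cx_shift (?R A)) (\<sigma> A)"
      using \<sigma> A Dbc_simps(7)[of Y] by (simp add: nat_iso_def comp_functor_def shift_functor_def del: Dbc_simps)
    then show ?thesis by (rule iso_mor_coh_iso_wordE) blast
  qed
  \<comment> \<open>A shift lowers degrees by one; used twice, it moves the cohomology from degree 0
    through -1 to -2.\<close>
  have rep_shift: "\<exists>\<theta>. constant_cohomology ?T (?R (Sho (mcat M Y) A)) ?S n (integer_mod_group 4) \<theta>"
    if A: "A \<in> Ob (mcat M Y)" and rep: "constant_cohomology ?T (?R A) ?S (n + 1) (integer_mod_group 4) \<theta>" for A n \<theta>
    using shift[OF A] constant_cohomology_transport[OF constant_cohomology_shift[OF rep]] by metis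
  have acyc_shift: "acyclic_at ?T (?R (Sho (mcat M Y) A)) n"
    if A: "A \<in> Ob (mcat M Y)" and acyc: "acyclic_at ?T (?R A) (n + 1)" for A n
  proof -
    have "bounded_complex ?T (?R A)" using obR[OF A] by simp
    then show ?thesis using shift[OF A] acyclic_at_transport[OF acyclic_at_shift[OF _ acyc]] by blast
  qed
  let ?Q = "?R (motivic_torsion M Y \<Sigma> C)"
  let ?F = "const_usheaf ?X (integer_mod_group 4)" and ?P = "sheaf_term Y \<Sigma> (const_usheaf ?X (integer_mod_group 4))"
  have iC: "?i C \<in> Ob (mcat M Y)" "Sho (mcat M Y) (?i C) \<in> Ob (mcat M Y)" using obp[OF C] shY by auto
  have Q: "?Q = ?R (Sho (mcat M Y) (Sho (mcat M Y) (?i C)))" by (simp add: motivic_torsion_def shift2_def)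
  obtain \<theta>1 where "constant_cohomology ?T (?R (Sho (mcat M Y) (?i C))) ?S (-1) (integer_mod_group 4) \<theta>1"
    using rep_shift[OF iC(1), of "-1" \<theta>] rep0 by auto
  then obtain \<theta>2 where rep2: "constant_cohomology ?T ?Q ?S (-2) (integer_mod_group 4) \<theta>2"
    using rep_shift[OF iC(2), of "-2" \<theta>1] unfolding Q by auto
  have acyc2: "acyclic_at ?T ?Q n" if "n \<noteq> -2" for n
    unfolding Q using that by (intro acyc_shift iC acyc0) simp

  have G: "comm_group (integer_mod_group 4)" by simp
  have F: "is_sheaf (subtopology ?T \<Sigma>) ?F" unfolding const_usheaf_def T by (rule const_univ_sheaf[OF G])
  have P_sec: "sec (trm ?P (-2)) V = sec (to_univ (const_sheaf (subtopology ?T \<Sigma>) (integer_mod_group 4))) (V \<inter> \<Sigma>)"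
    and P_res: "res (trm ?P (-2)) V W =
      res (to_univ (const_sheaf (subtopology ?T \<Sigma>) (integer_mod_group 4))) (V \<inter> \<Sigma>) (W \<inter> \<Sigma>)" for V W
    by (simp_all add: sheaf_term_trm degree_zero_simps const_usheaf_def T)
  obtain N s p where s: "quasi_iso ?T N ?Q s" and p: "quasi_iso ?T N ?P p"
    using constant_cohomology_roof[OF rep2 acyc2 diff sheaf_term_bounded[OF F] sheaf_term_trivial P_sec P_res]
    by blast
  \<comment> \<open>The realization is an object by functoriality, and the two legs of the roof
    carry its constructibility over to the sheaf term.\<close>
  have QOb: "?Q \<in> Ob (Dbc Y)" unfolding Q by (rule obR[OF shY[OF iC(2)]])
  then have POb: "?P \<in> Ob (Dbc Y)" using quasi_iso_Ob_iff[OF s] quasi_iso_Ob_iff[OF p] by blast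
  have 1: "isomorphic_in (Dbc Y) ?Q ?P" by (rule quasi_iso_roof_isomorphic[OF QOb POb s p])
  \<comment> \<open>The term of \<open>E\<close> is compared with the same constant term; composing
    the first isomorphism with the inverse of this one gives the last claim.\<close>
  have 2: "isomorphic_in (Dbc Y) (sheaf_term Y \<Sigma> E) ?P"
    by (rule sheaf_term_cong[OF E_sheaf F[folded T] T E_const POb])
  show ?thesis using 1 2 isomorphic_in_Dbc_trans[OF 1 isomorphic_in_sym[OF 2]] by blast
qed

end
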